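(* Let $G$ be a finite abelian $p$-group. The group $\mathrm{Ext}_{[\mathrm{triv}]}(\Bbbk C_p,\Bbbk^{G})$ of equivalence classes of commutative extensions of $\Bbbk C_p$ by $\Bbbk^G$ is isomorphic to the group $\mathrm{Cext}(G,C_p)$ of (equivalence classes of) central extensions of $G$ by $C_p$. The isomorphism is given by $H(\tau)\leftrightarrows\Bbbk^{G(\tau)}$, where $G(\tau)$ is the central extension defined by the $2$-cocycle $\tau$.
   Context: $\Bbbk$ is an algebraically closed field of characteristic $0$, $p$ a prime, $C_p$ the cyclic group of order $p$, $\Bbbk^L$ the Hopf algebra of functions on a finite group $L$ (dual of $\Bbbk L$); $\{p_a\}$ are the delta functions on $G$. Cochains are normalized (value $1$ if some argument is the identity). An extension of $\Bbbk C_p$ by $\Bbbk^G$ is a sequence of Hopf maps $\Bbbk^G\xrightarrow{\iota}H\xrightarrow{\pi}\Bbbk C_p$ with $\iota$ injective, $\pi$ surjective, $\iota(\Bbbk^G)$ normal in $H$ and $\ker\pi=\iota(\Bbbk^G)^+H$; equivalences are Hopf isomorphisms compatible with $\iota$ and $\pi$. Commutative extensions are exactly those whose associated action of $C_p$ on $G$ is trivial. Up to equivalence they are the Hopf algebras $H(\tau)=\bigoplus_{x\in C_p}\Bbbk^G\bar x$ with $(f\bar x)(f'\bar y)=ff'\,\overline{xy}$, $\Delta(f\bar x)=\sum_{a,b\in G}\tau(x,a,b)f_1p_a\bar x\otimes f_2p_b\bar x$, $\varepsilon(f\bar x)=f(1)$, where $\tau:C_p\times G\times G\to\Bbbk^\times$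 satisfies $\tau(x,a,bc)\tau(x,b,c)=\tau(x,ab,c)\tau(x,a,b)$ and $\tau(xy,a,b)=\tau(x,a,b)\tau(y,a,b)$. The group structure on $\mathrm{Ext}_{[\mathrm{triv}]}(\Bbbk C_p,\Bbbk^G)$ is that of pointwise multiplication of such $\tau$ modulo the $\tau$ of the form $\eta(x,a)\eta(x,b)\eta(x,ab)^{-1}$ with $\eta:C_p\times G\to\Bbbk^\times$ normalized and multiplicative in $x$. Such $\tau$ is the same as a $2$-cocycle $G\times G\to\widehat{C_p}=\mathrm{Hom}(C_p,\Bbbk^\times)\simeq C_p$, $(a,b)\mapsto\tau(-,a,b)$, for the trivial action of $G$; $G(\tau)$ is the central extension $1\to\widehat{C_p}\to G(\tau)\to G\to1$ that it defines. *)

theory Defs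
  imports "HOL-Algebra.Algebraic_Closure_Type" "HOL-Algebra.Elementary_Groups"
    "HOL-Algebra.Multiplicative_Group" "HOL-Library.Poly_Mapping"
begin

text \<open>The ground field is a type \<open>'k\<close> of class \<open>field\<close>, turned into a ring record so that
  the library's modules and homomorphisms apply.\<close>

abbreviation base_field :: "'k::field ring" where
  "base_field \<equiv> ring_of_type_algebra"


section \<open>Tensor powers\<close>

text \<open>The \<open>n\<close>-th tensor power of \<open>V\<close> is the free vector space on the words of length \<open>n\<close> over
  the carrier of \<open>V\<close>, modulo the subspace \<open>tensor_rel V n\<close> of multilinearity relations; the word
  \<open>[v\<^sub>1, \<dots>, v\<^sub>n]\<close> stands for \<open>v\<^sub>1 \<otimes> \<dots> \<otimes> v\<^sub>n\<close>.
  Its elements are given by representatives in the free vector space, and compared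
  with \<open>tensor_eq\<close>.\<close>

abbreviation pm_scale :: "'k::field \<Rightarrow> ('a \<Rightarrow>\<^sub>0 'k) \<Rightarrow> 'a \<Rightarrow>\<^sub>0 'k" where
  "pm_scale c t \<equiv> Poly_Mapping.map ((*) c) t"

definition words :: "('k, 'h, 'm) module_scheme \<Rightarrow> nat \<Rightarrow> 'h list set" where
  "words V n = {xs. length xs = n \<and> set xs \<subseteq> carrier V}"

definition tensors :: "('k::field, 'h, 'm) module_scheme \<Rightarrow> nat \<Rightarrow> ('h list \<Rightarrow>\<^sub>0 'k) set" where
  "tensors V n = {t. Poly_Mapping.keys t \<subseteq> words V n}"

inductive_set tensor_rel :: "('k::field, 'h, 'm) module_scheme \<Rightarrow> nat \<Rightarrow> ('h list \<Rightarrow>\<^sub>0 'k) set"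
  for V n where
  zero: "0 \<in> tensor_rel V n"
| add: "s \<in> tensor_rel V n \<Longrightarrow> t \<in> tensor_rel V n \<Longrightarrow> s + t \<in> tensor_rel V n"
| scale: "t \<in> tensor_rel V n \<Longrightarrow> pm_scale c t \<in> tensor_rel V n"
| additive: "xs \<in> words V n \<Longrightarrow> i < n \<Longrightarrow> a \<in> carrier V \<Longrightarrow> b \<in> carrier V \<Longrightarrow>
    Poly_Mapping.single (xs[i := a \<oplus>\<^bsub>V\<^esub> b]) 1
      - Poly_Mapping.single (xs[i := a]) 1 - Poly_Mapping.single (xs[i := b]) 1
    \<in> tensor_rel V n"
| homogeneous: "xs \<in> words V n \<Longrightarrow> i < n \<Longrightarrow> a \<in> carrier V \<Longrightarrow>
    Poly_Mapping.single (xs[i := c \<odot>\<^bsub>V\<^esub> a]) 1 - Poly_Mapping.single (xs[i := a]) c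
    \<in> tensor_rel V n"

definition tensor_eq ::
  "('k::field, 'h, 'm) module_scheme \<Rightarrow> nat \<Rightarrow> ('h list \<Rightarrow>\<^sub>0 'k) \<Rightarrow> ('h list \<Rightarrow>\<^sub>0 'k) \<Rightarrow> bool" where
  "tensor_eq V n s t \<longleftrightarrow> s - t \<in> tensor_rel V n"

text \<open>Linear extension of a map defined on words, with values in a free vector space
  and in \<open>V\<close>, respectively.\<close>

definition lin_ext :: "('a \<Rightarrow> ('b \<Rightarrow>\<^sub>0 'k)) \<Rightarrow> ('a \<Rightarrow>\<^sub>0 'k::field) \<Rightarrow> 'b \<Rightarrow>\<^sub>0 'k" where
  "lin_ext f t = (\<Sum>x\<in>Poly_Mapping.keys t. pm_scale (Poly_Mapping.lookup t x) (f x))"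

definition lin_val ::
  "('k::field, 'h, 'm) module_scheme \<Rightarrow> ('a \<Rightarrow> 'h) \<Rightarrow> ('a \<Rightarrow>\<^sub>0 'k) \<Rightarrow> 'h" where
  "lin_val V f t = finsum V (\<lambda>x. Poly_Mapping.lookup t x \<odot>\<^bsub>V\<^esub> f x) (Poly_Mapping.keys t)"


section \<open>Hopf algebras\<close>

record (overloaded) ('k::zero, 'h) bialg = "('k, 'h) module" +
  comult :: "'h \<Rightarrow> ('h list \<Rightarrow>\<^sub>0 'k)"
  counit :: "'h \<Rightarrow> 'k"

text \<open>The library locale \<open>algebra\<close> would impose commutativity.\<close>

definition k_algebra :: "('k::field, 'h, 'm) module_scheme \<Rightarrow> bool" where
  "k_algebra H \<longleftrightarrow> module base_field H \<and> ring H \<and>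
    (\<forall>c. \<forall>a\<in>carrier H. \<forall>b\<in>carrier H.
      (c \<odot>\<^bsub>H\<^esub> a) \<otimes>\<^bsub>H\<^esub> b = c \<odot>\<^bsub>H\<^esub> (a \<otimes>\<^bsub>H\<^esub> b) \<and>
      a \<otimes>\<^bsub>H\<^esub> (c \<odot>\<^bsub>H\<^esub> b) = c \<odot>\<^bsub>H\<^esub> (a \<otimes>\<^bsub>H\<^esub> b))"

definition tensor_mult ::
  "('k::field, 'h, 'm) module_scheme \<Rightarrow> ('h list \<Rightarrow>\<^sub>0 'k) \<Rightarrow> ('h list \<Rightarrow>\<^sub>0 'k) \<Rightarrow> 'h list \<Rightarrow>\<^sub>0 'k" where
  "tensor_mult H s t =
    lin_ext (\<lambda>xs. lin_ext (\<lambda>ys. Poly_Mapping.single (map2 (\<otimes>\<^bsub>H\<^esub>) xs ys) 1) t) s"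

definition bialgebra :: "('k::field, 'h) bialg \<Rightarrow> bool" where
  "bialgebra H \<longleftrightarrow> k_algebra H \<and>
    \<comment> \<open>\<open>\<Delta>\<close> and \<open>\<epsilon>\<close> are linear\<close>
    (\<forall>a\<in>carrier H. comult H a \<in> tensors H 2) \<and>
    (\<forall>a\<in>carrier H. \<forall>b\<in>carrier H.
      tensor_eq H 2 (comult H (a \<oplus>\<^bsub>H\<^esub> b)) (comult H a + comult H b) \<and>
      counit H (a \<oplus>\<^bsub>H\<^esub> b) = counit H a + counit H b) \<and>
    (\<forall>c. \<forall>a\<in>carrier H.
      tensor_eq H 2 (comult H (c \<odot>\<^bsub>H\<^esub> a)) (pm_scale c (comult H a)) \<and>
      counit H (c \<odot>\<^bsub>H\<^esub> a) = c * counit H a) \<and>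
    \<comment> \<open>\<open>(\<Delta> \<otimes> id) \<Delta> = (id \<otimes> \<Delta>) \<Delta>\<close>\<close>
    (\<forall>a\<in>carrier H. tensor_eq H 3
      (lin_ext (\<lambda>xs. lin_ext (\<lambda>ys. Poly_Mapping.single (ys @ [xs ! 1]) 1) (comult H (xs ! 0)))
        (comult H a))
      (lin_ext (\<lambda>xs. lin_ext (\<lambda>ys. Poly_Mapping.single ((xs ! 0) # ys) 1) (comult H (xs ! 1)))
        (comult H a))) \<and>
    \<comment> \<open>\<open>(\<epsilon> \<otimes> id) \<Delta> = id = (id \<otimes> \<epsilon>) \<Delta>\<close>\<close>
    (\<forall>a\<in>carrier H.
      lin_val H (\<lambda>xs. counit H (xs ! 0) \<odot>\<^bsub>H\<^esub> (xs ! 1)) (comult H a) = a \<and>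
      lin_val H (\<lambda>xs. counit H (xs ! 1) \<odot>\<^bsub>H\<^esub> (xs ! 0)) (comult H a) = a) \<and>
    \<comment> \<open>\<open>\<Delta>\<close> and \<open>\<epsilon>\<close> are algebra maps\<close>
    (\<forall>a\<in>carrier H. \<forall>b\<in>carrier H.
      tensor_eq H 2 (comult H (a \<otimes>\<^bsub>H\<^esub> b)) (tensor_mult H (comult H a) (comult H b)) \<and>
      counit H (a \<otimes>\<^bsub>H\<^esub> b) = counit H a * counit H b) \<and>
    tensor_eq H 2 (comult H \<one>\<^bsub>H\<^esub>) (Poly_Mapping.single [\<one>\<^bsub>H\<^esub>, \<one>\<^bsub>H\<^esub>] 1) \<and>
    counit H \<one>\<^bsub>H\<^esub> = 1"

definition is_antipode :: "('k::field, 'h) bialg \<Rightarrow> ('h \<Rightarrow> 'h) \<Rightarrow> bool" where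
  "is_antipode H S \<longleftrightarrow> S \<in> carrier H \<rightarrow> carrier H \<and>
    (\<forall>a\<in>carrier H. \<forall>b\<in>carrier H. S (a \<oplus>\<^bsub>H\<^esub> b) = S a \<oplus>\<^bsub>H\<^esub> S b) \<and>
    (\<forall>c. \<forall>a\<in>carrier H. S (c \<odot>\<^bsub>H\<^esub> a) = c \<odot>\<^bsub>H\<^esub> S a) \<and>
    (\<forall>a\<in>carrier H.
      lin_val H (\<lambda>xs. S (xs ! 0) \<otimes>\<^bsub>H\<^esub> (xs ! 1)) (comult H a) = counit H a \<odot>\<^bsub>H\<^esub> \<one>\<^bsub>H\<^esub> \<and>
      lin_val H (\<lambda>xs. (xs ! 0) \<otimes>\<^bsub>H\<^esub> S (xs ! 1)) (comult H a) = counit H a \<odot>\<^bsub>H\<^esub> \<one>\<^bsub>H\<^esub>)"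

definition hopf_algebra :: "('k::field, 'h) bialg \<Rightarrow> bool" where
  "hopf_algebra H \<longleftrightarrow> bialgebra H \<and> (\<exists>S. is_antipode H S)"

definition hopf_map :: "('k::field, 'h) bialg \<Rightarrow> ('k, 'l) bialg \<Rightarrow> ('h \<Rightarrow> 'l) \<Rightarrow> bool" where
  "hopf_map H L f \<longleftrightarrow> f \<in> ring_hom H L \<and>
    (\<forall>c. \<forall>a\<in>carrier H. f (c \<odot>\<^bsub>H\<^esub> a) = c \<odot>\<^bsub>L\<^esub> f a) \<and>
    (\<forall>a\<in>carrier H.
      tensor_eq L 2 (comult L (f a))
        (lin_ext (\<lambda>xs. Poly_Mapping.single (map f xs) 1) (comult H a)) \<and>
      counit L (f a) = counit H a)"

text \<open>Stability of a subspace \<open>A\<close> under the left and right adjoint actions,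
  \<open>h\<^sub>1 a S(h\<^sub>2) \<in> A\<close> and \<open>S(h\<^sub>1) a h\<^sub>2 \<in> A\<close>. The antipode is unique on the carrier.\<close>

definition normal_in :: "'h set \<Rightarrow> ('k::field, 'h) bialg \<Rightarrow> bool" where
  "normal_in A H \<longleftrightarrow> (\<forall>S. is_antipode H S \<longrightarrow> (\<forall>h\<in>carrier H. \<forall>a\<in>A.
    lin_val H (\<lambda>xs. (xs ! 0) \<otimes>\<^bsub>H\<^esub> a \<otimes>\<^bsub>H\<^esub> S (xs ! 1)) (comult H h) \<in> A \<and>
    lin_val H (\<lambda>xs. S (xs ! 0) \<otimes>\<^bsub>H\<^esub> a \<otimes>\<^bsub>H\<^esub> (xs ! 1)) (comult H h) \<in> A))"


section \<open>Function algebras and group algebras\<close>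

text \<open>Functions on a group \<open>L\<close> (or on a product of groups) are encoded as functions on the
  underlying type that vanish off the carrier.\<close>

definition funs_on :: "'a set \<Rightarrow> ('a \<Rightarrow> 'k::field) set" where
  "funs_on S = {f. \<forall>x. x \<notin> S \<longrightarrow> f x = 0}"

definition delta :: "'a \<Rightarrow> 'a \<Rightarrow> 'k::field" where
  "delta a = (\<lambda>x. if x = a then 1 else 0)"

definition fun_alg :: "'g monoid \<Rightarrow> ('k::field, 'g \<Rightarrow> 'k) bialg" where
  "fun_alg L = \<lparr>carrier = funs_on (carrier L),
     monoid.mult = (\<lambda>f f' a. f a * f' a),
     one = (\<lambda>a. if a \<in> carrier L then 1 else 0),
     zero = (\<lambda>a. 0),
     add = (\<lambda>f f' a. f a + f' a),
     module.smult = (\<lambda>c f a. c * f a),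
     comult = (\<lambda>f. \<Sum>a\<in>carrier L. \<Sum>b\<in>carrier L.
        Poly_Mapping.single [delta a, delta b] (f (a \<otimes>\<^bsub>L\<^esub> b))),
     counit = (\<lambda>f. f \<one>\<^bsub>L\<^esub>)\<rparr>"

definition group_alg :: "'c monoid \<Rightarrow> ('k::field, 'c \<Rightarrow> 'k) bialg" where
  "group_alg L = \<lparr>carrier = funs_on (carrier L),
     monoid.mult = (\<lambda>u v z. if z \<in> carrier L
        then \<Sum>x\<in>carrier L. u x * v (inv\<^bsub>L\<^esub> x \<otimes>\<^bsub>L\<^esub> z) else 0),
     one = delta \<one>\<^bsub>L\<^esub>,
     zero = (\<lambda>x. 0),
     add = (\<lambda>u v x. u x + v x),
     module.smult = (\<lambda>c u x. c * u x),
     comult = (\<lambda>u. \<Sum>x\<in>carrier L. Poly_Mapping.single [delta x, delta x] (u x)),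
     counit = (\<lambda>u. \<Sum>x\<in>carrier L. u x)\<rparr>"


section \<open>Commutative extensions of a group algebra by a function algebra\<close>

record (overloaded) ('g, 'c, 'k::zero, 'h) hopf_ext =
  hopf_total :: "('k, 'h) bialg"
  hopf_incl :: "('g \<Rightarrow> 'k) \<Rightarrow> 'h"
  hopf_proj :: "'h \<Rightarrow> ('c \<Rightarrow> 'k)"

text \<open>The last condition is \<open>ker \<pi> = \<iota>(k\<^sup>G)\<^sup>+ H\<close>: the additive subgroup generated by the products
  \<open>\<iota>(f) h\<close> with \<open>\<epsilon>(f) = 0\<close>.\<close>

definition hopf_extension ::
  "'c monoid \<Rightarrow> 'g monoid \<Rightarrow> ('g, 'c, 'k::field, 'h) hopf_ext \<Rightarrow> bool" where
  "hopf_extension C G E \<longleftrightarrow>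
    (let H = hopf_total E; \<iota> = hopf_incl E; \<pi> = hopf_proj E;
         A = (fun_alg G :: ('k, 'g \<Rightarrow> 'k) bialg); Q = (group_alg C :: ('k, 'c \<Rightarrow> 'k) bialg) in
      hopf_algebra H \<and>
      hopf_map A H \<iota> \<and> inj_on \<iota> (carrier A) \<and>
      hopf_map H Q \<pi> \<and> \<pi> ` carrier H = carrier Q \<and>
      normal_in (\<iota> ` carrier A) H \<and>
      {h \<in> carrier H. \<pi> h = \<zero>\<^bsub>Q\<^esub>} =
        generate (add_monoid H)
          {\<iota> f \<otimes>\<^bsub>H\<^esub> h | f h. f \<in> carrier A \<and> counit A f = 0 \<and> h \<in> carrier H})"

definition comm_hopf_extension ::
  "'c monoid \<Rightarrow> 'g monoid \<Rightarrow> ('g, 'c, 'k::field, 'h) hopf_ext \<Rightarrow> bool" where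
  "comm_hopf_extension C G E \<longleftrightarrow> hopf_extension C G E \<and>
    (\<forall>a\<in>carrier (hopf_total E). \<forall>b\<in>carrier (hopf_total E).
      a \<otimes>\<^bsub>hopf_total E\<^esub> b = b \<otimes>\<^bsub>hopf_total E\<^esub> a)"

definition hopf_ext_equiv ::
  "'g monoid \<Rightarrow> ('g, 'c, 'k::field, 'h) hopf_ext \<Rightarrow> ('g, 'c, 'k, 'l) hopf_ext \<Rightarrow> bool" where
  "hopf_ext_equiv G E E' \<longleftrightarrow>
    (\<exists>F. hopf_map (hopf_total E) (hopf_total E') F \<and>
      bij_betw F (carrier (hopf_total E)) (carrier (hopf_total E')) \<and>
      (\<forall>f\<in>funs_on (carrier G). F (hopf_incl E f) = hopf_incl E' f) \<and>
      (\<forall>h\<in>carrier (hopf_total E). hopf_proj E' (F h) = hopf_proj E h))"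

definition cocycles :: "'c monoid \<Rightarrow> 'g monoid \<Rightarrow> ('c \<Rightarrow> 'g \<Rightarrow> 'g \<Rightarrow> 'k::field) set" where
  "cocycles C G = {\<tau>.
    (\<forall>x\<in>carrier C. \<forall>a\<in>carrier G. \<forall>b\<in>carrier G. \<tau> x a b \<noteq> 0 \<and>
      (x = \<one>\<^bsub>C\<^esub> \<or> a = \<one>\<^bsub>G\<^esub> \<or> b = \<one>\<^bsub>G\<^esub> \<longrightarrow> \<tau> x a b = 1)) \<and>
    (\<forall>x\<in>carrier C. \<forall>a\<in>carrier G. \<forall>b\<in>carrier G. \<forall>c\<in>carrier G.
      \<tau> x a (b \<otimes>\<^bsub>G\<^esub> c) * \<tau> x b c = \<tau> x (a \<otimes>\<^bsub>G\<^esub> b) c * \<tau> x a b) \<and>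
    (\<forall>x\<in>carrier C. \<forall>y\<in>carrier C. \<forall>a\<in>carrier G. \<forall>b\<in>carrier G.
      \<tau> (x \<otimes>\<^bsub>C\<^esub> y) a b = \<tau> x a b * \<tau> y a b)}"

text \<open>An element \<open>\<Sum>\<^sub>x f\<^sub>x x\<close> (\<open>f\<^sub>x\<close> in \<open>k\<^sup>G\<close>) of the direct sum over \<open>C\<close> is encoded as the
  function \<open>(x, a) \<mapsto> f\<^sub>x(a)\<close>, so that \<open>p\<^sub>a x\<close> is \<open>delta (x, a)\<close>. In the comultiplication,
  \<open>f\<^sub>1 p\<^sub>a \<otimes> f\<^sub>2 p\<^sub>b = f(ab) p\<^sub>a \<otimes> p\<^sub>b\<close>.\<close>

definition H_alg ::
  "'c monoid \<Rightarrow> 'g monoid \<Rightarrow> ('c \<Rightarrow> 'g \<Rightarrow> 'g \<Rightarrow> 'k::field) \<Rightarrow> ('k, 'c \<times> 'g \<Rightarrow> 'k) bialg" where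
  "H_alg C G \<tau> = \<lparr>carrier = funs_on (carrier C \<times> carrier G),
     monoid.mult = (\<lambda>u v (z, a). if z \<in> carrier C
        then \<Sum>x\<in>carrier C. u (x, a) * v (inv\<^bsub>C\<^esub> x \<otimes>\<^bsub>C\<^esub> z, a) else 0),
     one = (\<lambda>(x, a). if x = \<one>\<^bsub>C\<^esub> \<and> a \<in> carrier G then 1 else 0),
     zero = (\<lambda>_. 0),
     add = (\<lambda>u v z. u z + v z),
     module.smult = (\<lambda>c u z. c * u z),
     comult = (\<lambda>u. \<Sum>x\<in>carrier C. \<Sum>a\<in>carrier G. \<Sum>b\<in>carrier G.
        Poly_Mapping.single [delta (x, a), delta (x, b)] (\<tau> x a b * u (x, a \<otimes>\<^bsub>G\<^esub> b))),
     counit = (\<lambda>u. \<Sum>x\<in>carrier C. u (x, \<one>\<^bsub>G\<^esub>))\<rparr>"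

text \<open>\<open>\<iota>(f) = f 1\<close> and \<open>\<pi>(f x) = f(1) x\<close>.\<close>

definition H_ext ::
  "'c monoid \<Rightarrow> 'g monoid \<Rightarrow> ('c \<Rightarrow> 'g \<Rightarrow> 'g \<Rightarrow> 'k::field)
    \<Rightarrow> ('g, 'c, 'k, 'c \<times> 'g \<Rightarrow> 'k) hopf_ext" where
  "H_ext C G \<tau> = \<lparr>hopf_total = H_alg C G \<tau>,
     hopf_incl = (\<lambda>f (x, a). if x = \<one>\<^bsub>C\<^esub> then f a else 0),
     hopf_proj = (\<lambda>u x. u (x, \<one>\<^bsub>G\<^esub>))\<rparr>"

text \<open>Equivalence classes are taken among the extensions carried by a set of functions
  \<open>'c \<times> 'g \<Rightarrow> 'k\<close>, where the \<open>H_ext C G \<tau>\<close> live. The extension \<open>E\<close> that names a class may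
  live on any type.\<close>

definition hopf_class ::
  "'c monoid \<Rightarrow> 'g monoid \<Rightarrow> ('g, 'c, 'k::field, 'h) hopf_ext
    \<Rightarrow> ('g, 'c, 'k, 'c \<times> 'g \<Rightarrow> 'k) hopf_ext set" where
  "hopf_class C G E = {E'. comm_hopf_extension C G E' \<and> hopf_ext_equiv G E' E}"

definition Ext_triv ::
  "'c monoid \<Rightarrow> 'g monoid \<Rightarrow> ('g, 'c, 'k::field, 'c \<times> 'g \<Rightarrow> 'k) hopf_ext set monoid" where
  "Ext_triv C G = \<lparr>
     carrier = {hopf_class C G E | E :: ('g, 'c, 'k, 'c \<times> 'g \<Rightarrow> 'k) hopf_ext.
        comm_hopf_extension C G E},
     monoid.mult = (\<lambda>U V. \<Union>{hopf_class C G (H_ext C G (\<lambda>x a b. \<sigma> x a b * \<tau> x a b)) | \<sigma> \<tau>.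
        \<sigma> \<in> cocycles C G \<and> \<tau> \<in> cocycles C G \<and> H_ext C G \<sigma> \<in> U \<and> H_ext C G \<tau> \<in> V}),
     one = hopf_class C G (H_ext C G (\<lambda>x a b. 1))\<rparr>"


section \<open>Central extensions\<close>

record ('g, 'c, 'e) grp_ext =
  grp_total :: "'e monoid"
  grp_incl :: "'c \<Rightarrow> 'e"
  grp_proj :: "'e \<Rightarrow> 'g"

definition central_extension :: "'c monoid \<Rightarrow> 'g monoid \<Rightarrow> ('g, 'c, 'e) grp_ext \<Rightarrow> bool" where
  "central_extension C G U \<longleftrightarrow>
    (let E = grp_total U; i = grp_incl U; q = grp_proj U in
      group E \<and>
      i \<in> hom C E \<and> inj_on i (carrier C) \<and>
      q \<in> hom E G \<and> q ` carrier E = carrier G \<and>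
      kernel E G q = i ` carrier C \<and>
      (\<forall>c\<in>carrier C. \<forall>e\<in>carrier E. i c \<otimes>\<^bsub>E\<^esub> e = e \<otimes>\<^bsub>E\<^esub> i c))"

definition grp_ext_equiv ::
  "'c monoid \<Rightarrow> ('g, 'c, 'e) grp_ext \<Rightarrow> ('g, 'c, 'f) grp_ext \<Rightarrow> bool" where
  "grp_ext_equiv C U V \<longleftrightarrow>
    (\<exists>F \<in> iso (grp_total U) (grp_total V).
      (\<forall>c\<in>carrier C. F (grp_incl U c) = grp_incl V c) \<and>
      (\<forall>e\<in>carrier (grp_total U). grp_proj V (F e) = grp_proj U e))"

text \<open>Baer sum: the fibre product of the two extensions over \<open>G\<close>, modulo the antidiagonal
  copy of \<open>C\<close>.\<close>

definition fibre_product ::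
  "('g, 'c, 'e) grp_ext \<Rightarrow> ('g, 'c, 'f) grp_ext \<Rightarrow> ('e \<times> 'f) monoid" where
  "fibre_product U V = (grp_total U \<times>\<times> grp_total V)
     \<lparr>carrier := {(e, f). e \<in> carrier (grp_total U) \<and> f \<in> carrier (grp_total V) \<and>
        grp_proj U e = grp_proj V f}\<rparr>"

definition antidiagonal ::
  "'c monoid \<Rightarrow> ('g, 'c, 'e) grp_ext \<Rightarrow> ('g, 'c, 'f) grp_ext \<Rightarrow> ('e \<times> 'f) set" where
  "antidiagonal C U V = (\<lambda>c. (grp_incl U c, grp_incl V (inv\<^bsub>C\<^esub> c))) ` carrier C"

definition baer_sum ::
  "'c monoid \<Rightarrow> ('g, 'c, 'e) grp_ext \<Rightarrow> ('g, 'c, 'f) grp_ext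
    \<Rightarrow> ('g, 'c, ('e \<times> 'f) set) grp_ext" where
  "baer_sum C U V = \<lparr>
     grp_total = fibre_product U V Mod antidiagonal C U V,
     grp_incl = (\<lambda>c. antidiagonal C U V #>\<^bsub>fibre_product U V\<^esub> (grp_incl U c, \<one>\<^bsub>grp_total V\<^esub>)),
     grp_proj = (\<lambda>N. the_elem ((grp_proj U \<circ> fst) ` N))\<rparr>"

text \<open>A central extension of \<open>G\<close> by \<open>C\<close> has as many elements as \<open>G \<times> C\<close>, so the classes are
  taken among the extensions carried by a subset of \<open>'g \<times> 'c\<close>.\<close>

definition grp_class ::
  "'c monoid \<Rightarrow> 'g monoid \<Rightarrow> ('g, 'c, 'e) grp_ext \<Rightarrow> ('g, 'c, 'g \<times> 'c) grp_ext set" where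
  "grp_class C G U = {U'. central_extension C G U' \<and> grp_ext_equiv C U' U}"

definition Cext :: "'g monoid \<Rightarrow> 'c monoid \<Rightarrow> ('g, 'c, 'g \<times> 'c) grp_ext set monoid" where
  "Cext G C = \<lparr>
     carrier = {grp_class C G U | U :: ('g, 'c, 'g \<times> 'c) grp_ext. central_extension C G U},
     monoid.mult = (\<lambda>K L. \<Union>{grp_class C G (baer_sum C U V) | U V. U \<in> K \<and> V \<in> L}),
     one = grp_class C G \<lparr>grp_total = G \<times>\<times> C, grp_incl = (\<lambda>c. (\<one>\<^bsub>G\<^esub>, c)), grp_proj = fst\<rparr>\<rparr>"


section \<open>The central extension defined by a cocycle\<close>

definition dual_group :: "'c monoid \<Rightarrow> ('c \<Rightarrow> 'k::field) monoid" where
  "dual_group C = \<lparr>carrier = hom C (mult_of base_field) \<inter> funs_on (carrier C),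
     monoid.mult = (\<lambda>\<chi> \<psi> x. \<chi> x * \<psi> x),
     one = (\<lambda>x. if x \<in> carrier C then 1 else 0)\<rparr>"

text \<open>The extension of \<open>G\<close> by an abelian group \<open>A\<close> with trivial action and
  normalized 2-cocycle \<open>\<sigma>\<close>.\<close>

definition cocycle_ext ::
  "'g monoid \<Rightarrow> 'a monoid \<Rightarrow> ('g \<Rightarrow> 'g \<Rightarrow> 'a) \<Rightarrow> ('g, 'a, 'g \<times> 'a) grp_ext" where
  "cocycle_ext G A \<sigma> = \<lparr>
     grp_total = \<lparr>carrier = carrier G \<times> carrier A,
       monoid.mult = (\<lambda>(a, u) (b, v). (a \<otimes>\<^bsub>G\<^esub> b, u \<otimes>\<^bsub>A\<^esub> v \<otimes>\<^bsub>A\<^esub> \<sigma> a b)),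
       one = (\<one>\<^bsub>G\<^esub>, \<one>\<^bsub>A\<^esub>)\<rparr>,
     grp_incl = (\<lambda>u. (\<one>\<^bsub>G\<^esub>, u)),
     grp_proj = fst\<rparr>"

definition G_ext ::
  "'c monoid \<Rightarrow> 'g monoid \<Rightarrow> ('c \<Rightarrow> 'g \<Rightarrow> 'g \<Rightarrow> 'k::field)
    \<Rightarrow> ('g, 'c \<Rightarrow> 'k, 'g \<times> ('c \<Rightarrow> 'k)) grp_ext" where
  "G_ext C G \<tau> = cocycle_ext G (dual_group C) (\<lambda>a b x. if x \<in> carrier C then \<tau> x a b else 0)"

text \<open>A group extension by the dual of \<open>C\<close>, read as one by \<open>C\<close> through an identification
  \<open>\<theta>\<close> of \<open>C\<close> with its dual.\<close>

definition via :: "('c \<Rightarrow> 'a) \<Rightarrow> ('g, 'a, 'e) grp_ext \<Rightarrow> ('g, 'c, 'e) grp_ext" where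
  "via \<theta> U = \<lparr>grp_total = grp_total U, grp_incl = grp_incl U \<circ> \<theta>, grp_proj = grp_proj U\<rparr>"

text \<open>For a central extension \<open>U\<close>, \<open>1 \<rightarrow> D \<rightarrow> E \<rightarrow> G \<rightarrow> 1\<close>, with \<open>D\<close> the dual of \<open>C\<close>: the
  dual sequence \<open>k\<^sup>G \<rightarrow> k\<^sup>E \<rightarrow> k\<^sup>D\<close>, followed by the inverse of the evaluation
  isomorphism from \<open>kC\<close> to \<open>k\<^sup>D\<close>.\<close>

definition evaluation :: "'c monoid \<Rightarrow> ('c \<Rightarrow> 'k::field) \<Rightarrow> ('c \<Rightarrow> 'k) \<Rightarrow> 'k" where
  "evaluation C u = (\<lambda>\<chi>. if \<chi> \<in> carrier (dual_group C) then \<Sum>x\<in>carrier C. u x * \<chi> x else 0)"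

definition fun_ext ::
  "'c monoid \<Rightarrow> ('g, 'c \<Rightarrow> 'k, 'e) grp_ext \<Rightarrow> ('g, 'c, 'k::field, 'e \<Rightarrow> 'k) hopf_ext" where
  "fun_ext C U = \<lparr>hopf_total = fun_alg (grp_total U),
     hopf_incl = (\<lambda>f e. if e \<in> carrier (grp_total U) then f (grp_proj U e) else 0),
     hopf_proj = (\<lambda>F. the_inv_into (funs_on (carrier C)) (evaluation C)
        (\<lambda>\<chi>. if \<chi> \<in> carrier (dual_group C) then F (grp_incl U \<chi>) else 0))\<rparr>"

end

theory Submission
  imports Defs "HOL-Number_Theory.Residues"
begin

text \<open>A commutative extension \<open>H\<close> is recovered from the group \<open>E\<close> of its points, the algebra maps
  from \<open>H\<close> to \<open>k\<close>. Write \<open>e\<^sub>a\<close> for the image of \<open>p\<^sub>a\<close> in \<open>H\<close>; it is idempotent, and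
  \<open>H\<close> is the sum of the ideals \<open>H e\<^sub>a\<close>. The coaction of \<open>kC\<close> grades \<open>H e\<^sub>a\<close> by \<open>C\<close> with
  components that are lines spanned by units, because the antipode inverts the canonical map. Since \<open>k\<close>
  contains the \<open>p\<close>-th roots of unity, \<open>H e\<^sub>a\<close> is then a product of copies of \<open>k\<close>. Hence there are
  points over each \<open>a\<close>, they form a torsor under the dual \<open>D\<close> of \<open>C\<close>, and \<open>H\<close> is \<open>k\<^sup>E\<close> for an
  extension \<open>E\<close> of \<open>G\<close> by \<open>D\<close>. Here \<open>D\<close> is central, as it is normal of order \<open>p\<close> in a \<open>p\<close>-group, so
  \<open>E\<close> is some \<open>G(\<tau>)\<close>, and \<open>k\<^sup>G\<^sup>(\<^sup>\<tau>\<^sup>)\<close> is \<open>H(\<tau>)\<close> by Fourier transform on \<open>C\<close>. Finally,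
  \<open>H(\<sigma>)\<close> and \<open>H(\<tau>)\<close> are equivalent iff \<open>\<sigma>\<close> and \<open>\<tau>\<close> are cohomologous iff \<open>G(\<sigma>)\<close> and
  \<open>G(\<tau>)\<close> are equivalent, and the Baer sum adds cocycles.\<close>

section \<open>Multilinear functionals on tensors\<close>

text \<open>Nothing bounds the dimension of \<open>H\<close> in advance and no section of its
  projection to kC by units is given, so the fibres \<open>H e a\<close> have to be understood from
  the Hopf axioms alone. Tensors are moreover only known modulo \<open>tensor_rel\<close>. An
  identity between tensors is therefore tested on multilinear functionals and an identity in
  \<open>H\<close> on linear ones; there are enough of both, because a subspace and a vector outside
  it can be separated. Every computation with the comultiplication becomes one with scalars. The
  inverse of the canonical map H e_a \<otimes> H e_a -> H e_a \<otimes> kC appears in the same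
  disguise, as the functional \<open>N\<close>. It replaces dimension counts twice: it makes the
  part of degree 1 of a fibre a line, and it makes the points separate \<open>H\<close>. That there
  are finitely many points is a consequence of the group extension they form. The field enters
  through the p-th roots of unity, through p-th roots of other scalars, which normalize the
  homogeneous units, and through the division by p in Fourier inversion.\<close>

lemma lookup_pm_scale [simp]:
  "Poly_Mapping.lookup (pm_scale c t) x = c * Poly_Mapping.lookup t x"
  by (simp add: Poly_Mapping.map.rep_eq when_def)

lemma keys_pm_scale: "Poly_Mapping.keys (pm_scale c t) \<subseteq> Poly_Mapping.keys t"
  by (auto simp: in_keys_iff)

lemma pm_scale_single [simp]: "pm_scale c (Poly_Mapping.single x d) = Poly_Mapping.single x (c * d)"
  by (simp add: Poly_Mapping.map_single)

lemma vector_space_pm_scale: "vector_space (pm_scale :: 'k::field \<Rightarrow> ('a \<Rightarrow>\<^sub>0 'k) \<Rightarrow> _)"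
  by unfold_locales
    (auto intro!: poly_mapping_eqI simp: lookup_add algebra_simps)

text \<open>A basis of \<open>S\<close> stays independent when \<open>v\<close> is added, so a
  functional may be prescribed to vanish on the basis and to be 1 at \<open>v\<close>.\<close>

lemma (in vector_space) functional_separating_subspace:
  assumes "subspace S" "v \<notin> S"
  shows "\<exists>F. Vector_Spaces.linear scale (*) F \<and> (\<forall>x\<in>S. F x = 0) \<and> F v = 1"
proof -
  interpret K: vector_space "(*) :: 'a \<Rightarrow> 'a \<Rightarrow> 'a"
    by unfold_locales (auto simp: algebra_simps)
  interpret P: vector_space_pair scale "(*) :: 'a \<Rightarrow> 'a \<Rightarrow> 'a" ..
  obtain B where B: "B \<subseteq> S" "independent B" "S \<subseteq> span B"
    using maximal_independent_subset[of S] by metis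
  have sp: "span B = S"
    using B assms(1) span_minimal by blast
  have "independent (insert v B)"
    using B(2) assms(2) sp by (simp add: independent_insertI)
  then obtain F where F: "Vector_Spaces.linear scale (*) F"
    "\<forall>x\<in>insert v B. F x = (if x = v then 1 else 0)"
    using P.linear_independent_extend[of "insert v B" "\<lambda>x. if x = v then 1 else 0"] by blast
  have "F x = 0" if "x \<in> S" for x
  proof (rule P.linear_eq_0_on_span[OF F(1)])
    show "x \<in> span B" using sp that by simp
    show "\<And>x. x \<in> B \<Longrightarrow> F x = 0" using F(2) assms(2) B(1) by auto
  qed
  with F show ?thesis by auto
qed

text \<open>The linear functional on the free vector space with value \<open>f x\<close> on the
  basis vector \<open>x\<close>. Every functional has this form, so tensors can be studied through
  \<open>tensor_eval\<close> alone.\<close>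

definition tensor_eval :: "('a \<Rightarrow> 'k) \<Rightarrow> ('a \<Rightarrow>\<^sub>0 'k::field) \<Rightarrow> 'k" where
  "tensor_eval f t = (\<Sum>x\<in>Poly_Mapping.keys t. Poly_Mapping.lookup t x * f x)"

lemma tensor_eval_superset:
  assumes "finite A" "Poly_Mapping.keys t \<subseteq> A"
  shows "tensor_eval f t = (\<Sum>x\<in>A. Poly_Mapping.lookup t x * f x)"
  unfolding tensor_eval_def
  using assms by (intro sum.mono_neutral_left) (auto simp: in_keys_iff)

lemma tensor_eval_zero [simp]: "tensor_eval f 0 = 0"
  by (simp add: tensor_eval_def)

lemma tensor_eval_add [simp]: "tensor_eval f (s + t) = tensor_eval f s + tensor_eval f t"
proof -
  let ?A = "Poly_Mapping.keys s \<union> Poly_Mapping.keys t"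
  have "Poly_Mapping.keys (s + t) \<subseteq> ?A" by (rule keys_add)
  then show ?thesis
    by (simp add: tensor_eval_superset[of ?A] lookup_add algebra_simps sum.distrib)
qed

lemma tensor_eval_scale [simp]: "tensor_eval f (pm_scale c t) = c * tensor_eval f t"
  using keys_pm_scale[of c t]
  by (simp add: tensor_eval_superset[of "Poly_Mapping.keys t"] sum_distrib_left algebra_simps)

lemma tensor_eval_diff [simp]: "tensor_eval f (s - t) = tensor_eval f s - tensor_eval f t"
proof -
  have "s - t = s + pm_scale (-1) t"
    by (rule poly_mapping_eqI) (simp add: lookup_add lookup_minus)
  then show ?thesis by (simp only: tensor_eval_add tensor_eval_scale) simp
qed

lemma tensor_eval_single [simp]: "tensor_eval f (Poly_Mapping.single x c) = c * f x"
  by (simp add: tensor_eval_superset[of "{x}"])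

lemma tensor_eval_sum [simp]: "tensor_eval f (\<Sum>i\<in>I. t i) = (\<Sum>i\<in>I. tensor_eval f (t i))"
  by (induction I rule: infinite_finite_induct) auto

lemma tensor_eval_lin_ext [simp]:
  "tensor_eval f (lin_ext g t) = tensor_eval (\<lambda>x. tensor_eval f (g x)) t"
  by (simp add: lin_ext_def tensor_eval_def[of _ t])

lemma tensor_eval_cong:
  "(\<And>x. x \<in> Poly_Mapping.keys t \<Longrightarrow> f x = g x) \<Longrightarrow> tensor_eval f t = tensor_eval g t"
  by (simp add: tensor_eval_def)

lemma tensor_eval_fun_add:
  "tensor_eval (\<lambda>x. f x + g x) t = tensor_eval f t + tensor_eval g t"
  by (simp add: tensor_eval_def algebra_simps sum.distrib)

lemma tensor_eval_fun_mult: "tensor_eval (\<lambda>x. c * f x) t = c * tensor_eval f t"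
  by (simp add: tensor_eval_def sum_distrib_left algebra_simps)

lemma tensor_eval_fun_mult_right: "tensor_eval (\<lambda>x. f x * c) t = tensor_eval f t * c"
  by (simp add: tensor_eval_def sum_distrib_left algebra_simps)

lemma tensor_eval_fun_sum:
  "tensor_eval (\<lambda>x. \<Sum>i\<in>I. f i x) t = (\<Sum>i\<in>I. tensor_eval (f i) t)"
  unfolding tensor_eval_def sum_distrib_left by (rule sum.swap)

lemma tensor_eval_swap:
  "tensor_eval (\<lambda>x. tensor_eval (\<lambda>y. f x y) t) s = tensor_eval (\<lambda>y. tensor_eval (\<lambda>x. f x y) s) t"
  unfolding tensor_eval_def sum_distrib_left
  by (subst sum.swap) (simp add: algebra_simps)

lemma lin_ext_eqI:
  assumes "\<And>f. tensor_eval f s = tensor_eval f t"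
  shows "s = t"
proof (rule poly_mapping_eqI)
  fix x
  have "tensor_eval (\<lambda>y. if y = x then 1 else 0) u = Poly_Mapping.lookup u x" for u :: "'a \<Rightarrow>\<^sub>0 'b"
    by (simp add: tensor_eval_superset[of "insert x (Poly_Mapping.keys u)"] mult.commute if_distrib subset_insertI
        cong: if_cong)
  with assms show "Poly_Mapping.lookup s x = Poly_Mapping.lookup t x" by metis
qed

definition multilinear :: "('k::field, 'h, 'm) module_scheme \<Rightarrow> nat \<Rightarrow> ('h list \<Rightarrow> 'k) \<Rightarrow> bool" where
  "multilinear V n f \<longleftrightarrow> (\<forall>xs\<in>words V n. \<forall>i<n. \<forall>a\<in>carrier V.
    (\<forall>b\<in>carrier V. f (xs[i := a \<oplus>\<^bsub>V\<^esub> b]) = f (xs[i := a]) + f (xs[i := b])) \<and>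
    (\<forall>c. f (xs[i := c \<odot>\<^bsub>V\<^esub> a]) = c * f (xs[i := a])))"

lemma multilinear_tensor_rel:
  assumes "multilinear V n f" "t \<in> tensor_rel V n"
  shows "tensor_eval f t = 0"
  using assms(2,1) by induction (auto simp: multilinear_def)

lemma tensor_rel_subspace:
  fixes V :: "('k::field, 'h, 'm) module_scheme"
  shows "module.subspace pm_scale (tensor_rel V n)"
proof -
  interpret vector_space "pm_scale :: 'k \<Rightarrow> ('h list \<Rightarrow>\<^sub>0 'k) \<Rightarrow> _" by (rule vector_space_pm_scale)
  show ?thesis by (auto simp: subspace_def intro: tensor_rel.intros)
qed

text \<open>Functionals on the free space correspond to functions on words, and those that kill
  \<open>tensor_rel\<close> are multilinear. If \<open>s - t\<close> were outside the relation
  subspace, a functional separating it from that subspace would be a multilinear function telling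
  \<open>s\<close> from \<open>t\<close>.\<close>

lemma tensor_eq_iff:
  fixes V :: "('k::field, 'h, 'm) module_scheme"
  shows "tensor_eq V n s t \<longleftrightarrow> (\<forall>f. multilinear V n f \<longrightarrow> tensor_eval f s = tensor_eval f t)"
proof
  assume "tensor_eq V n s t"
  then show "\<forall>f. multilinear V n f \<longrightarrow> tensor_eval f s = tensor_eval f t"
    using multilinear_tensor_rel unfolding tensor_eq_def by fastforce
next
  assume *: "\<forall>f. multilinear V n f \<longrightarrow> tensor_eval f s = tensor_eval f t"
  interpret vector_space "pm_scale :: 'k \<Rightarrow> ('h list \<Rightarrow>\<^sub>0 'k) \<Rightarrow> _" by (rule vector_space_pm_scale)
  show "tensor_eq V n s t"
  proof (rule ccontr)
    assume "\<not> tensor_eq V n s t"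
    then obtain F where F: "Vector_Spaces.linear pm_scale (*) F"
      "\<And>x. x \<in> tensor_rel V n \<Longrightarrow> F x = 0" "F (s - t) = 1"
      using functional_separating_subspace[OF tensor_rel_subspace, of "s - t" V n]
      unfolding tensor_eq_def by blast
    interpret F: Vector_Spaces.linear pm_scale "(*)" F by (rule F(1))
    define f where "f = (\<lambda>w. F (Poly_Mapping.single w 1))"
    have ev: "F u = tensor_eval f u" for u
    proof -
      have "u = (\<Sum>w\<in>Poly_Mapping.keys u. pm_scale (Poly_Mapping.lookup u w) (Poly_Mapping.single w 1))"
        by (rule poly_mapping_eqI)
          (simp add: lookup_sum lookup_single when_def in_keys_iff)
      then have "F u = F (\<Sum>w\<in>Poly_Mapping.keys u. pm_scale (Poly_Mapping.lookup u w) (Poly_Mapping.single w 1))"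
        by simp
      also have "\<dots> = tensor_eval f u"
        by (simp only: F.sum F.scale tensor_eval_def f_def)
      finally show ?thesis .
    qed
    have "multilinear V n f"
      unfolding multilinear_def
    proof (intro ballI allI impI conjI)
      fix xs i a b assume "xs \<in> words V n" "i < n" "a \<in> carrier V" "b \<in> carrier V"
      from F(2)[OF tensor_rel.additive[OF this]]
      show "f (xs[i := a \<oplus>\<^bsub>V\<^esub> b]) = f (xs[i := a]) + f (xs[i := b])"
        by (simp only: F.diff f_def) (simp add: diff_diff_eq)
    next
      fix xs i a c assume "xs \<in> words V n" "i < n" "a \<in> carrier V"
      from F(2)[OF tensor_rel.homogeneous[OF this, of c]]
      show "f (xs[i := c \<odot>\<^bsub>V\<^esub> a]) = c * f (xs[i := a])"
        by (simp add: ev)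
    qed
    with * F(3) show False by (simp add: ev)
  qed
qed

section \<open>Bilinear and trilinear forms, and Sweedler sums\<close>

definition linear_on :: "('k::field, 'h, 'm) module_scheme \<Rightarrow> ('h \<Rightarrow> 'k) \<Rightarrow> bool" where
  "linear_on V f \<longleftrightarrow>
    (\<forall>a\<in>carrier V. \<forall>b\<in>carrier V. f (a \<oplus>\<^bsub>V\<^esub> b) = f a + f b) \<and>
    (\<forall>c. \<forall>a\<in>carrier V. f (c \<odot>\<^bsub>V\<^esub> a) = c * f a)"

definition bilinear_on :: "('k::field, 'h, 'm) module_scheme \<Rightarrow> ('h \<Rightarrow> 'h \<Rightarrow> 'k) \<Rightarrow> bool" where
  "bilinear_on V B \<longleftrightarrow> (\<forall>a\<in>carrier V. linear_on V (B a) \<and> linear_on V (\<lambda>b. B b a))"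

definition trilinear_on :: "('k::field, 'h, 'm) module_scheme \<Rightarrow> ('h \<Rightarrow> 'h \<Rightarrow> 'h \<Rightarrow> 'k) \<Rightarrow> bool" where
  "trilinear_on V B \<longleftrightarrow> (\<forall>a\<in>carrier V. \<forall>b\<in>carrier V.
    linear_on V (\<lambda>x. B x a b) \<and> linear_on V (\<lambda>x. B a x b) \<and> linear_on V (\<lambda>x. B a b x))"

lemma words_2: "xs \<in> words V 2 \<longleftrightarrow> (\<exists>a\<in>carrier V. \<exists>b\<in>carrier V. xs = [a, b])"
  by (auto simp: words_def numeral_2_eq_2 length_Suc_conv)

lemma words_3:
  "xs \<in> words V 3 \<longleftrightarrow> (\<exists>a\<in>carrier V. \<exists>b\<in>carrier V. \<exists>c\<in>carrier V. xs = [a, b, c])"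
  by (auto simp: words_def numeral_3_eq_3 length_Suc_conv)

lemma bilinear_on_iff: "bilinear_on V B \<longleftrightarrow> multilinear V 2 (\<lambda>w. B (w ! 0) (w ! 1))"
proof
  show "multilinear V 2 (\<lambda>w. B (w ! 0) (w ! 1))" if "bilinear_on V B"
    using that by (auto simp: multilinear_def bilinear_on_def linear_on_def words_2 less_2_cases_iff)
  assume m: "multilinear V 2 (\<lambda>w. B (w ! 0) (w ! 1))"
  have w: "[a, b] \<in> words V 2" if "a \<in> carrier V" "b \<in> carrier V" for a b
    using that by (auto simp: words_2)
  show "bilinear_on V B"
    unfolding bilinear_on_def linear_on_def
  proof (intro ballI conjI allI)
    fix a b c assume c: "a \<in> carrier V" "b \<in> carrier V" "c \<in> carrier V"
    show "B a (b \<oplus>\<^bsub>V\<^esub> c) = B a b + B a c"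
      using m[unfolded multilinear_def, rule_format, OF w[OF c(1,1)], of 1 b] c by auto
    show "B (b \<oplus>\<^bsub>V\<^esub> c) a = B b a + B c a"
      using m[unfolded multilinear_def, rule_format, OF w[OF c(1,1)], of 0 b] c by auto
  next
    fix a b k assume c: "a \<in> carrier V" "b \<in> carrier V"
    show "B a (k \<odot>\<^bsub>V\<^esub> b) = k * B a b"
      using m[unfolded multilinear_def, rule_format, OF w[OF c(1,1)], of 1 b] c by auto
    show "B (k \<odot>\<^bsub>V\<^esub> b) a = k * B b a"
      using m[unfolded multilinear_def, rule_format, OF w[OF c(1,1)], of 0 b] c by auto
  qed
qed

lemma trilinear_on_iff: "trilinear_on V B \<longleftrightarrow> multilinear V 3 (\<lambda>w. B (w ! 0) (w ! 1) (w ! 2))"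
proof
  have three: "i < 3 \<longleftrightarrow> i = 0 \<or> i = 1 \<or> i = 2" for i :: nat by auto
  show "multilinear V 3 (\<lambda>w. B (w ! 0) (w ! 1) (w ! 2))" if "trilinear_on V B"
    using that by (auto simp: multilinear_def trilinear_on_def linear_on_def words_3 three)
  assume m: "multilinear V 3 (\<lambda>w. B (w ! 0) (w ! 1) (w ! 2))"
  have w: "[a, b, c] \<in> words V 3" if "a \<in> carrier V" "b \<in> carrier V" "c \<in> carrier V" for a b c
    using that by (auto simp: words_3)
  show "trilinear_on V B"
    unfolding trilinear_on_def linear_on_def
  proof (intro ballI conjI allI)
    fix a b c d assume c: "a \<in> carrier V" "b \<in> carrier V" "c \<in> carrier V" "d \<in> carrier V"
    note m' = m[unfolded multilinear_def, rule_format]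
    show "B (c \<oplus>\<^bsub>V\<^esub> d) a b = B c a b + B d a b"
      using m'[OF w[OF c(1,1,2)], of 0 c] c by auto
    show "B a (c \<oplus>\<^bsub>V\<^esub> d) b = B a c b + B a d b"
      using m'[OF w[OF c(1,1,2)], of 1 c] c by auto
    show "B a b (c \<oplus>\<^bsub>V\<^esub> d) = B a b c + B a b d"
      using m'[OF w[OF c(1,2,2)], of 2 c] c by auto
  next
    fix a b c k assume c: "a \<in> carrier V" "b \<in> carrier V" "c \<in> carrier V"
    note m' = m[unfolded multilinear_def, rule_format]
    show "B (k \<odot>\<^bsub>V\<^esub> c) a b = k * B c a b"
      using m'[OF w[OF c(1,1,2)], of 0 c] c by auto
    show "B a (k \<odot>\<^bsub>V\<^esub> c) b = k * B a c b"
      using m'[OF w[OF c(1,1,2)], of 1 c] c by auto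
    show "B a b (k \<odot>\<^bsub>V\<^esub> c) = k * B a b c"
      using m'[OF w[OF c(1,2,2)], of 2 c] c by auto
  qed
qed

text \<open>Sweedler notation: \<open>sweedler t B\<close> is \<open>\<Sum> B t\<^sub>1 t\<^sub>2\<close> for \<open>t = \<Sum> t\<^sub>1 \<otimes> t\<^sub>2\<close>.\<close>

definition sweedler :: "('h list \<Rightarrow>\<^sub>0 'k::field) \<Rightarrow> ('h \<Rightarrow> 'h \<Rightarrow> 'k) \<Rightarrow> 'k" where
  "sweedler t B = tensor_eval (\<lambda>w. B (w ! 0) (w ! 1)) t"

text \<open>A multilinear function is unconstrained on lists that are not words of length 2. Only
  words occur in \<open>t\<close>, so it may be replaced by a function of the two entries.\<close>

lemma multilinear_2_unfold: 
  assumes "multilinear V 2 f" "t \<in> tensors V 2"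
  shows "tensor_eval f t = sweedler t (\<lambda>a b. f [a, b])"
  unfolding sweedler_def using assms(2)
  by (intro tensor_eval_cong) (auto simp: tensors_def words_2 subset_iff)

lemma multilinear_3_unfold: 
  assumes "multilinear V 3 f" "t \<in> tensors V 3"
  shows "tensor_eval f t = tensor_eval (\<lambda>w. f [w ! 0, w ! 1, w ! 2]) t"
  using assms(2)
  by (intro tensor_eval_cong) (auto simp: tensors_def words_3 subset_iff)

text \<open>The closure assumptions keep updated words inside \<open>words V n\<close>, where the
  two functions are known to agree.\<close>

lemma multilinear_cong:
  assumes "\<And>xs. xs \<in> words V n \<Longrightarrow> f xs = g xs" "\<And>a b. a \<in> carrier V \<Longrightarrow> b \<in> carrier V \<Longrightarrow> a \<oplus>\<^bsub>V\<^esub> b \<in> carrier V"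
    "\<And>a c. a \<in> carrier V \<Longrightarrow> c \<odot>\<^bsub>V\<^esub> a \<in> carrier V" "multilinear V n f"
  shows "multilinear V n g"
proof -
  have up: "xs[i := a] \<in> words V n" if "xs \<in> words V n" "a \<in> carrier V" for xs i a
    using that set_update_subset_insert[of xs i a] by (auto simp: words_def)
  show ?thesis
    using assms(4) unfolding multilinear_def
    by (simp add: up assms(2,3) flip: assms(1))
qed

lemma tensor_eq_2_iff:
  assumes "s \<in> tensors V 2" "t \<in> tensors V 2"
    and "\<And>a b. a \<in> carrier V \<Longrightarrow> b \<in> carrier V \<Longrightarrow> a \<oplus>\<^bsub>V\<^esub> b \<in> carrier V"
    "\<And>a c. a \<in> carrier V \<Longrightarrow> c \<odot>\<^bsub>V\<^esub> a \<in> carrier V"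
  shows "tensor_eq V 2 s t \<longleftrightarrow> (\<forall>B. bilinear_on V B \<longrightarrow> sweedler s B = sweedler t B)"
proof
  assume "tensor_eq V 2 s t"
  then show "\<forall>B. bilinear_on V B \<longrightarrow> sweedler s B = sweedler t B"
    unfolding tensor_eq_iff bilinear_on_iff sweedler_def by blast
next
  assume *: "\<forall>B. bilinear_on V B \<longrightarrow> sweedler s B = sweedler t B"
  show "tensor_eq V 2 s t"
    unfolding tensor_eq_iff
  proof (intro allI impI)
    fix f assume f: "multilinear V 2 f"
    have "multilinear V 2 (\<lambda>w. f [w ! 0, w ! 1])"
      by (rule multilinear_cong[OF _ assms(3,4) f]) (auto simp: words_2)
    then have "bilinear_on V (\<lambda>a b. f [a, b])"
      by (simp add: bilinear_on_iff)
    then show "tensor_eval f s = tensor_eval f t"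
      using * f assms(1,2) by (simp add: multilinear_2_unfold)
  qed
qed

lemma tensor_eq_3_iff:
  assumes "s \<in> tensors V 3" "t \<in> tensors V 3"
    and "\<And>a b. a \<in> carrier V \<Longrightarrow> b \<in> carrier V \<Longrightarrow> a \<oplus>\<^bsub>V\<^esub> b \<in> carrier V"
    "\<And>a c. a \<in> carrier V \<Longrightarrow> c \<odot>\<^bsub>V\<^esub> a \<in> carrier V"
  shows "tensor_eq V 3 s t \<longleftrightarrow> (\<forall>B. trilinear_on V B \<longrightarrow>
    tensor_eval (\<lambda>w. B (w ! 0) (w ! 1) (w ! 2)) s = tensor_eval (\<lambda>w. B (w ! 0) (w ! 1) (w ! 2)) t)"
    (is "_ \<longleftrightarrow> ?R")
proof
  assume "tensor_eq V 3 s t"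
  then show ?R
    unfolding tensor_eq_iff trilinear_on_iff by blast
next
  assume *: ?R
  show "tensor_eq V 3 s t"
    unfolding tensor_eq_iff
  proof (intro allI impI)
    fix f assume f: "multilinear V 3 f"
    have "multilinear V 3 (\<lambda>w. f [w ! 0, w ! 1, w ! 2])"
      by (rule multilinear_cong[OF _ assms(3,4) f]) (auto simp: words_3)
    then have "trilinear_on V (\<lambda>a b c. f [a, b, c])"
      by (simp add: trilinear_on_iff)
    then show "tensor_eval f s = tensor_eval f t"
      using *[rule_format, of "\<lambda>a b c. f [a, b, c]"]
      by (simp only: multilinear_3_unfold[OF f assms(1)] multilinear_3_unfold[OF f assms(2)])
  qed
qed

section \<open>Vector spaces carried by a set, and their linear functionals\<close>

lemma base_field_simps [simp]:
  "carrier (base_field :: 'k::field ring) = UNIV"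
  "monoid.mult (base_field :: 'k ring) = (*)" "one (base_field :: 'k ring) = 1"
  "zero (base_field :: 'k ring) = 0" "add (base_field :: 'k ring) = (+)"
  by (auto simp: ring_of_type_algebra_def fun_eq_iff)

lemma (in abelian_group) additive_finsum:
  fixes f :: "'a \<Rightarrow> 'k::field"
  assumes "finite A" "g \<in> A \<rightarrow> carrier G"
    and add: "\<And>a b. a \<in> carrier G \<Longrightarrow> b \<in> carrier G \<Longrightarrow> f (a \<oplus> b) = f a + f b"
  shows "f (finsum G g A) = (\<Sum>x\<in>A. f (g x))"
  using assms(1,2)
proof (induction A rule: finite_induct)
  case empty
  have "f \<zero> + f \<zero> = f \<zero> + 0" using add[of \<zero> \<zero>] by simp
  then show ?case by (simp del: add_0_right)
next
  case (insert x A)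
  then show ?case by (simp add: add finsum_closed Pi_iff)
qed

locale vspace =
  fixes V :: "('k::field, 'h, 'm) module_scheme" (structure)
  assumes module_base_field: "module base_field V"
begin

sublocale module base_field V by (rule module_base_field)

lemma lin_val_closed:
  assumes "\<And>w. w \<in> Poly_Mapping.keys t \<Longrightarrow> g w \<in> carrier V"
  shows "lin_val V g t \<in> carrier V"
  unfolding lin_val_def using assms by (intro finsum_closed) auto

lemma linear_on_lin_val:
  assumes "linear_on V f" "\<And>w. w \<in> Poly_Mapping.keys t \<Longrightarrow> g w \<in> carrier V"
  shows "f (lin_val V g t) = tensor_eval (\<lambda>w. f (g w)) t"
proof -
  have "f (lin_val V g t) = (\<Sum>w\<in>Poly_Mapping.keys t. f (Poly_Mapping.lookup t w \<odot> g w))"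
    unfolding lin_val_def
    by (rule additive_finsum) (use assms in \<open>auto simp: linear_on_def\<close>)
  also have "\<dots> = tensor_eval (\<lambda>w. f (g w)) t"
    unfolding tensor_eval_def using assms by (intro sum.cong) (auto simp: linear_on_def)
  finally show ?thesis .
qed

lemma linear_on_zero: "linear_on V f \<Longrightarrow> f \<zero> = 0"
  using smult_l_null[of \<zero>] unfolding linear_on_def by (metis base_field_simps(4) mult_zero_left zero_closed)

lemma linear_on_uminus: "linear_on V f \<Longrightarrow> a \<in> carrier V \<Longrightarrow> f (\<ominus> a) = - f a"
  using l_neg[of a] linear_on_zero[of f] unfolding linear_on_def
  by (metis a_inv_closed add_eq_0_iff add.commute)

lemma linear_on_minus:
  "linear_on V f \<Longrightarrow> a \<in> carrier V \<Longrightarrow> b \<in> carrier V \<Longrightarrow> f (a \<ominus> b) = f a - f b"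
  by (simp add: minus_eq linear_on_uminus) (simp add: linear_on_def linear_on_uminus)

lemma linear_on_finsum:
  "linear_on V f \<Longrightarrow> finite A \<Longrightarrow> g \<in> A \<rightarrow> carrier V \<Longrightarrow> f (finsum V g A) = (\<Sum>x\<in>A. f (g x))"
  by (rule additive_finsum) (auto simp: linear_on_def)

text \<open>The carrier is the quotient of the free vector space on it by the kernel of \<open>lin_val\<close>, so
  functionals on the free space that kill this kernel descend.\<close>

lemma functional_exists:
  assumes v: "v \<in> carrier V" "v \<noteq> \<zero>"
  shows "\<exists>f. linear_on V f \<and> f v = 1"
proof -
  interpret P: vector_space "pm_scale :: 'k \<Rightarrow> ('h \<Rightarrow>\<^sub>0 'k) \<Rightarrow> _" by (rule vector_space_pm_scale)
  define val where "val = lin_val V (\<lambda>x. x)"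
  define N where "N = {t. Poly_Mapping.keys t \<subseteq> carrier V \<and> val t = \<zero>}"
  have val_superset: "val t = finsum V (\<lambda>x. Poly_Mapping.lookup t x \<odot> x) A"
    if "finite A" "Poly_Mapping.keys t \<subseteq> A" "A \<subseteq> carrier V" for t A
    unfolding val_def lin_val_def using that
    by (intro add.finprod_mono_neutral_cong_left) (auto simp: in_keys_iff smult_l_null[simplified])
  have val_add: "val (s + t) = val s \<oplus> val t"
    if "Poly_Mapping.keys s \<subseteq> carrier V" "Poly_Mapping.keys t \<subseteq> carrier V" for s t
  proof -
    let ?A = "Poly_Mapping.keys s \<union> Poly_Mapping.keys t"
    have "Poly_Mapping.keys (s + t) \<subseteq> ?A" by (rule keys_add)
    moreover have "finsum V (\<lambda>x. Poly_Mapping.lookup (s + t) x \<odot> x) ?A =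
      finsum V (\<lambda>x. Poly_Mapping.lookup s x \<odot> x \<oplus> Poly_Mapping.lookup t x \<odot> x) ?A"
      using that by (intro finsum_cong') (auto simp: lookup_add smult_l_distr[simplified])
    moreover have "\<dots> = finsum V (\<lambda>x. Poly_Mapping.lookup s x \<odot> x) ?A \<oplus>
      finsum V (\<lambda>x. Poly_Mapping.lookup t x \<odot> x) ?A"
      using that by (intro finsum_addf) auto
    ultimately show ?thesis using that by (simp add: val_superset[of ?A])
  qed
  have val_scale: "val (pm_scale c t) = c \<odot> val t"
    if "Poly_Mapping.keys t \<subseteq> carrier V" for c t
  proof -
    let ?A = "Poly_Mapping.keys t"
    have "val (pm_scale c t) = finsum V (\<lambda>x. c \<odot> (Poly_Mapping.lookup t x \<odot> x)) ?A"
      using that keys_pm_scale[of c t] smult_assoc1[simplified]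
      by (subst val_superset[of ?A]) (auto intro!: finsum_cong')
    also have "\<dots> = c \<odot> val t"
      unfolding val_def lin_val_def using that by (intro finsum_smult_ldistr[symmetric]) auto
    finally show ?thesis .
  qed
  have val_single: "val (Poly_Mapping.single x c) = c \<odot> x" if "x \<in> carrier V" for x c
    by (subst val_superset[of "{x}"]) (use that in auto)
  have sub: "P.subspace N"
    unfolding P.subspace_def N_def
  proof (intro conjI ballI allI; (elim CollectE conjE)?; (intro CollectI conjI)?)
    show "val 0 = \<zero>" by (simp add: val_def lin_val_def)
  next
    fix s t :: "'h \<Rightarrow>\<^sub>0 'k"
    assume "Poly_Mapping.keys s \<subseteq> carrier V" "Poly_Mapping.keys t \<subseteq> carrier V"
      "val s = \<zero>" "val t = \<zero>"
    then show "Poly_Mapping.keys (s + t) \<subseteq> carrier V" "val (s + t) = \<zero>"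
      using keys_add[of s t] by (auto simp: val_add)
  next
    fix c and t :: "'h \<Rightarrow>\<^sub>0 'k"
    assume "Poly_Mapping.keys t \<subseteq> carrier V" "val t = \<zero>"
    then show "Poly_Mapping.keys (pm_scale c t) \<subseteq> carrier V" "val (pm_scale c t) = \<zero>"
      using keys_pm_scale[of c t] smult_r_null[of c] by (auto simp: val_scale)
  qed auto
  have "Poly_Mapping.single v 1 \<notin> N"
    using v val_single[of v 1] smult_one[of v] by (auto simp: N_def)
  then obtain F where F: "Vector_Spaces.linear pm_scale (*) F"
      "\<And>x. x \<in> N \<Longrightarrow> F x = 0" "F (Poly_Mapping.single v 1) = 1"
    using P.functional_separating_subspace[OF sub] by blast
  interpret F: Vector_Spaces.linear pm_scale "(*)" F by (rule F(1))
  have keys_diff': "Poly_Mapping.keys (s - t) \<subseteq> Poly_Mapping.keys s \<union> Poly_Mapping.keys t"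
    for s t :: "'h \<Rightarrow>\<^sub>0 'k" by (auto simp: in_keys_iff lookup_minus)
  have eqI: "F s = F t" if "Poly_Mapping.keys s \<subseteq> carrier V" "Poly_Mapping.keys t \<subseteq> carrier V"
    "val s = val t" for s t
  proof -
    have d: "s - t = s + pm_scale (-1) t"
      by (rule poly_mapping_eqI) (simp add: lookup_add lookup_minus)
    have kt: "Poly_Mapping.keys (pm_scale (-1) t) \<subseteq> carrier V"
      using keys_pm_scale[of "-1" t] that by auto
    have c: "val t \<in> carrier V"
      unfolding val_def by (rule lin_val_closed) (use that in auto)
    have one: "1 \<odot> val t = val t" using smult_one[of "val t"] c by simp
    have "val (s - t) = 1 \<odot> val t \<oplus> (-1) \<odot> val t"
      by (simp only: d val_add[OF that(1) kt] val_scale[OF that(2)] that(3) one)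
    also have "\<dots> = (1 + (-1)) \<odot> val t" using c smult_l_distr[of 1 "-1" "val t"] by simp
    also have "\<dots> = \<zero>" using c smult_l_null[of "val t"] by simp
    finally have "s - t \<in> N"
      using keys_diff'[of s t] that by (auto simp: N_def)
    from F(2)[OF this] show ?thesis by (simp add: F.diff)
  qed
  define f where "f = (\<lambda>h. F (Poly_Mapping.single h 1))"
  have one: "1 \<odot> a = a" if "a \<in> carrier V" for a using smult_one[OF that] by simp
  have "linear_on V f"
    unfolding linear_on_def
  proof (intro conjI ballI allI)
    fix a b assume ab: "a \<in> carrier V" "b \<in> carrier V"
    have "F (Poly_Mapping.single (a \<oplus> b) 1) = F (Poly_Mapping.single a 1 + Poly_Mapping.single b 1)"
      using ab keys_add[of "Poly_Mapping.single a (1::'k)" "Poly_Mapping.single b 1"]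
      by (intro eqI) (auto simp: val_add val_single one)
    then show "f (a \<oplus> b) = f a + f b" by (simp add: f_def F.add)
  next
    fix c a assume a: "a \<in> carrier V"
    have "F (Poly_Mapping.single (c \<odot> a) 1) = F (pm_scale c (Poly_Mapping.single a 1))"
      using a keys_pm_scale[of c "Poly_Mapping.single a 1"]
      by (intro eqI) (auto simp: val_single one split: if_splits)
    then show "f (c \<odot> a) = c * f a" by (simp only: f_def F.scale)
  qed
  with F(3) show ?thesis by (auto simp: f_def)
qed

text \<open>Reduces every identity between vectors to one between scalars; in this way identities in
  a Hopf algebra become computations with Sweedler sums.\<close>

lemma eq_if_functionals_eq:
  assumes "a \<in> carrier V" "b \<in> carrier V" "\<And>f. linear_on V f \<Longrightarrow> f a = f b"
  shows "a = b"
proof (rule ccontr)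
  assume "a \<noteq> b"
  moreover have "a = (a \<ominus> b) \<oplus> b"
    using assms(1,2) by (simp add: minus_eq a_assoc l_neg)
  ultimately have "a \<ominus> b \<noteq> \<zero>" using assms(2) by auto
  then obtain f where "linear_on V f" "f (a \<ominus> b) = 1"
    using functional_exists[of "a \<ominus> b"] assms by auto
  with assms linear_on_minus[of f a b] assms(3)[of f] show False by simp
qed

end

section \<open>Groups of prime order and their duals\<close>

lemma dual_group_iff:
  "\<chi> \<in> carrier (dual_group C :: ('c \<Rightarrow> 'k::field) monoid) \<longleftrightarrow>
    (\<forall>x. x \<notin> carrier C \<longrightarrow> \<chi> x = 0) \<and> (\<forall>x\<in>carrier C. \<chi> x \<noteq> 0) \<and>
    (\<forall>x\<in>carrier C. \<forall>y\<in>carrier C. \<chi> (x \<otimes>\<^bsub>C\<^esub> y) = \<chi> x * \<chi> y)"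
  by (auto simp: dual_group_def hom_def funs_on_def)

lemma dual_group_simps [simp]:
  "monoid.mult (dual_group C) = (\<lambda>\<chi> \<psi> x. \<chi> x * \<psi> x)"
  "one (dual_group C) = (\<lambda>x. if x \<in> carrier C then 1 else 0)"
  by (auto simp: dual_group_def)

locale plain_group = group C for C :: "'a monoid" (structure)
begin

lemma inv_mult_eq_one_iff:
  "x \<in> carrier C \<Longrightarrow> y \<in> carrier C \<Longrightarrow> inv x \<otimes> y = \<one> \<longleftrightarrow> x = y"
  using inv_solve_left'[of \<one> x y] by auto

lemma dual_group_one: "\<chi> \<in> carrier (dual_group C) \<Longrightarrow> \<chi> \<one> = 1"
  unfolding dual_group_iff by (metis mult_cancel_left2 one_closed r_one)

lemma dual_group_comm_group: "comm_group (dual_group C :: ('a \<Rightarrow> 'k::field) monoid)"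
proof (rule comm_groupI)
  fix \<chi> :: "'a \<Rightarrow> 'k" assume c: "\<chi> \<in> carrier (dual_group C)"
  show "\<exists>\<psi>\<in>carrier (dual_group C). \<psi> \<otimes>\<^bsub>dual_group C\<^esub> \<chi> = \<one>\<^bsub>dual_group C\<^esub>"
    by (rule bexI[of _ "\<lambda>x. inverse (\<chi> x)"])
      (use c in \<open>auto simp: dual_group_iff fun_eq_iff\<close>)
qed (auto simp: dual_group_iff fun_eq_iff)

lemma dual_group_group: "group (dual_group C :: ('a \<Rightarrow> 'k::field) monoid)"
  by (rule comm_group.axioms(2)[OF dual_group_comm_group])

lemma dual_group_inv:
  assumes "\<chi> \<in> carrier (dual_group C :: ('a \<Rightarrow> 'k::field) monoid)"
  shows "inv\<^bsub>dual_group C\<^esub> \<chi> = (\<lambda>x. inverse (\<chi> x))"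
  by (rule group.inv_equality[OF dual_group_group])
    (use assms in \<open>auto simp: dual_group_iff fun_eq_iff\<close>)

lemma dual_group_inv_apply:
  assumes "\<chi> \<in> carrier (dual_group C :: ('a \<Rightarrow> 'k::field) monoid)" "x \<in> carrier C"
  shows "\<chi> (inv x) = inverse (\<chi> x)"
proof -
  have "\<chi> x * \<chi> (inv x) = 1"
    using assms dual_group_one[OF assms(1)] unfolding dual_group_iff by (metis inv_closed r_inv)
  then show ?thesis by (metis inverse_unique)
qed

lemma dual_group_pow:
  assumes "\<chi> \<in> carrier (dual_group C :: ('a \<Rightarrow> 'k::field) monoid)" "x \<in> carrier C"
  shows "\<chi> (x [^] (n::nat)) = \<chi> x ^ n"
  using assms by (induction n) (auto simp: dual_group_one dual_group_iff)

end

locale prime_group = plain_group C for C :: "'c monoid" (structure) +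
  fixes p :: nat
  assumes prime_p: "prime p" and order_C: "Coset.order C = p"
begin

lemma finite_C [simp]: "finite (carrier C)"
  using order_C prime_p unfolding Coset.order_def by (metis card.infinite not_prime_0)

lemma card_C [simp]: "card (carrier C) = p"
  using order_C by (simp add: Coset.order_def)

lemma p_pos [simp]: "0 < p"
  using prime_p by (rule prime_gt_0_nat)

lemma ord_eq_prime: "g \<in> carrier C \<Longrightarrow> g \<noteq> \<one> \<Longrightarrow> ord g = p"
  using ord_dvd_group_order[of g] ord_eq_1[of g] prime_p
  by (auto simp: order_C prime_nat_iff)

lemma pow_eq_iff:
  assumes "g \<in> carrier C" "g \<noteq> \<one>"
  shows "g [^] (i::nat) = g [^] (j::nat) \<longleftrightarrow> i mod p = j mod p"
  using int_pow_eq[OF assms(1), of "int i" "int j"] ord_eq_prime[OF assms]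
  by (simp add: int_pow_int mod_eq_dvd_iff[symmetric] flip: zmod_int) (metis zmod_int nat_int)

lemma pow_inj_on: "g \<in> carrier C \<Longrightarrow> g \<noteq> \<one> \<Longrightarrow> inj_on (\<lambda>i::nat. g [^] i) {..<p}"
  by (auto simp: inj_on_def pow_eq_iff)

lemma carrier_eq_powers:
  assumes "g \<in> carrier C" "g \<noteq> \<one>"
  shows "carrier C = (\<lambda>i::nat. g [^] i) ` {..<p}"
  by (rule card_subset_eq[symmetric]) (use assms in \<open>auto simp: card_image pow_inj_on\<close>)

lemma generator_exists: "\<exists>g\<in>carrier C. g \<noteq> \<one>"
proof (rule ccontr)
  assume "\<not> ?thesis"
  then have "carrier C = {\<one>}" by auto
  then have "card (carrier C) = 1" by simp
  then show False using prime_p prime_gt_1_nat[of p] by simp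
qed

lemma C_comm_group: "comm_group C"
proof -
  obtain g where g: "g \<in> carrier C" "g \<noteq> \<one>" using generator_exists by blast
  have "x \<otimes> y = y \<otimes> x" if xy: "x \<in> carrier C" "y \<in> carrier C" for x y
  proof -
    obtain i j :: nat where "x = g [^] i" "y = g [^] j"
      using xy carrier_eq_powers[OF g] by auto
    then show ?thesis using g by (simp add: nat_pow_mult add.commute)
  qed
  then show ?thesis by (simp add: group_comm_groupI)
qed

lemma comm_C: "x \<in> carrier C \<Longrightarrow> y \<in> carrier C \<Longrightarrow> x \<otimes> y = y \<otimes> x"
  using C_comm_group by (simp add: comm_group_def comm_monoid.m_comm)

lemma sum_shift:
  assumes "y \<in> carrier C"
  shows "(\<Sum>x\<in>carrier C. f (y \<otimes> x)) = (\<Sum>x\<in>carrier C. f x)"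
  by (rule sum.reindex_bij_witness[of _ "\<lambda>x. inv y \<otimes> x" "\<lambda>x. y \<otimes> x"])
    (use assms in \<open>auto simp: m_assoc[symmetric]\<close>)

end

section \<open>Roots of unity of prime order\<close>

lemma primitive_root_exists:
  assumes "prime p"
  shows "\<exists>\<zeta> :: 'k::{alg_closed_field, field_char_0}. \<forall>i. \<zeta> ^ i = 1 \<longleftrightarrow> p dvd i"
proof -
  have p: "p > 1" using assms by (rule prime_gt_1_nat)
  \<comment> \<open>A root of 1 + X + ... + X^(p-1). It is not 1, where this polynomial takes the
    value p, nonzero in characteristic 0.\<close>
  obtain \<zeta> :: 'k where z: "(\<Sum>k\<le>p - 1. 1 * \<zeta> ^ k) = 0"
    using alg_closed[of "p - 1" "\<lambda>_. 1 :: 'k"] p by auto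
  then have s: "(\<Sum>k<p. \<zeta> ^ k) = 0"
    using p by (simp add: lessThan_Suc_atMost[symmetric])
  have ne: "\<zeta> \<noteq> 1" using s p by auto
  have zp: "\<zeta> ^ p = 1" using power_diff_1_eq[of \<zeta> p] s by simp
  have "p dvd i" if i: "\<zeta> ^ i = 1" for i
  proof (rule ccontr)
    assume nd: "\<not> p dvd i"
    then have "i \<noteq> 0" by (cases "i = 0") auto
    have "coprime i p" using prime_imp_coprime[OF assms nd] by (simp add: coprime_commute)
    then have "gcd i p = 1" by (simp add: coprime_iff_gcd_eq_1)
    \<comment> \<open>The exponent i is invertible modulo p, so \<zeta> would be a power of
      \<zeta>^i = 1.\<close>
    with bezout_nat[OF \<open>i \<noteq> 0\<close>, of p] obtain x y where "i * x = p * y + 1" by auto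
    then have "(\<zeta> ^ i) ^ x = (\<zeta> ^ p) ^ y * \<zeta>"
      by (simp add: power_mult[symmetric])
    with i zp ne show False by simp
  qed
  moreover have "\<zeta> ^ i = 1" if "p dvd i" for i
    using that zp by (auto simp: power_mult elim!: dvdE)
  ultimately show ?thesis by blast
qed

lemma primitive_root_eq_iff:
  fixes \<zeta> :: "'k::field"
  assumes "\<And>i. \<zeta> ^ i = 1 \<longleftrightarrow> p dvd i" "p > 0"
  shows "\<zeta> ^ i = \<zeta> ^ j \<longleftrightarrow> i mod p = j mod p"
proof -
  have z: "\<zeta> \<noteq> 0" using assms(1)[of p] assms(2) by (auto simp: power_0_left)
  have *: "\<zeta> ^ i = \<zeta> ^ j \<longleftrightarrow> i mod p = j mod p" if "i \<le> j" for i j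
  proof -
    have "\<zeta> ^ i = \<zeta> ^ j \<longleftrightarrow> \<zeta> ^ (j - i) = 1"
      using z that by (auto simp: power_diff)
    then show ?thesis using assms(1) that by (metis mod_eq_dvd_iff_nat)
  qed
  show ?thesis using *[of i j] *[of j i] by (metis nat_le_linear)
qed

text \<open>X^p - 1 has at most p roots, and the powers of \<zeta> already supply p of them.\<close>

lemma roots_of_unity_eq_powers:
  fixes \<zeta> :: "'k::field"
  assumes "\<And>i. \<zeta> ^ i = 1 \<longleftrightarrow> p dvd i" "p > 0"
  shows "{z. z ^ p = 1} = (\<lambda>i. \<zeta> ^ i) ` {..<p}"
proof -
  let ?q = "Polynomial.monom (1::'k) p - 1"
  have c: "Polynomial.coeff ?q p = 1" using assms(2) by (simp add: coeff_1)
  then have q: "?q \<noteq> 0" by (metis coeff_0 zero_neq_one)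
  have eq: "{z. poly ?q z = 0} = {z. z ^ p = 1}" by (simp add: poly_monom)
  have "degree ?q \<le> p" by (rule degree_diff_le) (auto simp: degree_monom_le)
  then have "card {z::'k. z ^ p = 1} \<le> p"
    using card_poly_roots_bound[OF q] unfolding eq by simp
  moreover have "finite {z::'k. z ^ p = 1}"
    using poly_roots_finite[OF q] unfolding eq .
  moreover have "(\<lambda>i. \<zeta> ^ i) ` {..<p} \<subseteq> {z. z ^ p = 1}"
  proof -
    have "(\<zeta> ^ i) ^ p = 1" for i using assms(1)[of "i * p"] by (simp add: power_mult)
    then show ?thesis by auto
  qed
  moreover have "card ((\<lambda>i. \<zeta> ^ i) ` {..<p}) = p"
    by (subst card_image) (auto simp: inj_on_def primitive_root_eq_iff[OF assms])
  ultimately show ?thesis by (intro card_seteq[symmetric]) auto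
qed

section \<open>Duality and Fourier inversion on C\<close>

context prime_group
begin

text \<open>With discrete logarithms \<open>lg\<close> to the base \<open>g\<close>, the map (x, y)
  -> \<zeta>^(lg x * lg y) is a nondegenerate pairing of \<open>C\<close> with itself.\<close>

lemma dual_iso_exists:
  "\<exists>\<theta>. \<theta> \<in> iso C (dual_group C :: ('c \<Rightarrow> 'k::{alg_closed_field, field_char_0}) monoid)"
proof -
  obtain g where g: "g \<in> carrier C" "g \<noteq> \<one>" using generator_exists by blast
  obtain \<zeta> :: 'k where z: "\<And>i. \<zeta> ^ i = 1 \<longleftrightarrow> p dvd i"
    using primitive_root_exists[OF prime_p] by blast
  have z0: "\<zeta> \<noteq> 0" using z[of p] p_pos by (cases "\<zeta> = 0") (auto simp: power_0_left)
  note zeq = primitive_root_eq_iff[OF z p_pos]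
  \<comment> \<open>Only determined modulo p, which is enough because \<zeta>^p = 1.\<close>
  define lg where "lg x = (SOME i::nat. g [^] i = x)" for x
  have lg: "g [^] lg x = x" if "x \<in> carrier C" for x
    unfolding lg_def by (rule someI_ex) (use that carrier_eq_powers[OF g] in auto)
  have lgm: "lg (x \<otimes> y) mod p = (lg x + lg y) mod p" if "x \<in> carrier C" "y \<in> carrier C" for x y
    using that g lg[of "x \<otimes> y"] lg[of x] lg[of y]
    by (simp flip: pow_eq_iff[OF g] add: nat_pow_mult[symmetric])
  have lgg: "lg g mod p = 1 mod p"
    using lg[OF g(1)] pow_eq_iff[OF g, of "lg g" 1] g by simp
  define \<theta> where "\<theta> x = (\<lambda>y. if y \<in> carrier C then \<zeta> ^ (lg x * lg y) else 0)" for x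
  have m1: "\<zeta> ^ (lg (x \<otimes> y) * k) = \<zeta> ^ (lg x * k) * \<zeta> ^ (lg y * k)"
    if "x \<in> carrier C" "y \<in> carrier C" for x y k
    unfolding power_add[symmetric] zeq using lgm[OF that]
    by (metis distrib_right mod_mult_left_eq)
  have in_dual: "\<theta> x \<in> carrier (dual_group C)" if "x \<in> carrier C" for x
    using m1 z0 by (auto simp: dual_group_iff \<theta>_def mult.commute[of "lg x"])
  have "\<theta> \<in> hom C (dual_group C)"
    using in_dual m1 by (auto simp: hom_def fun_eq_iff \<theta>_def)
  moreover have "inj_on \<theta> (carrier C)"
  proof (rule inj_onI)
    fix x y assume xy: "x \<in> carrier C" "y \<in> carrier C" "\<theta> x = \<theta> y"
    then have "\<zeta> ^ (lg x * lg g) = \<zeta> ^ (lg y * lg g)"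
      using g by (metis \<theta>_def)
    then have "(lg x * lg g) mod p = (lg y * lg g) mod p" by (simp add: zeq)
    then have "lg x mod p = lg y mod p" using lgg by (metis mod_mult_right_eq mult.right_neutral)
    then have "g [^] lg x = g [^] lg y" using pow_eq_iff[OF g] by simp
    then show "x = y" using lg xy by metis
  qed
  moreover have "\<chi> \<in> \<theta> ` carrier C" if chi: "\<chi> \<in> carrier (dual_group C :: ('c \<Rightarrow> 'k) monoid)" for \<chi>
  proof -
    \<comment> \<open>A character is determined by its value at the generator, and this value is a
      p-th root of unity.\<close>
    have "\<chi> g ^ p = \<chi> (g [^] p)" using dual_group_pow[OF chi g(1)] by simp
    also have "g [^] p = \<one>" using pow_order_eq_1[OF g(1)] by (simp add: order_C)
    finally have "\<chi> g ^ p = 1" using dual_group_one[OF chi] by simp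
    then obtain i where i: "i < p" "\<chi> g = \<zeta> ^ i"
      using roots_of_unity_eq_powers[OF z p_pos] by auto
    have li: "lg (g [^] i) mod p = i mod p"
      using lg[of "g [^] i"] g pow_eq_iff[OF g] by simp
    have "\<chi> y = \<theta> (g [^] i) y" for y
    proof (cases "y \<in> carrier C")
      case True
      then have "\<chi> y = \<chi> (g [^] lg y)" by (simp add: lg)
      also have "\<dots> = \<zeta> ^ (i * lg y)" by (simp add: dual_group_pow[OF chi g(1)] i power_mult)
      also have "\<dots> = \<zeta> ^ (lg (g [^] i) * lg y)"
        unfolding zeq using li by (metis mod_mult_left_eq)
      finally show ?thesis using True by (simp add: \<theta>_def)
    qed (use chi in \<open>auto simp: dual_group_iff \<theta>_def\<close>)
    then show ?thesis using g by auto
  qed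
  ultimately have "\<theta> \<in> iso C (dual_group C)"
    using in_dual by (auto simp: iso_def bij_betw_def)
  then show ?thesis by blast
qed

lemma card_dual: "card (carrier (dual_group C :: ('c \<Rightarrow> 'k::{alg_closed_field, field_char_0}) monoid)) = p"
proof -
  obtain \<theta> where "\<theta> \<in> iso C (dual_group C :: ('c \<Rightarrow> 'k) monoid)" using dual_iso_exists by blast
  then have "bij_betw \<theta> (carrier C) (carrier (dual_group C :: ('c \<Rightarrow> 'k) monoid))" by (simp add: iso_def)
  then show ?thesis using bij_betw_same_card by fastforce
qed

lemma finite_dual: "finite (carrier (dual_group C :: ('c \<Rightarrow> 'k::{alg_closed_field, field_char_0}) monoid))"
  using card_dual p_pos by (metis card.infinite less_numeral_extra(3))

lemma dual_prime_group: "prime_group (dual_group C :: ('c \<Rightarrow> 'k::{alg_closed_field, field_char_0}) monoid) p"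
  using dual_group_group prime_p card_dual
  by (simp add: prime_group_def plain_group_def prime_group_axioms_def Coset.order_def)

text \<open>\<open>x\<close> generates \<open>C\<close>, so if all characters were 1 at
  \<open>x\<close> they would all be trivial, whereas \<open>card_dual\<close> gives p > 1 of
  them.\<close>

lemma dual_separates:
  assumes "x \<in> carrier C" "x \<noteq> \<one>"
  shows "\<exists>\<chi>\<in>carrier (dual_group C :: ('c \<Rightarrow> 'k::{alg_closed_field, field_char_0}) monoid). \<chi> x \<noteq> 1"
proof (rule ccontr)
  assume n: "\<not> ?thesis"
  have "\<chi> = (\<lambda>y. if y \<in> carrier C then 1 else 0)"
    if c: "\<chi> \<in> carrier (dual_group C :: ('c \<Rightarrow> 'k) monoid)" for \<chi>
  proof
    fix y show "\<chi> y = (if y \<in> carrier C then 1 else 0)"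
    proof (cases "y \<in> carrier C")
      case True
      then obtain i :: nat where "y = x [^] i" using carrier_eq_powers[OF assms] by auto
      then show ?thesis using n c True dual_group_pow[OF c assms(1), of i] by auto
    qed (use c in \<open>auto simp: dual_group_iff\<close>)
  qed
  then have "carrier (dual_group C :: ('c \<Rightarrow> 'k) monoid) \<subseteq> {\<lambda>y. if y \<in> carrier C then 1 else 0}"
    by auto
  from card_mono[OF _ this] card_dual prime_gt_1_nat[OF prime_p] show False
    by (metis card.empty card.insert empty_iff finite.emptyI finite.insertI le_antisym less_not_refl not_le One_nat_def)
qed

text \<open>Translation by some \<open>y\<close> with \<open>\<chi> y \<noteq> 1\<close> multiplies
  the sum by \<open>\<chi> y\<close>, so the sum vanishes.\<close>

lemma sum_char:
  fixes \<chi> :: "'c \<Rightarrow> 'k::{alg_closed_field, field_char_0}"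
  assumes "\<chi> \<in> carrier (dual_group C)"
  shows "(\<Sum>x\<in>carrier C. \<chi> x) = (if \<chi> = \<one>\<^bsub>dual_group C\<^esub> then of_nat p else 0)"
proof (cases "\<chi> = \<one>\<^bsub>dual_group C\<^esub>")
  case False
  then obtain y where y: "y \<in> carrier C" "\<chi> y \<noteq> 1"
    using assms by (auto simp: dual_group_iff fun_eq_iff split: if_splits)
  have "(\<Sum>x\<in>carrier C. \<chi> x) = (\<Sum>x\<in>carrier C. \<chi> (y \<otimes> x))" by (rule sum_shift[OF y(1), symmetric])
  also have "\<dots> = \<chi> y * (\<Sum>x\<in>carrier C. \<chi> x)"
    using assms y by (simp add: dual_group_iff sum_distrib_left)
  finally show ?thesis using y False by simp
qed simp

text \<open>The same argument in the dual group, itself of prime order: translation by a character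
  whose value at \<open>x\<close> is not 1 rescales the sum.\<close>

lemma sum_dual:
  assumes "x \<in> carrier C"
  shows "(\<Sum>\<chi>\<in>carrier (dual_group C :: ('c \<Rightarrow> 'k::{alg_closed_field, field_char_0}) monoid). \<chi> x)
    = (if x = \<one> then of_nat p else 0)"
proof (cases "x = \<one>")
  case True
  then show ?thesis by (simp add: dual_group_one card_dual)
next
  case False
  interpret D: prime_group "dual_group C :: ('c \<Rightarrow> 'k) monoid" p by (rule dual_prime_group)
  let ?s = "\<Sum>\<chi>\<in>carrier (dual_group C :: ('c \<Rightarrow> 'k) monoid). \<chi> x"
  obtain \<psi> where psi: "\<psi> \<in> carrier (dual_group C :: ('c \<Rightarrow> 'k) monoid)" "\<psi> x \<noteq> 1"
    using dual_separates[OF assms False] by blast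
  have "?s = (\<Sum>\<chi>\<in>carrier (dual_group C :: ('c \<Rightarrow> 'k) monoid). \<psi> x * \<chi> x)"
    using D.sum_shift[OF psi(1), of "\<lambda>\<chi>. \<chi> x"] by simp
  then show ?thesis using psi False by (simp add: sum_distrib_left[symmetric])
qed

text \<open>Fourier inversion: orthogonality of characters leaves only the term y = x. As p is
  invertible in the field, the coefficients of \<open>u\<close> are recovered from
  \<open>evaluation C u\<close>.\<close>

lemma evaluation_inversion:
  fixes u :: "'c \<Rightarrow> 'k::{alg_closed_field, field_char_0}"
  assumes "x \<in> carrier C"
  shows "(\<Sum>\<chi>\<in>carrier (dual_group C). evaluation C u \<chi> * \<chi> (inv x)) = of_nat p * u x"
proof -
  have "(\<Sum>\<chi>\<in>carrier (dual_group C). evaluation C u \<chi> * \<chi> (inv x)) =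
    (\<Sum>\<chi>\<in>carrier (dual_group C). \<Sum>y\<in>carrier C. u y * \<chi> (inv x \<otimes> y))"
    using assms by (intro sum.cong)
      (auto simp: evaluation_def sum_distrib_right dual_group_iff intro!: sum.cong)
  also have "\<dots> = (\<Sum>y\<in>carrier C. u y * (\<Sum>\<chi>\<in>carrier (dual_group C). \<chi> (inv x \<otimes> y)))"
    by (subst sum.swap) (simp add: sum_distrib_left)
  also have "\<dots> = (\<Sum>y\<in>carrier C. if y = x then u x * of_nat p else 0)"
  proof (rule sum.cong)
    fix y assume y: "y \<in> carrier C"
    have "inv x \<otimes> y = \<one> \<longleftrightarrow> y = x"
      using inv_mult_eq_one_iff[OF assms y] by auto
    then show "u y * (\<Sum>\<chi>\<in>carrier (dual_group C). \<chi> (inv x \<otimes> y)) = (if y = x then u x * of_nat p else 0)"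
      using sum_dual[of "inv x \<otimes> y", where 'k='k] assms y by auto
  qed simp
  finally show ?thesis using assms by (simp add: mult.commute)
qed

lemma evaluation_inj_on:
  "inj_on (evaluation C :: ('c \<Rightarrow> 'k::{alg_closed_field, field_char_0}) \<Rightarrow> _) (funs_on (carrier C))"
proof (rule inj_onI, rule ext)
  fix u v :: "'c \<Rightarrow> 'k" and x
  assume uv: "u \<in> funs_on (carrier C)" "v \<in> funs_on (carrier C)" "evaluation C u = evaluation C v"
  show "u x = v x"
  proof (cases "x \<in> carrier C")
    case True
    have "of_nat p * u x = of_nat p * v x"
      unfolding evaluation_inversion[OF True, symmetric] uv(3) ..
    then show ?thesis using p_pos by simp
  qed (use uv in \<open>auto simp: funs_on_def\<close>)
qed

lemma evaluation_surj:
  fixes w :: "('c \<Rightarrow> 'k::{alg_closed_field, field_char_0}) \<Rightarrow> 'k"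
  shows "\<exists>u\<in>funs_on (carrier C). \<forall>\<chi>\<in>carrier (dual_group C). evaluation C u \<chi> = w \<chi>"
proof (intro bexI ballI)
  \<comment> \<open>The inverse Fourier transform of \<open>w\<close>.\<close>
  define u where "u x = (if x \<in> carrier C then
    (\<Sum>\<psi>\<in>carrier (dual_group C). w \<psi> * \<psi> (inv x)) / of_nat p else 0)" for x
  show "u \<in> funs_on (carrier C)" by (simp add: u_def funs_on_def)
  fix \<chi> :: "'c \<Rightarrow> 'k" assume c: "\<chi> \<in> carrier (dual_group C)"
  interpret D: prime_group "dual_group C :: ('c \<Rightarrow> 'k) monoid" p by (rule dual_prime_group)
  have "evaluation C u \<chi> = (\<Sum>x\<in>carrier C. (\<Sum>\<psi>\<in>carrier (dual_group C). w \<psi> * \<psi> (inv x)) / of_nat p * \<chi> x)"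
    using c by (simp add: evaluation_def u_def)
  also have "\<dots> = (\<Sum>x\<in>carrier C. \<Sum>\<psi>\<in>carrier (dual_group C).
      w \<psi> / of_nat p * (inv\<^bsub>dual_group C\<^esub> \<psi> \<otimes>\<^bsub>dual_group C\<^esub> \<chi>) x)"
    by (intro sum.cong)
      (auto simp: sum_distrib_right sum_divide_distrib dual_group_inv dual_group_inv_apply intro!: sum.cong)
  also have "\<dots> = (\<Sum>\<psi>\<in>carrier (dual_group C). w \<psi> / of_nat p *
      (\<Sum>x\<in>carrier C. (inv\<^bsub>dual_group C\<^esub> \<psi> \<otimes>\<^bsub>dual_group C\<^esub> \<chi>) x))"
    by (subst sum.swap) (simp add: sum_distrib_left)
  also have "\<dots> = (\<Sum>\<psi>\<in>carrier (dual_group C). if \<psi> = \<chi> then w \<chi> else 0)"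
  proof (rule sum.cong)
    fix \<psi> :: "'c \<Rightarrow> 'k" assume psi: "\<psi> \<in> carrier (dual_group C)"
    have "inv\<^bsub>dual_group C\<^esub> \<psi> \<otimes>\<^bsub>dual_group C\<^esub> \<chi> = \<one>\<^bsub>dual_group C\<^esub> \<longleftrightarrow> \<psi> = \<chi>"
      by (rule D.inv_mult_eq_one_iff[OF psi c])
    moreover have "inv\<^bsub>dual_group C\<^esub> \<psi> \<otimes>\<^bsub>dual_group C\<^esub> \<chi> \<in> carrier (dual_group C)"
      using c psi by (intro D.m_closed D.inv_closed)
    ultimately show "w \<psi> / of_nat p * (\<Sum>x\<in>carrier C. (inv\<^bsub>dual_group C\<^esub> \<psi> \<otimes>\<^bsub>dual_group C\<^esub> \<chi>) x)
      = (if \<psi> = \<chi> then w \<chi> else 0)"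
      using sum_char[of "inv\<^bsub>dual_group C\<^esub> \<psi> \<otimes>\<^bsub>dual_group C\<^esub> \<chi>"] p_pos by (auto simp del: dual_group_simps)
  qed simp
  finally show "evaluation C u \<chi> = w \<chi>" using c by (simp add: finite_dual)
qed

end

section \<open>Morphisms and equivalences of extensions\<close>

lemma multilinear_map:
  assumes "\<And>a. a \<in> carrier V \<Longrightarrow> f a \<in> carrier W"
    "\<And>a b. a \<in> carrier V \<Longrightarrow> b \<in> carrier V \<Longrightarrow> f (a \<oplus>\<^bsub>V\<^esub> b) = f a \<oplus>\<^bsub>W\<^esub> f b"
    "\<And>a c. a \<in> carrier V \<Longrightarrow> f (c \<odot>\<^bsub>V\<^esub> a) = c \<odot>\<^bsub>W\<^esub> f a"
    "multilinear W n g"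
  shows "multilinear V n (\<lambda>xs. g (map f xs))"
proof -
  have "map f xs \<in> words W n" if "xs \<in> words V n" for xs
    using that assms(1) by (auto simp: words_def)
  then show ?thesis
    using assms unfolding multilinear_def by (simp add: map_update)
qed

text \<open>The tensor powers of \<open>f\<close>, in the shape in which \<open>hopf_map\<close>
  states compatibility with the comultiplication.\<close>

definition map_tensor :: "('h \<Rightarrow> 'l) \<Rightarrow> ('h list \<Rightarrow>\<^sub>0 'k::field) \<Rightarrow> 'l list \<Rightarrow>\<^sub>0 'k" where
  "map_tensor f = lin_ext (\<lambda>xs. Poly_Mapping.single (map f xs) 1)"

lemma tensor_eval_map_tensor [simp]:
  "tensor_eval g (map_tensor f t) = tensor_eval (\<lambda>xs. g (map f xs)) t"
  by (simp add: map_tensor_def)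

lemma map_tensor_comp: "map_tensor g (map_tensor f t) = map_tensor (g \<circ> f) t"
  by (rule lin_ext_eqI) simp

lemma map_tensor_id:
  assumes "t \<in> tensors V n" "\<And>a. a \<in> carrier V \<Longrightarrow> f a = a"
  shows "map_tensor f t = t"
proof (rule lin_ext_eqI)
  fix g
  show "tensor_eval g (map_tensor f t) = tensor_eval g t"
    using assms(1) unfolding tensor_eval_map_tensor
    by (intro tensor_eval_cong arg_cong[of _ _ g] map_idI assms(2)) (auto simp: tensors_def words_def)
qed

lemma map_tensor_in_tensors:
  assumes "t \<in> tensors V n" "\<And>a. a \<in> carrier V \<Longrightarrow> f a \<in> carrier W"
  shows "map_tensor f t \<in> tensors W n"
proof -
  have "Poly_Mapping.keys (map_tensor f t) \<subseteq> (\<lambda>xs. map f xs) ` Poly_Mapping.keys t"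
  proof
    fix w assume "w \<in> Poly_Mapping.keys (map_tensor f t)"
    then have "(\<Sum>x\<in>Poly_Mapping.keys t. Poly_Mapping.lookup (Poly_Mapping.single (map f x) (Poly_Mapping.lookup t x)) w) \<noteq> 0"
      by (simp add: in_keys_iff map_tensor_def lin_ext_def lookup_sum)
    then obtain x where "x \<in> Poly_Mapping.keys t"
      "Poly_Mapping.lookup (Poly_Mapping.single (map f x) (Poly_Mapping.lookup t x)) w \<noteq> 0"
      by (meson sum.neutral)
    then show "w \<in> (\<lambda>xs. map f xs) ` Poly_Mapping.keys t"
      by (auto simp: lookup_single when_def split: if_splits)
  qed
  then show ?thesis using assms by (fastforce simp: tensors_def words_def)
qed

lemma tensor_eq_refl [simp]: "tensor_eq V n t t"
  by (simp add: tensor_eq_iff)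

lemma tensor_eq_sym: "tensor_eq V n s t \<Longrightarrow> tensor_eq V n t s"
  by (simp add: tensor_eq_iff)

lemma tensor_eq_trans: "tensor_eq V n s t \<Longrightarrow> tensor_eq V n t u \<Longrightarrow> tensor_eq V n s u"
  by (simp add: tensor_eq_iff)

lemma hopf_map_iff:
  "hopf_map H L f \<longleftrightarrow> f \<in> ring_hom H L \<and>
    (\<forall>c. \<forall>a\<in>carrier H. f (c \<odot>\<^bsub>H\<^esub> a) = c \<odot>\<^bsub>L\<^esub> f a) \<and>
    (\<forall>a\<in>carrier H. tensor_eq L 2 (comult L (f a)) (map_tensor f (comult H a)) \<and>
      counit L (f a) = counit H a)"
  by (simp add: hopf_map_def map_tensor_def)

lemma hopf_map_tensor_eq:
  assumes "hopf_map H L f" "tensor_eq H n s t"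
  shows "tensor_eq L n (map_tensor f s) (map_tensor f t)"
  unfolding tensor_eq_iff
proof (intro allI impI)
  fix g assume g: "multilinear L n g"
  have "multilinear H n (\<lambda>xs. g (map f xs))"
    using assms(1) by (intro multilinear_map[OF _ _ _ g]) (auto simp: hopf_map_iff ring_hom_def)
  then show "tensor_eval g (map_tensor f s) = tensor_eval g (map_tensor f t)"
    using assms(2) by (simp add: tensor_eq_iff)
qed

lemma hopf_map_comp:
  assumes f: "hopf_map H L f" and g: "hopf_map L M g"
  shows "hopf_map H M (g \<circ> f)"
proof -
  have fc: "f a \<in> carrier L" if "a \<in> carrier H" for a
    using that f by (auto simp: hopf_map_iff ring_hom_def)
  have "tensor_eq M 2 (comult M (g (f a))) (map_tensor (g \<circ> f) (comult H a))"
    if a: "a \<in> carrier H" for a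
  proof -
    have "tensor_eq M 2 (comult M (g (f a))) (map_tensor g (comult L (f a)))"
      using g fc[OF a] by (simp add: hopf_map_iff)
    moreover have "tensor_eq M 2 (map_tensor g (comult L (f a))) (map_tensor g (map_tensor f (comult H a)))"
      using f a by (intro hopf_map_tensor_eq[OF g]) (simp add: hopf_map_iff)
    ultimately show ?thesis by (simp only: map_tensor_comp) (rule tensor_eq_trans)
  qed
  then show ?thesis
    using assms fc by (auto simp: hopf_map_iff ring_hom_def)
qed

lemma hopf_map_id: "(\<And>a. a \<in> carrier H \<Longrightarrow> comult H a \<in> tensors H 2) \<Longrightarrow> hopf_map H H (\<lambda>x. x)"
  by (simp add: hopf_map_iff ring_hom_def map_tensor_id[where V = H and n = 2])

lemma hopf_map_inv:
  assumes f: "hopf_map H L f" "bij_betw f (carrier H) (carrier L)"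
    and H: "k_algebra H" "\<And>a. a \<in> carrier H \<Longrightarrow> comult H a \<in> tensors H 2"
  shows "hopf_map L H (inv_into (carrier H) f)"
proof -
  interpret M: module base_field H using H by (simp add: k_algebra_def)
  interpret R: ring H using H by (simp add: k_algebra_def)
  let ?g = "inv_into (carrier H) f"
  have gf [simp]: "?g (f a) = a" if "a \<in> carrier H" for a
    using f(2) that by (simp add: bij_betw_inv_into_left)
  have ex: "\<exists>a\<in>carrier H. b = f a" if "b \<in> carrier L" for b
    using f(2) that by (auto simp: bij_betw_def)
  note fd = f(1)[unfolded hopf_map_iff ring_hom_def, simplified]
  have g: "?g b \<in> carrier H" if "b \<in> carrier L" for b using ex[OF that] by auto
  have add: "?g (b \<oplus>\<^bsub>L\<^esub> b') = ?g b \<oplus>\<^bsub>H\<^esub> ?g b'" if b: "b \<in> carrier L" "b' \<in> carrier L" for b b'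
  proof -
    obtain a a' where a: "a \<in> carrier H" "b = f a" "a' \<in> carrier H" "b' = f a'" using ex b by meson
    then have "b \<oplus>\<^bsub>L\<^esub> b' = f (a \<oplus>\<^bsub>H\<^esub> a')" using fd by auto
    then show ?thesis using a by simp
  qed
  have mult: "?g (b \<otimes>\<^bsub>L\<^esub> b') = ?g b \<otimes>\<^bsub>H\<^esub> ?g b'" if b: "b \<in> carrier L" "b' \<in> carrier L" for b b'
  proof -
    obtain a a' where a: "a \<in> carrier H" "b = f a" "a' \<in> carrier H" "b' = f a'" using ex b by meson
    then have "b \<otimes>\<^bsub>L\<^esub> b' = f (a \<otimes>\<^bsub>H\<^esub> a')" using fd by auto
    then show ?thesis using a by simp
  qed
  have smult: "?g (c \<odot>\<^bsub>L\<^esub> b) = c \<odot>\<^bsub>H\<^esub> ?g b" if b: "b \<in> carrier L" for b c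
  proof -
    obtain a where a: "a \<in> carrier H" "b = f a" using ex b by meson
    then have "c \<odot>\<^bsub>L\<^esub> b = f (c \<odot>\<^bsub>H\<^esub> a)" using fd by auto
    then show ?thesis using a M.smult_closed[of c a] by simp
  qed
  have one: "?g \<one>\<^bsub>L\<^esub> = \<one>\<^bsub>H\<^esub>" using fd gf[of "\<one>\<^bsub>H\<^esub>"] by simp
  have cm: "tensor_eq H 2 (comult H (?g b)) (map_tensor ?g (comult L b))" if b: "b \<in> carrier L" for b
  proof -
    obtain a where a: "a \<in> carrier H" "b = f a" using ex b by meson
    have eq: "tensor_eq L 2 (comult L b) (map_tensor f (comult H a))" using fd a by simp
    \<comment> \<open>The inverse is only now being shown to be a Hopf map, so
      \<open>hopf_map_tensor_eq\<close> cannot be applied to it; its linearity suffices to pull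
      multilinear functionals back.\<close>
    have "tensor_eq H 2 (map_tensor ?g (comult L b)) (map_tensor ?g (map_tensor f (comult H a)))"
      unfolding tensor_eq_iff
    proof (intro allI impI)
      fix h assume h: "multilinear H 2 h"
      have "multilinear L 2 (\<lambda>xs. h (map ?g xs))"
        by (rule multilinear_map[OF _ _ _ h]) (use g add smult in auto)
      then show "tensor_eval h (map_tensor ?g (comult L b)) = tensor_eval h (map_tensor ?g (map_tensor f (comult H a)))"
        using eq by (simp add: tensor_eq_iff)
    qed
    moreover have "map_tensor ?g (map_tensor f (comult H a)) = comult H a"
      unfolding map_tensor_comp by (rule map_tensor_id[OF H(2)[OF a(1)]]) simp
    ultimately show ?thesis using a by (simp add: tensor_eq_sym)
  qed
  have "counit H (?g b) = counit L b" if "b \<in> carrier L" for b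
    using ex[OF that] fd by auto
  then show ?thesis
    using g add mult smult one cm by (auto simp: hopf_map_iff ring_hom_def)
qed

section \<open>Equivalence of Hopf extensions\<close>

lemma hopf_ext_equiv_trans:
  assumes "hopf_ext_equiv G E E'" "hopf_ext_equiv G E' E''"
  shows "hopf_ext_equiv G E E''"
proof -
  obtain F where F: "hopf_map (hopf_total E) (hopf_total E') F"
      "bij_betw F (carrier (hopf_total E)) (carrier (hopf_total E'))"
      "\<forall>f\<in>funs_on (carrier G). F (hopf_incl E f) = hopf_incl E' f"
      "\<forall>h\<in>carrier (hopf_total E). hopf_proj E' (F h) = hopf_proj E h"
    using assms(1) by (auto simp: hopf_ext_equiv_def)
  obtain F' where F': "hopf_map (hopf_total E') (hopf_total E'') F'"
      "bij_betw F' (carrier (hopf_total E')) (carrier (hopf_total E''))"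
      "\<forall>f\<in>funs_on (carrier G). F' (hopf_incl E' f) = hopf_incl E'' f"
      "\<forall>h\<in>carrier (hopf_total E'). hopf_proj E'' (F' h) = hopf_proj E' h"
    using assms(2) by (auto simp: hopf_ext_equiv_def)
  have "hopf_map (hopf_total E) (hopf_total E'') (F' \<circ> F)"
    by (rule hopf_map_comp[OF F(1) F'(1)])
  moreover have "bij_betw (F' \<circ> F) (carrier (hopf_total E)) (carrier (hopf_total E''))"
    by (rule bij_betw_trans[OF F(2) F'(2)])
  moreover have "F h \<in> carrier (hopf_total E')" if "h \<in> carrier (hopf_total E)" for h
    using F(2) that by (auto simp: bij_betw_def)
  ultimately show ?thesis
    unfolding hopf_ext_equiv_def using F F' by (intro exI[of _ "F' \<circ> F"]) simp
qed

lemma hopf_extension_simps: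
  assumes "hopf_extension C G E"
  shows "hopf_algebra (hopf_total E)" "bialgebra (hopf_total E)" "k_algebra (hopf_total E)"
    "\<And>a. a \<in> carrier (hopf_total E) \<Longrightarrow> comult (hopf_total E) a \<in> tensors (hopf_total E) 2"
    "\<And>f. f \<in> funs_on (carrier G) \<Longrightarrow> hopf_incl E f \<in> carrier (hopf_total E)"
proof -
  show h: "hopf_algebra (hopf_total E)" using assms by (simp add: hopf_extension_def Let_def)
  then show b: "bialgebra (hopf_total E)" by (simp add: hopf_algebra_def)
  then show "k_algebra (hopf_total E)"
    "\<And>a. a \<in> carrier (hopf_total E) \<Longrightarrow> comult (hopf_total E) a \<in> tensors (hopf_total E) 2"
    by (simp_all add: bialgebra_def)
  have "hopf_map (fun_alg G) (hopf_total E) (hopf_incl E)"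
    using assms by (simp add: hopf_extension_def Let_def)
  then show "hopf_incl E f \<in> carrier (hopf_total E)" if "f \<in> funs_on (carrier G)" for f
    using that by (auto simp: hopf_map_def ring_hom_def fun_alg_def)
qed

lemma hopf_ext_equiv_refl: "hopf_extension C G E \<Longrightarrow> hopf_ext_equiv G E E"
  unfolding hopf_ext_equiv_def
  by (rule exI[of _ "\<lambda>x. x"])
    (auto simp: bij_betw_def hopf_extension_simps(4) intro: hopf_map_id)

lemma hopf_ext_equiv_sym:
  assumes E: "hopf_extension C G E" and "hopf_ext_equiv G E E'"
  shows "hopf_ext_equiv G E' E"
proof -
  obtain F where F: "hopf_map (hopf_total E) (hopf_total E') F"
      "bij_betw F (carrier (hopf_total E)) (carrier (hopf_total E'))"
      "\<forall>f\<in>funs_on (carrier G). F (hopf_incl E f) = hopf_incl E' f"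
      "\<forall>h\<in>carrier (hopf_total E). hopf_proj E' (F h) = hopf_proj E h"
    using assms(2) by (auto simp: hopf_ext_equiv_def)
  let ?F = "inv_into (carrier (hopf_total E)) F"
  have left: "?F (F h) = h" if "h \<in> carrier (hopf_total E)" for h
    using F(2) that by (simp add: bij_betw_inv_into_left)
  have ex: "\<exists>h\<in>carrier (hopf_total E). b = F h" if "b \<in> carrier (hopf_total E')" for b
    using F(2) that by (auto simp: bij_betw_def)
  have "hopf_map (hopf_total E') (hopf_total E) ?F"
    by (rule hopf_map_inv[OF F(1,2)]) (use hopf_extension_simps[OF E] in auto)
  moreover have "bij_betw ?F (carrier (hopf_total E')) (carrier (hopf_total E))"
    by (rule bij_betw_inv_into[OF F(2)])
  moreover have "?F (hopf_incl E' f) = hopf_incl E f" if "f \<in> funs_on (carrier G)" for f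
    using F(3) that left[OF hopf_extension_simps(5)[OF E that]] by simp
  moreover have "hopf_proj E (?F b) = hopf_proj E' b" if "b \<in> carrier (hopf_total E')" for b
    using ex[OF that] F(4) left by auto
  ultimately show ?thesis unfolding hopf_ext_equiv_def by blast
qed

text \<open>On the designated carrier type \<open>E\<close> belongs to its own class, which gives
  one direction; the other is symmetry and transitivity.\<close>

lemma hopf_class_eq_iff:
  fixes E E' :: "('g, 'c, 'k::field, 'c \<times> 'g \<Rightarrow> 'k) hopf_ext"
  assumes "comm_hopf_extension C G E"
  shows "hopf_class C G E = hopf_class C G E' \<longleftrightarrow> hopf_ext_equiv G E E'"
proof -
  have h: "hopf_extension C G E" using assms by (simp add: comm_hopf_extension_def)
  show ?thesis
  proof
    have "E \<in> hopf_class C G E" using assms hopf_ext_equiv_refl[OF h] by (simp add: hopf_class_def)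
    then show "hopf_ext_equiv G E E'" if "hopf_class C G E = hopf_class C G E'"
      using that unfolding hopf_class_def by blast
  next
    assume e: "hopf_ext_equiv G E E'"
    then show "hopf_class C G E = hopf_class C G E'"
      using hopf_ext_equiv_sym[OF h e] by (auto simp: hopf_class_def intro: hopf_ext_equiv_trans)
  qed
qed

text \<open>Here the extensions may live on different types and need not belong to the classes they
  name, so the equivalence is supplied in both directions.\<close>

lemma hopf_class_cong:
  assumes "hopf_ext_equiv G E E'" "hopf_ext_equiv G E' E"
  shows "hopf_class C G E = hopf_class C G E'"
  using assms by (auto simp: hopf_class_def intro: hopf_ext_equiv_trans)

section \<open>Spaces of functions\<close>

lemma funs_on_zero: "f \<in> funs_on S \<Longrightarrow> x \<notin> S \<Longrightarrow> f x = 0"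
  by (simp add: funs_on_def)

lemma delta_in_funs_on [simp]: "a \<in> S \<Longrightarrow> delta a \<in> funs_on S"
  by (auto simp: funs_on_def delta_def)

lemma delta_apply: "delta a x = (if x = a then 1 else 0)"
  by (simp add: delta_def)

text \<open>The function algebra, the group algebra and \<open>H_alg\<close> share this underlying
  space of functions on a finite set, with the delta functions as a basis.\<close>

locale fun_space =
  fixes V :: "('k::field, 'a \<Rightarrow> 'k, 'm) module_scheme" and S :: "'a set"
  assumes carrier_V: "carrier V = funs_on S"
    and finite_S: "finite S"
    and add_V: "add V = (\<lambda>u v x. u x + v x)"
    and zero_V: "zero V = (\<lambda>x. 0)"
    and smult_V: "module.smult V = (\<lambda>c u x. c * u x)"
begin

lemma abelian_group_V: "abelian_group V"
proof (rule abelian_groupI)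
  fix u assume "u \<in> carrier V"
  then show "\<exists>v\<in>carrier V. v \<oplus>\<^bsub>V\<^esub> u = \<zero>\<^bsub>V\<^esub>"
    by (intro bexI[of _ "\<lambda>x. - u x"]) (auto simp: carrier_V add_V zero_V funs_on_def)
qed (auto simp: carrier_V add_V zero_V funs_on_def fun_eq_iff algebra_simps)

lemma module_V: "module base_field V"
  by (rule moduleI[OF cring_from_type_algebra abelian_group_V])
    (auto simp: carrier_V add_V zero_V smult_V funs_on_def fun_eq_iff algebra_simps)

sublocale vspace V by (rule vspace.intro[OF module_V])

lemma linear_on_eval: "linear_on V (\<lambda>u. u x)"
  by (simp add: linear_on_def add_V smult_V)

lemma closed_V:
  "a \<in> carrier V \<Longrightarrow> b \<in> carrier V \<Longrightarrow> a \<oplus>\<^bsub>V\<^esub> b \<in> carrier V"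
  "a \<in> carrier V \<Longrightarrow> c \<odot>\<^bsub>V\<^esub> a \<in> carrier V"
  by (auto simp: carrier_V add_V smult_V funs_on_def)

text \<open>By induction over finite subsets \<open>Y\<close> of \<open>S\<close>, applied to the
  truncation of \<open>u\<close> to \<open>Y\<close>.\<close>

lemma linear_on_expand:
  assumes f: "linear_on V f" and u: "u \<in> carrier V"
  shows "f u = (\<Sum>x\<in>S. u x * f (delta x))"
proof -
  have d: "delta x \<in> carrier V" if "x \<in> S" for x using that by (simp add: carrier_V)
  have "f (\<lambda>y. if y \<in> Y then u y else 0) = (\<Sum>x\<in>Y. u x * f (delta x))"
    if "finite Y" "Y \<subseteq> S" for Y
    using that
  proof (induction Y rule: finite_induct)
    case empty
    have "f \<zero>\<^bsub>V\<^esub> = 0" by (rule linear_on_zero[OF f])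
    then show ?case by (simp add: zero_V)
  next
    case (insert y Y)
    let ?r = "\<lambda>z. if z \<in> Y then u z else 0"
    have r: "?r \<in> carrier V" using insert by (auto simp: carrier_V funs_on_def)
    have "(\<lambda>z. if z \<in> insert y Y then u z else 0) = (u y \<odot>\<^bsub>V\<^esub> delta y) \<oplus>\<^bsub>V\<^esub> ?r"
      using insert by (auto simp: smult_V add_V delta_def fun_eq_iff)
    then have "f (\<lambda>z. if z \<in> insert y Y then u z else 0) = u y * f (delta y) + f ?r"
      using f r d[of y] closed_V insert(4) by (simp add: linear_on_def)
    then show ?case using insert by simp
  qed
  from this[of S] have "f (\<lambda>y. if y \<in> S then u y else 0) = (\<Sum>x\<in>S. u x * f (delta x))"
    using finite_S by simp
  moreover have "(\<lambda>y. if y \<in> S then u y else 0) = u"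
    using u by (auto simp: carrier_V funs_on_def fun_eq_iff)
  ultimately show ?thesis by simp
qed

lemma bilinear_on_expand:
  assumes B: "bilinear_on V B" and u: "u \<in> carrier V" and v: "v \<in> carrier V"
  shows "B u v = (\<Sum>x\<in>S. \<Sum>y\<in>S. B (delta x) (delta y) * (u x * v y))"
proof -
  have "B u v = (\<Sum>x\<in>S. u x * B (delta x) v)"
    by (rule linear_on_expand) (use assms in \<open>auto simp: bilinear_on_def\<close>)
  also have "\<dots> = (\<Sum>x\<in>S. u x * (\<Sum>y\<in>S. v y * B (delta x) (delta y)))"
  proof (intro sum.cong refl arg_cong2[of _ _ _ _ "(*)"])
    fix x assume "x \<in> S"
    then have "linear_on V (B (delta x))" using B by (simp add: bilinear_on_def carrier_V)
    from linear_on_expand[OF this v]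
    show "B (delta x) v = (\<Sum>y\<in>S. v y * B (delta x) (delta y))" .
  qed
  finally show ?thesis by (simp add: sum_distrib_left algebra_simps)
qed

lemma trilinear_on_expand:
  assumes B: "trilinear_on V B" and u: "u \<in> carrier V" and v: "v \<in> carrier V" and w: "w \<in> carrier V"
  shows "B u v w = (\<Sum>x\<in>S. \<Sum>y\<in>S. \<Sum>z\<in>S. B (delta x) (delta y) (delta z) * (u x * v y * w z))"
proof -
  have "B u v w = (\<Sum>x\<in>S. u x * B (delta x) v w)"
    by (rule linear_on_expand[of "\<lambda>u. B u v w"]) (use assms in \<open>auto simp: trilinear_on_def\<close>)
  also have "\<dots> = (\<Sum>x\<in>S. u x * (\<Sum>y\<in>S. \<Sum>z\<in>S. B (delta x) (delta y) (delta z) * (v y * w z)))"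
  proof (intro sum.cong refl arg_cong2[of _ _ _ _ "(*)"])
    fix x assume "x \<in> S"
    then have "bilinear_on V (B (delta x))" using B by (simp add: trilinear_on_def bilinear_on_def carrier_V)
    from bilinear_on_expand[OF this v w]
    show "B (delta x) v w = (\<Sum>y\<in>S. \<Sum>z\<in>S. B (delta x) (delta y) (delta z) * (v y * w z))" .
  qed
  finally show ?thesis by (simp add: sum_distrib_left algebra_simps)
qed

text \<open>A bilinear form is a linear combination of products of two coordinates, so these
  products alone detect equality of tensors.\<close>

lemma tensor_eq_2_coords:
  assumes s: "s \<in> tensors V 2" and t: "t \<in> tensors V 2"
    and eq: "\<And>x y. x \<in> S \<Longrightarrow> y \<in> S \<Longrightarrow>
      sweedler s (\<lambda>u v. u x * v y) = sweedler t (\<lambda>u v. u x * v y)"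
  shows "tensor_eq V 2 s t"
proof (subst tensor_eq_2_iff[OF s t]; (intro closed_V allI impI)?)
  fix B assume B: "bilinear_on V B"
  have *: "sweedler r B = (\<Sum>x\<in>S. \<Sum>y\<in>S. B (delta x) (delta y) * sweedler r (\<lambda>u v. u x * v y))"
    if r: "r \<in> tensors V 2" for r
  proof -
    have "sweedler r B = tensor_eval (\<lambda>w. \<Sum>x\<in>S. \<Sum>y\<in>S. B (delta x) (delta y) * ((w ! 0) x * (w ! 1) y)) r"
      unfolding sweedler_def
    proof (rule tensor_eval_cong)
      fix w assume "w \<in> Poly_Mapping.keys r"
      with r have "w ! 0 \<in> carrier V" "w ! 1 \<in> carrier V"
        by (force simp: tensors_def words_2)+
      from bilinear_on_expand[OF B this]
      show "B (w ! 0) (w ! 1) = (\<Sum>x\<in>S. \<Sum>y\<in>S. B (delta x) (delta y) * ((w ! 0) x * (w ! 1) y))" .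
    qed
    then show ?thesis by (simp only: tensor_eval_fun_sum tensor_eval_fun_mult sweedler_def)
  qed
  show "sweedler s B = sweedler t B" by (simp add: * s t eq)
qed

lemma tensor_eq_3_coords:
  assumes s: "s \<in> tensors V 3" and t: "t \<in> tensors V 3"
    and eq: "\<And>x y z. x \<in> S \<Longrightarrow> y \<in> S \<Longrightarrow> z \<in> S \<Longrightarrow>
      tensor_eval (\<lambda>w. (w ! 0) x * (w ! 1) y * (w ! 2) z) s =
      tensor_eval (\<lambda>w. (w ! 0) x * (w ! 1) y * (w ! 2) z) t"
  shows "tensor_eq V 3 s t"
proof (subst tensor_eq_3_iff[OF s t]; (intro closed_V allI impI)?)
  fix B assume B: "trilinear_on V B"
  have *: "tensor_eval (\<lambda>w. B (w ! 0) (w ! 1) (w ! 2)) r = (\<Sum>x\<in>S. \<Sum>y\<in>S. \<Sum>z\<in>S.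
      B (delta x) (delta y) (delta z) * tensor_eval (\<lambda>w. (w ! 0) x * (w ! 1) y * (w ! 2) z) r)"
    if r: "r \<in> tensors V 3" for r
  proof -
    have "tensor_eval (\<lambda>w. B (w ! 0) (w ! 1) (w ! 2)) r =
      tensor_eval (\<lambda>w. \<Sum>x\<in>S. \<Sum>y\<in>S. \<Sum>z\<in>S.
        B (delta x) (delta y) (delta z) * ((w ! 0) x * (w ! 1) y * (w ! 2) z)) r"
    proof (rule tensor_eval_cong)
      fix w assume "w \<in> Poly_Mapping.keys r"
      with r have "w ! 0 \<in> carrier V" "w ! 1 \<in> carrier V" "w ! 2 \<in> carrier V"
        by (force simp: tensors_def words_3)+
      from trilinear_on_expand[OF B this]
      show "B (w ! 0) (w ! 1) (w ! 2) = (\<Sum>x\<in>S. \<Sum>y\<in>S. \<Sum>z\<in>S.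
        B (delta x) (delta y) (delta z) * ((w ! 0) x * (w ! 1) y * (w ! 2) z))" .
    qed
    then show ?thesis by (simp only: tensor_eval_fun_sum tensor_eval_fun_mult)
  qed
  show "tensor_eval (\<lambda>w. B (w ! 0) (w ! 1) (w ! 2)) s = tensor_eval (\<lambda>w. B (w ! 0) (w ! 1) (w ! 2)) t"
    unfolding *[OF s] *[OF t] by (intro sum.cong refl arg_cong2[of _ _ _ _ "(*)"] eq)
qed

end

section \<open>Membership in tensor powers, and the bialgebra axioms as Sweedler sums\<close>

lemma tensors_add: "s \<in> tensors V n \<Longrightarrow> t \<in> tensors V n \<Longrightarrow> s + t \<in> tensors V n"
  using keys_add[of s t] by (auto simp: tensors_def)

lemma tensors_zero: "0 \<in> tensors V n"
  by (simp add: tensors_def)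

lemma tensors_sum: "(\<And>i. i \<in> I \<Longrightarrow> t i \<in> tensors V n) \<Longrightarrow> (\<Sum>i\<in>I. t i) \<in> tensors V n"
  by (induction I rule: infinite_finite_induct) (auto simp: tensors_add tensors_zero)

lemma tensors_single: "w \<in> words V n \<Longrightarrow> Poly_Mapping.single w c \<in> tensors V n"
  by (simp add: tensors_def)

lemma tensors_scale: "t \<in> tensors V n \<Longrightarrow> pm_scale c t \<in> tensors V n"
  using keys_pm_scale[of c t] by (auto simp: tensors_def)

lemma tensors_lin_ext:
  assumes "s \<in> tensors W m" "\<And>w. w \<in> words W m \<Longrightarrow> f w \<in> tensors V n"
  shows "lin_ext f s \<in> tensors V n"
  using assms unfolding lin_ext_def
  by (intro tensors_sum tensors_scale) (auto simp: tensors_def)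

lemma sweedler_tensor_mult:
  assumes "s \<in> tensors H 2" "t \<in> tensors H 2"
  shows "sweedler (tensor_mult H s t) B =
    sweedler s (\<lambda>u v. sweedler t (\<lambda>u' v'. B (u \<otimes>\<^bsub>H\<^esub> u') (v \<otimes>\<^bsub>H\<^esub> v')))"
  unfolding sweedler_def tensor_mult_def tensor_eval_lin_ext
proof (intro tensor_eval_cong)
  fix x y assume "x \<in> Poly_Mapping.keys s" "y \<in> Poly_Mapping.keys t"
  with assms have "x \<in> words H 2" "y \<in> words H 2" by (auto simp: tensors_def)
  then show "tensor_eval (\<lambda>w. B (w ! 0) (w ! 1)) (Poly_Mapping.single (map2 (\<otimes>\<^bsub>H\<^esub>) x y) 1)
    = B (x ! 0 \<otimes>\<^bsub>H\<^esub> y ! 0) (x ! 1 \<otimes>\<^bsub>H\<^esub> y ! 1)"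
    by (auto simp: words_2)
qed

lemma tensors_tensor_mult:
  assumes "s \<in> tensors H 2" "t \<in> tensors H 2"
    "\<And>a b. a \<in> carrier H \<Longrightarrow> b \<in> carrier H \<Longrightarrow> a \<otimes>\<^bsub>H\<^esub> b \<in> carrier H"
  shows "tensor_mult H s t \<in> tensors H 2"
  unfolding tensor_mult_def
  by (rule tensors_lin_ext[OF assms(1)], rule tensors_lin_ext[OF assms(2)], rule tensors_single)
    (auto simp: words_2 assms(3))

definition coassoc_left :: "('k::field, 'h) bialg \<Rightarrow> 'h \<Rightarrow> 'h list \<Rightarrow>\<^sub>0 'k" where
  "coassoc_left H a =
      (lin_ext (\<lambda>xs. lin_ext (\<lambda>ys. Poly_Mapping.single (ys @ [xs ! 1]) 1) (comult H (xs ! 0)))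
        (comult H a))"

definition coassoc_right :: "('k::field, 'h) bialg \<Rightarrow> 'h \<Rightarrow> 'h list \<Rightarrow>\<^sub>0 'k" where
  "coassoc_right H a =
      (lin_ext (\<lambda>xs. lin_ext (\<lambda>ys. Poly_Mapping.single ((xs ! 0) # ys) 1) (comult H (xs ! 1)))
        (comult H a))"

lemma tensors_coassoc:
  assumes "\<And>a. a \<in> carrier H \<Longrightarrow> comult H a \<in> tensors H 2" "a \<in> carrier H"
  shows "coassoc_left H a \<in> tensors H 3" "coassoc_right H a \<in> tensors H 3"
proof -
  note a = assms(1)[OF assms(2)]
  show "coassoc_left H a \<in> tensors H 3"
    unfolding coassoc_left_def
  proof (rule tensors_lin_ext[OF a])
    fix xs assume "xs \<in> words H 2"
    then have x: "xs ! 0 \<in> carrier H" "xs ! 1 \<in> carrier H" by (auto simp: words_2)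
    show "lin_ext (\<lambda>ys. Poly_Mapping.single (ys @ [xs ! 1]) 1) (comult H (xs ! 0)) \<in> tensors H 3"
      by (rule tensors_lin_ext[OF assms(1)[OF x(1)]], rule tensors_single) (use x in \<open>auto simp: words_2 words_3\<close>)
  qed
  show "coassoc_right H a \<in> tensors H 3"
    unfolding coassoc_right_def
  proof (rule tensors_lin_ext[OF a])
    fix xs assume "xs \<in> words H 2"
    then have x: "xs ! 0 \<in> carrier H" "xs ! 1 \<in> carrier H" by (auto simp: words_2)
    show "lin_ext (\<lambda>ys. Poly_Mapping.single (xs ! 0 # ys) 1) (comult H (xs ! 1)) \<in> tensors H 3"
      by (rule tensors_lin_ext[OF assms(1)[OF x(2)]], rule tensors_single) (use x in \<open>auto simp: words_2 words_3\<close>)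
  qed
qed

lemma tensor_eval_coassoc:
  assumes "\<And>a. a \<in> carrier H \<Longrightarrow> comult H a \<in> tensors H 2" "a \<in> carrier H"
  shows "tensor_eval (\<lambda>w. B (w ! 0) (w ! 1) (w ! 2)) (coassoc_left H a) =
      sweedler (comult H a) (\<lambda>u v. sweedler (comult H u) (\<lambda>u1 u2. B u1 u2 v))"
    "tensor_eval (\<lambda>w. B (w ! 0) (w ! 1) (w ! 2)) (coassoc_right H a) =
      sweedler (comult H a) (\<lambda>u v. sweedler (comult H v) (\<lambda>v1 v2. B u v1 v2))"
proof -
  have w: "w \<in> words H 2" if "a \<in> carrier H" "w \<in> Poly_Mapping.keys (comult H a)" for a w
    using assms(1)[OF that(1)] that(2) by (auto simp: tensors_def)
  have c: "w ! 0 \<in> carrier H" "w ! 1 \<in> carrier H"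
    if "a \<in> carrier H" "w \<in> Poly_Mapping.keys (comult H a)" for a w
    using w[OF that] by (auto simp: words_2)
  show "tensor_eval (\<lambda>w. B (w ! 0) (w ! 1) (w ! 2)) (coassoc_left H a) =
      sweedler (comult H a) (\<lambda>u v. sweedler (comult H u) (\<lambda>u1 u2. B u1 u2 v))"
    unfolding coassoc_left_def sweedler_def tensor_eval_lin_ext
  proof (intro tensor_eval_cong)
    fix x y assume x: "x \<in> Poly_Mapping.keys (comult H a)" and y: "y \<in> Poly_Mapping.keys (comult H (x ! 0))"
    from w[OF c(1)[OF assms(2) x] y]
    show "tensor_eval (\<lambda>w. B (w ! 0) (w ! 1) (w ! 2)) (Poly_Mapping.single (y @ [x ! 1]) 1) =
      B (y ! 0) (y ! 1) (x ! 1)" by (auto simp: words_2)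
  qed
  show "tensor_eval (\<lambda>w. B (w ! 0) (w ! 1) (w ! 2)) (coassoc_right H a) =
      sweedler (comult H a) (\<lambda>u v. sweedler (comult H v) (\<lambda>v1 v2. B u v1 v2))"
    unfolding coassoc_right_def sweedler_def tensor_eval_lin_ext
  proof (intro tensor_eval_cong)
    fix x y assume x: "x \<in> Poly_Mapping.keys (comult H a)" and y: "y \<in> Poly_Mapping.keys (comult H (x ! 1))"
    from w[OF c(2)[OF assms(2) x] y]
    show "tensor_eval (\<lambda>w. B (w ! 0) (w ! 1) (w ! 2)) (Poly_Mapping.single (x ! 0 # y) 1) =
      B (x ! 0) (y ! 0) (y ! 1)" by (auto simp: words_2)
  qed
qed

lemma sweedler_sum_single:
  "sweedler (\<Sum>i\<in>I. f i) B = (\<Sum>i\<in>I. sweedler (f i) B)"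
  "sweedler (Poly_Mapping.single [a, b] c) B = c * B a b"
  "sweedler (s + t) B = sweedler s B + sweedler t B"
  "sweedler (pm_scale c t) B = c * sweedler t B"
  by (simp_all add: sweedler_def)

lemma sweedler_fun_sum: "sweedler t (\<lambda>u v. \<Sum>i\<in>I. B i u v) = (\<Sum>i\<in>I. sweedler t (B i))"
  by (simp add: sweedler_def tensor_eval_fun_sum)

lemma sweedler_fun_mult: "sweedler t (\<lambda>u v. c * B u v) = c * sweedler t B"
  by (simp add: sweedler_def tensor_eval_fun_mult)

lemma sweedler_map_tensor:
  assumes "t \<in> tensors V 2"
  shows "sweedler (map_tensor f t) B = sweedler t (\<lambda>u v. B (f u) (f v))"
  unfolding sweedler_def tensor_eval_map_tensor
  by (rule tensor_eval_cong) (use assms in \<open>force simp: tensors_def words_2\<close>)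

lemma sweedler_cong:
  assumes "t \<in> tensors V 2" "\<And>u v. u \<in> carrier V \<Longrightarrow> v \<in> carrier V \<Longrightarrow> B u v = B' u v"
  shows "sweedler t B = sweedler t B'"
  unfolding sweedler_def
  by (rule tensor_eval_cong) (use assms in \<open>force simp: tensors_def words_2\<close>)

section \<open>The extensions attached to cocycles\<close>

context prime_group
begin

text \<open>The product of kC, not truncated off the carrier. The product of \<open>H_alg\<close> is
  this convolution in the first variable, separately at every point of \<open>G\<close>.\<close>

definition conv :: "('c \<Rightarrow> 'k::field) \<Rightarrow> ('c \<Rightarrow> 'k) \<Rightarrow> 'c \<Rightarrow> 'k" where
  "conv f g z = (\<Sum>x\<in>carrier C. f x * g (inv x \<otimes> z))"

lemma conv_cong:
  "(\<And>x. x \<in> carrier C \<Longrightarrow> f x = f' x) \<Longrightarrow> (\<And>x. x \<in> carrier C \<Longrightarrow> g x = g' x) \<Longrightarrow> z \<in> carrier C \<Longrightarrow>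
    conv f g z = conv f' g' z"
  unfolding conv_def by (intro sum.cong) auto

text \<open>The substitution x -> x^(-1) z exchanges the two factors; it is an involution because
  \<open>C\<close> is abelian.\<close>

lemma conv_comm:
  assumes z: "z \<in> carrier C"
  shows "conv f g z = conv g f z"
proof -
  have "inv (inv x \<otimes> z) \<otimes> z = x" if x: "x \<in> carrier C" for x
  proof -
    have "inv (inv x \<otimes> z) = x \<otimes> inv z"
      using x z comm_C[of "inv z" x] by (simp add: inv_mult_group)
    then show ?thesis using x z by (simp add: m_assoc)
  qed
  then show ?thesis
    unfolding conv_def
    by (intro sum.reindex_bij_witness[of _ "\<lambda>x. inv x \<otimes> z" "\<lambda>x. inv x \<otimes> z"])
      (use z in \<open>auto simp: mult.commute\<close>)
qed

lemma conv_assoc: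
  assumes z: "z \<in> carrier C"
  shows "conv (conv f g) h z = conv f (conv g h) z"
proof -
  have "conv (conv f g) h z = (\<Sum>y\<in>carrier C. f y * (\<Sum>x\<in>carrier C. g (inv y \<otimes> x) * h (inv x \<otimes> z)))"
    unfolding conv_def sum_distrib_right
    by (subst sum.swap) (simp add: sum_distrib_left mult.assoc)
  also have "\<dots> = conv f (conv g h) z"
  proof -
    have eq: "(\<Sum>x\<in>carrier C. g (inv y \<otimes> x) * h (inv x \<otimes> z)) =
      (\<Sum>x\<in>carrier C. g x * h (inv x \<otimes> (inv y \<otimes> z)))" if y: "y \<in> carrier C" for y
    proof -
      \<comment> \<open>Substitution x -> y x in the inner sum.\<close>
      have "(\<Sum>x\<in>carrier C. g (inv y \<otimes> x) * h (inv x \<otimes> z)) =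
        (\<Sum>x\<in>carrier C. g (inv y \<otimes> (y \<otimes> x)) * h (inv (y \<otimes> x) \<otimes> z))"
        using sum_shift[OF y, of "\<lambda>x. g (inv y \<otimes> x) * h (inv x \<otimes> z)"] by simp
      also have "\<dots> = (\<Sum>x\<in>carrier C. g x * h (inv x \<otimes> (inv y \<otimes> z)))"
        using y z by (intro sum.cong) (auto simp: inv_mult_group m_assoc[symmetric])
      finally show ?thesis .
    qed
    show ?thesis unfolding conv_def by (rule sum.cong[OF refl]) (simp only: eq)
  qed
  finally show ?thesis .
qed

lemma conv_scale: "conv (\<lambda>x. k * f x) g z = k * conv f g z" "conv f (\<lambda>x. k * g x) z = k * conv f g z"
  by (simp_all add: conv_def sum_distrib_left mult.assoc mult.left_commute)

lemma conv_delta: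
  assumes "c \<in> carrier C" "z \<in> carrier C"
  shows "conv (\<lambda>x. if x = c then k else 0) g z = k * g (inv c \<otimes> z)"
  unfolding conv_def using assms by (simp add: if_distrib[of "\<lambda>c. c * _"] cong: if_cong)

end

lemma sweedler_fun_mult_right: "sweedler t (\<lambda>u v. B u v * c) = sweedler t B * c"
  by (simp add: sweedler_def tensor_eval_fun_mult_right)

locale ext_setup = prime_group C p for C :: "'c monoid" (structure) and p +
  fixes G :: "'g monoid" and n :: nat
  assumes comm_group_G: "comm_group G" and finite_G [simp]: "finite (carrier G)"
    and order_G: "Coset.order G = p ^ n"
begin

sublocale G: comm_group G by (rule comm_group_G)

lemma group_G: "group G" by (rule G.is_group)

end

locale cocycle_setup = ext_setup C p G n for C :: "'c monoid" (structure) and p and G :: "'g monoid" and n +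
  fixes \<tau> :: "'c \<Rightarrow> 'g \<Rightarrow> 'g \<Rightarrow> 'k::field"
  assumes cocycle: "\<tau> \<in> cocycles C G"
begin

lemma cocycle_simps:
  "x \<in> carrier C \<Longrightarrow> a \<in> carrier G \<Longrightarrow> b \<in> carrier G \<Longrightarrow> \<tau> x a b \<noteq> 0"
  "a \<in> carrier G \<Longrightarrow> b \<in> carrier G \<Longrightarrow> \<tau> \<one> a b = 1"
  "x \<in> carrier C \<Longrightarrow> b \<in> carrier G \<Longrightarrow> \<tau> x \<one>\<^bsub>G\<^esub> b = 1"
  "x \<in> carrier C \<Longrightarrow> a \<in> carrier G \<Longrightarrow> \<tau> x a \<one>\<^bsub>G\<^esub> = 1"
  "x \<in> carrier C \<Longrightarrow> a \<in> carrier G \<Longrightarrow> b \<in> carrier G \<Longrightarrow> c \<in> carrier G \<Longrightarrow>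
    \<tau> x a (b \<otimes>\<^bsub>G\<^esub> c) * \<tau> x b c = \<tau> x (a \<otimes>\<^bsub>G\<^esub> b) c * \<tau> x a b"
  "x \<in> carrier C \<Longrightarrow> y \<in> carrier C \<Longrightarrow> a \<in> carrier G \<Longrightarrow> b \<in> carrier G \<Longrightarrow>
    \<tau> (x \<otimes> y) a b = \<tau> x a b * \<tau> y a b"
  using cocycle unfolding cocycles_def by auto

text \<open>The cocycle identity at the triple a, a^(-1), a. It lets a single formula serve as left
  and as right antipode.\<close>

lemma cocycle_inv:
  assumes "x \<in> carrier C" "a \<in> carrier G"
  shows "\<tau> x a (inv\<^bsub>G\<^esub> a) = \<tau> x (inv\<^bsub>G\<^esub> a) a"
  using cocycle_simps(5)[OF assms(1,2) G.inv_closed[OF assms(2)] assms(2)] cocycle_simps(3,4) assms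
  by (simp add: G.l_inv G.r_inv)

abbreviation "H \<equiv> H_alg C G \<tau>"

lemma carrier_H: "carrier H = funs_on (carrier C \<times> carrier G)"
  by (simp add: H_alg_def)

lemma H_simps:
  "one H = (\<lambda>(x, a). if x = \<one> \<and> a \<in> carrier G then 1 else 0)"
  "zero H = (\<lambda>_. 0)" "add H = (\<lambda>u v z. u z + v z)" "module.smult H = (\<lambda>c u z. c * u z)"
  "counit H u = (\<Sum>x\<in>carrier C. u (x, \<one>\<^bsub>G\<^esub>))"
  by (simp_all add: H_alg_def)

lemma mult_H: "u \<otimes>\<^bsub>H\<^esub> v = (\<lambda>(z, a). if z \<in> carrier C then conv (\<lambda>x. u (x, a)) (\<lambda>x. v (x, a)) z else 0)"
  by (auto simp: H_alg_def conv_def fun_eq_iff)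

lemma comult_H: "comult H u = (\<Sum>x\<in>carrier C. \<Sum>a\<in>carrier G. \<Sum>b\<in>carrier G.
        Poly_Mapping.single [delta (x, a), delta (x, b)] (\<tau> x a b * u (x, a \<otimes>\<^bsub>G\<^esub> b)))"
  by (simp add: H_alg_def)

sublocale fs: fun_space H "carrier C \<times> carrier G"
  by unfold_locales (simp_all add: carrier_H H_simps)

lemma comult_in_tensors: "comult H u \<in> tensors H 2"
  unfolding comult_H by (intro tensors_sum tensors_single) (auto simp: words_2 carrier_H)

lemma sweedler_comult: "sweedler (comult H u) B = (\<Sum>x\<in>carrier C. \<Sum>a\<in>carrier G. \<Sum>b\<in>carrier G.
    \<tau> x a b * u (x, a \<otimes>\<^bsub>G\<^esub> b) * B (delta (x, a)) (delta (x, b)))"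
  by (simp add: comult_H sweedler_sum_single)

text \<open>Combined with \<open>tensor_eq_2_coords\<close>, this turns identities between tensors
  over \<open>H\<close> into identities for \<tau>.\<close>

lemma comult_coords:
  assumes "y \<in> carrier C" "z \<in> carrier C" "c \<in> carrier G" "d \<in> carrier G"
  shows "sweedler (comult H u) (\<lambda>v w. v (y, c) * w (z, d)) = (if y = z then \<tau> y c d * u (y, c \<otimes>\<^bsub>G\<^esub> d) else 0)"
proof -
  have "sweedler (comult H u) (\<lambda>v w. v (y, c) * w (z, d)) = (\<Sum>x\<in>carrier C. \<Sum>a\<in>carrier G. \<Sum>b\<in>carrier G.
    if b = d then if a = c then if x = y then if y = z then \<tau> y c d * u (y, c \<otimes>\<^bsub>G\<^esub> d) else 0 else 0 else 0 else 0)"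
    unfolding sweedler_comult by (intro sum.cong) (auto simp: delta_apply)
  also have "\<dots> = (if y = z then \<tau> y c d * u (y, c \<otimes>\<^bsub>G\<^esub> d) else 0)"
    using assms by simp
  finally show ?thesis .
qed

lemma H_cring: "cring H"
proof (rule cringI[OF fs.abelian_group_V])
  show "comm_monoid H"
  proof (rule comm_monoidI)
    fix u v w assume u: "u \<in> carrier H" and v: "v \<in> carrier H" and w: "w \<in> carrier H"
    show "u \<otimes>\<^bsub>H\<^esub> v \<in> carrier H"
      using u v by (auto simp: carrier_H mult_H funs_on_def conv_def)
    show "u \<otimes>\<^bsub>H\<^esub> v = v \<otimes>\<^bsub>H\<^esub> u"
      by (auto simp: mult_H fun_eq_iff conv_comm)
    have "conv (\<lambda>x. if x \<in> carrier C then conv (\<lambda>x. u (x, a)) (\<lambda>x. v (x, a)) x else 0) (\<lambda>x. w (x, a)) z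
      = conv (\<lambda>x. u (x, a)) (\<lambda>x. if x \<in> carrier C then conv (\<lambda>x. v (x, a)) (\<lambda>x. w (x, a)) x else 0) z"
      if z: "z \<in> carrier C" for z a
      by (rule trans[OF _ trans[OF conv_assoc[OF z]]]) (rule conv_cong; use z in simp)+
    then show "u \<otimes>\<^bsub>H\<^esub> v \<otimes>\<^bsub>H\<^esub> w = u \<otimes>\<^bsub>H\<^esub> (v \<otimes>\<^bsub>H\<^esub> w)"
      by (simp add: mult_H fun_eq_iff)
  next
    show "\<one>\<^bsub>H\<^esub> \<in> carrier H" by (auto simp: carrier_H H_simps funs_on_def)
  next
    fix u assume u: "u \<in> carrier H"
    have "conv (\<lambda>x. if x = \<one> \<and> a \<in> carrier G then 1 else 0) (\<lambda>x. u (x, a)) z = u (z, a)"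
      if z: "z \<in> carrier C" for z a
    proof -
      have "(\<lambda>x. if x = \<one> \<and> a \<in> carrier G then 1 else 0 :: 'k) = (\<lambda>x. if x = \<one> then if a \<in> carrier G then 1 else 0 else 0)"
        by auto
      moreover have "u (z, a) = 0" if "a \<notin> carrier G" using that u by (auto simp: carrier_H funs_on_def)
      ultimately show ?thesis using z by (simp add: conv_delta)
    qed
    then show "\<one>\<^bsub>H\<^esub> \<otimes>\<^bsub>H\<^esub> u = u"
      using u by (auto simp: mult_H H_simps fun_eq_iff carrier_H funs_on_def)
  qed
  fix u v w assume u: "u \<in> carrier H" and v: "v \<in> carrier H" and w: "w \<in> carrier H"
  show "(u \<oplus>\<^bsub>H\<^esub> v) \<otimes>\<^bsub>H\<^esub> w = u \<otimes>\<^bsub>H\<^esub> w \<oplus>\<^bsub>H\<^esub> v \<otimes>\<^bsub>H\<^esub> w"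
    by (auto simp: mult_H H_simps fun_eq_iff conv_def sum.distrib algebra_simps)
qed

sublocale H: cring H by (rule H_cring)

lemma H_k_algebra: "k_algebra H"
  unfolding k_algebra_def
  using fs.module_V H.ring_axioms
  by (auto simp: mult_H H_simps fun_eq_iff conv_scale)

lemma carrier_H_eqI:
  assumes "u \<in> carrier H" "v \<in> carrier H"
    "\<And>z a. z \<in> carrier C \<Longrightarrow> a \<in> carrier G \<Longrightarrow> u (z, a) = v (z, a)"
  shows "u = v"
proof
  fix q show "u q = v q"
    using assms by (cases "q \<in> carrier C \<times> carrier G") (auto simp: carrier_H funs_on_zero)
qed

lemma lin_val_apply:
  assumes "\<And>v w. v \<in> carrier H \<Longrightarrow> w \<in> carrier H \<Longrightarrow> f v w \<in> carrier H"
  shows "lin_val H (\<lambda>xs. f (xs ! 0) (xs ! 1)) (comult H u) \<in> carrier H"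
    "lin_val H (\<lambda>xs. f (xs ! 0) (xs ! 1)) (comult H u) q = sweedler (comult H u) (\<lambda>v w. f v w q)"
proof -
  have c: "f (xs ! 0) (xs ! 1) \<in> carrier H" if "xs \<in> Poly_Mapping.keys (comult H u)" for xs
  proof -
    have "xs \<in> words H 2" using comult_in_tensors[of u] that by (auto simp: tensors_def)
    then show ?thesis using assms by (auto simp: words_2)
  qed
  show "lin_val H (\<lambda>xs. f (xs ! 0) (xs ! 1)) (comult H u) \<in> carrier H"
    by (rule fs.lin_val_closed) (rule c)
  show "lin_val H (\<lambda>xs. f (xs ! 0) (xs ! 1)) (comult H u) q = sweedler (comult H u) (\<lambda>v w. f v w q)"
    using fs.linear_on_lin_val[OF fs.linear_on_eval[of q], of "comult H u" "\<lambda>xs. f (xs ! 0) (xs ! 1)"] c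
    by (simp add: sweedler_def)
qed

text \<open>In coordinates both sides vanish unless the three labels in \<open>C\<close> agree, and
  then their equality is the cocycle identity in the variables of \<open>G\<close>.\<close>

lemma H_coassoc: 
  assumes u: "u \<in> carrier H"
  shows "tensor_eq H 3 (coassoc_left H u) (coassoc_right H u)"
proof (rule fs.tensor_eq_3_coords)
  show "coassoc_left H u \<in> tensors H 3" "coassoc_right H u \<in> tensors H 3"
    using u by (auto intro: tensors_coassoc comult_in_tensors)
  fix q r s assume "q \<in> carrier C \<times> carrier G" "r \<in> carrier C \<times> carrier G" "s \<in> carrier C \<times> carrier G"
  then obtain x y z a b c where q: "q = (x, a)" "r = (y, b)" "s = (z, c)"
    and m: "x \<in> carrier C" "y \<in> carrier C" "z \<in> carrier C" "a \<in> carrier G" "b \<in> carrier G" "c \<in> carrier G"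
    by auto
  have "sweedler (comult H u) (\<lambda>v w. sweedler (comult H v) (\<lambda>v1 v2. v1 q * v2 r * w s)) =
    sweedler (comult H u) (\<lambda>v w. (if x = y then \<tau> x a b else 0) * (v (x, a \<otimes>\<^bsub>G\<^esub> b) * w (z, c)))"
    by (rule arg_cong[of _ _ "sweedler _"])
      (auto simp: fun_eq_iff q m sweedler_fun_mult_right comult_coords)
  also have "\<dots> = (if x = y \<and> y = z then \<tau> x a b * \<tau> x (a \<otimes>\<^bsub>G\<^esub> b) c * u (x, a \<otimes>\<^bsub>G\<^esub> b \<otimes>\<^bsub>G\<^esub> c) else 0)"
    unfolding sweedler_fun_mult using m by (subst comult_coords) auto
  also have "\<dots> = (if x = y \<and> y = z then \<tau> y b c * \<tau> x a (b \<otimes>\<^bsub>G\<^esub> c) * u (x, a \<otimes>\<^bsub>G\<^esub> (b \<otimes>\<^bsub>G\<^esub> c)) else 0)"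
    using cocycle_simps(5)[OF m(1,4-6)] m by (auto simp: G.m_assoc mult.commute)
  also have "\<dots> = sweedler (comult H u) (\<lambda>v w. (if y = z then \<tau> y b c else 0) * (v (x, a) * w (y, b \<otimes>\<^bsub>G\<^esub> c)))"
    unfolding sweedler_fun_mult using m by (subst comult_coords) auto
  also have "\<dots> = sweedler (comult H u) (\<lambda>v w. sweedler (comult H w) (\<lambda>w1 w2. v q * w1 r * w2 s))"
    by (rule arg_cong[of _ _ "sweedler _"])
      (auto simp: fun_eq_iff q m mult.assoc sweedler_fun_mult comult_coords)
  finally show "tensor_eval (\<lambda>w. (w ! 0) q * (w ! 1) r * (w ! 2) s) (coassoc_left H u) =
      tensor_eval (\<lambda>w. (w ! 0) q * (w ! 1) r * (w ! 2) s) (coassoc_right H u)"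
    using tensor_eval_coassoc[of H u "\<lambda>v1 v2 v3. v1 q * v2 r * v3 s"] u comult_in_tensors by simp
qed

text \<open>In coordinates the factors \<tau> coming from the two comultiplications combine into a
  single one, because \<tau> is multiplicative in its first argument.\<close>

lemma H_comult_mult:
  assumes u: "u \<in> carrier H" and v: "v \<in> carrier H"
  shows "tensor_eq H 2 (comult H (u \<otimes>\<^bsub>H\<^esub> v)) (tensor_mult H (comult H u) (comult H v))"
proof (rule fs.tensor_eq_2_coords)
  show "comult H (u \<otimes>\<^bsub>H\<^esub> v) \<in> tensors H 2" by (rule comult_in_tensors)
  show "tensor_mult H (comult H u) (comult H v) \<in> tensors H 2"
    by (intro tensors_tensor_mult comult_in_tensors H.m_closed)
  fix q r assume "q \<in> carrier C \<times> carrier G" "r \<in> carrier C \<times> carrier G"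
  then obtain y z a b where q: "q = (y, a)" "r = (z, b)"
    and m: "y \<in> carrier C" "z \<in> carrier C" "a \<in> carrier G" "b \<in> carrier G"
    by auto
  have "sweedler (tensor_mult H (comult H u) (comult H v)) (\<lambda>u v. u q * v r) =
    sweedler (comult H u) (\<lambda>s t. sweedler (comult H v) (\<lambda>s' t'.
      \<Sum>c\<in>carrier C. \<Sum>d\<in>carrier C. (s (c, a) * t (d, b)) * (s' (inv c \<otimes> y, a) * t' (inv d \<otimes> z, b))))"
    unfolding sweedler_tensor_mult[OF comult_in_tensors comult_in_tensors]
    by (intro arg_cong[of _ _ "sweedler _"] ext)
      (simp add: q m mult_H conv_def sum_product algebra_simps)
  also have "\<dots> = (\<Sum>c\<in>carrier C. \<Sum>d\<in>carrier C. sweedler (comult H u) (\<lambda>s t. s (c, a) * t (d, b)) *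
     sweedler (comult H v) (\<lambda>s' t'. s' (inv c \<otimes> y, a) * t' (inv d \<otimes> z, b)))"
    by (simp only: sweedler_fun_sum sweedler_fun_mult) (simp add: sweedler_fun_mult_right)
  also have "\<dots> = (\<Sum>c\<in>carrier C. \<Sum>d\<in>carrier C. if d = c then (if y = z then
      \<tau> c a b * u (c, a \<otimes>\<^bsub>G\<^esub> b) * (\<tau> (inv c \<otimes> y) a b * v (inv c \<otimes> y, a \<otimes>\<^bsub>G\<^esub> b)) else 0) else 0)"
    by (intro sum.cong refl) (use m in \<open>auto simp: comult_coords\<close>)
  also have "\<dots> = (if y = z then \<Sum>c\<in>carrier C. 
      \<tau> c a b * u (c, a \<otimes>\<^bsub>G\<^esub> b) * (\<tau> (inv c \<otimes> y) a b * v (inv c \<otimes> y, a \<otimes>\<^bsub>G\<^esub> b)) else 0)"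
    by simp
  also have "\<dots> = (if y = z then \<tau> y a b * (u \<otimes>\<^bsub>H\<^esub> v) (y, a \<otimes>\<^bsub>G\<^esub> b) else 0)"
  proof -
    have "\<tau> c a b * \<tau> (inv c \<otimes> y) a b = \<tau> y a b" if "c \<in> carrier C" for c
      using cocycle_simps(6)[of c "inv c \<otimes> y" a b] that m by (simp add: m_assoc[symmetric])
    then have "(\<Sum>c\<in>carrier C. \<tau> c a b * u (c, a \<otimes>\<^bsub>G\<^esub> b) * (\<tau> (inv c \<otimes> y) a b * v (inv c \<otimes> y, a \<otimes>\<^bsub>G\<^esub> b)))
      = (\<Sum>c\<in>carrier C. \<tau> y a b * (u (c, a \<otimes>\<^bsub>G\<^esub> b) * v (inv c \<otimes> y, a \<otimes>\<^bsub>G\<^esub> b)))"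
      by (intro sum.cong) (auto simp: algebra_simps)
    then show ?thesis using m by (cases "y = z") (simp_all add: mult_H conv_def sum_distrib_left)
  qed
  also have "\<dots> = sweedler (comult H (u \<otimes>\<^bsub>H\<^esub> v)) (\<lambda>u v. u q * v r)"
    using m by (simp add: q comult_coords)
  finally show "sweedler (comult H (u \<otimes>\<^bsub>H\<^esub> v)) (\<lambda>u v. u q * v r) =
    sweedler (tensor_mult H (comult H u) (comult H v)) (\<lambda>u v. u q * v r)" ..
qed

lemma H_bialgebra: "bialgebra H"
  unfolding bialgebra_def coassoc_left_def[symmetric] coassoc_right_def[symmetric]
proof (intro conjI ballI allI)
  show "k_algebra H" by (rule H_k_algebra)
  fix u assume u: "u \<in> carrier H"
  show "comult H u \<in> tensors H 2" by (rule comult_in_tensors)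
  show "tensor_eq H 3 (coassoc_left H u) (coassoc_right H u)" by (rule H_coassoc[OF u])
  {
    fix v assume v: "v \<in> carrier H"
    have "comult H (u \<oplus>\<^bsub>H\<^esub> v) = comult H u + comult H v"
      by (simp add: comult_H H_simps algebra_simps single_add sum.distrib)
    then show "tensor_eq H 2 (comult H (u \<oplus>\<^bsub>H\<^esub> v)) (comult H u + comult H v)" by simp
    show "counit H (u \<oplus>\<^bsub>H\<^esub> v) = counit H u + counit H v"
      by (simp add: H_simps sum.distrib)
    show "tensor_eq H 2 (comult H (u \<otimes>\<^bsub>H\<^esub> v)) (tensor_mult H (comult H u) (comult H v))"
      by (rule H_comult_mult[OF u v])
    have "counit H (u \<otimes>\<^bsub>H\<^esub> v) = (\<Sum>x\<in>carrier C. \<Sum>z\<in>carrier C. u (x, \<one>\<^bsub>G\<^esub>) * v (inv x \<otimes> z, \<one>\<^bsub>G\<^esub>))"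
      by (simp add: H_simps mult_H conv_def) (rule sum.swap)
    also have "\<dots> = (\<Sum>x\<in>carrier C. \<Sum>z\<in>carrier C. u (x, \<one>\<^bsub>G\<^esub>) * v (z, \<one>\<^bsub>G\<^esub>))"
      by (intro sum.cong refl sum_shift) auto
    finally show "counit H (u \<otimes>\<^bsub>H\<^esub> v) = counit H u * counit H v"
      by (simp add: H_simps sum_product)
  }
  show "tensor_eq H 2 (comult H (c \<odot>\<^bsub>H\<^esub> u)) (pm_scale c (comult H u))" for c
    by (rule fs.tensor_eq_2_coords[OF comult_in_tensors tensors_scale[OF comult_in_tensors]])
      (auto simp: sweedler_sum_single(4) comult_coords H_simps)
  show "counit H (c \<odot>\<^bsub>H\<^esub> u) = c * counit H u" for c
    by (simp add: H_simps sum_distrib_left)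
  have cl: "counit H w \<odot>\<^bsub>H\<^esub> v \<in> carrier H" if "v \<in> carrier H" for v w
    using that by (auto simp: carrier_H H_simps funs_on_def)
  show "lin_val H (\<lambda>xs. counit H (xs ! 0) \<odot>\<^bsub>H\<^esub> xs ! 1) (comult H u) = u"
  proof (rule carrier_H_eqI[OF lin_val_apply(1) u])
    fix z a assume z: "z \<in> carrier C" "a \<in> carrier G"
    \<comment> \<open>The counit reads the coordinates over the identity of \<open>G\<close>, where
      \<tau> is normalized.\<close>
    have "sweedler (comult H u) (\<lambda>v w. (counit H v \<odot>\<^bsub>H\<^esub> w) (z, a)) =
      (\<Sum>x\<in>carrier C. sweedler (comult H u) (\<lambda>v w. v (x, \<one>\<^bsub>G\<^esub>) * w (z, a)))"
      by (simp add: H_simps sum_distrib_right sweedler_fun_sum)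
    also have "\<dots> = u (z, a)" using z by (simp add: comult_coords cocycle_simps cong: if_cong)
    finally show "lin_val H (\<lambda>xs. counit H (xs ! 0) \<odot>\<^bsub>H\<^esub> xs ! 1) (comult H u) (z, a) = u (z, a)"
      by (subst lin_val_apply(2)[of "\<lambda>v w. counit H v \<odot>\<^bsub>H\<^esub> w"]) (auto intro: cl)
  qed (rule cl)
  show "lin_val H (\<lambda>xs. counit H (xs ! 1) \<odot>\<^bsub>H\<^esub> xs ! 0) (comult H u) = u"
  proof (rule carrier_H_eqI[OF lin_val_apply(1)[of "\<lambda>v w. counit H w \<odot>\<^bsub>H\<^esub> v"] u])
    fix z a assume z: "z \<in> carrier C" "a \<in> carrier G"
    have "sweedler (comult H u) (\<lambda>v w. (counit H w \<odot>\<^bsub>H\<^esub> v) (z, a)) =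
      (\<Sum>x\<in>carrier C. sweedler (comult H u) (\<lambda>v w. v (z, a) * w (x, \<one>\<^bsub>G\<^esub>)))"
      by (simp add: H_simps sum_distrib_left mult.commute flip: sweedler_fun_sum)
    also have "\<dots> = u (z, a)" using z by (simp add: comult_coords cocycle_simps cong: if_cong)
    finally show "lin_val H (\<lambda>xs. counit H (xs ! 1) \<odot>\<^bsub>H\<^esub> xs ! 0) (comult H u) (z, a) = u (z, a)"
      by (subst lin_val_apply(2)[of "\<lambda>v w. counit H w \<odot>\<^bsub>H\<^esub> v"]) (auto intro: cl)
  qed (rule cl)
next
  show "tensor_eq H 2 (comult H \<one>\<^bsub>H\<^esub>) (Poly_Mapping.single [\<one>\<^bsub>H\<^esub>, \<one>\<^bsub>H\<^esub>] 1)"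
    by (rule fs.tensor_eq_2_coords[OF comult_in_tensors])
      (auto simp: words_2 sweedler_sum_single comult_coords H_simps cocycle_simps intro!: tensors_single
        H.one_closed[unfolded H_simps])
  show "counit H \<one>\<^bsub>H\<^esub> = 1" by (simp add: H_simps)
qed

text \<open>On the basis, S(p_a x) = \<tau>(x, a, a^(-1))^(-1) p_b x^(-1) with b = a^(-1). The
  scalar cancels the factor that the comultiplication introduces.\<close>

definition H_antipode :: "('c \<times> 'g \<Rightarrow> 'k) \<Rightarrow> 'c \<times> 'g \<Rightarrow> 'k" where
  "H_antipode u = (\<lambda>(y, b). if y \<in> carrier C \<and> b \<in> carrier G
     then inverse (\<tau> (inv y) (inv\<^bsub>G\<^esub> b) b) * u (inv y, inv\<^bsub>G\<^esub> b) else 0)"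

lemma H_is_antipode: "is_antipode H H_antipode"
  unfolding is_antipode_def
proof (intro conjI ballI allI)
  have cl: "H_antipode u \<in> carrier H" for u
    by (auto simp: H_antipode_def carrier_H funs_on_def)
  show "H_antipode \<in> carrier H \<rightarrow> carrier H" using cl by auto
  fix u assume u: "u \<in> carrier H"
  show "H_antipode (u \<oplus>\<^bsub>H\<^esub> v) = H_antipode u \<oplus>\<^bsub>H\<^esub> H_antipode v" for v
    by (auto simp: H_antipode_def H_simps algebra_simps)
  show "H_antipode (c \<odot>\<^bsub>H\<^esub> u) = c \<odot>\<^bsub>H\<^esub> H_antipode u" for c
    by (auto simp: H_antipode_def H_simps algebra_simps)
  have one: "counit H u \<odot>\<^bsub>H\<^esub> \<one>\<^bsub>H\<^esub> \<in> carrier H" by (simp add: fs.closed_V)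
  have inv_eq: "inv x = inv x \<otimes> z \<longleftrightarrow> z = \<one>" "x = inv (inv x \<otimes> z) \<longleftrightarrow> z = \<one>"
    if "x \<in> carrier C" "z \<in> carrier C" for x z
    using that by (auto simp: inv_mult_group)
  show "lin_val H (\<lambda>xs. H_antipode (xs ! 0) \<otimes>\<^bsub>H\<^esub> xs ! 1) (comult H u) = counit H u \<odot>\<^bsub>H\<^esub> \<one>\<^bsub>H\<^esub>"
  proof (rule carrier_H_eqI[OF lin_val_apply(1) one])
    fix z a assume z: "z \<in> carrier C" "a \<in> carrier G"
    have "sweedler (comult H u) (\<lambda>v w. (H_antipode v \<otimes>\<^bsub>H\<^esub> w) (z, a)) =
      (\<Sum>x\<in>carrier C. inverse (\<tau> (inv x) (inv\<^bsub>G\<^esub> a) a) *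
        sweedler (comult H u) (\<lambda>v w. v (inv x, inv\<^bsub>G\<^esub> a) * w (inv x \<otimes> z, a)))"
      using z by (simp add: mult_H conv_def H_antipode_def mult.assoc sweedler_fun_sum sweedler_fun_mult)
    also have "\<dots> = (\<Sum>x\<in>carrier C. if z = \<one> then u (inv x, \<one>\<^bsub>G\<^esub>) else 0)"
      using z by (intro sum.cong refl) (simp add: comult_coords inv_eq cocycle_simps)
    also have "\<dots> = (if z = \<one> then counit H u else 0)"
      using sum.reindex_bij_witness[of "carrier C" "m_inv C" "m_inv C" "carrier C" "\<lambda>x. u (inv x, \<one>\<^bsub>G\<^esub>)" "\<lambda>x. u (x, \<one>\<^bsub>G\<^esub>)"]
      by (auto simp: H_simps)
    finally show "lin_val H (\<lambda>xs. H_antipode (xs ! 0) \<otimes>\<^bsub>H\<^esub> xs ! 1) (comult H u) (z, a) = (counit H u \<odot>\<^bsub>H\<^esub> \<one>\<^bsub>H\<^esub>) (z, a)"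
      using z by (subst lin_val_apply(2)[of "\<lambda>v w. H_antipode v \<otimes>\<^bsub>H\<^esub> w"]) (auto simp: H_simps intro: cl)
  qed (use cl in auto)
  show "lin_val H (\<lambda>xs. xs ! 0 \<otimes>\<^bsub>H\<^esub> H_antipode (xs ! 1)) (comult H u) = counit H u \<odot>\<^bsub>H\<^esub> \<one>\<^bsub>H\<^esub>"
  proof (rule carrier_H_eqI[OF lin_val_apply(1)[of "\<lambda>v w. v \<otimes>\<^bsub>H\<^esub> H_antipode w"] one])
    fix z a assume z: "z \<in> carrier C" "a \<in> carrier G"
    have "sweedler (comult H u) (\<lambda>v w. (v \<otimes>\<^bsub>H\<^esub> H_antipode w) (z, a)) =
      (\<Sum>x\<in>carrier C. inverse (\<tau> (inv (inv x \<otimes> z)) (inv\<^bsub>G\<^esub> a) a) *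
        sweedler (comult H u) (\<lambda>v w. v (x, a) * w (inv (inv x \<otimes> z), inv\<^bsub>G\<^esub> a)))"
      using z by (simp add: mult_H conv_def H_antipode_def mult.left_commute sweedler_fun_sum flip: sweedler_fun_mult)
    also have "\<dots> = (\<Sum>x\<in>carrier C. if z = \<one> then u (x, \<one>\<^bsub>G\<^esub>) else 0)"
      using z by (intro sum.cong refl) (simp add: comult_coords inv_eq cocycle_simps cocycle_inv)
    also have "\<dots> = (if z = \<one> then counit H u else 0)"
      by (auto simp: H_simps)
    finally show "lin_val H (\<lambda>xs. xs ! 0 \<otimes>\<^bsub>H\<^esub> H_antipode (xs ! 1)) (comult H u) (z, a) = (counit H u \<odot>\<^bsub>H\<^esub> \<one>\<^bsub>H\<^esub>) (z, a)"
      using z by (subst lin_val_apply(2)[of "\<lambda>v w. v \<otimes>\<^bsub>H\<^esub> H_antipode w"]) (auto simp: H_simps intro: cl)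
  qed (use cl in auto)
qed

lemma H_hopf_algebra: "hopf_algebra H"
  using H_bialgebra H_is_antipode by (auto simp: hopf_algebra_def)

end

text \<open>By commutativity a leaves the adjoint action, h_1 a S(h_2) = a h_1 S(h_2) =
  \<epsilon>(h) a, and \<open>A\<close> is closed under scalars.\<close>

lemma normal_in_comm:
  fixes H :: "('k::field, 'h) bialg"
  assumes H: "bialgebra H"
    and comm: "\<And>a b. a \<in> carrier H \<Longrightarrow> b \<in> carrier H \<Longrightarrow> a \<otimes>\<^bsub>H\<^esub> b = b \<otimes>\<^bsub>H\<^esub> a"
    and A: "A \<subseteq> carrier H" "\<And>a c. a \<in> A \<Longrightarrow> c \<odot>\<^bsub>H\<^esub> a \<in> A"
  shows "normal_in A H"
  unfolding normal_in_def
proof (intro allI impI ballI conjI)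
  fix S h a assume S: "is_antipode H S" and h: "h \<in> carrier H" and a: "a \<in> A"
  have k: "k_algebra H" using H by (simp add: bialgebra_def)
  interpret vspace H by (rule vspace.intro) (use k in \<open>simp add: k_algebra_def\<close>)
  interpret H: ring H using k by (simp add: k_algebra_def)
  interpret H: cring H by unfold_locales (rule comm)
  have ac: "a \<in> carrier H" using a A by auto
  have smult: "a \<otimes>\<^bsub>H\<^esub> (c \<odot>\<^bsub>H\<^esub> b) = c \<odot>\<^bsub>H\<^esub> (a \<otimes>\<^bsub>H\<^esub> b)" if "a \<in> carrier H" "b \<in> carrier H" for a b c
    using k that by (simp add: k_algebra_def)
  have key: "comult H h \<in> tensors H 2" using H h by (simp add: bialgebra_def)
  have w: "xs ! 0 \<in> carrier H" "xs ! 1 \<in> carrier H" if "xs \<in> Poly_Mapping.keys (comult H h)" for xs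
    using key that by (force simp: tensors_def words_2)+
  have Sc: "S b \<in> carrier H" if "b \<in> carrier H" for b
    using S that by (auto simp: is_antipode_def)
  have pull: "lin_val H (\<lambda>xs. a \<otimes>\<^bsub>H\<^esub> g xs) (comult H h) = a \<otimes>\<^bsub>H\<^esub> lin_val H g (comult H h)"
    if g: "\<And>xs. xs \<in> Poly_Mapping.keys (comult H h) \<Longrightarrow> g xs \<in> carrier H" for g
    unfolding lin_val_def
    by (subst H.finsum_rdistr[OF _ ac]) (use g ac in \<open>auto simp: smult intro!: finsum_cong'\<close>)
  have cong: "lin_val H f (comult H h) = lin_val H g (comult H h)"
    if "\<And>xs. xs \<in> Poly_Mapping.keys (comult H h) \<Longrightarrow> f xs = g xs"
      "\<And>xs. xs \<in> Poly_Mapping.keys (comult H h) \<Longrightarrow> g xs \<in> carrier H" for f g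
    unfolding lin_val_def using that by (intro finsum_cong') auto
  have res: "a \<otimes>\<^bsub>H\<^esub> (counit H h \<odot>\<^bsub>H\<^esub> \<one>\<^bsub>H\<^esub>) \<in> A"
    using smult[of a "\<one>\<^bsub>H\<^esub>"] ac a A by simp
  have "lin_val H (\<lambda>xs. (xs ! 0) \<otimes>\<^bsub>H\<^esub> a \<otimes>\<^bsub>H\<^esub> S (xs ! 1)) (comult H h) =
      lin_val H (\<lambda>xs. a \<otimes>\<^bsub>H\<^esub> ((xs ! 0) \<otimes>\<^bsub>H\<^esub> S (xs ! 1))) (comult H h)"
    by (rule cong) (use w Sc ac in \<open>auto simp: H.m_ac\<close>)
  also have "\<dots> = a \<otimes>\<^bsub>H\<^esub> (counit H h \<odot>\<^bsub>H\<^esub> \<one>\<^bsub>H\<^esub>)"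
    by (subst pull) (use S h w Sc in \<open>auto simp: is_antipode_def\<close>)
  finally show "lin_val H (\<lambda>xs. (xs ! 0) \<otimes>\<^bsub>H\<^esub> a \<otimes>\<^bsub>H\<^esub> S (xs ! 1)) (comult H h) \<in> A" using res by simp
  have "lin_val H (\<lambda>xs. S (xs ! 0) \<otimes>\<^bsub>H\<^esub> a \<otimes>\<^bsub>H\<^esub> (xs ! 1)) (comult H h) =
      lin_val H (\<lambda>xs. a \<otimes>\<^bsub>H\<^esub> (S (xs ! 0) \<otimes>\<^bsub>H\<^esub> (xs ! 1))) (comult H h)"
    by (rule cong) (use w Sc ac in \<open>auto simp: H.m_ac\<close>)
  also have "\<dots> = a \<otimes>\<^bsub>H\<^esub> (counit H h \<odot>\<^bsub>H\<^esub> \<one>\<^bsub>H\<^esub>)"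
    by (subst pull) (use S h w Sc in \<open>auto simp: is_antipode_def\<close>)
  finally show "lin_val H (\<lambda>xs. S (xs ! 0) \<otimes>\<^bsub>H\<^esub> a \<otimes>\<^bsub>H\<^esub> (xs ! 1)) (comult H h) \<in> A" using res by simp
qed

section \<open>Function algebras and group algebras in coordinates\<close>

lemma fun_alg_simps [simp]:
  "carrier (fun_alg L :: ('k::field, 'g \<Rightarrow> 'k) bialg) = funs_on (carrier L)"
  "f \<otimes>\<^bsub>fun_alg L\<^esub> f' = (\<lambda>a. f a * f' a)"
  "\<one>\<^bsub>fun_alg L\<^esub> = (\<lambda>a. if a \<in> carrier L then 1 else 0)"
  "\<zero>\<^bsub>fun_alg L\<^esub> = (\<lambda>a. 0)"
  "add (fun_alg L) = (\<lambda>f f' a. f a + f' a)"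
  "module.smult (fun_alg L) = (\<lambda>c f a. c * f a)"
  "counit (fun_alg L) f = f \<one>\<^bsub>L\<^esub>"
  by (simp_all add: fun_alg_def)

lemma sweedler_fun_alg:
  "sweedler (comult (fun_alg L) f) B =
    (\<Sum>a\<in>carrier L. \<Sum>b\<in>carrier L. f (a \<otimes>\<^bsub>L\<^esub> b) * B (delta a) (delta b))"
  by (simp add: fun_alg_def sweedler_sum_single)

lemma fun_alg_tensors: "comult (fun_alg L) f \<in> tensors (fun_alg L) 2"
proof -
  have "comult (fun_alg L) f =
    (\<Sum>a\<in>carrier L. \<Sum>b\<in>carrier L. Poly_Mapping.single [delta a, delta b] (f (a \<otimes>\<^bsub>L\<^esub> b)))"
    by (simp add: fun_alg_def)
  then show ?thesis by (auto intro!: tensors_sum tensors_single simp: words_2)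
qed

lemma fun_space_fun_alg: "finite (carrier L) \<Longrightarrow> fun_space (fun_alg L) (carrier L)"
  by unfold_locales auto

lemma fun_alg_coords:
  assumes "finite (carrier L)" "x \<in> carrier L" "y \<in> carrier L"
  shows "sweedler (comult (fun_alg L) f) (\<lambda>u v. u x * v y) = f (x \<otimes>\<^bsub>L\<^esub> y)"
proof -
  have "sweedler (comult (fun_alg L) f) (\<lambda>u v. u x * v y) =
    (\<Sum>a\<in>carrier L. \<Sum>b\<in>carrier L. if b = y then if a = x then f (x \<otimes>\<^bsub>L\<^esub> y) else 0 else 0)"
    unfolding sweedler_fun_alg by (intro sum.cong) (auto simp: delta_apply)
  then show ?thesis using assms by simp
qed

lemma group_alg_simps [simp]:
  "carrier (group_alg L :: ('k::field, 'g \<Rightarrow> 'k) bialg) = funs_on (carrier L)"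
  "\<one>\<^bsub>group_alg L\<^esub> = delta \<one>\<^bsub>L\<^esub>"
  "\<zero>\<^bsub>group_alg L\<^esub> = (\<lambda>a. 0)"
  "add (group_alg L) = (\<lambda>f f' a. f a + f' a)"
  "module.smult (group_alg L) = (\<lambda>c f a. c * f a)"
  "counit (group_alg L) f = (\<Sum>x\<in>carrier L. f x)"
  by (simp_all add: group_alg_def)

lemma (in prime_group) group_alg_mult:
  "u \<otimes>\<^bsub>group_alg C\<^esub> v = (\<lambda>z. if z \<in> carrier C then conv u v z else 0)"
  by (rule ext) (simp add: group_alg_def conv_def)

lemma sweedler_group_alg:
  "sweedler (comult (group_alg L) f) B = (\<Sum>x\<in>carrier L. f x * B (delta x) (delta x))"
  by (simp add: group_alg_def sweedler_sum_single)

lemma group_alg_tensors: "comult (group_alg L) f \<in> tensors (group_alg L) 2"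
proof -
  have "comult (group_alg L) f = (\<Sum>x\<in>carrier L. Poly_Mapping.single [delta x, delta x] (f x))"
    by (simp add: group_alg_def)
  then show ?thesis by (auto intro!: tensors_sum tensors_single simp: words_2)
qed

lemma fun_space_group_alg: "finite (carrier L) \<Longrightarrow> fun_space (group_alg L) (carrier L)"
  by unfold_locales auto

lemma group_alg_coords:
  assumes "finite (carrier L)" "x \<in> carrier L" "y \<in> carrier L"
  shows "sweedler (comult (group_alg L) f) (\<lambda>u v. u x * v y) = (if x = y then f x else 0)"
proof -
  have "sweedler (comult (group_alg L) f) (\<lambda>u v. u x * v y) =
    (\<Sum>a\<in>carrier L. if a = x then if x = y then f x else 0 else 0)"
    unfolding sweedler_group_alg by (intro sum.cong) (auto simp: delta_apply)
  then show ?thesis using assms by simp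
qed

lemma H_ext_simps [simp]:
  "hopf_total (H_ext C G \<tau>) = H_alg C G \<tau>"
  "hopf_incl (H_ext C G \<tau>) f (x, a) = (if x = \<one>\<^bsub>C\<^esub> then f a else 0)"
  "hopf_proj (H_ext C G \<tau>) u x = u (x, \<one>\<^bsub>G\<^esub>)"
  by (simp_all add: H_ext_def)

section \<open>The exact sequence of H(\<tau>)\<close>

context cocycle_setup
begin

abbreviation "incl \<equiv> hopf_incl (H_ext C G \<tau>)"
abbreviation "proj \<equiv> hopf_proj (H_ext C G \<tau>)"

lemma incl_closed: "f \<in> funs_on (carrier G) \<Longrightarrow> incl f \<in> carrier H"
  by (auto simp: carrier_H funs_on_def)

lemma incl_mult:
  assumes "z \<in> carrier C"
  shows "(incl f \<otimes>\<^bsub>H\<^esub> u) (z, a) = f a * u (z, a)"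
  using conv_delta[of \<one> z "f a" "\<lambda>x. u (x, a)"] assms by (simp add: mult_H)

lemma incl_hopf_map: "hopf_map (fun_alg G) H incl"
  unfolding hopf_map_iff
proof (intro conjI allI ballI)
  have "incl (f \<otimes>\<^bsub>fun_alg G\<^esub> f') = incl f \<otimes>\<^bsub>H\<^esub> incl f'"
    if "f \<in> funs_on (carrier G)" "f' \<in> funs_on (carrier G)" for f f'
  proof (rule carrier_H_eqI)
    show "incl f \<otimes>\<^bsub>H\<^esub> incl f' \<in> carrier H" using that incl_closed by simp
    show "incl (f \<otimes>\<^bsub>fun_alg G\<^esub> f') \<in> carrier H" using that by (intro incl_closed) (auto simp: funs_on_def)
  qed (simp add: incl_mult)
  then show "incl \<in> ring_hom (fun_alg G) H"
    by (auto simp: ring_hom_def incl_closed H_simps fun_eq_iff)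
  fix f assume f: "f \<in> carrier (fun_alg G :: ('k, 'g \<Rightarrow> 'k) bialg)"
  show "incl (c \<odot>\<^bsub>fun_alg G\<^esub> f) = c \<odot>\<^bsub>H\<^esub> incl f" for c
    by (auto simp: H_simps fun_eq_iff)
  show "counit H (incl f) = counit (fun_alg G) f" by (simp add: H_simps)
  show "tensor_eq H 2 (comult H (incl f)) (map_tensor incl (comult (fun_alg G) f))"
  proof (rule fs.tensor_eq_2_coords[OF comult_in_tensors])
    show "map_tensor incl (comult (fun_alg G) f) \<in> tensors H 2"
      by (rule map_tensor_in_tensors[OF fun_alg_tensors]) (simp add: incl_closed)
    fix q r assume "q \<in> carrier C \<times> carrier G" "r \<in> carrier C \<times> carrier G"
    then obtain y z a b where q: "q = (y, a)" "r = (z, b)"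
      and m: "y \<in> carrier C" "z \<in> carrier C" "a \<in> carrier G" "b \<in> carrier G" by auto
    have "sweedler (map_tensor incl (comult (fun_alg G) f)) (\<lambda>u v. u q * v r) =
      sweedler (comult (fun_alg G) f) (\<lambda>u v. (if y = \<one> \<and> z = \<one> then 1 else 0) * (u a * v b))"
      by (auto simp: sweedler_map_tensor[OF fun_alg_tensors] q intro!: arg_cong[of _ _ "sweedler _"])
    also have "\<dots> = (if y = \<one> \<and> z = \<one> then f (a \<otimes>\<^bsub>G\<^esub> b) else 0)"
      unfolding sweedler_fun_mult using m by (simp add: fun_alg_coords)
    also have "\<dots> = sweedler (comult H (incl f)) (\<lambda>u v. u q * v r)"
      using m by (auto simp: q comult_coords cocycle_simps)
    finally show "sweedler (comult H (incl f)) (\<lambda>u v. u q * v r) =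
      sweedler (map_tensor incl (comult (fun_alg G) f)) (\<lambda>u v. u q * v r)" ..
  qed
qed

lemma proj_closed: "u \<in> carrier H \<Longrightarrow> proj u \<in> funs_on (carrier C)"
  by (auto simp: carrier_H funs_on_def)

lemma proj_hopf_map: "hopf_map H (group_alg C) proj"
  unfolding hopf_map_iff
proof (intro conjI allI ballI)
  show "proj \<in> ring_hom H (group_alg C)"
    unfolding ring_hom_def
    using proj_closed by (auto simp: group_alg_mult mult_H H_simps fun_eq_iff delta_def cong: conv_cong)
  fix u assume u: "u \<in> carrier H"
  show "proj (c \<odot>\<^bsub>H\<^esub> u) = c \<odot>\<^bsub>group_alg C\<^esub> proj u" for c
    by (auto simp: H_simps fun_eq_iff)
  show "counit (group_alg C) (proj u) = counit H u" by (simp add: H_simps)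
  interpret Q: fun_space "group_alg C :: ('k, 'c \<Rightarrow> 'k) bialg" "carrier C" by (rule fun_space_group_alg) simp
  show "tensor_eq (group_alg C) 2 (comult (group_alg C) (proj u)) (map_tensor proj (comult H u))"
  proof (rule Q.tensor_eq_2_coords[OF group_alg_tensors])
    show "map_tensor proj (comult H u) \<in> tensors (group_alg C) 2"
      by (rule map_tensor_in_tensors[OF comult_in_tensors]) (simp add: proj_closed)
    fix x y assume "x \<in> carrier C" "y \<in> carrier C"
    then show "sweedler (comult (group_alg C) (proj u)) (\<lambda>u v. u x * v y) =
      sweedler (map_tensor proj (comult H u)) (\<lambda>u v. u x * v y)"
      by (simp add: sweedler_map_tensor[OF comult_in_tensors] group_alg_coords comult_coords cocycle_simps)
  qed
qed

lemma H_ext_kernel: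
  "{h \<in> carrier H. proj h = \<zero>\<^bsub>group_alg C\<^esub>} =
    generate (add_monoid H) {incl f \<otimes>\<^bsub>H\<^esub> h | f h.
      f \<in> carrier (fun_alg G :: ('k, 'g \<Rightarrow> 'k) bialg) \<and> counit (fun_alg G) f = 0 \<and> h \<in> carrier H}"
    (is "?K = generate _ ?S")
proof
  show "?K \<subseteq> generate (add_monoid H) ?S"
  proof
    fix h assume h: "h \<in> ?K"
    \<comment> \<open>The function 1 - p_1. Multiplication by its image removes the coordinates over
      the identity of \<open>G\<close> and fixes the others, so it fixes every element of the
      kernel.\<close>
    let ?f = "\<lambda>a. if a \<in> carrier G \<and> a \<noteq> \<one>\<^bsub>G\<^esub> then 1 else 0 :: 'k"
    have f: "?f \<in> funs_on (carrier G)" by (simp add: funs_on_def)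
    have "h = incl ?f \<otimes>\<^bsub>H\<^esub> h"
    proof (rule carrier_H_eqI)
      show "h \<in> carrier H" "incl ?f \<otimes>\<^bsub>H\<^esub> h \<in> carrier H" using h incl_closed[OF f] by auto
      fix z a assume z: "z \<in> carrier C" "a \<in> carrier G"
      have "h (z, \<one>\<^bsub>G\<^esub>) = 0" using h by (simp add: fun_eq_iff)
      then show "h (z, a) = (incl ?f \<otimes>\<^bsub>H\<^esub> h) (z, a)" using z by (simp add: incl_mult)
    qed
    then have "h \<in> ?S" using h f by (intro CollectI exI[of _ ?f] exI[of _ h]) simp
    then show "h \<in> generate (add_monoid H) ?S" by (rule generate.incl)
  qed
  show "generate (add_monoid H) ?S \<subseteq> ?K"
  proof
    fix h assume "h \<in> generate (add_monoid H) ?S"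
    then show "h \<in> ?K"
    proof induction
      case one
      show ?case by (simp add: H_simps fun_eq_iff fs.carrier_V funs_on_def)
    next
      case (incl h)
      then obtain f h' where f: "h = incl f \<otimes>\<^bsub>H\<^esub> h'" "f \<in> funs_on (carrier G)" "f \<one>\<^bsub>G\<^esub> = 0" "h' \<in> carrier H"
        by auto
      then have c: "h \<in> carrier H" using incl_closed by simp
      then have "proj h x = 0" for x
        using f by (cases "x \<in> carrier C") (auto simp: incl_mult carrier_H funs_on_def)
      then show ?case using c by (simp add: fun_eq_iff)
    next
      case (inv h)
      then obtain f h' where f: "h = incl f \<otimes>\<^bsub>H\<^esub> h'" "f \<in> funs_on (carrier G)" "f \<one>\<^bsub>G\<^esub> = 0" "h' \<in> carrier H"
        by auto
      then have c: "h \<in> carrier H" using incl_closed by simp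
      then have "proj h x = 0" for x
        using f by (cases "x \<in> carrier C") (auto simp: incl_mult carrier_H funs_on_def)
      then have "proj (\<ominus>\<^bsub>H\<^esub> h) x = 0" for x
        using fs.linear_on_uminus[OF fs.linear_on_eval c, of "(x, \<one>\<^bsub>G\<^esub>)"] by simp
      then show ?case using c by (simp add: fun_eq_iff a_inv_def[symmetric] del: H_ext_simps(3))
    next
      case (eng h1 h2)
      then have "h1 \<oplus>\<^bsub>H\<^esub> h2 \<in> carrier H" by (intro fs.closed_V) auto
      moreover have "(h1 \<oplus>\<^bsub>H\<^esub> h2) (x, \<one>\<^bsub>G\<^esub>) = 0" for x using eng by (simp add: H_simps fun_eq_iff)
      ultimately show ?case by (simp add: fun_eq_iff)
    qed
  qed
qed

lemma H_ext_comm: "comm_hopf_extension C G (H_ext C G \<tau>)"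
proof -
  have "proj ` carrier H = funs_on (carrier C)"
  proof
    show "funs_on (carrier C) \<subseteq> proj ` carrier H"
    proof
      fix g :: "'c \<Rightarrow> 'k" assume g: "g \<in> funs_on (carrier C)"
      have eq: "g = proj (\<lambda>(x, a). if a = \<one>\<^bsub>G\<^esub> then g x else 0)" by (simp add: fun_eq_iff)
      have "(\<lambda>(x, a). if a = \<one>\<^bsub>G\<^esub> then g x else 0) \<in> carrier H"
        using g by (auto simp: carrier_H funs_on_def)
      with eq show "g \<in> proj ` carrier H" by (rule image_eqI)
    qed
  qed (use proj_closed in auto)
  moreover have "inj_on incl (funs_on (carrier G))"
  proof (rule inj_onI)
    fix f f' :: "'g \<Rightarrow> 'k" assume "incl f = incl f'"
    then have "incl f (\<one>, a) = incl f' (\<one>, a)" for a by simp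
    then show "f = f'" by (simp add: fun_eq_iff)
  qed
  moreover have "normal_in (incl ` funs_on (carrier G)) H"
  proof (rule normal_in_comm[OF H_bialgebra H.m_comm])
    show "incl ` funs_on (carrier G) \<subseteq> carrier H" using incl_closed by auto
    fix a c assume "a \<in> incl ` funs_on (carrier G)"
    then obtain f where f: "f \<in> funs_on (carrier G)" "a = incl f" by auto
    then have "c \<odot>\<^bsub>H\<^esub> a = incl (\<lambda>a. c * f a)" by (auto simp: H_simps fun_eq_iff)
    then show "c \<odot>\<^bsub>H\<^esub> a \<in> incl ` funs_on (carrier G)" using f by (auto simp: funs_on_def)
  qed
  ultimately show ?thesis
    unfolding comm_hopf_extension_def hopf_extension_def Let_def H_ext_simps(1)
    using H_hopf_algebra incl_hopf_map proj_hopf_map H_ext_kernel H.m_comm by simp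
qed

lemma H_ext_hopf: "hopf_extension C G (H_ext C G \<tau>)"
  using H_ext_comm by (simp add: comm_hopf_extension_def)

end

section \<open>Equivalence of the H(\<tau>) and cohomology of cocycles\<close>

definition cohomologous ::
  "'c monoid \<Rightarrow> 'g monoid \<Rightarrow> ('c \<Rightarrow> 'g \<Rightarrow> 'g \<Rightarrow> 'k::field) \<Rightarrow> ('c \<Rightarrow> 'g \<Rightarrow> 'g \<Rightarrow> 'k) \<Rightarrow> bool" where
  "cohomologous C G \<sigma> \<tau> \<longleftrightarrow> (\<exists>\<eta>. (\<forall>x\<in>carrier C. \<forall>a\<in>carrier G. \<eta> x a \<noteq> 0) \<and>
    (\<forall>x\<in>carrier C. \<forall>y\<in>carrier C. \<forall>a\<in>carrier G. \<eta> (x \<otimes>\<^bsub>C\<^esub> y) a = \<eta> x a * \<eta> y a) \<and>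
    (\<forall>x\<in>carrier C. \<forall>a\<in>carrier G. \<forall>b\<in>carrier G.
      \<sigma> x a b * (\<eta> x a * \<eta> x b) = \<tau> x a b * \<eta> x (a \<otimes>\<^bsub>G\<^esub> b)))"

context ext_setup
begin

lemma H_ext_equiv_if_cohomologous:
  fixes \<sigma> \<tau> :: "'c \<Rightarrow> 'g \<Rightarrow> 'g \<Rightarrow> 'k::field"
  assumes st: "\<sigma> \<in> cocycles C G" "\<tau> \<in> cocycles C G" and co: "cohomologous C G \<sigma> \<tau>"
  shows "hopf_ext_equiv G (H_ext C G \<sigma>) (H_ext C G \<tau>)"
proof -
  interpret S: cocycle_setup C p G n \<sigma> by unfold_locales (rule st)
  interpret T: cocycle_setup C p G n \<tau> by unfold_locales (rule st)
  obtain \<eta> where co': "\<forall>x\<in>carrier C. \<forall>a\<in>carrier G. \<eta> x a \<noteq> 0"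
    "\<forall>x\<in>carrier C. \<forall>y\<in>carrier C. \<forall>a\<in>carrier G. \<eta> (x \<otimes> y) a = \<eta> x a * \<eta> y a"
    "\<forall>x\<in>carrier C. \<forall>a\<in>carrier G. \<forall>b\<in>carrier G.
      \<sigma> x a b * (\<eta> x a * \<eta> x b) = \<tau> x a b * \<eta> x (a \<otimes>\<^bsub>G\<^esub> b)"
    using co unfolding cohomologous_def by blast
  note e = co'[rule_format]
  \<comment> \<open>\<eta> is normalized in \<open>C\<close> because it is multiplicative there, and
    in \<open>G\<close> (\<open>e2\<close>) because \<sigma> and \<tau> are normalized.\<close>
  have e1: "\<eta> \<one> a = 1" if "a \<in> carrier G" for a
    using e(2)[of \<one> \<one> a] e(1)[of \<one> a] that by simp
  have e2: "\<eta> x \<one>\<^bsub>G\<^esub> = 1" if "x \<in> carrier C" for x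
    using e(3)[of x "\<one>\<^bsub>G\<^esub>" "\<one>\<^bsub>G\<^esub>"] e(1)[of x "\<one>\<^bsub>G\<^esub>"] that
    by (simp add: S.cocycle_simps T.cocycle_simps)
  \<comment> \<open>Rescales the basis vector p_a x by \<eta>(x, a). Multiplicativity of \<eta>
    makes this an algebra map, the coboundary relation a coalgebra map, and normalization makes it
    compatible with both maps of the extensions.\<close>
  define F where "F u = (\<lambda>(x, a). \<eta> x a * u (x, a))" for u :: "'c \<times> 'g \<Rightarrow> 'k"
  have Fc: "F u \<in> carrier T.H" if "u \<in> carrier S.H" for u
    using that by (auto simp: F_def S.carrier_H T.carrier_H funs_on_def)
  have map: "hopf_map S.H T.H F"
    unfolding hopf_map_iff
  proof (intro conjI allI ballI)
    have "F (u \<otimes>\<^bsub>S.H\<^esub> v) = F u \<otimes>\<^bsub>T.H\<^esub> F v" if "u \<in> carrier S.H" "v \<in> carrier S.H" for u v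
    proof (rule T.carrier_H_eqI)
      show "F (u \<otimes>\<^bsub>S.H\<^esub> v) \<in> carrier T.H" "F u \<otimes>\<^bsub>T.H\<^esub> F v \<in> carrier T.H" using that Fc by auto
      fix z a assume z: "z \<in> carrier C" "a \<in> carrier G"
      have "\<eta> z a = \<eta> x a * \<eta> (inv x \<otimes> z) a" if "x \<in> carrier C" for x
        using e(2)[of x "inv x \<otimes> z" a] that z by (simp add: m_assoc[symmetric])
      then show "F (u \<otimes>\<^bsub>S.H\<^esub> v) (z, a) = (F u \<otimes>\<^bsub>T.H\<^esub> F v) (z, a)"
        using z by (simp add: F_def S.mult_H T.mult_H conv_def sum_distrib_left ac_simps)
    qed
    moreover have "F (u \<oplus>\<^bsub>S.H\<^esub> v) = F u \<oplus>\<^bsub>T.H\<^esub> F v" for u v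
      by (auto simp: S.H_simps T.H_simps F_def fun_eq_iff algebra_simps)
    moreover have "F \<one>\<^bsub>S.H\<^esub> = \<one>\<^bsub>T.H\<^esub>"
      by (auto simp: S.H_simps T.H_simps F_def fun_eq_iff e1)
    ultimately show "F \<in> ring_hom S.H T.H"
      by (simp add: ring_hom_def Fc)
    fix u assume u: "u \<in> carrier S.H"
    show "F (c \<odot>\<^bsub>S.H\<^esub> u) = c \<odot>\<^bsub>T.H\<^esub> F u" for c
      by (auto simp: S.H_simps T.H_simps F_def fun_eq_iff algebra_simps)
    show "counit T.H (F u) = counit S.H u"
      by (simp add: S.H_simps T.H_simps F_def e2)
    show "tensor_eq T.H 2 (comult T.H (F u)) (map_tensor F (comult S.H u))"
    proof (rule T.fs.tensor_eq_2_coords[OF T.comult_in_tensors])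
      show "map_tensor F (comult S.H u) \<in> tensors T.H 2"
        by (rule map_tensor_in_tensors[OF S.comult_in_tensors]) (rule Fc)
      fix q r assume "q \<in> carrier C \<times> carrier G" "r \<in> carrier C \<times> carrier G"
      then obtain y z a b where q: "q = (y, a)" "r = (z, b)"
        and m: "y \<in> carrier C" "z \<in> carrier C" "a \<in> carrier G" "b \<in> carrier G" by auto
      have "sweedler (map_tensor F (comult S.H u)) (\<lambda>u v. u q * v r) =
        sweedler (comult S.H u) (\<lambda>u v. (\<eta> y a * \<eta> z b) * (u (y, a) * v (z, b)))"
        by (simp add: sweedler_map_tensor[OF S.comult_in_tensors] q F_def ac_simps)
      also have "\<dots> = sweedler (comult T.H (F u)) (\<lambda>u v. u q * v r)"
        unfolding sweedler_fun_mult using m e(3)[of y a b]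
        by (auto simp: q S.comult_coords T.comult_coords F_def ac_simps)
      finally show "sweedler (comult T.H (F u)) (\<lambda>u v. u q * v r) =
        sweedler (map_tensor F (comult S.H u)) (\<lambda>u v. u q * v r)" ..
    qed
  qed
  have "bij_betw F (carrier S.H) (carrier T.H)"
  proof (rule bij_betwI[of _ _ _ "\<lambda>u (x, a). u (x, a) / \<eta> x a"])
    show "F \<in> carrier S.H \<rightarrow> carrier T.H" using Fc by auto
    show "(\<lambda>u (x, a). u (x, a) / \<eta> x a) \<in> carrier T.H \<rightarrow> carrier S.H"
      by (auto simp: S.carrier_H T.carrier_H funs_on_def)
    show "(\<lambda>(x, a). F u (x, a) / \<eta> x a) = u" if "u \<in> carrier S.H" for u
      using that e(1) by (auto simp: F_def fun_eq_iff S.carrier_H funs_on_def)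
    show "F (\<lambda>(x, a). u (x, a) / \<eta> x a) = u" if "u \<in> carrier T.H" for u
      using that e(1) by (auto simp: F_def fun_eq_iff T.carrier_H funs_on_def)
  qed
  moreover have "F (hopf_incl (H_ext C G \<sigma>) f) = hopf_incl (H_ext C G \<tau>) f"
    if "f \<in> funs_on (carrier G)" for f
    using that e1 by (auto simp: F_def fun_eq_iff funs_on_def)
  moreover have "hopf_proj (H_ext C G \<tau>) (F u) = hopf_proj (H_ext C G \<sigma>) u" if "u \<in> carrier S.H" for u
    using that e2 by (auto simp: F_def fun_eq_iff S.carrier_H funs_on_def)
  ultimately show ?thesis
    unfolding hopf_ext_equiv_def H_ext_simps(1) using map by blast
qed

text \<open>An equivalence preserves the coaction of \<open>kC\<close>, hence the decomposition of \<open>H(\<tau>)\<close> into lines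
  spanned by the \<open>p\<^sub>a x\<close>.\<close>

lemma cohomologous_if_H_ext_equiv:
  fixes \<sigma> \<tau> :: "'c \<Rightarrow> 'g \<Rightarrow> 'g \<Rightarrow> 'k::field"
  assumes st: "\<sigma> \<in> cocycles C G" "\<tau> \<in> cocycles C G"
    and eq: "hopf_ext_equiv G (H_ext C G \<sigma>) (H_ext C G \<tau>)"
  shows "cohomologous C G \<sigma> \<tau>"
proof -
  interpret S: cocycle_setup C p G n \<sigma> by unfold_locales (rule st)
  interpret T: cocycle_setup C p G n \<tau> by unfold_locales (rule st)
  obtain F where F: "hopf_map S.H T.H F" "bij_betw F (carrier S.H) (carrier T.H)"
    "\<And>f. f \<in> funs_on (carrier G) \<Longrightarrow> F (hopf_incl (H_ext C G \<sigma>) f) = hopf_incl (H_ext C G \<tau>) f"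
    "\<And>h. h \<in> carrier S.H \<Longrightarrow> hopf_proj (H_ext C G \<tau>) (F h) = hopf_proj (H_ext C G \<sigma>) h"
    using eq unfolding hopf_ext_equiv_def H_ext_simps(1) by blast
  note Fm = F(1)[unfolded hopf_map_iff ring_hom_def, simplified]
  have Fc: "F u \<in> carrier T.H" if "u \<in> carrier S.H" for u using Fm that by auto
  have lin: "linear_on S.H (\<lambda>u. F u q)" for q
    using Fm by (auto simp: linear_on_def T.H_simps)
  have coords: "sweedler (comult T.H (F u)) (\<lambda>v w. v q * w r) =
      sweedler (comult S.H u) (\<lambda>v w. F v q * F w r)" if u: "u \<in> carrier S.H" for u q r
  proof -
    have "bilinear_on T.H (\<lambda>v w. v q * w r)"
      by (auto simp: bilinear_on_def linear_on_def T.H_simps algebra_simps)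
    then have "sweedler (comult T.H (F u)) (\<lambda>v w. v q * w r) = sweedler (map_tensor F (comult S.H u)) (\<lambda>v w. v q * w r)"
      using Fm u unfolding tensor_eq_iff bilinear_on_iff sweedler_def by blast
    then show ?thesis by (simp add: sweedler_map_tensor[OF S.comult_in_tensors])
  qed
  have prj: "F u (x, \<one>\<^bsub>G\<^esub>) = u (x, \<one>\<^bsub>G\<^esub>)" if "u \<in> carrier S.H" for u x
    using F(4)[OF that] by (simp add: fun_eq_iff)
  have supp: "F u (y, b) = (if y = x then F u (y, b) else 0)"
    if y: "y \<in> carrier C" "b \<in> carrier G" and x: "x \<in> carrier C" "a \<in> carrier G" and u: "u = delta (x, a)" for x y a b u
  proof -
    have uc: "u \<in> carrier S.H" using x by (simp add: u S.carrier_H)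
    \<comment> \<open>Reading the second leg at (y, 1) amounts to applying the projection, which
      \<open>F\<close> preserves; the factor \<open>\<tau> y b \<one>\<close> is 1.\<close>
    have "F u (y, b) = sweedler (comult T.H (F u)) (\<lambda>v w. v (y, b) * w (y, \<one>\<^bsub>G\<^esub>))"
      using y by (simp add: T.comult_coords T.cocycle_simps)
    also have "\<dots> = sweedler (comult S.H u) (\<lambda>v w. F v (y, b) * w (y, \<one>\<^bsub>G\<^esub>))"
      unfolding coords[OF uc] by (rule sweedler_cong[OF S.comult_in_tensors]) (simp add: prj)
    also have "\<dots> = (\<Sum>z\<in>carrier C. \<Sum>c\<in>carrier G. \<Sum>d\<in>carrier G.
        \<sigma> z c d * u (z, c \<otimes>\<^bsub>G\<^esub> d) * (F (delta (z, c)) (y, b) * delta (z, d) (y, \<one>\<^bsub>G\<^esub>)))"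
      by (rule S.sweedler_comult)
    also have "\<dots> = (if y = x then F u (y, b) else 0)"
    proof (cases "y = x")
      case False
      then have "(\<Sum>z\<in>carrier C. \<Sum>c\<in>carrier G. \<Sum>d\<in>carrier G.
        \<sigma> z c d * u (z, c \<otimes>\<^bsub>G\<^esub> d) * (F (delta (z, c)) (y, b) * delta (z, d) (y, \<one>\<^bsub>G\<^esub>))) = 0"
        by (intro sum.neutral ballI) (auto simp: u delta_apply)
      then show ?thesis using False by simp
    next
      case True
      have "(\<Sum>z\<in>carrier C. \<Sum>c\<in>carrier G. \<Sum>d\<in>carrier G.
        \<sigma> z c d * u (z, c \<otimes>\<^bsub>G\<^esub> d) * (F (delta (z, c)) (y, b) * delta (z, d) (y, \<one>\<^bsub>G\<^esub>))) =
        (\<Sum>z\<in>carrier C. \<Sum>c\<in>carrier G. \<Sum>d\<in>carrier G.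
          if d = \<one>\<^bsub>G\<^esub> then if c = a then if z = x then F u (y, b) else 0 else 0 else 0)"
        using True by (intro sum.cong refl) (auto simp: u delta_apply S.cocycle_simps)
      then show ?thesis using True x by simp
    qed
    finally show ?thesis .
  qed
  define \<eta> where "\<eta> x a = F (delta (x, a)) (x, a)" for x a
  have diag: "F u (x, a) = \<eta> x a * u (x, a)"
    if u: "u \<in> carrier S.H" and x: "x \<in> carrier C" "a \<in> carrier G" for u x a
  proof -
    have "F u (x, a) = (\<Sum>q\<in>carrier C \<times> carrier G. u q * F (delta q) (x, a))"
      using S.fs.linear_on_expand[OF lin u] .
    also have "\<dots> = (\<Sum>q\<in>carrier C \<times> carrier G. if q = (x, a) then u (x, a) * \<eta> x a else 0)"
    proof (intro sum.cong refl)
      fix q assume "q \<in> carrier C \<times> carrier G"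
      then obtain y b where q: "q = (y, b)" and y: "y \<in> carrier C" "b \<in> carrier G" by auto
      have dc: "delta (y, b) \<in> carrier S.H" using y by (simp add: S.carrier_H)
      \<comment> \<open>The idempotent of b fixes p_b y, and \<open>F\<close> carries it to the
        idempotent of b in the other algebra, whose multiples vanish over a.\<close>
      have "F (delta (y, b)) (x, a) = 0" if "b \<noteq> a"
      proof -
        have "hopf_incl (H_ext C G \<sigma>) (delta b) \<otimes>\<^bsub>S.H\<^esub> delta (y, b) = delta (y, b)"
        proof (rule S.carrier_H_eqI)
          show "hopf_incl (H_ext C G \<sigma>) (delta b) \<otimes>\<^bsub>S.H\<^esub> delta (y, b) \<in> carrier S.H"
            using dc y S.incl_closed by simp
        qed (use dc in \<open>auto simp: S.incl_mult delta_apply\<close>)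
        moreover have "F (hopf_incl (H_ext C G \<sigma>) (delta b) \<otimes>\<^bsub>S.H\<^esub> delta (y, b)) =
          hopf_incl (H_ext C G \<tau>) (delta b) \<otimes>\<^bsub>T.H\<^esub> F (delta (y, b))"
          using Fm dc S.incl_closed[of "delta b"] F(3)[of "delta b"] y by auto
        ultimately show ?thesis using that x by (metis T.incl_mult delta_apply mult_zero_left)
      qed
      then show "u q * F (delta q) (x, a) = (if q = (x, a) then u (x, a) * \<eta> x a else 0)"
        using supp[OF x y refl] by (auto simp: q \<eta>_def)
    qed
    finally show ?thesis using x by (simp add: mult.commute)
  qed
  have nz: "\<eta> x a \<noteq> 0" if x: "x \<in> carrier C" "a \<in> carrier G" for x a
  proof
    assume z: "\<eta> x a = 0"
    \<comment> \<open>Surjectivity of \<open>F\<close>: by \<open>diag\<close>, a zero of \<eta>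
      would keep p_a x out of the image.\<close>
    have "delta (x, a) \<in> F ` carrier S.H"
      using F(2) x by (simp add: bij_betw_def T.carrier_H)
    then obtain u where "u \<in> carrier S.H" "F u = delta (x, a)" by auto
    then have "delta (x, a) (x, a) = \<eta> x a * u (x, a)" using diag[of u x a] x by simp
    then show False by (simp add: z delta_apply)
  qed
  \<comment> \<open>Compares the images of p_a x, p_a y and their product p_a xy at the only
    coordinate where the latter is nonzero.\<close>
  have mul: "\<eta> (x \<otimes> y) a = \<eta> x a * \<eta> y a"
    if x: "x \<in> carrier C" "y \<in> carrier C" "a \<in> carrier G" for x y a
  proof -
    have d: "delta (z, a) \<in> carrier S.H" if "z \<in> carrier C" for z using that x by (simp add: S.carrier_H)
    have cd: "conv (\<lambda>z. delta (x, a) (z, a)) f (x \<otimes> y) = f y" for f :: "'c \<Rightarrow> 'k"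
      using conv_delta[of x "x \<otimes> y" 1 f] x by (simp add: delta_apply m_assoc[symmetric])
    have "(delta (x, a) \<otimes>\<^bsub>S.H\<^esub> delta (y, a)) (x \<otimes> y, a) = (1 :: 'k)"
      using x by (simp add: S.mult_H cd) (simp add: delta_apply)
    then have "\<eta> (x \<otimes> y) a = F (delta (x, a) \<otimes>\<^bsub>S.H\<^esub> delta (y, a)) (x \<otimes> y, a)"
      using diag[of "delta (x, a) \<otimes>\<^bsub>S.H\<^esub> delta (y, a)" "x \<otimes> y" a] x d by simp
    also have "\<dots> = (F (delta (x, a)) \<otimes>\<^bsub>T.H\<^esub> F (delta (y, a))) (x \<otimes> y, a)"
      using Fm d x by simp
    also have "\<dots> = conv (\<lambda>z. \<eta> x a * delta (x, a) (z, a)) (\<lambda>z. \<eta> z a * delta (y, a) (z, a)) (x \<otimes> y)"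
      using x by (simp add: T.mult_H) (rule conv_cong; use x d diag in \<open>auto simp: delta_apply\<close>)
    also have "\<dots> = \<eta> x a * \<eta> y a"
      by (simp add: conv_scale cd) (simp add: delta_apply)
    finally show ?thesis .
  qed
  have cob: "\<sigma> x a b * (\<eta> x a * \<eta> x b) = \<tau> x a b * \<eta> x (a \<otimes>\<^bsub>G\<^esub> b)"
    if x: "x \<in> carrier C" "a \<in> carrier G" "b \<in> carrier G" for x a b
  proof -
    let ?u = "delta (x, a \<otimes>\<^bsub>G\<^esub> b) :: 'c \<times> 'g \<Rightarrow> 'k"
    have u: "?u \<in> carrier S.H" using x by (simp add: S.carrier_H)
    have "\<tau> x a b * \<eta> x (a \<otimes>\<^bsub>G\<^esub> b) = sweedler (comult T.H (F ?u)) (\<lambda>v w. v (x, a) * w (x, b))"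
      using x by (simp add: T.comult_coords \<eta>_def)
    also have "\<dots> = sweedler (comult S.H ?u) (\<lambda>v w. (\<eta> x a * \<eta> x b) * (v (x, a) * w (x, b)))"
      unfolding coords[OF u] by (rule sweedler_cong[OF S.comult_in_tensors]) (use x diag in simp)
    also have "\<dots> = \<sigma> x a b * (\<eta> x a * \<eta> x b)"
      unfolding sweedler_fun_mult using x by (simp add: S.comult_coords) (simp add: delta_apply)
    finally show ?thesis ..
  qed
  show ?thesis unfolding cohomologous_def using nz mul cob by blast
qed

lemma H_ext_equiv_iff:
  fixes \<sigma> \<tau> :: "'c \<Rightarrow> 'g \<Rightarrow> 'g \<Rightarrow> 'k::field"
  assumes "\<sigma> \<in> cocycles C G" "\<tau> \<in> cocycles C G"
  shows "hopf_ext_equiv G (H_ext C G \<sigma>) (H_ext C G \<tau>) \<longleftrightarrow> cohomologous C G \<sigma> \<tau>"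
  using H_ext_equiv_if_cohomologous cohomologous_if_H_ext_equiv assms by blast

end

section \<open>The function algebra of G(\<tau>)\<close>

lemma G_ext_simps [simp]:
  "carrier (grp_total (G_ext C G \<tau>)) = carrier G \<times> carrier (dual_group C)"
  "(a, \<chi>) \<otimes>\<^bsub>grp_total (G_ext C G \<tau>)\<^esub> (b, \<psi>) =
    (a \<otimes>\<^bsub>G\<^esub> b, \<lambda>x. \<chi> x * \<psi> x * (if x \<in> carrier C then \<tau> x a b else 0))"
  "\<one>\<^bsub>grp_total (G_ext C G \<tau>)\<^esub> = (\<one>\<^bsub>G\<^esub>, \<one>\<^bsub>dual_group C\<^esub>)"
  "grp_incl (G_ext C G \<tau>) \<chi> = (\<one>\<^bsub>G\<^esub>, \<chi>)"
  "grp_proj (G_ext C G \<tau>) = fst"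
  by (simp_all add: G_ext_def cocycle_ext_def)

lemma fun_ext_simps [simp]:
  "hopf_total (fun_ext C U) = fun_alg (grp_total U)"
  "hopf_incl (fun_ext C U) f e = (if e \<in> carrier (grp_total U) then f (grp_proj U e) else 0)"
  by (simp_all add: fun_ext_def)

context prime_group
begin

lemma evaluation_conv:
  assumes "\<chi> \<in> carrier (dual_group C)"
  shows "evaluation C (conv u v) \<chi> = evaluation C u \<chi> * evaluation C v \<chi>"
proof -
  have "evaluation C (conv u v) \<chi> = (\<Sum>x\<in>carrier C. \<Sum>z\<in>carrier C. u x * v (inv x \<otimes> z) * \<chi> z)"
    using assms by (simp add: evaluation_def conv_def sum_distrib_right) (rule sum.swap)
  also have "\<dots> = (\<Sum>x\<in>carrier C. \<Sum>z\<in>carrier C. u x * \<chi> x * (v z * \<chi> z))"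
  proof (rule sum.cong[OF refl])
    fix x assume x: "x \<in> carrier C"
    have "(\<Sum>z\<in>carrier C. u x * v (inv x \<otimes> z) * \<chi> z) =
      (\<Sum>z\<in>carrier C. u x * v (inv x \<otimes> (x \<otimes> z)) * \<chi> (x \<otimes> z))"
      using sum_shift[OF x, of "\<lambda>z. u x * v (inv x \<otimes> z) * \<chi> z"] by simp
    also have "\<dots> = (\<Sum>z\<in>carrier C. u x * \<chi> x * (v z * \<chi> z))"
      using x assms by (intro sum.cong refl) (simp add: m_assoc[symmetric] dual_group_iff ac_simps)
    finally show "(\<Sum>z\<in>carrier C. u x * v (inv x \<otimes> z) * \<chi> z) = \<dots>" .
  qed
  also have "\<dots> = evaluation C u \<chi> * evaluation C v \<chi>"
    using assms by (simp add: evaluation_def sum_product)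
  finally show ?thesis .
qed

text \<open>The projection is defined by inverting \<open>evaluation\<close>, so by injectivity it
  is found by exhibiting any preimage.\<close>

lemma fun_ext_proj:
  fixes u :: "'c \<Rightarrow> 'k::{alg_closed_field, field_char_0}"
  assumes "u \<in> funs_on (carrier C)"
    "\<And>\<chi>. \<chi> \<in> carrier (dual_group C) \<Longrightarrow> f (grp_incl U \<chi>) = evaluation C u \<chi>"
  shows "hopf_proj (fun_ext C U) f = u"
proof -
  have "(\<lambda>\<chi>. if \<chi> \<in> carrier (dual_group C) then f (grp_incl U \<chi>) else 0) = evaluation C u"
    using assms(2) by (auto simp: fun_eq_iff evaluation_def)
  then show ?thesis
    using the_inv_into_f_f[OF evaluation_inj_on assms(1)] by (simp add: fun_ext_def)
qed

text \<open>Functions are transported along the inverse isomorphism \<open>?g\<close>, whose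
  multiplicativity is, in coordinates, compatibility with the comultiplication.\<close>

lemma fun_ext_equiv_if_grp_ext_equiv:
  fixes U :: "('g, 'c \<Rightarrow> 'k::field, 'e) grp_ext" and V :: "('g, 'c \<Rightarrow> 'k, 'f) grp_ext"
  assumes fin: "finite (carrier (grp_total U))"
    and gU: "group (grp_total U)" and gV: "group (grp_total V)"
    and UV: "grp_ext_equiv (dual_group C) U V"
    and incl: "\<And>\<chi>. \<chi> \<in> carrier (dual_group C :: ('c \<Rightarrow> 'k) monoid) \<Longrightarrow> grp_incl U \<chi> \<in> carrier (grp_total U)"
  shows "hopf_ext_equiv G (fun_ext C U) (fun_ext C V)"
proof -
  obtain F where F: "F \<in> iso (grp_total U) (grp_total V)"
    "\<And>\<chi>. \<chi> \<in> carrier (dual_group C :: ('c \<Rightarrow> 'k) monoid) \<Longrightarrow> F (grp_incl U \<chi>) = grp_incl V \<chi>"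
    "\<And>e. e \<in> carrier (grp_total U) \<Longrightarrow> grp_proj V (F e) = grp_proj U e"
    using UV unfolding grp_ext_equiv_def by blast
  let ?U = "grp_total U" and ?V = "grp_total V"
  let ?g = "inv_into (carrier ?U) F"
  have bij: "bij_betw F (carrier ?U) (carrier ?V)" using F(1) by (simp add: iso_def)
  have g: "?g \<in> iso ?V ?U" using F(1) by (rule group.iso_set_sym[OF gU])
  have gc: "?g e \<in> carrier ?U" if "e \<in> carrier ?V" for e
    using g that by (auto simp: iso_def hom_def)
  have Fc: "F e \<in> carrier ?V" if "e \<in> carrier ?U" for e using bij that by (auto simp: bij_betw_def)
  have gF: "?g (F e) = e" if "e \<in> carrier ?U" for e using bij that by (simp add: bij_betw_inv_into_left)
  have Fg: "F (?g e) = e" if "e \<in> carrier ?V" for e using bij that by (simp add: bij_betw_inv_into_right)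
  have fin': "finite (carrier ?V)" using bij fin bij_betw_finite by blast
  define \<Psi> where "\<Psi> f = (\<lambda>e. if e \<in> carrier ?V then f (?g e) else 0)" for f :: "'e \<Rightarrow> 'k"
  interpret A: fun_space "fun_alg ?V :: ('k, 'f \<Rightarrow> 'k) bialg" "carrier ?V" by (rule fun_space_fun_alg[OF fin'])
  have "hopf_map (fun_alg ?U) (fun_alg ?V) \<Psi>"
    unfolding hopf_map_iff
  proof (intro conjI allI ballI)
    show "\<Psi> \<in> ring_hom (fun_alg ?U) (fun_alg ?V)"
      using gc by (auto simp: ring_hom_def \<Psi>_def funs_on_def fun_eq_iff)
    fix f :: "'e \<Rightarrow> 'k" assume "f \<in> carrier (fun_alg ?U)"
    show "\<Psi> (c \<odot>\<^bsub>fun_alg ?U\<^esub> f) = c \<odot>\<^bsub>fun_alg ?V\<^esub> \<Psi> f" for c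
      by (auto simp: \<Psi>_def)
    have "?g \<one>\<^bsub>?V\<^esub> = \<one>\<^bsub>?U\<^esub>" using hom_one[of ?g ?V ?U] g gU gV by (simp add: iso_def)
    then show "counit (fun_alg ?V) (\<Psi> f) = counit (fun_alg ?U) f"
      using group.is_monoid[OF gV] by (simp add: \<Psi>_def monoid.one_closed)
    show "tensor_eq (fun_alg ?V) 2 (comult (fun_alg ?V) (\<Psi> f)) (map_tensor \<Psi> (comult (fun_alg ?U) f))"
    proof (rule A.tensor_eq_2_coords[OF fun_alg_tensors])
      show "map_tensor \<Psi> (comult (fun_alg ?U) f) \<in> tensors (fun_alg ?V) 2"
        by (rule map_tensor_in_tensors[OF fun_alg_tensors]) (simp add: \<Psi>_def funs_on_def)
      fix x y assume xy: "x \<in> carrier ?V" "y \<in> carrier ?V"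
      then have "?g (x \<otimes>\<^bsub>?V\<^esub> y) = ?g x \<otimes>\<^bsub>?U\<^esub> ?g y" using g by (auto simp: iso_def hom_def)
      moreover have "x \<otimes>\<^bsub>?V\<^esub> y \<in> carrier ?V" using xy gV by (simp add: group.is_monoid monoid.m_closed)
      ultimately show "sweedler (comult (fun_alg ?V) (\<Psi> f)) (\<lambda>u v. u x * v y) =
        sweedler (map_tensor \<Psi> (comult (fun_alg ?U) f)) (\<lambda>u v. u x * v y)"
        using xy gc by (simp add: sweedler_map_tensor[OF fun_alg_tensors] \<Psi>_def fun_alg_coords fin fin')
    qed
  qed
  moreover have "bij_betw \<Psi> (funs_on (carrier ?U)) (funs_on (carrier ?V))"
  proof (rule bij_betwI[of _ _ _ "\<lambda>f e. if e \<in> carrier ?U then f (F e) else 0"])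
    show "\<Psi> \<in> funs_on (carrier ?U) \<rightarrow> funs_on (carrier ?V)" by (auto simp: \<Psi>_def funs_on_def)
    show "(\<lambda>f e. if e \<in> carrier ?U then f (F e) else 0) \<in> funs_on (carrier ?V) \<rightarrow> funs_on (carrier ?U)"
      by (auto simp: funs_on_def)
    show "(\<lambda>e. if e \<in> carrier ?U then \<Psi> f (F e) else 0) = f" if "f \<in> funs_on (carrier ?U)" for f
      using that Fc gF by (auto simp: fun_eq_iff \<Psi>_def funs_on_def)
    show "\<Psi> (\<lambda>e. if e \<in> carrier ?U then f (F e) else 0) = f" if "f \<in> funs_on (carrier ?V)" for f
      using that gc Fg by (auto simp: fun_eq_iff \<Psi>_def funs_on_def)
  qed
  moreover have "\<Psi> (hopf_incl (fun_ext C U) f) = hopf_incl (fun_ext C V) f" for f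
  proof
    fix e show "\<Psi> (hopf_incl (fun_ext C U) f) e = hopf_incl (fun_ext C V) f e"
      using gc[of e] F(3)[of "?g e"] Fg[of e] by (cases "e \<in> carrier ?V") (simp_all add: \<Psi>_def)
  qed
  moreover have "hopf_proj (fun_ext C V) (\<Psi> f) = hopf_proj (fun_ext C U) f" for f
  proof -
    have "\<Psi> f (grp_incl V \<chi>) = f (grp_incl U \<chi>)" if "\<chi> \<in> carrier (dual_group C)" for \<chi> :: "'c \<Rightarrow> 'k"
      using F(2)[OF that] gF[OF incl[OF that]] Fc[OF incl[OF that]] by (simp add: \<Psi>_def)
    then show ?thesis by (simp add: fun_ext_def cong: if_cong)
  qed
  ultimately show ?thesis unfolding hopf_ext_equiv_def by auto
qed

end

context ext_setup
begin

text \<open>Fourier transform in the variable of \<open>C\<close>, separately over every a in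
  \<open>G\<close>: p_a x becomes the function supported over a with value \<chi>(x) at (a, \<chi>).
  Convolution becomes the pointwise product, and the factor \<tau>(x, a, b) in the comultiplication
  becomes the cocycle in the product (a, \<chi>)(b, \<psi>).\<close>

lemma H_ext_equiv_fun_ext:
  fixes \<tau> :: "'c \<Rightarrow> 'g \<Rightarrow> 'g \<Rightarrow> 'k::{alg_closed_field, field_char_0}"
  assumes \<tau>: "\<tau> \<in> cocycles C G"
  shows "hopf_ext_equiv G (H_ext C G \<tau>) (fun_ext C (G_ext C G \<tau>))"
proof -
  interpret S: cocycle_setup C p G n \<tau> by unfold_locales (rule \<tau>)
  let ?L = "grp_total (G_ext C G \<tau>)"
  let ?D = "dual_group C :: ('c \<Rightarrow> 'k) monoid"
  interpret D: prime_group ?D p by (rule dual_prime_group)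
  have fin: "finite (carrier ?L)" by (simp add: finite_dual)
  interpret A: fun_space "fun_alg ?L" "carrier ?L" by (rule fun_space_fun_alg[OF fin])
  define \<Psi> where "\<Psi> u = (\<lambda>(a, \<chi>). if a \<in> carrier G then evaluation C (\<lambda>x. u (x, a)) \<chi> else 0)"
    for u :: "'c \<times> 'g \<Rightarrow> 'k"
  have ev: "evaluation C u \<chi> = (\<Sum>x\<in>carrier C. u x * \<chi> x)" if "\<chi> \<in> carrier ?D" for u and \<chi> :: "'c \<Rightarrow> 'k"
    using that by (simp add: evaluation_def)
  have ev0: "evaluation C u \<chi> = 0" if "\<chi> \<notin> carrier ?D" for u and \<chi> :: "'c \<Rightarrow> 'k"
    using that by (simp add: evaluation_def)
  have \<Psi>c: "\<Psi> u \<in> funs_on (carrier ?L)" for u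
    by (auto simp: \<Psi>_def funs_on_def ev0)
  have "hopf_map S.H (fun_alg ?L) \<Psi>"
    unfolding hopf_map_iff
  proof (intro conjI allI ballI)
    have "\<Psi> (u \<otimes>\<^bsub>S.H\<^esub> v) = (\<lambda>e. \<Psi> u e * \<Psi> v e)" for u v
    proof (rule ext, clarify)
      fix a \<chi> show "\<Psi> (u \<otimes>\<^bsub>S.H\<^esub> v) (a, \<chi>) = \<Psi> u (a, \<chi>) * \<Psi> v (a, \<chi>)"
      proof (cases "\<chi> \<in> carrier ?D")
        case True
        have "evaluation C (\<lambda>x. (u \<otimes>\<^bsub>S.H\<^esub> v) (x, a)) \<chi> = evaluation C (conv (\<lambda>x. u (x, a)) (\<lambda>x. v (x, a))) \<chi>"
          using True by (simp add: ev S.mult_H)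
        then show ?thesis by (simp add: \<Psi>_def evaluation_conv[OF True])
      qed (simp add: \<Psi>_def ev0)
    qed
    moreover have "\<Psi> (u \<oplus>\<^bsub>S.H\<^esub> v) = (\<lambda>e. \<Psi> u e + \<Psi> v e)" for u v
      by (auto simp: \<Psi>_def S.H_simps evaluation_def fun_eq_iff algebra_simps sum.distrib)
    moreover have "\<Psi> \<one>\<^bsub>S.H\<^esub> = \<one>\<^bsub>fun_alg ?L\<^esub>"
    proof (rule ext, clarify)
      fix a \<chi>
      have "evaluation C (\<lambda>x. if x = \<one> \<and> a \<in> carrier G then 1 else 0) \<chi> = 1"
        if "\<chi> \<in> carrier ?D" "a \<in> carrier G"
        using that dual_group_one[OF that(1)]
        by (simp add: ev if_distrib[of "\<lambda>c. c * _"] cong: if_cong)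
      then show "\<Psi> \<one>\<^bsub>S.H\<^esub> (a, \<chi>) = \<one>\<^bsub>fun_alg ?L\<^esub> (a, \<chi>)"
        by (cases "\<chi> \<in> carrier ?D") (auto simp: \<Psi>_def S.H_simps ev0)
    qed
    ultimately show "\<Psi> \<in> ring_hom S.H (fun_alg ?L)" using \<Psi>c by (simp add: ring_hom_def)
    fix u assume u: "u \<in> carrier S.H"
    show "\<Psi> (c \<odot>\<^bsub>S.H\<^esub> u) = c \<odot>\<^bsub>fun_alg ?L\<^esub> \<Psi> u" for c
      by (auto simp: \<Psi>_def S.H_simps evaluation_def fun_eq_iff algebra_simps sum_distrib_left)
    show "counit (fun_alg ?L) (\<Psi> u) = counit S.H u"
      using D.one_closed by (simp add: \<Psi>_def S.H_simps ev)
    show "tensor_eq (fun_alg ?L) 2 (comult (fun_alg ?L) (\<Psi> u)) (map_tensor \<Psi> (comult S.H u))"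
    proof (rule A.tensor_eq_2_coords[OF fun_alg_tensors])
      show "map_tensor \<Psi> (comult S.H u) \<in> tensors (fun_alg ?L) 2"
        by (rule map_tensor_in_tensors[OF S.comult_in_tensors]) (use \<Psi>c in simp)
      fix q r assume qr: "q \<in> carrier ?L" "r \<in> carrier ?L"
      then obtain a b \<chi> \<psi> where q: "q = (a, \<chi>)" "r = (b, \<psi>)"
        and m: "a \<in> carrier G" "b \<in> carrier G" "\<chi> \<in> carrier ?D" "\<psi> \<in> carrier ?D" by auto
      \<comment> \<open>\<tau>(-, a, b) is itself a character, so the second component of a product
        in G(\<tau>) is one too.\<close>
      have mem: "(\<lambda>x. \<chi> x * \<psi> x * (if x \<in> carrier C then \<tau> x a b else 0)) \<in> carrier ?D"
        using m S.cocycle_simps(1,6) by (auto simp: dual_group_iff)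
      have "sweedler (map_tensor \<Psi> (comult S.H u)) (\<lambda>u v. u q * v r) =
        sweedler (comult S.H u) (\<lambda>v w. \<Sum>x\<in>carrier C. \<Sum>y\<in>carrier C. (\<chi> x * \<psi> y) * (v (x, a) * w (y, b)))"
        using m by (simp add: sweedler_map_tensor[OF S.comult_in_tensors] q \<Psi>_def ev sum_product ac_simps)
      also have "\<dots> = (\<Sum>x\<in>carrier C. \<Sum>y\<in>carrier C. if y = x then \<chi> x * \<psi> x * (\<tau> x a b * u (x, a \<otimes>\<^bsub>G\<^esub> b)) else 0)"
        unfolding sweedler_fun_sum sweedler_fun_mult
        by (intro sum.cong refl) (use m in \<open>auto simp: S.comult_coords\<close>)
      also have "\<dots> = \<Psi> u (q \<otimes>\<^bsub>?L\<^esub> r)"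
        using m by (simp add: q \<Psi>_def ev[OF mem]) (intro sum.cong refl, simp add: ac_simps)
      also have "\<dots> = sweedler (comult (fun_alg ?L) (\<Psi> u)) (\<lambda>u v. u q * v r)"
        by (rule fun_alg_coords[OF fin qr, symmetric])
      finally show "sweedler (comult (fun_alg ?L) (\<Psi> u)) (\<lambda>u v. u q * v r) =
        sweedler (map_tensor \<Psi> (comult S.H u)) (\<lambda>u v. u q * v r)" ..
    qed
  qed
  moreover have "bij_betw \<Psi> (carrier S.H) (funs_on (carrier ?L))"
  proof -
    have "inj_on \<Psi> (carrier S.H)"
    proof (rule inj_onI)
      fix u v assume u: "u \<in> carrier S.H" and v: "v \<in> carrier S.H" and eq: "\<Psi> u = \<Psi> v"
      show "u = v"
      proof (rule S.carrier_H_eqI[OF u v])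
        fix z a assume z: "z \<in> carrier C" "a \<in> carrier G"
        have "evaluation C (\<lambda>x. u (x, a)) = evaluation C (\<lambda>x. v (x, a))"
        proof
          fix \<chi> show "evaluation C (\<lambda>x. u (x, a)) \<chi> = evaluation C (\<lambda>x. v (x, a)) \<chi>"
            using fun_cong[OF eq, of "(a, \<chi>)"] z by (simp add: \<Psi>_def)
        qed
        then have "(\<lambda>x. u (x, a)) = (\<lambda>x. v (x, a))"
          by (rule inj_onD[OF evaluation_inj_on]) (use u v in \<open>auto simp: S.carrier_H funs_on_def\<close>)
        then show "u (z, a) = v (z, a)" by (rule fun_cong)
      qed
    qed
    moreover have "funs_on (carrier ?L) \<subseteq> \<Psi> ` carrier S.H"
    proof
      fix w :: "'g \<times> ('c \<Rightarrow> 'k) \<Rightarrow> 'k" assume w: "w \<in> funs_on (carrier ?L)"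
      \<comment> \<open>The transform is inverted over every a separately; what is chosen off the
        carrier of \<open>G\<close> is discarded in \<open>?u\<close>.\<close>
      have "\<forall>a. \<exists>u. u \<in> funs_on (carrier C) \<and> (\<forall>\<chi>\<in>carrier ?D. evaluation C u \<chi> = w (a, \<chi>))"
        using evaluation_surj[of "\<lambda>\<chi>. w (_, \<chi>)"] by blast
      from choice[OF this] obtain U where U: "\<And>a. U a \<in> funs_on (carrier C)"
        "\<And>a \<chi>. \<chi> \<in> carrier ?D \<Longrightarrow> evaluation C (U a) \<chi> = w (a, \<chi>)"
        by blast
      let ?u = "\<lambda>(x, a). if a \<in> carrier G then U a x else 0"
      have "?u \<in> carrier S.H" using U(1) by (auto simp: S.carrier_H funs_on_def)
      moreover have "w = \<Psi> ?u"
      proof (rule ext, clarify)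
        fix a \<chi> show "w (a, \<chi>) = \<Psi> ?u (a, \<chi>)"
          using w U(2)[of \<chi> a] by (cases "\<chi> \<in> carrier ?D") (auto simp: \<Psi>_def ev0 funs_on_def cong: if_cong)
      qed
      ultimately show "w \<in> \<Psi> ` carrier S.H" by blast
    qed
    ultimately show ?thesis using \<Psi>c by (auto simp: bij_betw_def)
  qed
  moreover have "\<Psi> (hopf_incl (H_ext C G \<tau>) f) = hopf_incl (fun_ext C (G_ext C G \<tau>)) f"
    if f: "f \<in> funs_on (carrier G)" for f
  proof (rule ext, clarify)
    fix a \<chi>
    show "\<Psi> (hopf_incl (H_ext C G \<tau>) f) (a, \<chi>) = hopf_incl (fun_ext C (G_ext C G \<tau>)) f (a, \<chi>)"
      using dual_group_one[of \<chi>]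
      by (cases "\<chi> \<in> carrier ?D") (auto simp: \<Psi>_def ev ev0 if_distrib[of "\<lambda>c. c * _"] cong: if_cong)
  qed
  moreover have "hopf_proj (fun_ext C (G_ext C G \<tau>)) (\<Psi> u) = hopf_proj (H_ext C G \<tau>) u" if u: "u \<in> carrier S.H" for u
    by (rule fun_ext_proj) (use S.proj_closed[OF u] in \<open>auto simp: \<Psi>_def H_ext_def\<close>)
  ultimately show ?thesis unfolding hopf_ext_equiv_def by auto
qed

end

section \<open>Central extensions of groups\<close>

lemma iso_inv_into:
  assumes F: "F \<in> iso A B" and cl: "\<And>x y. x \<in> carrier A \<Longrightarrow> y \<in> carrier A \<Longrightarrow> x \<otimes>\<^bsub>A\<^esub> y \<in> carrier A"
  shows "inv_into (carrier A) F \<in> iso B A"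
proof -
  let ?g = "inv_into (carrier A) F"
  have bij: "bij_betw F (carrier A) (carrier B)" using F by (simp add: iso_def)
  have g: "?g b \<in> carrier A" "F (?g b) = b" if "b \<in> carrier B" for b
    using bij that by (auto simp: bij_betw_def inv_into_into f_inv_into_f)
  have "?g (x \<otimes>\<^bsub>B\<^esub> y) = ?g x \<otimes>\<^bsub>A\<^esub> ?g y" if "x \<in> carrier B" "y \<in> carrier B" for x y
  proof -
    have "x \<otimes>\<^bsub>B\<^esub> y = F (?g x \<otimes>\<^bsub>A\<^esub> ?g y)" using F g that by (simp add: iso_def hom_def)
    then show ?thesis using bij cl g that by (simp add: bij_betw_inv_into_left)
  qed
  then show ?thesis using g bij_betw_inv_into[OF bij] by (auto simp: iso_def hom_def)
qed

lemma grp_ext_equiv_trans: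
  assumes "grp_ext_equiv C U V" "grp_ext_equiv C V W"
  shows "grp_ext_equiv C U W"
proof -
  obtain F where F: "F \<in> iso (grp_total U) (grp_total V)"
    "\<forall>c\<in>carrier C. F (grp_incl U c) = grp_incl V c" "\<forall>e\<in>carrier (grp_total U). grp_proj V (F e) = grp_proj U e"
    using assms(1) unfolding grp_ext_equiv_def by blast
  obtain F' where F': "F' \<in> iso (grp_total V) (grp_total W)"
    "\<forall>c\<in>carrier C. F' (grp_incl V c) = grp_incl W c" "\<forall>e\<in>carrier (grp_total V). grp_proj W (F' e) = grp_proj V e"
    using assms(2) unfolding grp_ext_equiv_def by blast
  have "F' \<circ> F \<in> iso (grp_total U) (grp_total W)" by (rule iso_set_trans[OF F(1) F'(1)])
  moreover have "F e \<in> carrier (grp_total V)" if "e \<in> carrier (grp_total U)" for e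
    using F(1) that by (auto simp: iso_def hom_def)
  ultimately show ?thesis unfolding grp_ext_equiv_def using F F' by (intro bexI[of _ "F' \<circ> F"]) auto
qed

lemma grp_ext_equiv_sym:
  assumes "grp_ext_equiv C U V"
    and cl: "\<And>x y. x \<in> carrier (grp_total U) \<Longrightarrow> y \<in> carrier (grp_total U) \<Longrightarrow> x \<otimes>\<^bsub>grp_total U\<^esub> y \<in> carrier (grp_total U)"
    and incl: "\<And>c. c \<in> carrier C \<Longrightarrow> grp_incl U c \<in> carrier (grp_total U)"
  shows "grp_ext_equiv C V U"
proof -
  obtain F where F: "F \<in> iso (grp_total U) (grp_total V)"
    "\<forall>c\<in>carrier C. F (grp_incl U c) = grp_incl V c" "\<forall>e\<in>carrier (grp_total U). grp_proj V (F e) = grp_proj U e"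
    using assms(1) unfolding grp_ext_equiv_def by blast
  let ?g = "inv_into (carrier (grp_total U)) F"
  have bij: "bij_betw F (carrier (grp_total U)) (carrier (grp_total V))" using F(1) by (simp add: iso_def)
  have gF: "?g (F e) = e" if "e \<in> carrier (grp_total U)" for e using bij that by (simp add: bij_betw_inv_into_left)
  have "?g \<in> iso (grp_total V) (grp_total U)" by (rule iso_inv_into[OF F(1) cl])
  moreover have "?g (grp_incl V c) = grp_incl U c" if "c \<in> carrier C" for c
    using gF[OF incl[OF that]] F(2) that by simp
  moreover have "grp_proj U (?g e) = grp_proj V e" if "e \<in> carrier (grp_total V)" for e
  proof -
    have "e \<in> F ` carrier (grp_total U)" using bij that by (simp add: bij_betw_def)
    then show ?thesis using gF F(3) by auto
  qed
  ultimately show ?thesis unfolding grp_ext_equiv_def by (intro bexI[of _ ?g]) auto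
qed

lemma central_extension_simps:
  assumes "central_extension C G U"
  shows "group (grp_total U)" "grp_incl U \<in> hom C (grp_total U)" "inj_on (grp_incl U) (carrier C)"
    "grp_proj U \<in> hom (grp_total U) G" "grp_proj U ` carrier (grp_total U) = carrier G"
    "kernel (grp_total U) G (grp_proj U) = grp_incl U ` carrier C"
    "\<And>c e. c \<in> carrier C \<Longrightarrow> e \<in> carrier (grp_total U) \<Longrightarrow>
      grp_incl U c \<otimes>\<^bsub>grp_total U\<^esub> e = e \<otimes>\<^bsub>grp_total U\<^esub> grp_incl U c"
    "\<And>c. c \<in> carrier C \<Longrightarrow> grp_incl U c \<in> carrier (grp_total U)"
  using assms by (auto simp: central_extension_def Let_def hom_def)

lemma central_extension_equiv_sym:
  "central_extension C G U \<Longrightarrow> grp_ext_equiv C U V \<Longrightarrow> grp_ext_equiv C V U"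
  by (rule grp_ext_equiv_sym)
    (auto simp: central_extension_simps intro!: monoid.m_closed[OF group.is_monoid[OF central_extension_simps(1)]])

lemma grp_ext_equiv_refl: "grp_ext_equiv C U U"
  unfolding grp_ext_equiv_def by (intro bexI[of _ "\<lambda>x. x"]) (auto simp: iso_def hom_def bij_betw_def)

section \<open>Group cocycles and the central extensions they define\<close>

definition grp_cocycles :: "'g monoid \<Rightarrow> 'a monoid \<Rightarrow> ('g \<Rightarrow> 'g \<Rightarrow> 'a) set" where
  "grp_cocycles G A = {c. (\<forall>a\<in>carrier G. \<forall>b\<in>carrier G. c a b \<in> carrier A) \<and>
    (\<forall>a\<in>carrier G. c a \<one>\<^bsub>G\<^esub> = \<one>\<^bsub>A\<^esub> \<and> c \<one>\<^bsub>G\<^esub> a = \<one>\<^bsub>A\<^esub>) \<and>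
    (\<forall>a\<in>carrier G. \<forall>b\<in>carrier G. \<forall>d\<in>carrier G.
      c a (b \<otimes>\<^bsub>G\<^esub> d) \<otimes>\<^bsub>A\<^esub> c b d = c (a \<otimes>\<^bsub>G\<^esub> b) d \<otimes>\<^bsub>A\<^esub> c a b)}"

lemma cocycle_ext_simps [simp]:
  "carrier (grp_total (cocycle_ext G A c)) = carrier G \<times> carrier A"
  "(a, u) \<otimes>\<^bsub>grp_total (cocycle_ext G A c)\<^esub> (b, v) = (a \<otimes>\<^bsub>G\<^esub> b, u \<otimes>\<^bsub>A\<^esub> v \<otimes>\<^bsub>A\<^esub> c a b)"
  "\<one>\<^bsub>grp_total (cocycle_ext G A c)\<^esub> = (\<one>\<^bsub>G\<^esub>, \<one>\<^bsub>A\<^esub>)"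
  "grp_incl (cocycle_ext G A c) u = (\<one>\<^bsub>G\<^esub>, u)"
  "grp_proj (cocycle_ext G A c) = fst"
  by (simp_all add: cocycle_ext_def)

locale grp_setup = G: group G + A: comm_group A for G :: "'g monoid" and A :: "'a monoid"
begin

lemma grp_cocycleD:
  assumes "c \<in> grp_cocycles G A"
  shows "a \<in> carrier G \<Longrightarrow> b \<in> carrier G \<Longrightarrow> c a b \<in> carrier A"
    "a \<in> carrier G \<Longrightarrow> c a \<one>\<^bsub>G\<^esub> = \<one>\<^bsub>A\<^esub>" "a \<in> carrier G \<Longrightarrow> c \<one>\<^bsub>G\<^esub> a = \<one>\<^bsub>A\<^esub>"
    "a \<in> carrier G \<Longrightarrow> b \<in> carrier G \<Longrightarrow> d \<in> carrier G \<Longrightarrow>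
      c a (b \<otimes>\<^bsub>G\<^esub> d) \<otimes>\<^bsub>A\<^esub> c b d = c (a \<otimes>\<^bsub>G\<^esub> b) d \<otimes>\<^bsub>A\<^esub> c a b"
  using assms unfolding grp_cocycles_def by blast+

lemma cocycle_ext_central:
  assumes c: "c \<in> grp_cocycles G A"
  shows "central_extension A G (cocycle_ext G A c)"
proof -
  let ?E = "grp_total (cocycle_ext G A c)"
  note c' = grp_cocycleD[OF c]
  have "group ?E"
  proof (rule groupI)
    fix x y z assume "x \<in> carrier ?E" "y \<in> carrier ?E" "z \<in> carrier ?E"
    then obtain a u b v d w where x: "x = (a, u)" "y = (b, v)" "z = (d, w)"
      and m: "a \<in> carrier G" "b \<in> carrier G" "d \<in> carrier G" "u \<in> carrier A" "v \<in> carrier A" "w \<in> carrier A"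
      by auto
    note cl = c'(1)[OF m(1,2)] c'(1)[OF m(2,3)] c'(1)[OF m(1) G.m_closed[OF m(2,3)]] c'(1)[OF G.m_closed[OF m(1,2)] m(3)]
    \<comment> \<open>Up to reordering in \<open>A\<close>, associativity of the product is the
      cocycle identity.\<close>
    have "u \<otimes>\<^bsub>A\<^esub> v \<otimes>\<^bsub>A\<^esub> c a b \<otimes>\<^bsub>A\<^esub> w \<otimes>\<^bsub>A\<^esub> c (a \<otimes>\<^bsub>G\<^esub> b) d = u \<otimes>\<^bsub>A\<^esub> v \<otimes>\<^bsub>A\<^esub> w \<otimes>\<^bsub>A\<^esub> (c (a \<otimes>\<^bsub>G\<^esub> b) d \<otimes>\<^bsub>A\<^esub> c a b)"
      using m cl by (simp add: A.m_ac)
    also have "\<dots> = u \<otimes>\<^bsub>A\<^esub> (v \<otimes>\<^bsub>A\<^esub> w \<otimes>\<^bsub>A\<^esub> c b d) \<otimes>\<^bsub>A\<^esub> c a (b \<otimes>\<^bsub>G\<^esub> d)"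
      unfolding c'(4)[OF m(1-3), symmetric] using m cl by (simp add: A.m_ac)
    finally show "x \<otimes>\<^bsub>?E\<^esub> y \<otimes>\<^bsub>?E\<^esub> z = x \<otimes>\<^bsub>?E\<^esub> (y \<otimes>\<^bsub>?E\<^esub> z)"
      using m by (simp add: x G.m_assoc)
  next
    fix x assume "x \<in> carrier ?E"
    then obtain a u where x: "x = (a, u)" and m: "a \<in> carrier G" "u \<in> carrier A" by auto
    have cl: "c (inv\<^bsub>G\<^esub> a) a \<in> carrier A" using m c' by simp
    \<comment> \<open>The second component v of the inverse solves v u c(a^(-1), a) = 1.\<close>
    show "\<exists>y\<in>carrier ?E. y \<otimes>\<^bsub>?E\<^esub> x = \<one>\<^bsub>?E\<^esub>"
      by (rule bexI[of _ "(inv\<^bsub>G\<^esub> a, inv\<^bsub>A\<^esub> (u \<otimes>\<^bsub>A\<^esub> c (inv\<^bsub>G\<^esub> a) a))"])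
        (use m cl in \<open>auto simp: x A.m_assoc\<close>)
  qed (use c' in auto)
  moreover have "kernel ?E G fst = (\<lambda>u. (\<one>\<^bsub>G\<^esub>, u)) ` carrier A"
    by (auto simp: kernel_def)
  ultimately show ?thesis
    using c' by (auto simp: central_extension_def Let_def hom_def inj_on_def A.m_comm image_iff)
qed

text \<open>An equivalence fixes \<open>A\<close> and covers the identity of \<open>G\<close>, so it
  has the form (a, u) -> (a, u \<eta>(a)); being a homomorphism is then the coboundary
  relation.\<close>

lemma cocycle_ext_equiv_iff:
  assumes c: "c \<in> grp_cocycles G A" and c2: "c' \<in> grp_cocycles G A"
  shows "grp_ext_equiv A (cocycle_ext G A c) (cocycle_ext G A c') \<longleftrightarrow>
    (\<exists>\<eta>. (\<forall>a\<in>carrier G. \<eta> a \<in> carrier A) \<and> (\<forall>a\<in>carrier G. \<forall>b\<in>carrier G.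
      c' a b \<otimes>\<^bsub>A\<^esub> (\<eta> a \<otimes>\<^bsub>A\<^esub> \<eta> b) = c a b \<otimes>\<^bsub>A\<^esub> \<eta> (a \<otimes>\<^bsub>G\<^esub> b)))"
proof
  let ?E = "grp_total (cocycle_ext G A c)" and ?E' = "grp_total (cocycle_ext G A c')"
  note cd = grp_cocycleD[OF c] and cd' = grp_cocycleD[OF c2]
  assume "grp_ext_equiv A (cocycle_ext G A c) (cocycle_ext G A c')"
  then obtain F where F: "F \<in> iso ?E ?E'" "\<And>u. u \<in> carrier A \<Longrightarrow> F (\<one>\<^bsub>G\<^esub>, u) = (\<one>\<^bsub>G\<^esub>, u)"
    "\<And>e. e \<in> carrier G \<times> carrier A \<Longrightarrow> fst (F e) = fst e"
    unfolding grp_ext_equiv_def by auto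
  have hom: "F (x \<otimes>\<^bsub>?E\<^esub> y) = F x \<otimes>\<^bsub>?E'\<^esub> F y" if "x \<in> carrier G \<times> carrier A" "y \<in> carrier G \<times> carrier A" for x y
    using F(1) that by (auto simp: iso_def hom_def)
  have Fc: "F x \<in> carrier G \<times> carrier A" if "x \<in> carrier G \<times> carrier A" for x
    using F(1) that by (auto simp: iso_def hom_def)
  define \<eta> where "\<eta> a = snd (F (a, \<one>\<^bsub>A\<^esub>))" for a
  have e: "\<eta> a \<in> carrier A" if "a \<in> carrier G" for a
    using Fc[of "(a, \<one>\<^bsub>A\<^esub>)"] that by (auto simp: \<eta>_def mem_Times_iff)
  have F1: "F (a, \<one>\<^bsub>A\<^esub>) = (a, \<eta> a)" if "a \<in> carrier G" for a
    using F(3)[of "(a, \<one>\<^bsub>A\<^esub>)"] that by (simp add: \<eta>_def prod_eq_iff)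
  \<comment> \<open>Uses (a, u) = (1, u)(a, 1), which holds because the cocycles are
    normalized.\<close>
  have Fu: "F (a, u) = (a, u \<otimes>\<^bsub>A\<^esub> \<eta> a)" if "a \<in> carrier G" "u \<in> carrier A" for a u
    using hom[of "(\<one>\<^bsub>G\<^esub>, u)" "(a, \<one>\<^bsub>A\<^esub>)"] that cd cd' F(2)[of u] F1[of a] e[of a] by simp
  have "c' a b \<otimes>\<^bsub>A\<^esub> (\<eta> a \<otimes>\<^bsub>A\<^esub> \<eta> b) = c a b \<otimes>\<^bsub>A\<^esub> \<eta> (a \<otimes>\<^bsub>G\<^esub> b)" if m: "a \<in> carrier G" "b \<in> carrier G" for a b
  proof -
    have "F (a \<otimes>\<^bsub>G\<^esub> b, c a b) = (a \<otimes>\<^bsub>G\<^esub> b, \<eta> a \<otimes>\<^bsub>A\<^esub> \<eta> b \<otimes>\<^bsub>A\<^esub> c' a b)"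
      using hom[of "(a, \<one>\<^bsub>A\<^esub>)" "(b, \<one>\<^bsub>A\<^esub>)"] m cd F1 by simp
    then have "\<eta> a \<otimes>\<^bsub>A\<^esub> \<eta> b \<otimes>\<^bsub>A\<^esub> c' a b = c a b \<otimes>\<^bsub>A\<^esub> \<eta> (a \<otimes>\<^bsub>G\<^esub> b)"
      using Fu[of "a \<otimes>\<^bsub>G\<^esub> b" "c a b"] m cd by simp
    then show ?thesis using m e cd' by (simp add: A.m_comm)
  qed
  then show "\<exists>\<eta>. (\<forall>a\<in>carrier G. \<eta> a \<in> carrier A) \<and> (\<forall>a\<in>carrier G. \<forall>b\<in>carrier G.
      c' a b \<otimes>\<^bsub>A\<^esub> (\<eta> a \<otimes>\<^bsub>A\<^esub> \<eta> b) = c a b \<otimes>\<^bsub>A\<^esub> \<eta> (a \<otimes>\<^bsub>G\<^esub> b))" using e by blast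
next
  let ?E = "grp_total (cocycle_ext G A c)" and ?E' = "grp_total (cocycle_ext G A c')"
  note cd = grp_cocycleD[OF c] and cd' = grp_cocycleD[OF c2]
  assume "\<exists>\<eta>. (\<forall>a\<in>carrier G. \<eta> a \<in> carrier A) \<and> (\<forall>a\<in>carrier G. \<forall>b\<in>carrier G.
      c' a b \<otimes>\<^bsub>A\<^esub> (\<eta> a \<otimes>\<^bsub>A\<^esub> \<eta> b) = c a b \<otimes>\<^bsub>A\<^esub> \<eta> (a \<otimes>\<^bsub>G\<^esub> b))"
  then obtain \<eta> where e: "\<forall>a\<in>carrier G. \<eta> a \<in> carrier A"
    and eq: "\<forall>a\<in>carrier G. \<forall>b\<in>carrier G. c' a b \<otimes>\<^bsub>A\<^esub> (\<eta> a \<otimes>\<^bsub>A\<^esub> \<eta> b) = c a b \<otimes>\<^bsub>A\<^esub> \<eta> (a \<otimes>\<^bsub>G\<^esub> b)"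
    by blast
  \<comment> \<open>At the pair (1, 1) the relation says that \<eta>(1) is idempotent.\<close>
  have "\<eta> \<one>\<^bsub>G\<^esub> \<otimes>\<^bsub>A\<^esub> \<eta> \<one>\<^bsub>G\<^esub> = \<eta> \<one>\<^bsub>G\<^esub>" using eq[rule_format, of "\<one>\<^bsub>G\<^esub>" "\<one>\<^bsub>G\<^esub>"] cd cd' e by simp
  then have e1: "\<eta> \<one>\<^bsub>G\<^esub> = \<one>\<^bsub>A\<^esub>" using e by (simp add: A.l_cancel_one)
  define F where "F = (\<lambda>(a, u). (a, u \<otimes>\<^bsub>A\<^esub> \<eta> a))"
  have hom: "F (x \<otimes>\<^bsub>?E\<^esub> y) = F x \<otimes>\<^bsub>?E'\<^esub> F y" if xy: "x \<in> carrier ?E" "y \<in> carrier ?E" for x y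
  proof -
    obtain a u b v where x: "x = (a, u)" "y = (b, v)"
      and m: "a \<in> carrier G" "b \<in> carrier G" "u \<in> carrier A" "v \<in> carrier A" using xy by auto
    have cl: "c a b \<in> carrier A" "c' a b \<in> carrier A" "\<eta> a \<in> carrier A" "\<eta> b \<in> carrier A" "\<eta> (a \<otimes>\<^bsub>G\<^esub> b) \<in> carrier A"
      using m cd cd' e by auto
    have "u \<otimes>\<^bsub>A\<^esub> v \<otimes>\<^bsub>A\<^esub> c a b \<otimes>\<^bsub>A\<^esub> \<eta> (a \<otimes>\<^bsub>G\<^esub> b) = u \<otimes>\<^bsub>A\<^esub> v \<otimes>\<^bsub>A\<^esub> (c' a b \<otimes>\<^bsub>A\<^esub> (\<eta> a \<otimes>\<^bsub>A\<^esub> \<eta> b))"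
      using m cl eq by (simp add: A.m_assoc)
    also have "\<dots> = u \<otimes>\<^bsub>A\<^esub> \<eta> a \<otimes>\<^bsub>A\<^esub> (v \<otimes>\<^bsub>A\<^esub> \<eta> b) \<otimes>\<^bsub>A\<^esub> c' a b"
      using m cl by (simp add: A.m_ac)
    finally show ?thesis by (simp add: x F_def)
  qed
  have "bij_betw F (carrier G \<times> carrier A) (carrier G \<times> carrier A)"
    by (rule bij_betwI[of _ _ _ "\<lambda>(a, u). (a, u \<otimes>\<^bsub>A\<^esub> inv\<^bsub>A\<^esub> \<eta> a)"])
      (use e in \<open>auto simp: F_def A.m_assoc\<close>)
  then have "F \<in> iso ?E ?E'"
    using hom e by (auto simp: iso_def hom_def F_def)
  then show "grp_ext_equiv A (cocycle_ext G A c) (cocycle_ext G A c')"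
    unfolding grp_ext_equiv_def using e1 by (intro bexI[of _ F]) (auto simp: F_def)
qed

text \<open>The cocycle measures how far a set-theoretic section \<open>s\<close> is from being a
  homomorphism; every element of the extension is i(u) s(a) for unique u and a.\<close>

lemma central_extension_equiv_cocycle_ext:
  fixes U :: "('g, 'a, 'e) grp_ext"
  assumes U: "central_extension A G U"
  shows "\<exists>c\<in>grp_cocycles G A. grp_ext_equiv A U (cocycle_ext G A c)"
proof -
  note Us = central_extension_simps[OF U]
  let ?E = "grp_total U" and ?i = "grp_incl U" and ?q = "grp_proj U"
  interpret E: group ?E by (rule Us(1))
  interpret q: group_hom ?E G ?q by unfold_locales (rule Us(4))
  interpret i: group_hom A ?E ?i by unfold_locales (rule Us(2))
  \<comment> \<open>Sends the identity to the identity, so that the resulting cocycle is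
    normalized.\<close>
  define s where "s a = (if a = \<one>\<^bsub>G\<^esub> then \<one>\<^bsub>?E\<^esub> else (SOME e. e \<in> carrier ?E \<and> ?q e = a))" for a
  have s: "s a \<in> carrier ?E" "?q (s a) = a" if "a \<in> carrier G" for a
  proof -
    have "a \<in> ?q ` carrier ?E" using that by (simp add: Us(5))
    then have "\<exists>e. e \<in> carrier ?E \<and> ?q e = a" by blast
    from someI_ex[OF this] show "s a \<in> carrier ?E" "?q (s a) = a" by (auto simp: s_def)
  qed
  have s1: "s \<one>\<^bsub>G\<^esub> = \<one>\<^bsub>?E\<^esub>" by (simp add: s_def)
  have ker: "\<exists>u\<in>carrier A. e = ?i u" if "e \<in> carrier ?E" "?q e = \<one>\<^bsub>G\<^esub>" for e
  proof -
    have "e \<in> kernel ?E G ?q" using that by (simp add: kernel_def)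
    then show ?thesis unfolding Us(6) by blast
  qed
  have qi: "?q (?i u) = \<one>\<^bsub>G\<^esub>" if "u \<in> carrier A" for u
  proof -
    have "?i u \<in> kernel ?E G ?q" unfolding Us(6) using that by blast
    then show ?thesis by (simp add: kernel_def)
  qed
  have inj: "u = v" if "?i u = ?i v" "u \<in> carrier A" "v \<in> carrier A" for u v
    using Us(3) that by (auto dest: inj_onD)
  note ic = Us(8)
  have "\<exists>u\<in>carrier A. s a \<otimes>\<^bsub>?E\<^esub> s b \<otimes>\<^bsub>?E\<^esub> inv\<^bsub>?E\<^esub> s (a \<otimes>\<^bsub>G\<^esub> b) = ?i u" if "a \<in> carrier G" "b \<in> carrier G" for a b
    using that s by (intro ker) auto
  then have "\<forall>a\<in>carrier G. \<forall>b\<in>carrier G. \<exists>u. u \<in> carrier A \<and> s a \<otimes>\<^bsub>?E\<^esub> s b \<otimes>\<^bsub>?E\<^esub> inv\<^bsub>?E\<^esub> s (a \<otimes>\<^bsub>G\<^esub> b) = ?i u"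
    by blast
  define c where "c a b = (SOME u. u \<in> carrier A \<and> s a \<otimes>\<^bsub>?E\<^esub> s b \<otimes>\<^bsub>?E\<^esub> inv\<^bsub>?E\<^esub> s (a \<otimes>\<^bsub>G\<^esub> b) = ?i u)" for a b
  have c: "c a b \<in> carrier A" "s a \<otimes>\<^bsub>?E\<^esub> s b \<otimes>\<^bsub>?E\<^esub> inv\<^bsub>?E\<^esub> s (a \<otimes>\<^bsub>G\<^esub> b) = ?i (c a b)"
    if "a \<in> carrier G" "b \<in> carrier G" for a b
  proof -
    have "\<exists>u. u \<in> carrier A \<and> s a \<otimes>\<^bsub>?E\<^esub> s b \<otimes>\<^bsub>?E\<^esub> inv\<^bsub>?E\<^esub> s (a \<otimes>\<^bsub>G\<^esub> b) = ?i u"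
      using ker[of "s a \<otimes>\<^bsub>?E\<^esub> s b \<otimes>\<^bsub>?E\<^esub> inv\<^bsub>?E\<^esub> s (a \<otimes>\<^bsub>G\<^esub> b)"] that s by auto
    from someI_ex[OF this] show "c a b \<in> carrier A" "s a \<otimes>\<^bsub>?E\<^esub> s b \<otimes>\<^bsub>?E\<^esub> inv\<^bsub>?E\<^esub> s (a \<otimes>\<^bsub>G\<^esub> b) = ?i (c a b)"
      unfolding c_def by auto
  qed
  have sab: "s a \<otimes>\<^bsub>?E\<^esub> s b = ?i (c a b) \<otimes>\<^bsub>?E\<^esub> s (a \<otimes>\<^bsub>G\<^esub> b)" if "a \<in> carrier G" "b \<in> carrier G" for a b
    using that s by (simp add: c(2)[symmetric] E.m_assoc)
  note cen = Us(7)
  have cc: "c \<in> grp_cocycles G A"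
    unfolding grp_cocycles_def
  proof (intro CollectI conjI ballI)
    fix a b assume "a \<in> carrier G" "b \<in> carrier G"
    then show "c a b \<in> carrier A" by (rule c(1))
  next
    fix a assume a: "a \<in> carrier G"
    show "c a \<one>\<^bsub>G\<^esub> = \<one>\<^bsub>A\<^esub>" by (rule inj) (use a c s s1 in \<open>auto simp: c(2)[symmetric]\<close>)
    show "c \<one>\<^bsub>G\<^esub> a = \<one>\<^bsub>A\<^esub>" by (rule inj) (use a c s s1 in \<open>auto simp: c(2)[symmetric]\<close>)
  next
    fix a b d assume m: "a \<in> carrier G" "b \<in> carrier G" "d \<in> carrier G"
    note cl = c(1)[OF m(1,2)] c(1)[OF m(2,3)] c(1)[OF m(1) G.m_closed[OF m(2,3)]] c(1)[OF G.m_closed[OF m(1,2)] m(3)]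
    note sl = s(1)[OF m(1)] s(1)[OF m(2)] s(1)[OF m(3)] s(1)[OF G.m_closed[OF m(1,2)]] s(1)[OF G.m_closed[OF m(2,3)]]
      s(1)[OF G.m_closed[OF G.m_closed[OF m(1,2)] m(3)]]
    \<comment> \<open>The product s(a) s(b) s(d) is expanded with both bracketings; centrality moves
      the value of c(b, d) past s(a).\<close>
    have "?i (c a b) \<otimes>\<^bsub>?E\<^esub> (?i (c (a \<otimes>\<^bsub>G\<^esub> b) d) \<otimes>\<^bsub>?E\<^esub> s (a \<otimes>\<^bsub>G\<^esub> b \<otimes>\<^bsub>G\<^esub> d)) = (s a \<otimes>\<^bsub>?E\<^esub> s b) \<otimes>\<^bsub>?E\<^esub> s d"
      using sab[OF m(1,2)] sab[of "a \<otimes>\<^bsub>G\<^esub> b" d] m sl ic cl by (simp add: E.m_assoc)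
    also have "\<dots> = s a \<otimes>\<^bsub>?E\<^esub> (?i (c b d) \<otimes>\<^bsub>?E\<^esub> s (b \<otimes>\<^bsub>G\<^esub> d))"
      using sab[OF m(2,3)] m sl by (simp add: E.m_assoc)
    also have "\<dots> = ?i (c b d) \<otimes>\<^bsub>?E\<^esub> (s a \<otimes>\<^bsub>?E\<^esub> s (b \<otimes>\<^bsub>G\<^esub> d))"
      using cen[OF cl(2) sl(1)] sl ic cl by (simp add: E.m_assoc[symmetric])
    also have "\<dots> = ?i (c b d) \<otimes>\<^bsub>?E\<^esub> (?i (c a (b \<otimes>\<^bsub>G\<^esub> d)) \<otimes>\<^bsub>?E\<^esub> s (a \<otimes>\<^bsub>G\<^esub> b \<otimes>\<^bsub>G\<^esub> d))"
      using sab[of a "b \<otimes>\<^bsub>G\<^esub> d"] m by (simp add: G.m_assoc)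
    finally have "?i (c a b \<otimes>\<^bsub>A\<^esub> c (a \<otimes>\<^bsub>G\<^esub> b) d) = ?i (c b d \<otimes>\<^bsub>A\<^esub> c a (b \<otimes>\<^bsub>G\<^esub> d))"
      using sl ic cl by (simp add: E.m_assoc[symmetric])
    then have "c a b \<otimes>\<^bsub>A\<^esub> c (a \<otimes>\<^bsub>G\<^esub> b) d = c b d \<otimes>\<^bsub>A\<^esub> c a (b \<otimes>\<^bsub>G\<^esub> d)"
      using cl by (intro inj) auto
    then show "c a (b \<otimes>\<^bsub>G\<^esub> d) \<otimes>\<^bsub>A\<^esub> c b d = c (a \<otimes>\<^bsub>G\<^esub> b) d \<otimes>\<^bsub>A\<^esub> c a b"
      using cl by (simp add: A.m_comm)
  qed
  let ?T = "grp_total (cocycle_ext G A c)"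
  define F where "F = (\<lambda>(a, u). ?i u \<otimes>\<^bsub>?E\<^esub> s a)"
  have Fhom: "F \<in> hom ?T ?E"
  proof (rule homI)
    fix x assume "x \<in> carrier ?T"
    then show "F x \<in> carrier ?E" using ic s by (auto simp: F_def)
  next
    fix x y assume "x \<in> carrier ?T" "y \<in> carrier ?T"
    then obtain a u b v where x: "x = (a, u)" "y = (b, v)"
      and m: "a \<in> carrier G" "b \<in> carrier G" "u \<in> carrier A" "v \<in> carrier A" by auto
    note cl = c(1)[OF m(1,2)] s(1)[OF m(1)] s(1)[OF m(2)] ic[OF m(3)] ic[OF m(4)] ic[OF c(1)[OF m(1,2)]]
      s(1)[OF G.m_closed[OF m(1,2)]]
    have "F x \<otimes>\<^bsub>?E\<^esub> F y = ?i u \<otimes>\<^bsub>?E\<^esub> (s a \<otimes>\<^bsub>?E\<^esub> ?i v) \<otimes>\<^bsub>?E\<^esub> s b"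
      using cl by (simp add: x F_def E.m_assoc)
    also have "\<dots> = ?i u \<otimes>\<^bsub>?E\<^esub> ?i v \<otimes>\<^bsub>?E\<^esub> (s a \<otimes>\<^bsub>?E\<^esub> s b)"
      using cl by (simp only: cen[OF m(4) cl(2), symmetric]) (simp add: E.m_assoc)
    also have "\<dots> = F (x \<otimes>\<^bsub>?T\<^esub> y)"
      using m cl by (simp add: x F_def sab E.m_assoc)
    finally show "F (x \<otimes>\<^bsub>?T\<^esub> y) = F x \<otimes>\<^bsub>?E\<^esub> F y" ..
  qed
  have qF: "?q (F (a, u)) = a" if "a \<in> carrier G" "u \<in> carrier A" for a u
    using that s ic qi by (simp add: F_def)
  have "bij_betw F (carrier ?T) (carrier ?E)"
    unfolding bij_betw_def
  proof
    show "inj_on F (carrier ?T)"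
    proof (rule inj_onI)
      fix x y assume xy: "x \<in> carrier ?T" "y \<in> carrier ?T" "F x = F y"
      then obtain a u b v where x: "x = (a, u)" "y = (b, v)"
        and m: "a \<in> carrier G" "b \<in> carrier G" "u \<in> carrier A" "v \<in> carrier A" by auto
      have ab: "a = b" using qF m xy(3) x by metis
      then have "?i u \<otimes>\<^bsub>?E\<^esub> s a = ?i v \<otimes>\<^bsub>?E\<^esub> s a" using xy(3) by (simp add: x F_def)
      then have "?i u = ?i v" using m s ic by (simp add: E.r_cancel)
      then show "x = y" using inj m ab x by simp
    qed
    show "F ` carrier ?T = carrier ?E"
    proof
      show "F ` carrier ?T \<subseteq> carrier ?E" using Fhom by (auto simp: hom_def)
      show "carrier ?E \<subseteq> F ` carrier ?T"
      proof
        fix e assume e: "e \<in> carrier ?E"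
        let ?a = "?q e"
        have a: "?a \<in> carrier G" using e by simp
        obtain u where u: "u \<in> carrier A" "e \<otimes>\<^bsub>?E\<^esub> inv\<^bsub>?E\<^esub> s ?a = ?i u"
          using ker[of "e \<otimes>\<^bsub>?E\<^esub> inv\<^bsub>?E\<^esub> s ?a"] e a s by auto
        have "F (?a, u) = e" using e a s by (simp add: F_def u(2)[symmetric] E.m_assoc)
        moreover have "(?a, u) \<in> carrier ?T" using a u by simp
        ultimately show "e \<in> F ` carrier ?T" by (metis image_eqI)
      qed
    qed
  qed
  then have "F \<in> iso ?T ?E" using Fhom by (simp add: iso_def)
  moreover have "F (grp_incl (cocycle_ext G A c) u) = ?i u" if "u \<in> carrier A" for u
    using that ic s1 by (simp add: F_def)
  ultimately have "grp_ext_equiv A (cocycle_ext G A c) U"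
    unfolding grp_ext_equiv_def using qF by (intro bexI[of _ F]) auto
  then show ?thesis using cc central_extension_equiv_sym[OF cocycle_ext_central[OF cc]] by blast
qed

end

section \<open>Baer sums add cocycles\<close>

context grp_setup
begin

lemma cocycle_mult:
  assumes "c \<in> grp_cocycles G A" "c' \<in> grp_cocycles G A"
  shows "(\<lambda>a b. c a b \<otimes>\<^bsub>A\<^esub> c' a b) \<in> grp_cocycles G A"
proof -
  note cd = grp_cocycleD[OF assms(1)] and cd' = grp_cocycleD[OF assms(2)]
  have "c a (b \<otimes>\<^bsub>G\<^esub> d) \<otimes>\<^bsub>A\<^esub> c' a (b \<otimes>\<^bsub>G\<^esub> d) \<otimes>\<^bsub>A\<^esub> (c b d \<otimes>\<^bsub>A\<^esub> c' b d) =
      c (a \<otimes>\<^bsub>G\<^esub> b) d \<otimes>\<^bsub>A\<^esub> c' (a \<otimes>\<^bsub>G\<^esub> b) d \<otimes>\<^bsub>A\<^esub> (c a b \<otimes>\<^bsub>A\<^esub> c' a b)"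
    if m: "a \<in> carrier G" "b \<in> carrier G" "d \<in> carrier G" for a b d
  proof -
    note m' = m G.m_closed[OF m(1,2)] G.m_closed[OF m(2,3)]
    have "c a (b \<otimes>\<^bsub>G\<^esub> d) \<otimes>\<^bsub>A\<^esub> c' a (b \<otimes>\<^bsub>G\<^esub> d) \<otimes>\<^bsub>A\<^esub> (c b d \<otimes>\<^bsub>A\<^esub> c' b d) =
      (c a (b \<otimes>\<^bsub>G\<^esub> d) \<otimes>\<^bsub>A\<^esub> c b d) \<otimes>\<^bsub>A\<^esub> (c' a (b \<otimes>\<^bsub>G\<^esub> d) \<otimes>\<^bsub>A\<^esub> c' b d)"
      using m' cd(1) cd'(1) by (simp add: A.m_ac)
    also have "\<dots> = c (a \<otimes>\<^bsub>G\<^esub> b) d \<otimes>\<^bsub>A\<^esub> c' (a \<otimes>\<^bsub>G\<^esub> b) d \<otimes>\<^bsub>A\<^esub> (c a b \<otimes>\<^bsub>A\<^esub> c' a b)"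
      unfolding cd(4)[OF m] cd'(4)[OF m] using m' cd(1) cd'(1) by (simp add: A.m_ac)
    finally show ?thesis .
  qed
  then show ?thesis using cd(1-3) cd'(1-3) by (auto simp: grp_cocycles_def)
qed

text \<open>Multiplying the \<open>A\<close>-coordinates \<open>g\<close> and \<open>g'\<close> of
  the two extensions gives a surjection from the fibre product onto the extension of the product
  cocycle. Its kernel is the antidiagonal, so the first isomorphism theorem identifies the Baer
  sum.\<close>

lemma baer_sum_equiv:
  fixes U :: "('g, 'a, 'e) grp_ext" and V :: "('g, 'a, 'f) grp_ext"
  assumes U: "central_extension A G U" and V: "central_extension A G V"
    and c: "c \<in> grp_cocycles G A" and c2: "c' \<in> grp_cocycles G A"
    and Uc: "grp_ext_equiv A U (cocycle_ext G A c)" and Vc: "grp_ext_equiv A V (cocycle_ext G A c')"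
  shows "grp_ext_equiv A (baer_sum A U V) (cocycle_ext G A (\<lambda>a b. c a b \<otimes>\<^bsub>A\<^esub> c' a b))"
    and "grp_ext_equiv A (cocycle_ext G A (\<lambda>a b. c a b \<otimes>\<^bsub>A\<^esub> c' a b)) (baer_sum A U V)"
proof -
  note Us = central_extension_simps[OF U] and Vs = central_extension_simps[OF V]
  note cd = grp_cocycleD[OF c] and cd' = grp_cocycleD[OF c2]
  let ?c = "\<lambda>a b. c a b \<otimes>\<^bsub>A\<^esub> c' a b"
  let ?E = "grp_total U" and ?E' = "grp_total V" and ?P = "fibre_product U V" and ?T = "grp_total (cocycle_ext G A ?c)"
  let ?K = "antidiagonal A U V"
  interpret E: group ?E by (rule Us(1))
  interpret E': group ?E' by (rule Vs(1))
  interpret q: group_hom ?E G "grp_proj U" by unfold_locales (rule Us(4))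
  interpret q': group_hom ?E' G "grp_proj V" by unfold_locales (rule Vs(4))
  interpret i': group_hom A ?E' "grp_incl V" by unfold_locales (rule Vs(2))
  have cc: "?c \<in> grp_cocycles G A" by (rule cocycle_mult[OF c c2])
  have T: "group ?T" using central_extension_simps(1)[OF cocycle_ext_central[OF cc]] .
  obtain F where F: "F \<in> iso ?E (grp_total (cocycle_ext G A c))"
    "\<And>u. u \<in> carrier A \<Longrightarrow> F (grp_incl U u) = (\<one>\<^bsub>G\<^esub>, u)"
    "\<And>e. e \<in> carrier ?E \<Longrightarrow> fst (F e) = grp_proj U e"
    using Uc unfolding grp_ext_equiv_def by auto
  obtain F' where F': "F' \<in> iso ?E' (grp_total (cocycle_ext G A c'))"
    "\<And>u. u \<in> carrier A \<Longrightarrow> F' (grp_incl V u) = (\<one>\<^bsub>G\<^esub>, u)"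
    "\<And>e. e \<in> carrier ?E' \<Longrightarrow> fst (F' e) = grp_proj V e"
    using Vc unfolding grp_ext_equiv_def by auto
  define g where "g e = snd (F e)" for e
  define g' where "g' e = snd (F' e)" for e
  have Fg: "F e = (grp_proj U e, g e)" if "e \<in> carrier ?E" for e
    using F(3)[OF that] by (simp add: g_def prod_eq_iff)
  have Fg': "F' e = (grp_proj V e, g' e)" if "e \<in> carrier ?E'" for e
    using F'(3)[OF that] by (simp add: g'_def prod_eq_iff)
  have gc: "g e \<in> carrier A" if "e \<in> carrier ?E" for e
  proof -
    have "F e \<in> carrier G \<times> carrier A" using F(1) that by (auto simp: iso_def hom_def)
    then show ?thesis by (simp add: Fg[OF that])
  qed
  have gc': "g' e \<in> carrier A" if "e \<in> carrier ?E'" for e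
  proof -
    have "F' e \<in> carrier G \<times> carrier A" using F'(1) that by (auto simp: iso_def hom_def)
    then show ?thesis by (simp add: Fg'[OF that])
  qed
  have gm: "g (e \<otimes>\<^bsub>?E\<^esub> f) = g e \<otimes>\<^bsub>A\<^esub> g f \<otimes>\<^bsub>A\<^esub> c (grp_proj U e) (grp_proj U f)"
    if "e \<in> carrier ?E" "f \<in> carrier ?E" for e f
  proof -
    have "F (e \<otimes>\<^bsub>?E\<^esub> f) = F e \<otimes>\<^bsub>grp_total (cocycle_ext G A c)\<^esub> F f" using F(1) that by (auto simp: iso_def hom_def)
    then show ?thesis using that by (simp add: Fg)
  qed
  have gm': "g' (e \<otimes>\<^bsub>?E'\<^esub> f) = g' e \<otimes>\<^bsub>A\<^esub> g' f \<otimes>\<^bsub>A\<^esub> c' (grp_proj V e) (grp_proj V f)"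
    if "e \<in> carrier ?E'" "f \<in> carrier ?E'" for e f
  proof -
    have "F' (e \<otimes>\<^bsub>?E'\<^esub> f) = F' e \<otimes>\<^bsub>grp_total (cocycle_ext G A c')\<^esub> F' f" using F'(1) that by (auto simp: iso_def hom_def)
    then show ?thesis using that by (simp add: Fg')
  qed
  have gi: "g (grp_incl U u) = u" if "u \<in> carrier A" for u using F(2)[OF that] by (simp add: g_def)
  have gi': "g' (grp_incl V u) = u" if "u \<in> carrier A" for u using F'(2)[OF that] by (simp add: g'_def)
  have qi: "grp_proj U (grp_incl U u) = \<one>\<^bsub>G\<^esub>" if "u \<in> carrier A" for u
    using F(2)[OF that] F(3)[OF Us(8)[OF that]] by simp
  have qi': "grp_proj V (grp_incl V u) = \<one>\<^bsub>G\<^esub>" if "u \<in> carrier A" for u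
    using F'(2)[OF that] F'(3)[OF Vs(8)[OF that]] by simp
  have inj: "e = f" if "e \<in> carrier ?E" "f \<in> carrier ?E" "grp_proj U e = grp_proj U f" "g e = g f" for e f
  proof -
    have "inj_on F (carrier ?E)" using F(1) by (simp add: iso_def bij_betw_def)
    then show ?thesis by (rule inj_onD) (use that in \<open>simp_all add: Fg\<close>)
  qed
  have inj': "e = f" if "e \<in> carrier ?E'" "f \<in> carrier ?E'" "grp_proj V e = grp_proj V f" "g' e = g' f" for e f
  proof -
    have "inj_on F' (carrier ?E')" using F'(1) by (simp add: iso_def bij_betw_def)
    then show ?thesis by (rule inj_onD) (use that in \<open>simp_all add: Fg'\<close>)
  qed
  have carr: "carrier ?P = {(e, f). e \<in> carrier ?E \<and> f \<in> carrier ?E' \<and> grp_proj U e = grp_proj V f}"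
    by (simp add: fibre_product_def)
  have mult: "(e, f) \<otimes>\<^bsub>?P\<^esub> (e', f') = (e \<otimes>\<^bsub>?E\<^esub> e', f \<otimes>\<^bsub>?E'\<^esub> f')" for e f e' f'
    by (simp add: fibre_product_def)
  have P: "group ?P"
  proof -
    interpret EE: group "?E \<times>\<times> ?E'" by (rule DirProd_group[OF Us(1) Vs(1)])
    have "subgroup {(e, f). e \<in> carrier ?E \<and> f \<in> carrier ?E' \<and> grp_proj U e = grp_proj V f} (?E \<times>\<times> ?E')"
    proof (rule EE.subgroupI)
      have "(\<one>\<^bsub>?E\<^esub>, \<one>\<^bsub>?E'\<^esub>) \<in> {(e, f). e \<in> carrier ?E \<and> f \<in> carrier ?E' \<and> grp_proj U e = grp_proj V f}"
        by simp
      then show "{(e, f). e \<in> carrier ?E \<and> f \<in> carrier ?E' \<and> grp_proj U e = grp_proj V f} \<noteq> {}" by blast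
    qed (auto simp: inv_DirProd[OF Us(1) Vs(1)])
    then show ?thesis unfolding fibre_product_def by (rule subgroup.subgroup_is_group[OF _ EE.is_group])
  qed
  define \<psi> where "\<psi> = (\<lambda>(e, f). (grp_proj U e, g e \<otimes>\<^bsub>A\<^esub> g' f))"
  have hom: "\<psi> \<in> hom ?P ?T"
  proof (rule homI)
    fix x assume "x \<in> carrier ?P"
    then show "\<psi> x \<in> carrier ?T" by (auto simp: carr \<psi>_def gc gc')
  next
    fix x y assume "x \<in> carrier ?P" "y \<in> carrier ?P"
    then obtain e f e' f' where x: "x = (e, f)" "y = (e', f')"
      and m: "e \<in> carrier ?E" "f \<in> carrier ?E'" "grp_proj U e = grp_proj V f"
        "e' \<in> carrier ?E" "f' \<in> carrier ?E'" "grp_proj U e' = grp_proj V f'" by (auto simp: carr)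
    have cl: "c (grp_proj V f) (grp_proj V f') \<in> carrier A" "c' (grp_proj V f) (grp_proj V f') \<in> carrier A"
      using m cd(1) cd'(1) by auto
    show "\<psi> (x \<otimes>\<^bsub>?P\<^esub> y) = \<psi> x \<otimes>\<^bsub>?T\<^esub> \<psi> y"
      using m cl gc[OF m(1)] gc[OF m(4)] gc'[OF m(2)] gc'[OF m(5)]
      by (simp add: x mult \<psi>_def gm gm' A.m_ac)
  qed
  interpret psi: group_hom ?P ?T \<psi>
    by (rule group_hom.intro[OF P T]) (simp add: group_hom_axioms_def hom)
  have ker: "kernel ?P ?T \<psi> = ?K"
  proof
    show "?K \<subseteq> kernel ?P ?T \<psi>"
      by (auto simp: antidiagonal_def kernel_def carr \<psi>_def Us(8) Vs(8) qi qi' gi gi' simp del: i'.hom_inv)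
    show "kernel ?P ?T \<psi> \<subseteq> ?K"
    proof
      fix x assume "x \<in> kernel ?P ?T \<psi>"
      then obtain e f where x: "x = (e, f)"
        and m: "e \<in> carrier ?E" "f \<in> carrier ?E'" "grp_proj U e = grp_proj V f"
          "grp_proj U e = \<one>\<^bsub>G\<^esub>" "g e \<otimes>\<^bsub>A\<^esub> g' f = \<one>\<^bsub>A\<^esub>" by (auto simp: kernel_def carr \<psi>_def)
      \<comment> \<open>A pair in the kernel lies over the identity and has mutually inverse
        coordinates; \<open>inj\<close> and \<open>inj'\<close> then identify it with the
        antidiagonal element of \<open>g e\<close>.\<close>
      have gg: "g' f = inv\<^bsub>A\<^esub> g e" using m gc gc' by (metis A.inv_equality A.m_comm A.inv_inv)
      have "e = grp_incl U (g e)"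
        by (rule inj) (use m gc in \<open>auto simp: Us(8) qi gi\<close>)
      moreover have "f = grp_incl V (inv\<^bsub>A\<^esub> g e)"
        by (rule inj') (use m gc gg in \<open>auto simp: Vs(8) qi' gi' simp del: i'.hom_inv\<close>)
      ultimately show "x \<in> ?K" unfolding x antidiagonal_def
        using gc[OF m(1)] by (metis (no_types, lifting) image_eqI)
    qed
  qed
  have surj: "\<psi> ` carrier ?P = carrier ?T"
  proof
    show "\<psi> ` carrier ?P \<subseteq> carrier ?T" using psi.hom_closed by blast
    show "carrier ?T \<subseteq> \<psi> ` carrier ?P"
    proof
      fix x assume "x \<in> carrier ?T"
      then obtain a u where x: "x = (a, u)" and m: "a \<in> carrier G" "u \<in> carrier A" by auto
      \<comment> \<open>A preimage that carries the coordinate u in the first factor and 1 in the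
        second.\<close>
      have "(a, u) \<in> F ` carrier ?E" "(a, \<one>\<^bsub>A\<^esub>) \<in> F' ` carrier ?E'"
        using F(1) F'(1) m by (auto simp: iso_def bij_betw_def)
      then obtain e f where e: "e \<in> carrier ?E" "F e = (a, u)" "f \<in> carrier ?E'" "F' f = (a, \<one>\<^bsub>A\<^esub>)"
        by (metis imageE)
      then have "grp_proj U e = a" "g e = u" "grp_proj V f = a" "g' f = \<one>\<^bsub>A\<^esub>"
        using Fg[OF e(1)] Fg'[OF e(3)] by auto
      then have "\<psi> (e, f) = x" "(e, f) \<in> carrier ?P" using e m by (auto simp: \<psi>_def x carr)
      then show "x \<in> \<psi> ` carrier ?P" by blast
    qed
  qed
  define \<Psi> where "\<Psi> = (\<lambda>N. the_elem (\<psi> ` N))"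
  have iso: "\<Psi> \<in> iso (?P Mod ?K) ?T"
    using psi.FactGroup_iso_set[OF surj] by (simp add: ker \<Psi>_def)
  \<comment> \<open>\<psi> is constant on cosets of its kernel, so \<open>the_elem\<close> reads off
    its value; the projection of \<open>baer_sum\<close> is the first component of that
    value.\<close>
  have coset: "\<psi> ` (?K #>\<^bsub>?P\<^esub> x) = {\<psi> x}" "?K #>\<^bsub>?P\<^esub> x \<noteq> {}" "?K #>\<^bsub>?P\<^esub> x \<subseteq> carrier ?P" if x: "x \<in> carrier ?P" for x
  proof -
    show ne: "?K #>\<^bsub>?P\<^esub> x \<noteq> {}" by (auto simp: r_coset_def antidiagonal_def)
    show "?K #>\<^bsub>?P\<^esub> x \<subseteq> carrier ?P"
      unfolding ker[symmetric] using x by (auto simp: r_coset_def kernel_def)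
    have "\<psi> y = \<psi> x" if "y \<in> ?K #>\<^bsub>?P\<^esub> x" for y
      using that x psi.hom_closed[OF x] group.is_monoid[OF T] unfolding ker[symmetric]
      by (auto simp: r_coset_def kernel_def monoid.l_one simp del: cocycle_ext_simps)
    then show "\<psi> ` (?K #>\<^bsub>?P\<^esub> x) = {\<psi> x}" using ne by (auto simp: image_iff)
  qed
  have incl: "\<Psi> (grp_incl (baer_sum A U V) u) = (\<one>\<^bsub>G\<^esub>, u)" if u: "u \<in> carrier A" for u
  proof -
    have m: "(grp_incl U u, \<one>\<^bsub>?E'\<^esub>) \<in> carrier ?P" using u by (simp add: carr Us(8) qi)
    have "g' \<one>\<^bsub>?E'\<^esub> = \<one>\<^bsub>A\<^esub>" using gi'[of "\<one>\<^bsub>A\<^esub>"] by simp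
    then show ?thesis using coset(1)[OF m] u by (simp add: baer_sum_def \<Psi>_def \<psi>_def qi gi)
  qed
  have proj: "fst (\<Psi> N) = grp_proj (baer_sum A U V) N" if N: "N \<in> carrier (?P Mod ?K)" for N
  proof -
    obtain x where x: "x \<in> carrier ?P" "N = ?K #>\<^bsub>?P\<^esub> x" using N by (auto simp: carrier_FactGroup)
    have "(grp_proj U \<circ> fst) ` N = fst ` \<psi> ` N"
      unfolding image_image by (rule image_cong) (auto simp: \<psi>_def split_beta)
    then show ?thesis using coset(1)[OF x(1)] by (simp add: x(2) \<Psi>_def baer_sum_def)
  qed
  show *: "grp_ext_equiv A (baer_sum A U V) (cocycle_ext G A ?c)"
    unfolding grp_ext_equiv_def
    using iso incl proj by (intro bexI[of _ \<Psi>]) (auto simp: baer_sum_def)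
  have tot: "grp_total (baer_sum A U V) = ?P Mod ?K" by (simp add: baer_sum_def)
  have "group (?P Mod ?K)"
    using normal.factorgroup_is_group[OF psi.normal_kernel] by (simp add: ker)
  moreover have "grp_incl (baer_sum A U V) u \<in> carrier (?P Mod ?K)" if "u \<in> carrier A" for u
    unfolding carrier_FactGroup using that by (auto simp: baer_sum_def carr Us(8) qi)
  ultimately show "grp_ext_equiv A (cocycle_ext G A ?c) (baer_sum A U V)"
    by (intro grp_ext_equiv_sym[OF *]) (simp_all only: tot monoid.m_closed[OF group.is_monoid])
qed

lemma grp_class_eq_iff:
  fixes U V :: "('g, 'a, 'g \<times> 'a) grp_ext"
  assumes "central_extension A G U"
  shows "grp_class A G U = grp_class A G V \<longleftrightarrow> grp_ext_equiv A U V"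
proof
  have "U \<in> grp_class A G U" using assms grp_ext_equiv_refl by (simp add: grp_class_def)
  then show "grp_ext_equiv A U V" if "grp_class A G U = grp_class A G V"
    using that unfolding grp_class_def by blast
next
  assume e: "grp_ext_equiv A U V"
  then show "grp_class A G U = grp_class A G V"
    using central_extension_equiv_sym[OF assms e] by (auto simp: grp_class_def intro: grp_ext_equiv_trans)
qed

lemma grp_class_cong:
  assumes "grp_ext_equiv A U V" "grp_ext_equiv A V U"
  shows "grp_class A G U = grp_class A G V"
  using assms by (auto simp: grp_class_def intro: grp_ext_equiv_trans)

end

section \<open>Commutative extensions\<close>

locale comm_extension = ext_setup C p G n for C :: "'c monoid" (structure) and p and G :: "'g monoid" and n +
  fixes E :: "('g, 'c, 'k::{alg_closed_field, field_char_0}, 'h) hopf_ext"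
  assumes comm_E: "comm_hopf_extension C G E"
begin

abbreviation "H \<equiv> hopf_total E"
abbreviation "\<iota> \<equiv> hopf_incl E"
abbreviation "\<pi> \<equiv> hopf_proj E"
abbreviation mul (infixl \<open>\<bullet>\<close> 70) where "a \<bullet> b \<equiv> a \<otimes>\<^bsub>H\<^esub> b"
abbreviation "sw h B \<equiv> sweedler (comult H h) B"

lemma extension_E: "hopf_extension C G E"
  using comm_E by (simp add: comm_hopf_extension_def)

lemma bialgebra_H: "bialgebra H" and k_algebra_H: "k_algebra H"
  using hopf_extension_simps[OF extension_E] by auto

lemma vspace_H: "vspace H"
  by (rule vspace.intro) (use k_algebra_H in \<open>simp add: k_algebra_def\<close>)

lemma cring_H: "cring H"
proof -
  interpret ring H using k_algebra_H by (simp add: k_algebra_def)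
  show ?thesis by unfold_locales (use comm_E in \<open>simp add: comm_hopf_extension_def\<close>)
qed

sublocale vs: vspace H by (rule vspace_H)
sublocale H: cring H by (rule cring_H)

lemma smult_mult:
  "a \<in> carrier H \<Longrightarrow> b \<in> carrier H \<Longrightarrow> (c \<odot>\<^bsub>H\<^esub> a) \<bullet> b = c \<odot>\<^bsub>H\<^esub> (a \<bullet> b)"
  "a \<in> carrier H \<Longrightarrow> b \<in> carrier H \<Longrightarrow> a \<bullet> (c \<odot>\<^bsub>H\<^esub> b) = c \<odot>\<^bsub>H\<^esub> (a \<bullet> b)"
  using k_algebra_H by (simp_all add: k_algebra_def)

lemma comult_H: "a \<in> carrier H \<Longrightarrow> comult H a \<in> tensors H 2"
  using hopf_extension_simps(4)[OF extension_E] .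

section \<open>Sweedler calculus in a commutative extension\<close>

lemma sw_cong:
  "h \<in> carrier H \<Longrightarrow> (\<And>x y. x \<in> carrier H \<Longrightarrow> y \<in> carrier H \<Longrightarrow> B x y = B' x y) \<Longrightarrow> sw h B = sw h B'"
  by (rule sweedler_cong[OF comult_H])

text \<open>The bialgebra axioms hold only modulo the multilinearity relations, so a Sweedler sum
  may be rewritten by them when \<open>B\<close> is bilinear on the carrier. This is the reason for
  the multilinearity side conditions in all later computations.\<close>

lemma sw_bilinear:
  assumes "bilinear_on H B" and "tensor_eq H 2 s t"
  shows "sweedler s B = sweedler t B"
  using assms unfolding bilinear_on_iff tensor_eq_iff sweedler_def by blast

lemma sw_add:
  "bilinear_on H B \<Longrightarrow> a \<in> carrier H \<Longrightarrow> b \<in> carrier H \<Longrightarrow> sw (a \<oplus>\<^bsub>H\<^esub> b) B = sw a B + sw b B"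
  using bialgebra_H sw_bilinear[of B "comult H (a \<oplus>\<^bsub>H\<^esub> b)" "comult H a + comult H b"]
  by (simp add: bialgebra_def sweedler_sum_single)

lemma sw_smult:
  "bilinear_on H B \<Longrightarrow> a \<in> carrier H \<Longrightarrow> sw (c \<odot>\<^bsub>H\<^esub> a) B = c * sw a B"
  using bialgebra_H sw_bilinear[of B "comult H (c \<odot>\<^bsub>H\<^esub> a)" "pm_scale c (comult H a)"]
  by (simp add: bialgebra_def sweedler_sum_single)

lemma sw_mult:
  "bilinear_on H B \<Longrightarrow> a \<in> carrier H \<Longrightarrow> b \<in> carrier H \<Longrightarrow>
    sw (a \<bullet> b) B = sw a (\<lambda>x y. sw b (\<lambda>z w. B (x \<bullet> z) (y \<bullet> w)))"
  using bialgebra_H sw_bilinear[of B "comult H (a \<bullet> b)" "tensor_mult H (comult H a) (comult H b)"]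
  by (simp add: bialgebra_def sweedler_tensor_mult)

lemma sw_one: "bilinear_on H B \<Longrightarrow> sw \<one>\<^bsub>H\<^esub> B = B \<one>\<^bsub>H\<^esub> \<one>\<^bsub>H\<^esub>"
  using bialgebra_H sw_bilinear[of B "comult H \<one>\<^bsub>H\<^esub>" "Poly_Mapping.single [\<one>\<^bsub>H\<^esub>, \<one>\<^bsub>H\<^esub>] 1"]
  by (simp add: bialgebra_def sweedler_sum_single)

lemma sw_coassoc:
  assumes "trilinear_on H B" and h: "h \<in> carrier H"
  shows "sw h (\<lambda>x y. sw x (\<lambda>z w. B z w y)) = sw h (\<lambda>x y. sw y (\<lambda>z w. B x z w))"
proof -
  have "tensor_eq H 3 (coassoc_left H h) (coassoc_right H h)"
    using bialgebra_H h by (simp add: bialgebra_def coassoc_left_def coassoc_right_def)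
  then have "tensor_eval (\<lambda>w. B (w ! 0) (w ! 1) (w ! 2)) (coassoc_left H h) =
    tensor_eval (\<lambda>w. B (w ! 0) (w ! 1) (w ! 2)) (coassoc_right H h)"
    using assms(1) unfolding tensor_eq_iff trilinear_on_iff by blast
  then show ?thesis using h by (simp only: tensor_eval_coassoc[OF comult_H])
qed

lemma counit_linear: "linear_on H (counit H)"
  using bialgebra_H by (simp add: bialgebra_def linear_on_def)

lemma counit_mult: "a \<in> carrier H \<Longrightarrow> b \<in> carrier H \<Longrightarrow> counit H (a \<bullet> b) = counit H a * counit H b"
  and counit_one: "counit H \<one>\<^bsub>H\<^esub> = 1"
  using bialgebra_H by (simp_all add: bialgebra_def)

lemma linear_lin_val:
  assumes f: "linear_on H f" and h: "h \<in> carrier H"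
    and g: "\<And>x y. x \<in> carrier H \<Longrightarrow> y \<in> carrier H \<Longrightarrow> g x y \<in> carrier H"
  shows "f (lin_val H (\<lambda>xs. g (xs ! 0) (xs ! 1)) (comult H h)) = sw h (\<lambda>x y. f (g x y))"
    "lin_val H (\<lambda>xs. g (xs ! 0) (xs ! 1)) (comult H h) \<in> carrier H"
proof -
  have c: "g (xs ! 0) (xs ! 1) \<in> carrier H" if "xs \<in> Poly_Mapping.keys (comult H h)" for xs
  proof -
    have "xs \<in> words H 2" using comult_H[OF h] that by (auto simp: tensors_def)
    then show ?thesis using g by (auto simp: words_2)
  qed
  show "f (lin_val H (\<lambda>xs. g (xs ! 0) (xs ! 1)) (comult H h)) = sw h (\<lambda>x y. f (g x y))"
    using vs.linear_on_lin_val[OF f c] by (simp add: sweedler_def)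
  show "lin_val H (\<lambda>xs. g (xs ! 0) (xs ! 1)) (comult H h) \<in> carrier H"
    by (rule vs.lin_val_closed) (rule c)
qed

lemma linear_simps:
  assumes "linear_on H f"
  shows "a \<in> carrier H \<Longrightarrow> b \<in> carrier H \<Longrightarrow> f (a \<oplus>\<^bsub>H\<^esub> b) = f a + f b"
    "a \<in> carrier H \<Longrightarrow> f (c \<odot>\<^bsub>H\<^esub> a) = c * f a"
  using assms by (simp_all add: linear_on_def)

lemma sw_counit:
  assumes f: "linear_on H f" and h: "h \<in> carrier H"
  shows "sw h (\<lambda>x y. counit H x * f y) = f h" "sw h (\<lambda>x y. counit H y * f x) = f h"
proof -
  have "lin_val H (\<lambda>xs. counit H (xs ! 0) \<odot>\<^bsub>H\<^esub> (xs ! 1)) (comult H h) = h"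
    "lin_val H (\<lambda>xs. counit H (xs ! 1) \<odot>\<^bsub>H\<^esub> (xs ! 0)) (comult H h) = h"
    using bialgebra_H h by (simp_all add: bialgebra_def)
  moreover have "sw h (\<lambda>x y. f (counit H x \<odot>\<^bsub>H\<^esub> y)) = sw h (\<lambda>x y. counit H x * f y)"
    "sw h (\<lambda>x y. f (counit H y \<odot>\<^bsub>H\<^esub> x)) = sw h (\<lambda>x y. counit H y * f x)"
    using f by (intro sw_cong[OF h]; simp add: linear_on_def)+
  ultimately show "sw h (\<lambda>x y. counit H x * f y) = f h" "sw h (\<lambda>x y. counit H y * f x) = f h"
    using linear_lin_val(1)[OF f h, of "\<lambda>x y. counit H x \<odot>\<^bsub>H\<^esub> y"]
      linear_lin_val(1)[OF f h, of "\<lambda>x y. counit H y \<odot>\<^bsub>H\<^esub> x"] by simp_all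
qed

section \<open>The antipode\<close>

definition "S = (SOME S. is_antipode H S)"

lemma is_antipode_S: "is_antipode H S"
proof -
  have "\<exists>S. is_antipode H S"
    using hopf_extension_simps(1)[OF extension_E] by (simp add: hopf_algebra_def)
  then show ?thesis unfolding S_def by (rule someI_ex)
qed

lemma S_simps:
  shows S_closed: "a \<in> carrier H \<Longrightarrow> S a \<in> carrier H"
    and S_add: "a \<in> carrier H \<Longrightarrow> b \<in> carrier H \<Longrightarrow> S (a \<oplus>\<^bsub>H\<^esub> b) = S a \<oplus>\<^bsub>H\<^esub> S b"
    and S_smult: "a \<in> carrier H \<Longrightarrow> S (c \<odot>\<^bsub>H\<^esub> a) = c \<odot>\<^bsub>H\<^esub> S a"
  using is_antipode_S by (auto simp: is_antipode_def)

lemma sw_antipode: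
  assumes f: "linear_on H f" and h: "h \<in> carrier H"
  shows "sw h (\<lambda>x y. f (S x \<bullet> y)) = counit H h * f \<one>\<^bsub>H\<^esub>"
    "sw h (\<lambda>x y. f (x \<bullet> S y)) = counit H h * f \<one>\<^bsub>H\<^esub>"
proof -
  have "lin_val H (\<lambda>xs. S (xs ! 0) \<bullet> (xs ! 1)) (comult H h) = counit H h \<odot>\<^bsub>H\<^esub> \<one>\<^bsub>H\<^esub>"
    "lin_val H (\<lambda>xs. (xs ! 0) \<bullet> S (xs ! 1)) (comult H h) = counit H h \<odot>\<^bsub>H\<^esub> \<one>\<^bsub>H\<^esub>"
    using h is_antipode_S by (simp_all add: is_antipode_def)
  then show "sw h (\<lambda>x y. f (S x \<bullet> y)) = counit H h * f \<one>\<^bsub>H\<^esub>"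
    "sw h (\<lambda>x y. f (x \<bullet> S y)) = counit H h * f \<one>\<^bsub>H\<^esub>"
    using linear_lin_val(1)[OF f h, of "\<lambda>x y. S x \<bullet> y"] linear_lin_val(1)[OF f h, of "\<lambda>x y. x \<bullet> S y"]
      f S_simps(1) by (simp_all add: linear_on_def)
qed

lemmas multilinear_simps = linear_on_def H.l_distr H.r_distr smult_mult S_simps

lemma linear_functional_mult:
  assumes "linear_on H f" "a \<in> carrier H"
  shows "linear_on H (\<lambda>x. f (a \<bullet> x))" "linear_on H (\<lambda>x. f (x \<bullet> a))"
  using assms by (simp_all add: multilinear_simps)

lemma bilinear_onI:
  "(\<And>a. a \<in> carrier H \<Longrightarrow> linear_on H (B a)) \<Longrightarrow> (\<And>a. a \<in> carrier H \<Longrightarrow> linear_on H (\<lambda>x. B x a)) \<Longrightarrow>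
    bilinear_on H B"
  by (simp add: bilinear_on_def)

lemma linear_sw: "bilinear_on H B \<Longrightarrow> linear_on H (\<lambda>h. sw h B)"
  by (simp add: linear_on_def sw_add sw_smult)

lemma linear_sw_param:
  assumes "h \<in> carrier H" "\<And>y z. y \<in> carrier H \<Longrightarrow> z \<in> carrier H \<Longrightarrow> linear_on H (\<lambda>x. B x y z)"
  shows "linear_on H (\<lambda>x. sw h (B x))"
  unfolding linear_on_def
proof (intro conjI ballI allI)
  fix a b assume ab: "a \<in> carrier H" "b \<in> carrier H"
  have "sw h (B (a \<oplus>\<^bsub>H\<^esub> b)) = sw h (\<lambda>y z. B a y z + B b y z)"
    using assms ab by (intro sw_cong) (simp_all add: linear_on_def)
  then show "sw h (B (a \<oplus>\<^bsub>H\<^esub> b)) = sw h (B a) + sw h (B b)"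
    by (simp add: sweedler_def tensor_eval_fun_add)
next
  fix c a assume a: "a \<in> carrier H"
  have "sw h (B (c \<odot>\<^bsub>H\<^esub> a)) = sw h (\<lambda>y z. c * B a y z)"
    using assms a by (intro sw_cong) (simp_all add: linear_on_def)
  then show "sw h (B (c \<odot>\<^bsub>H\<^esub> a)) = c * sw h (B a)" by (simp add: sweedler_fun_mult)
qed

lemma sw_swap: "sw h (\<lambda>x y. sw k (\<lambda>z w. B x y z w)) = sw k (\<lambda>z w. sw h (\<lambda>x y. B x y z w))"
  unfolding sweedler_def by (rule tensor_eval_swap)

lemma S_one: "S \<one>\<^bsub>H\<^esub> = \<one>\<^bsub>H\<^esub>"
proof (rule vs.eq_if_functionals_eq)
  fix f assume f: "linear_on H f"
  have "bilinear_on H (\<lambda>x y. f (S x \<bullet> y))" using f by (intro bilinear_onI) (simp_all add: multilinear_simps)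
  from sw_one[OF this] show "f (S \<one>\<^bsub>H\<^esub>) = f \<one>\<^bsub>H\<^esub>"
    using sw_antipode(1)[OF f H.one_closed] by (simp add: counit_one S_simps)
qed (auto simp: S_simps)

text \<open>Both sides are convolution inverses of the multiplication map.\<close>

lemma S_mult:
  assumes h: "h \<in> carrier H" and k: "k \<in> carrier H"
  shows "S (h \<bullet> k) = S h \<bullet> S k"
proof (rule vs.eq_if_functionals_eq)
  show "S (h \<bullet> k) \<in> carrier H" "S h \<bullet> S k \<in> carrier H" using assms by (simp_all add: S_simps)
  fix f assume f: "linear_on H f"
  \<comment> \<open>The triple convolution S(h_1 k_1) (h_2 k_2) S(h_3) S(k_3) under
    \<open>f\<close>. Contracting the last two factors gives S(hk), contracting the first two gives
    S(h) S(k); commutativity of \<open>H\<close> allows this order of the antipodes.\<close>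
  define \<Phi> where "\<Phi> h1 h2 h3 k1 k2 k3 = f (S (h1 \<bullet> k1) \<bullet> (h2 \<bullet> k2) \<bullet> (S h3 \<bullet> S k3))" for h1 h2 h3 k1 k2 k3
  define T where "T h1 h2 h3 = sw k (\<lambda>k1 k2. sw k2 (\<lambda>k21 k22. \<Phi> h1 h2 h3 k1 k21 k22))" for h1 h2 h3
  note f' = f[unfolded linear_on_def]
  have lk: "linear_on H (\<lambda>k1. \<Phi> h1 h2 h3 k1 k2 k3)" "linear_on H (\<lambda>k2. \<Phi> h1 h2 h3 k1 k2 k3)"
      "linear_on H (\<lambda>k3. \<Phi> h1 h2 h3 k1 k2 k3)" 
      "linear_on H (\<lambda>h1. \<Phi> h1 h2 h3 k1 k2 k3)" "linear_on H (\<lambda>h2. \<Phi> h1 h2 h3 k1 k2 k3)"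
      "linear_on H (\<lambda>h3. \<Phi> h1 h2 h3 k1 k2 k3)"
    if "h1 \<in> carrier H" "h2 \<in> carrier H" "h3 \<in> carrier H" "k1 \<in> carrier H" "k2 \<in> carrier H" "k3 \<in> carrier H"
    for h1 h2 h3 k1 k2 k3
    using that f' by (simp_all add: \<Phi>_def multilinear_simps)
  have T': "T h1 h2 h3 = sw k (\<lambda>k1 k2. sw k1 (\<lambda>k11 k12. \<Phi> h1 h2 h3 k11 k12 k2))"
    if "h1 \<in> carrier H" "h2 \<in> carrier H" "h3 \<in> carrier H" for h1 h2 h3
    unfolding T_def using that k
    by (intro sw_coassoc[symmetric]) (simp_all add: trilinear_on_def lk)
  have Tlin: "trilinear_on H T"
    unfolding trilinear_on_def T_def
    by (intro ballI conjI linear_sw_param lk) (use k in auto)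
  have "sw h (\<lambda>h1 h2. sw h2 (\<lambda>h21 h22. T h1 h21 h22)) = f (S (h \<bullet> k))"
  proof -
    have "T h1 h2 h3 = f (S (h1 \<bullet> k) \<bullet> (h2 \<bullet> S h3))"
      if m: "h1 \<in> carrier H" "h2 \<in> carrier H" "h3 \<in> carrier H" for h1 h2 h3
    proof -
      have "sw k2 (\<lambda>k21 k22. \<Phi> h1 h2 h3 k1 k21 k22) = counit H k2 * f (S (h1 \<bullet> k1) \<bullet> (h2 \<bullet> S h3))"
        if "k1 \<in> carrier H" "k2 \<in> carrier H" for k1 k2
      proof -
        let ?c = "S (h1 \<bullet> k1) \<bullet> (h2 \<bullet> S h3)"
        have c: "?c \<in> carrier H" using m that by (simp add: S_simps)
        have "sw k2 (\<lambda>k21 k22. \<Phi> h1 h2 h3 k1 k21 k22) = sw k2 (\<lambda>k21 k22. f (?c \<bullet> (k21 \<bullet> S k22)))"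
          using m that by (intro sw_cong) (simp_all add: \<Phi>_def S_simps H.m_ac)
        also have "\<dots> = counit H k2 * f (?c \<bullet> \<one>\<^bsub>H\<^esub>)"
          using sw_antipode(2)[OF linear_functional_mult(1)[OF f c] that(2)] .
        finally show ?thesis using c by simp
      qed
      then have "T h1 h2 h3 = sw k (\<lambda>k1 k2. counit H k2 * f (S (h1 \<bullet> k1) \<bullet> (h2 \<bullet> S h3)))"
        unfolding T_def by (intro sw_cong[OF k])
      also have "\<dots> = f (S (h1 \<bullet> k) \<bullet> (h2 \<bullet> S h3))"
        by (rule sw_counit(2)[OF _ k]) (use m f' in \<open>simp add: multilinear_simps\<close>)
      finally show ?thesis .
    qed
    then have "sw h (\<lambda>h1 h2. sw h2 (\<lambda>h21 h22. T h1 h21 h22)) =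
      sw h (\<lambda>h1 h2. sw h2 (\<lambda>h21 h22. f (S (h1 \<bullet> k) \<bullet> (h21 \<bullet> S h22))))"
      by (intro sw_cong) (use h in auto)
    also have "\<dots> = sw h (\<lambda>h1 h2. counit H h2 * f (S (h1 \<bullet> k)))"
    proof (rule sw_cong[OF h])
      fix h1 h2 assume m: "h1 \<in> carrier H" "h2 \<in> carrier H"
      then have c: "S (h1 \<bullet> k) \<in> carrier H" using k by (simp add: S_simps)
      show "sw h2 (\<lambda>h21 h22. f (S (h1 \<bullet> k) \<bullet> (h21 \<bullet> S h22))) = counit H h2 * f (S (h1 \<bullet> k))"
        using sw_antipode(2)[OF linear_functional_mult(1)[OF f c] m(2)] c by simp
    qed
    also have "\<dots> = f (S (h \<bullet> k))"
      by (rule sw_counit(2)[OF _ h]) (use k f' in \<open>simp add: multilinear_simps\<close>)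
    finally show ?thesis .
  qed
  moreover have "sw h (\<lambda>h1 h2. sw h1 (\<lambda>h11 h12. T h11 h12 h2)) = f (S h \<bullet> S k)"
  proof -
    have "sw h1 (\<lambda>h11 h12. T h11 h12 h2) = counit H h1 * f (S h2 \<bullet> S k)"
      if m: "h1 \<in> carrier H" "h2 \<in> carrier H" for h1 h2
    proof -
      have "sw h1 (\<lambda>h11 h12. T h11 h12 h2) =
        sw h1 (\<lambda>h11 h12. sw k (\<lambda>k1 k2. sw k1 (\<lambda>k11 k12. \<Phi> h11 h12 h2 k11 k12 k2)))"
        using m by (intro sw_cong) (simp_all add: T')
      also have "\<dots> = sw k (\<lambda>k1 k2. sw h1 (\<lambda>h11 h12. sw k1 (\<lambda>k11 k12. \<Phi> h11 h12 h2 k11 k12 k2)))"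
        by (rule sw_swap)
      also have "\<dots> = sw k (\<lambda>k1 k2. counit H k1 * (counit H h1 * f (S h2 \<bullet> S k2)))"
      proof (rule sw_cong[OF k])
        fix k1 k2 assume m': "k1 \<in> carrier H" "k2 \<in> carrier H"
        let ?c = "S h2 \<bullet> S k2"
        have c: "?c \<in> carrier H" using m m' by (simp add: S_simps)
        have l: "linear_on H (\<lambda>x. f (x \<bullet> ?c))" by (rule linear_functional_mult(2)[OF f c])
        \<comment> \<open>The joint sum over the legs of h1 and of k1 is the Sweedler sum of their
          product, to which the antipode axiom applies.\<close>
        have "sw h1 (\<lambda>h11 h12. sw k1 (\<lambda>k11 k12. \<Phi> h11 h12 h2 k11 k12 k2)) =
          sw (h1 \<bullet> k1) (\<lambda>x y. f (S x \<bullet> y \<bullet> ?c))"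
          using m m' c f' by (subst sw_mult) (simp_all add: \<Phi>_def bilinear_on_def multilinear_simps)
        also have "\<dots> = counit H (h1 \<bullet> k1) * f (\<one>\<^bsub>H\<^esub> \<bullet> ?c)"
          by (rule sw_antipode(1)[OF l]) (use m m' in simp)
        finally show "sw h1 (\<lambda>h11 h12. sw k1 (\<lambda>k11 k12. \<Phi> h11 h12 h2 k11 k12 k2)) =
          counit H k1 * (counit H h1 * f (S h2 \<bullet> S k2))"
          using m m' c by (simp add: counit_mult)
      qed
      also have "\<dots> = counit H h1 * f (S h2 \<bullet> S k)"
        by (rule sw_counit(1)[OF _ k]) (use m f' in \<open>simp add: multilinear_simps algebra_simps\<close>)
      finally show ?thesis .
    qed
    then have "sw h (\<lambda>h1 h2. sw h1 (\<lambda>h11 h12. T h11 h12 h2)) = sw h (\<lambda>h1 h2. counit H h1 * f (S h2 \<bullet> S k))"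
      by (intro sw_cong[OF h])
    also have "\<dots> = f (S h \<bullet> S k)"
      by (rule sw_counit(1)[OF _ h]) (use k f' in \<open>simp add: multilinear_simps\<close>)
    finally show ?thesis .
  qed
  ultimately show "f (S (h \<bullet> k)) = f (S h \<bullet> S k)"
    using sw_coassoc[OF Tlin h] by simp
qed

end

section \<open>The idempotents of the fibres, and the fibre over 1\<close>

context comm_extension
begin

definition e :: "'g \<Rightarrow> 'h" where "e a = \<iota> (delta a)"

lemma incl_hopf: "hopf_map (fun_alg G :: ('k, 'g \<Rightarrow> 'k) bialg) H \<iota>"
  and incl_inj: "inj_on \<iota> (funs_on (carrier G))"
  and proj_hopf: "hopf_map H (group_alg C :: ('k, 'c \<Rightarrow> 'k) bialg) \<pi>"
  and proj_surj: "\<pi> ` carrier H = funs_on (carrier C)"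
  and proj_kernel: "{h \<in> carrier H. \<pi> h = (\<lambda>x. 0)} =
        generate (add_monoid H) {\<iota> f \<bullet> h | f h. f \<in> funs_on (carrier G) \<and> f \<one>\<^bsub>G\<^esub> = 0 \<and> h \<in> carrier H}"
  using extension_E by (simp_all add: hopf_extension_def Let_def)

lemma incl_closed: "f \<in> funs_on (carrier G) \<Longrightarrow> \<iota> f \<in> carrier H"
  using hopf_extension_simps(5)[OF extension_E] .

lemma incl_linear: "linear_on H f \<Longrightarrow> linear_on (fun_alg G) (\<lambda>u. f (\<iota> u))"
  using incl_hopf incl_closed by (simp add: linear_on_def hopf_map_iff ring_hom_def)

lemma incl_mult:
  "f \<in> funs_on (carrier G) \<Longrightarrow> g \<in> funs_on (carrier G) \<Longrightarrow> \<iota> (\<lambda>a. f a * g a) = \<iota> f \<bullet> \<iota> g"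
  and incl_one: "\<iota> (\<lambda>a. if a \<in> carrier G then 1 else 0) = \<one>\<^bsub>H\<^esub>"
  using incl_hopf by (auto simp: hopf_map_iff ring_hom_def)

lemma incl_zero: "\<iota> (\<lambda>a. 0) = \<zero>\<^bsub>H\<^esub>"
proof -
  have z: "(\<lambda>a. 0) \<in> funs_on (carrier G)" by (simp add: funs_on_def)
  have "\<forall>c. \<forall>a\<in>carrier (fun_alg G). \<iota> (c \<odot>\<^bsub>fun_alg G\<^esub> a) = c \<odot>\<^bsub>H\<^esub> \<iota> a"
    using incl_hopf unfolding hopf_map_iff by blast
  from this[rule_format, of "\<lambda>a. 0" 0] have "\<iota> (\<lambda>a. 0) = 0 \<odot>\<^bsub>H\<^esub> \<iota> (\<lambda>a. 0)" using z by simp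
  then show ?thesis using vs.smult_l_null[OF incl_closed[OF z]] by simp
qed

interpretation A: fun_space "fun_alg G :: ('k, 'g \<Rightarrow> 'k) bialg" "carrier G"
  by (rule fun_space_fun_alg) simp

lemma incl_expand:
  assumes "linear_on H f" "u \<in> funs_on (carrier G)"
  shows "f (\<iota> u) = (\<Sum>a\<in>carrier G. u a * f (e a))"
  using A.linear_on_expand[OF incl_linear[OF assms(1)]] assms(2) by (simp add: e_def)

lemma counit_incl: "u \<in> funs_on (carrier G) \<Longrightarrow> counit H (\<iota> u) = u \<one>\<^bsub>G\<^esub>"
  using incl_hopf by (simp add: hopf_map_iff)

lemma e_closed [simp]: "a \<in> carrier G \<Longrightarrow> e a \<in> carrier H"
  by (simp add: e_def incl_closed)

lemma e_mult:
  assumes "a \<in> carrier G" "b \<in> carrier G"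
  shows "e a \<bullet> e b = (if a = b then e a else \<zero>\<^bsub>H\<^esub>)"
proof -
  have "e a \<bullet> e b = \<iota> (\<lambda>x. delta a x * delta b x)"
    using assms by (simp add: e_def incl_mult)
  also have "(\<lambda>x. delta a x * delta b x) = (if a = b then delta a else (\<lambda>x. 0))"
    by (auto simp: delta_def)
  finally show ?thesis by (simp add: e_def incl_zero)
qed

lemma e_nonzero:
  assumes "a \<in> carrier G"
  shows "e a \<noteq> \<zero>\<^bsub>H\<^esub>"
proof
  assume "e a = \<zero>\<^bsub>H\<^esub>"
  then have "\<iota> (delta a) = \<iota> (\<lambda>x. 0)" by (simp add: e_def incl_zero)
  then have "delta a = (\<lambda>x. 0 :: 'k)"
    by (rule inj_onD[OF incl_inj]) (use assms in \<open>auto simp: funs_on_def delta_def\<close>)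
  from fun_cong[OF this, of a] show False by (simp add: delta_def)
qed

lemma counit_e: "a \<in> carrier G \<Longrightarrow> counit H (e a) = (if a = \<one>\<^bsub>G\<^esub> then 1 else 0)"
  by (simp add: e_def counit_incl) (auto simp: delta_def)

text \<open>The idempotents \<open>e a\<close> add up to the unit of \<open>H\<close>.\<close>

lemma e_sum:
  assumes f: "linear_on H f" and h: "h \<in> carrier H"
  shows "f h = (\<Sum>a\<in>carrier G. f (h \<bullet> e a))"
proof -
  have "f h = f (h \<bullet> \<iota> (\<lambda>a. if a \<in> carrier G then 1 else 0))" using h by (simp add: incl_one)
  also have "\<dots> = (\<Sum>a\<in>carrier G. (if a \<in> carrier G then 1 else 0) * f (h \<bullet> e a))"
    by (rule incl_expand[OF linear_functional_mult(1)[OF f h]]) (simp add: funs_on_def)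
  finally show ?thesis by simp
qed

lemma sw_e:
  assumes B: "bilinear_on H B" and a: "a \<in> carrier G"
  shows "sw (e a) B = (\<Sum>b\<in>carrier G. B (e b) (e (inv\<^bsub>G\<^esub> b \<otimes>\<^bsub>G\<^esub> a)))"
proof -
  have "tensor_eq H 2 (comult H (e a)) (map_tensor \<iota> (comult (fun_alg G) (delta a)))"
    using incl_hopf a by (simp add: e_def hopf_map_iff)
  then have "sw (e a) B = sweedler (map_tensor \<iota> (comult (fun_alg G) (delta a))) B"
    by (rule sw_bilinear[OF B])
  also have "\<dots> = (\<Sum>b\<in>carrier G. \<Sum>c\<in>carrier G. delta a (b \<otimes>\<^bsub>G\<^esub> c) * B (e b) (e c))"
    by (simp add: sweedler_map_tensor[OF fun_alg_tensors] sweedler_fun_alg e_def)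
  also have "\<dots> = (\<Sum>b\<in>carrier G. \<Sum>c\<in>carrier G. if c = inv\<^bsub>G\<^esub> b \<otimes>\<^bsub>G\<^esub> a then B (e b) (e (inv\<^bsub>G\<^esub> b \<otimes>\<^bsub>G\<^esub> a)) else 0)"
    by (intro sum.cong refl) (use a in \<open>auto simp: delta_def G.m_assoc[symmetric]\<close>)
  finally show ?thesis using a by simp
qed

lemma proj_closed: "h \<in> carrier H \<Longrightarrow> \<pi> h \<in> funs_on (carrier C)"
  using proj_surj by auto

lemma proj_linear: "linear_on H (\<lambda>h. \<pi> h c)"
  using proj_hopf by (simp add: linear_on_def hopf_map_iff ring_hom_def)

lemmas proj_add = linear_simps(1)[OF proj_linear] and proj_smult = linear_simps(2)[OF proj_linear]

lemma proj_mult: "a \<in> carrier H \<Longrightarrow> b \<in> carrier H \<Longrightarrow> c \<in> carrier C \<Longrightarrow> \<pi> (a \<bullet> b) c = conv (\<pi> a) (\<pi> b) c"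
  using proj_hopf by (simp add: hopf_map_iff ring_hom_def group_alg_mult)

lemma proj_one: "\<pi> \<one>\<^bsub>H\<^esub> = delta \<one>"
  using proj_hopf by (simp add: hopf_map_iff ring_hom_def)

lemma counit_proj: "h \<in> carrier H \<Longrightarrow> counit H h = (\<Sum>c\<in>carrier C. \<pi> h c)"
  using proj_hopf by (simp add: hopf_map_iff)

lemma sw_proj:
  assumes h: "h \<in> carrier H" and c: "c \<in> carrier C" "d \<in> carrier C"
  shows "sw h (\<lambda>x y. \<pi> x c * \<pi> y d) = (if c = d then \<pi> h c else 0)"
proof -
  have "tensor_eq (group_alg C) 2 (comult (group_alg C) (\<pi> h)) (map_tensor \<pi> (comult H h))"
    using proj_hopf h by (simp add: hopf_map_iff)
  moreover have "bilinear_on (group_alg C) (\<lambda>u v. u c * v d)"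
    by (simp add: bilinear_on_def linear_on_def algebra_simps)
  ultimately have "sweedler (comult (group_alg C) (\<pi> h)) (\<lambda>u v. u c * v d) = sweedler (map_tensor \<pi> (comult H h)) (\<lambda>u v. u c * v d)"
    unfolding bilinear_on_iff tensor_eq_iff sweedler_def by blast
  then show ?thesis using c by (simp add: sweedler_map_tensor[OF comult_H[OF h]] group_alg_coords)
qed

text \<open>For a other than 1, the element \<open>e a\<close> is \<iota>(f) 1 with f(1) = 0, hence
  in the kernel; the value at the identity of \<open>G\<close> follows because all the
  \<open>e a\<close> add up to 1.\<close>

lemma proj_e:
  assumes a: "a \<in> carrier G" and c: "c \<in> carrier C"
  shows "\<pi> (e a) c = (if a = \<one>\<^bsub>G\<^esub> \<and> c = \<one> then 1 else 0)"
proof -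
  have zero: "\<pi> (e a) = (\<lambda>x. 0)" if "a \<in> carrier G" "a \<noteq> \<one>\<^bsub>G\<^esub>" for a
  proof -
    have "e a = \<iota> (delta a) \<bullet> \<one>\<^bsub>H\<^esub>" "delta a \<in> funs_on (carrier G)" "delta a \<one>\<^bsub>G\<^esub> = (0 :: 'k)"
      using that e_closed[OF that(1)] by (auto simp: e_def delta_def funs_on_def)
    then have "e a \<in> {\<iota> f \<bullet> h | f h. f \<in> funs_on (carrier G) \<and> f \<one>\<^bsub>G\<^esub> = 0 \<and> h \<in> carrier H}"
      by (intro CollectI exI[of _ "delta a"] exI[of _ "\<one>\<^bsub>H\<^esub>"]) simp
    then have "e a \<in> {h \<in> carrier H. \<pi> h = (\<lambda>x. 0)}" unfolding proj_kernel by (rule generate.incl)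
    then show ?thesis by simp
  qed
  show ?thesis
  proof (cases "a = \<one>\<^bsub>G\<^esub>")
    case True
    have "\<pi> \<one>\<^bsub>H\<^esub> c = (\<Sum>b\<in>carrier G. \<pi> (\<one>\<^bsub>H\<^esub> \<bullet> e b) c)" by (rule e_sum[OF proj_linear]) simp
    also have "\<dots> = (\<Sum>b\<in>carrier G. if b = \<one>\<^bsub>G\<^esub> then \<pi> (e \<one>\<^bsub>G\<^esub>) c else 0)"
      by (intro sum.cong refl) (auto simp: zero)
    also have "\<dots> = \<pi> (e \<one>\<^bsub>G\<^esub>) c" by simp
    finally show ?thesis using True by (simp add: proj_one delta_def)
  qed (use zero a in simp)
qed

text \<open>The generators \<iota>(f) h of the kernel satisfy f p_1 = 0. With
  \<open>proj_mult_e_one\<close>, the fibre over 1 becomes a copy of kC: multiplication by e_1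
  forgets exactly what \<pi> forgets.\<close>

lemma mult_e_one_zero:
  assumes h: "h \<in> carrier H" "\<pi> h = (\<lambda>x. 0)"
  shows "h \<bullet> e \<one>\<^bsub>G\<^esub> = \<zero>\<^bsub>H\<^esub>"
proof -
  let ?S = "{\<iota> f \<bullet> h | f h. f \<in> funs_on (carrier G) \<and> f \<one>\<^bsub>G\<^esub> = 0 \<and> h \<in> carrier H}"
  have base: "k \<in> carrier H \<and> k \<bullet> e \<one>\<^bsub>G\<^esub> = \<zero>\<^bsub>H\<^esub>" if "k \<in> ?S" for k
  proof -
    obtain f h where f: "k = \<iota> f \<bullet> h" "f \<in> funs_on (carrier G)" "f \<one>\<^bsub>G\<^esub> = 0" "h \<in> carrier H"
      using \<open>k \<in> ?S\<close> by blast
    have "\<iota> f \<bullet> e \<one>\<^bsub>G\<^esub> = \<iota> (\<lambda>x. f x * delta \<one>\<^bsub>G\<^esub> x)" using f by (simp add: e_def incl_mult)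
    also have "(\<lambda>x. f x * delta \<one>\<^bsub>G\<^esub> x) = (\<lambda>x. 0)" using f by (auto simp: delta_def)
    finally have "\<iota> f \<bullet> e \<one>\<^bsub>G\<^esub> = \<zero>\<^bsub>H\<^esub>" by (simp add: incl_zero)
    moreover have "k \<bullet> e \<one>\<^bsub>G\<^esub> = (\<iota> f \<bullet> e \<one>\<^bsub>G\<^esub>) \<bullet> h"
      using f incl_closed[OF f(2)] by (simp add: H.m_ac)
    ultimately show ?thesis using f incl_closed[OF f(2)] by simp
  qed
  have "h \<in> generate (add_monoid H) ?S" using h unfolding proj_kernel[symmetric] by simp
  then have "h \<in> carrier H \<and> h \<bullet> e \<one>\<^bsub>G\<^esub> = \<zero>\<^bsub>H\<^esub>"
  proof induction
    case one
    show ?case by simp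
  next
    case (incl k)
    then show ?case by (rule base)
  next
    case (eng h1 h2)
    then show ?case by (simp add: H.l_distr)
  next
    case (inv k)
    then show ?case using base[of k] by (simp add: a_inv_def[symmetric] H.l_minus)
  qed
  then show ?thesis by simp
qed

definition lift :: "'c \<Rightarrow> 'h" where "lift c = (SOME h. h \<in> carrier H \<and> \<pi> h = delta c)"

lemma lift:
  assumes "c \<in> carrier C"
  shows "lift c \<in> carrier H" "\<pi> (lift c) = delta c"
proof -
  have "delta c \<in> \<pi> ` carrier H" unfolding proj_surj using assms by simp
  then have "\<exists>h. h \<in> carrier H \<and> \<pi> h = delta c" by (elim imageE) auto
  from someI_ex[OF this] show "lift c \<in> carrier H" "\<pi> (lift c) = delta c" unfolding lift_def by simp_all
qed

text \<open>Independent of the choice made in \<open>lift\<close>, since two lifts differ by an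
  element of the kernel, which e_1 annihilates. These elements are the basis of the fibre over 1
  that \<pi> sends to the elements of \<open>C\<close>.\<close>

definition s :: "'c \<Rightarrow> 'h" where "s c = lift c \<bullet> e \<one>\<^bsub>G\<^esub>"

lemma proj_mult_e_one:
  assumes "h \<in> carrier H" "c \<in> carrier C"
  shows "\<pi> (h \<bullet> e \<one>\<^bsub>G\<^esub>) c = \<pi> h c"
proof -
  have "\<pi> (h \<bullet> e \<one>\<^bsub>G\<^esub>) c = conv (\<pi> (e \<one>\<^bsub>G\<^esub>)) (\<pi> h) c"
    using assms by (simp add: proj_mult conv_comm)
  also have "\<dots> = conv (\<lambda>x. if x = \<one> then 1 else 0) (\<pi> h) c"
    by (rule conv_cong) (use assms in \<open>auto simp: proj_e\<close>)
  also have "\<dots> = \<pi> h c" using assms by (simp add: conv_delta)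
  finally show ?thesis .
qed

lemma s_closed: "c \<in> carrier C \<Longrightarrow> s c \<in> carrier H"
  and proj_s: "c \<in> carrier C \<Longrightarrow> d \<in> carrier C \<Longrightarrow> \<pi> (s c) d = delta c d"
  using lift[of c] proj_mult_e_one[of "lift c" d] by (simp_all add: s_def)

text \<open>The difference of \<open>y\<close> and \<open>?z\<close> is killed by \<pi>, hence by
  e_1.\<close>

lemma mult_e_one_expand:
  assumes f: "linear_on H f" and y: "y \<in> carrier H"
  shows "f (y \<bullet> e \<one>\<^bsub>G\<^esub>) = (\<Sum>c\<in>carrier C. \<pi> y c * f (s c))"
proof -
  let ?e = "e \<one>\<^bsub>G\<^esub>"
  let ?z = "finsum H (\<lambda>c. \<pi> y c \<odot>\<^bsub>H\<^esub> s c) (carrier C)"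
  have sc: "(\<lambda>c. \<pi> y c \<odot>\<^bsub>H\<^esub> s c) \<in> carrier C \<rightarrow> carrier H" using s_closed by auto
  have zc: "?z \<in> carrier H" using sc by (rule vs.finsum_closed)
  have fin: "g ?z = (\<Sum>c\<in>carrier C. \<pi> y c * g (s c))" if "linear_on H g" for g
    using vs.linear_on_finsum[OF that finite_C sc] linear_simps(2)[OF that] s_closed by simp
  have "\<pi> (y \<ominus>\<^bsub>H\<^esub> ?z) d = 0" for d
  proof (cases "d \<in> carrier C")
    case True
    have "\<pi> (y \<ominus>\<^bsub>H\<^esub> ?z) d = \<pi> y d - (\<Sum>c\<in>carrier C. \<pi> y c * \<pi> (s c) d)"
      using vs.linear_on_minus[OF proj_linear y zc] fin[OF proj_linear] by simp
    also have "(\<Sum>c\<in>carrier C. \<pi> y c * \<pi> (s c) d) = (\<Sum>c\<in>carrier C. if c = d then \<pi> y d else 0)"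
      by (intro sum.cong refl) (use True in \<open>auto simp: proj_s delta_def\<close>)
    finally show ?thesis using True by simp
  next
    case False
    then show ?thesis using proj_closed[of "y \<ominus>\<^bsub>H\<^esub> ?z"] y zc by (simp add: funs_on_def)
  qed
  then have "\<pi> (y \<ominus>\<^bsub>H\<^esub> ?z) = (\<lambda>x. 0)" by (simp add: fun_eq_iff)
  then have "(y \<ominus>\<^bsub>H\<^esub> ?z) \<bullet> ?e = \<zero>\<^bsub>H\<^esub>" using y zc by (intro mult_e_one_zero) auto
  moreover have "f ((y \<ominus>\<^bsub>H\<^esub> ?z) \<bullet> ?e) = f (y \<bullet> ?e) - (\<Sum>c\<in>carrier C. \<pi> y c * f (s c \<bullet> ?e))"
    using vs.linear_on_minus[OF linear_functional_mult(2)[OF f, of ?e] y zc] fin[OF linear_functional_mult(2)[OF f, of ?e]] by simp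
  moreover have "s c \<bullet> ?e = s c" if "c \<in> carrier C" for c
    using lift(1)[OF that] by (simp add: s_def H.m_assoc e_mult)
  ultimately show ?thesis using vs.linear_on_zero[OF f] by simp
qed

text \<open>The part of the rule S(e_c) = e_(c^(-1)) that is used later. The antipode axiom at e_b
  with b = ca, where the counit is 0, makes the sum of the S(e_d) e_(d^(-1) b) vanish, and
  multiplication by e_a leaves only d = c.\<close>

lemma S_e:
  assumes a: "a \<in> carrier G" and c: "c \<in> carrier G" "c \<noteq> inv\<^bsub>G\<^esub> a"
  shows "S (e c) \<bullet> e a = \<zero>\<^bsub>H\<^esub>"
proof (rule vs.eq_if_functionals_eq)
  show "S (e c) \<bullet> e a \<in> carrier H" using a c by (simp add: S_simps)
  fix f assume f: "linear_on H f"
  let ?b = "c \<otimes>\<^bsub>G\<^esub> a"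
  have b: "?b \<noteq> \<one>\<^bsub>G\<^esub>" using a c by (metis G.inv_equality)
  have l: "linear_on H (\<lambda>x. f (x \<bullet> e a))" using a by (rule linear_functional_mult(2)[OF f e_closed])
  have "(\<Sum>d\<in>carrier G. f (S (e d) \<bullet> e (inv\<^bsub>G\<^esub> d \<otimes>\<^bsub>G\<^esub> ?b) \<bullet> e a)) = sw (e ?b) (\<lambda>x y. f (S x \<bullet> y \<bullet> e a))"
    using a c f by (intro sw_e[symmetric]) (simp_all add: bilinear_on_def multilinear_simps)
  also have "\<dots> = 0"
    using sw_antipode(1)[OF l, of "e ?b"] a c b by (simp add: counit_e)
  finally have "(\<Sum>d\<in>carrier G. f (S (e d) \<bullet> e (inv\<^bsub>G\<^esub> d \<otimes>\<^bsub>G\<^esub> ?b) \<bullet> e a)) = 0" .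
  moreover have "f (S (e d) \<bullet> e (inv\<^bsub>G\<^esub> d \<otimes>\<^bsub>G\<^esub> ?b) \<bullet> e a) = (if d = c then f (S (e c) \<bullet> e a) else 0)"
    if d: "d \<in> carrier G" for d
  proof -
    have "inv\<^bsub>G\<^esub> d \<otimes>\<^bsub>G\<^esub> ?b = a \<longleftrightarrow> d = c"
      using a c d G.inv_solve_left'[of a d ?b] by (auto simp: G.r_cancel)
    then show ?thesis
      using a c d vs.linear_on_zero[OF f] by (auto simp: H.m_assoc S_simps e_mult)
  qed
  ultimately show "f (S (e c) \<bullet> e a) = f \<zero>\<^bsub>H\<^esub>"
    using c vs.linear_on_zero[OF f] by simp
qed simp

text \<open>The functional \<open>N g f a x h = \<Sum> g (e\<^sub>a x S(h\<^sub>1)) f (h\<^sub>2 e\<^sub>a)\<close> undoes the canonical map of the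
  torsor \<open>H e\<^sub>a\<close>; it only sees the component \<open>h e\<^sub>1\<close> of \<open>h\<close>, which is determined by \<open>\<pi> h\<close>.\<close>

definition N where "N g f a x h = sw h (\<lambda>h1 h2. g (e a \<bullet> x \<bullet> S h1) * f (h2 \<bullet> e a))"

context
  fixes g f :: "'h \<Rightarrow> 'k" and a
  assumes g: "linear_on H g" and f: "linear_on H f" and a: "a \<in> carrier G"
begin

lemma N_bilinear_inner:
  assumes x: "x \<in> carrier H"
  shows "bilinear_on H (\<lambda>h1 h2. g (e a \<bullet> x \<bullet> S h1) * f (h2 \<bullet> e a))"
  using x a linear_simps[OF g] linear_simps[OF f] by (simp add: bilinear_on_def multilinear_simps algebra_simps)

lemma N_linear:
  assumes x: "x \<in> carrier H"
  shows "linear_on H (N g f a x)"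
  unfolding N_def using x by (intro linear_sw N_bilinear_inner)

lemma N_linear': "h \<in> carrier H \<Longrightarrow> linear_on H (\<lambda>x. N g f a x h)"
  unfolding N_def
  using a linear_simps[OF g] linear_simps[OF f] by (intro linear_sw_param) (simp_all add: multilinear_simps algebra_simps)

text \<open>Write h as the sum of the h e_b. The legs of e_b are e_d and e_(d^(-1) b); the first
  survives only for d = a^(-1) and the second only for d^(-1) b = a, so only b = 1
  contributes.\<close>

lemma N_e_one:
  assumes x: "x \<in> carrier H" and h: "h \<in> carrier H"
  shows "N g f a x h = N g f a x (h \<bullet> e \<one>\<^bsub>G\<^esub>)"
proof -
  have "N g f a x (h \<bullet> e b) = 0" if b: "b \<in> carrier G" "b \<noteq> \<one>\<^bsub>G\<^esub>" for b
  proof -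
    have "N g f a x (h \<bullet> e b) = sw h (\<lambda>h1 h2. sw (e b) (\<lambda>u v.
        g (e a \<bullet> x \<bullet> S (h1 \<bullet> u)) * f ((h2 \<bullet> v) \<bullet> e a)))"
      unfolding N_def by (rule sw_mult[OF N_bilinear_inner[OF x] h]) (use b in simp)
    also have "\<dots> = sw h (\<lambda>h1 h2. 0)"
    proof (rule sw_cong[OF h])
      fix h1 h2 assume m: "h1 \<in> carrier H" "h2 \<in> carrier H"
      have "sw (e b) (\<lambda>u v. g (e a \<bullet> x \<bullet> S (h1 \<bullet> u)) * f ((h2 \<bullet> v) \<bullet> e a)) =
        (\<Sum>d\<in>carrier G. g (e a \<bullet> x \<bullet> S (h1 \<bullet> e d)) * f ((h2 \<bullet> e (inv\<^bsub>G\<^esub> d \<otimes>\<^bsub>G\<^esub> b)) \<bullet> e a))"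
        by (rule sw_e[OF _ b(1)])
          (use m a x linear_simps[OF g] linear_simps[OF f] in \<open>simp add: bilinear_on_def multilinear_simps algebra_simps\<close>)
      also have "\<dots> = 0"
      proof (intro sum.neutral ballI)
        fix d assume d: "d \<in> carrier G"
        show "g (e a \<bullet> x \<bullet> S (h1 \<bullet> e d)) * f ((h2 \<bullet> e (inv\<^bsub>G\<^esub> d \<otimes>\<^bsub>G\<^esub> b)) \<bullet> e a) = 0"
        proof (cases "d = inv\<^bsub>G\<^esub> a")
          case False
          have "e a \<bullet> x \<bullet> S (h1 \<bullet> e d) = (x \<bullet> S h1) \<bullet> (S (e d) \<bullet> e a)"
            using a d m x by (simp add: S_mult S_closed H.m_ac)
          then have "e a \<bullet> x \<bullet> S (h1 \<bullet> e d) = \<zero>\<^bsub>H\<^esub>"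
            using S_e[OF a d False] x m by (simp add: S_closed)
          then show ?thesis using vs.linear_on_zero[OF g] by simp
        next
          case True
          have "inv\<^bsub>G\<^esub> d \<otimes>\<^bsub>G\<^esub> b \<noteq> a" using a b True by simp
          then have "(h2 \<bullet> e (inv\<^bsub>G\<^esub> d \<otimes>\<^bsub>G\<^esub> b)) \<bullet> e a = \<zero>\<^bsub>H\<^esub>"
            using a b d m by (simp add: H.m_assoc e_mult)
          then show ?thesis using vs.linear_on_zero[OF f] by simp
        qed
      qed
      finally show "sw (e b) (\<lambda>u v. g (e a \<bullet> x \<bullet> S (h1 \<bullet> u)) * f ((h2 \<bullet> v) \<bullet> e a)) = 0" .
    qed
    finally show ?thesis by (simp add: sweedler_def tensor_eval_def)
  qed
  then have "(\<Sum>b\<in>carrier G. N g f a x (h \<bullet> e b)) = (\<Sum>b\<in>carrier G. if b = \<one>\<^bsub>G\<^esub> then N g f a x (h \<bullet> e \<one>\<^bsub>G\<^esub>) else 0)"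
    by (intro sum.cong) auto
  then show ?thesis using e_sum[OF N_linear[OF x] h] by simp
qed

lemma N_expand:
  assumes x: "x \<in> carrier H" and h: "h \<in> carrier H"
  shows "N g f a x h = (\<Sum>c\<in>carrier C. \<pi> h c * N g f a x (s c))"
  using N_e_one[OF assms] mult_e_one_expand[OF N_linear[OF x] h] by simp

text \<open>\<pi>(1) is the delta function at the identity, so the expansion of \<open>N\<close> at
  the unit of \<open>H\<close> has the single term \<open>s \<one>\<close>.\<close>

lemma N_one:
  assumes x: "x \<in> carrier H"
  shows "N g f a x (s \<one>) = g (e a \<bullet> x) * f (e a)"
proof -
  have "N g f a x \<one>\<^bsub>H\<^esub> = (\<Sum>c\<in>carrier C. if c = \<one> then N g f a x (s \<one>) else 0)"
    unfolding N_expand[OF x H.one_closed] by (intro sum.cong refl) (auto simp: proj_one delta_def)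
  moreover have "N g f a x \<one>\<^bsub>H\<^esub> = g (e a \<bullet> x) * f (e a)"
    unfolding N_def using x a by (subst sw_one[OF N_bilinear_inner]) (simp_all add: S_one)
  ultimately show ?thesis by simp
qed

end

text \<open>The coaction condition r_1 \<otimes> \<pi>(r_2) = r \<otimes> c, tested on functionals
  of the first leg and on coordinates of the second.\<close>

definition homogeneous :: "'c \<Rightarrow> 'h \<Rightarrow> bool" where
  "homogeneous c r \<longleftrightarrow> r \<in> carrier H \<and> (\<forall>f. linear_on H f \<longrightarrow> (\<forall>d\<in>carrier C.
    sw r (\<lambda>y z. f y * \<pi> z d) = (if d = c then f r else 0)))"

lemma homogeneousD:
  "homogeneous c r \<Longrightarrow> r \<in> carrier H"
  "homogeneous c r \<Longrightarrow> linear_on H f \<Longrightarrow> d \<in> carrier C \<Longrightarrow> sw r (\<lambda>y z. f y * \<pi> z d) = (if d = c then f r else 0)"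
  by (simp_all add: homogeneous_def)

text \<open>The component of degree 1 of \<open>H e\<^sub>a\<close> is a line.\<close>

lemma homogeneous_one_e:
  assumes r: "homogeneous \<one> r" and a: "a \<in> carrier G" and f: "linear_on H f" "f (e a) = 1"
  shows "r \<bullet> e a = f (r \<bullet> e a) \<odot>\<^bsub>H\<^esub> e a"
proof (rule vs.eq_if_functionals_eq)
  note rc = homogeneousD(1)[OF r]
  show "r \<bullet> e a \<in> carrier H" "f (r \<bullet> e a) \<odot>\<^bsub>H\<^esub> e a \<in> carrier H" using rc a by auto
  fix g assume g: "linear_on H g"
  \<comment> \<open>The sum of g(e_a r_1 S(r_2)) f(r_3 e_a) is computed twice. The antipode
    contracts the first two legs; on the other hand \<open>N_expand\<close> and the degree of r
    replace the last two by \<open>s \<one>\<close>.\<close>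
  have "sw r (\<lambda>x y. N g f a x y) = sw r (\<lambda>x y. sw x (\<lambda>x1 x2. g (e a \<bullet> x1 \<bullet> S x2) * f (y \<bullet> e a)))"
    unfolding N_def
    by (rule sw_coassoc[symmetric, OF _ rc])
      (use a linear_simps[OF g] linear_simps[OF f(1)] in \<open>simp add: trilinear_on_def multilinear_simps algebra_simps\<close>)
  also have "\<dots> = sw r (\<lambda>x y. counit H x * (g (e a) * f (y \<bullet> e a)))"
  proof (rule sw_cong[OF rc])
    fix x y assume m: "x \<in> carrier H" "y \<in> carrier H"
    have "sw x (\<lambda>x1 x2. g (e a \<bullet> x1 \<bullet> S x2) * f (y \<bullet> e a)) = sw x (\<lambda>x1 x2. f (y \<bullet> e a) * g (e a \<bullet> (x1 \<bullet> S x2)))"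
      using m a by (intro sw_cong) (simp_all add: S_closed H.m_assoc)
    also have "\<dots> = f (y \<bullet> e a) * (counit H x * g (e a \<bullet> \<one>\<^bsub>H\<^esub>))"
      unfolding sweedler_fun_mult
      using sw_antipode(2)[OF linear_functional_mult(1)[OF g e_closed[OF a]] m(1)] by simp
    finally show "sw x (\<lambda>x1 x2. g (e a \<bullet> x1 \<bullet> S x2) * f (y \<bullet> e a)) = counit H x * (g (e a) * f (y \<bullet> e a))"
      using a by simp
  qed
  also have "\<dots> = g (e a) * f (r \<bullet> e a)"
    by (rule sw_counit(1)[OF _ rc]) (use a linear_simps[OF f(1)] in \<open>simp add: multilinear_simps algebra_simps\<close>)
  finally have 1: "sw r (\<lambda>x y. N g f a x y) = g (e a) * f (r \<bullet> e a)" .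
  have "sw r (\<lambda>x y. N g f a x y) = sw r (\<lambda>x y. \<Sum>c\<in>carrier C. N g f a x (s c) * \<pi> y c)"
    by (rule sw_cong[OF rc]) (simp add: N_expand[OF g f(1) a] mult.commute)
  also have "\<dots> = (\<Sum>c\<in>carrier C. if c = \<one> then N g f a r (s \<one>) else 0)"
    unfolding sweedler_fun_sum
    by (intro sum.cong refl)
      (auto simp: homogeneousD(2)[OF r N_linear'[OF g f(1) a s_closed]])
  also have "\<dots> = g (r \<bullet> e a)"
    using rc a f(2) by (simp add: N_one[OF g f(1) a rc] H.m_comm)
  finally show "g (r \<bullet> e a) = g (f (r \<bullet> e a) \<odot>\<^bsub>H\<^esub> e a)"
    using 1 a linear_simps(2)[OF g e_closed[OF a]] by (simp add: mult.commute)
qed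

text \<open>The projection h_1 \<pi>(h_2)(c) of h to the part of degree c.\<close>

definition comp :: "'c \<Rightarrow> 'h \<Rightarrow> 'h" where
  "comp c h = lin_val H (\<lambda>w. \<pi> (w ! 1) c \<odot>\<^bsub>H\<^esub> (w ! 0)) (comult H h)"

lemma comp_closed: "h \<in> carrier H \<Longrightarrow> comp c h \<in> carrier H"
  unfolding comp_def by (rule linear_lin_val(2)[OF counit_linear]) auto

lemma comp_apply:
  assumes "linear_on H f" "h \<in> carrier H"
  shows "f (comp c h) = sw h (\<lambda>y z. f y * \<pi> z c)"
proof -
  have "f (comp c h) = sw h (\<lambda>y z. f (\<pi> z c \<odot>\<^bsub>H\<^esub> y))"
    unfolding comp_def by (rule linear_lin_val(1)[OF assms, of "\<lambda>y z. \<pi> z c \<odot>\<^bsub>H\<^esub> y"]) simp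
  also have "\<dots> = sw h (\<lambda>y z. f y * \<pi> z c)"
    by (rule sw_cong[OF assms(2)]) (simp add: linear_simps[OF assms(1)])
  finally show ?thesis .
qed

lemma proj_bilinear: "linear_on H f \<Longrightarrow> bilinear_on H (\<lambda>y z. f y * \<pi> z c)"
  by (simp add: bilinear_on_def linear_on_def proj_add proj_smult algebra_simps)

lemma comp_linear: "linear_on H f \<Longrightarrow> linear_on H (\<lambda>h. f (comp c h))"
  using linear_sw[OF proj_bilinear, of f c] by (simp add: comp_apply linear_on_def)

text \<open>The counit of \<open>H\<close> is the sum of the coordinates of \<pi>, so summing over c
  contracts the second leg with the counit.\<close>

lemma comp_sum:
  assumes f: "linear_on H f" and h: "h \<in> carrier H"
  shows "f h = (\<Sum>c\<in>carrier C. f (comp c h))"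
proof -
  have "(\<Sum>c\<in>carrier C. f (comp c h)) = sw h (\<lambda>y z. \<Sum>c\<in>carrier C. f y * \<pi> z c)"
    by (simp add: comp_apply[OF f h] sweedler_fun_sum)
  also have "\<dots> = sw h (\<lambda>y z. counit H z * f y)"
    by (rule sw_cong[OF h]) (simp add: counit_proj sum_distrib_left mult.commute)
  finally show ?thesis using sw_counit(2)[OF f h] by simp
qed

text \<open>Coassociativity moves both coactions to the last legs, where the elements of
  \<open>C\<close> are grouplike in kC.\<close>

lemma comp_homogeneous:
  assumes h: "h \<in> carrier H" and c: "c \<in> carrier C"
  shows "homogeneous c (comp c h)"
  unfolding homogeneous_def
proof (intro conjI allI impI ballI comp_closed[OF h])
  fix f d assume f: "linear_on H f" and d: "d \<in> carrier C"
  let ?g = "\<lambda>h. sw h (\<lambda>y z. f y * \<pi> z d)"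
  have "?g (comp c h) = sw h (\<lambda>y z. sw y (\<lambda>y1 y2. f y1 * \<pi> y2 d) * \<pi> z c)"
    by (rule comp_apply[OF linear_sw[OF proj_bilinear[OF f]] h])
  also have "\<dots> = sw h (\<lambda>y z. sw y (\<lambda>y1 y2. f y1 * \<pi> y2 d * \<pi> z c))"
    by (simp add: sweedler_fun_mult_right)
  also have "\<dots> = sw h (\<lambda>y z. sw z (\<lambda>z1 z2. f y * \<pi> z1 d * \<pi> z2 c))"
    by (rule sw_coassoc[OF _ h])
      (use linear_simps[OF f] in \<open>simp add: trilinear_on_def linear_on_def proj_add proj_smult algebra_simps\<close>)
  also have "\<dots> = sw h (\<lambda>y z. f y * (if d = c then \<pi> z c else 0))"
    by (rule sw_cong[OF h]) (use c d in \<open>simp add: mult.assoc sweedler_fun_mult sw_proj\<close>)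
  also have "\<dots> = (if d = c then f (comp c h) else 0)"
    by (simp add: comp_apply[OF f h] sweedler_def tensor_eval_def)
  finally show "?g (comp c h) = (if d = c then f (comp c h) else 0)" .
qed

lemma comp_apply_homogeneous:
  "homogeneous d r \<Longrightarrow> linear_on H f \<Longrightarrow> c \<in> carrier C \<Longrightarrow> f (comp c r) = (if c = d then f r else 0)"
  using homogeneousD comp_apply by simp

lemma homogeneous_one: "homogeneous \<one> \<one>\<^bsub>H\<^esub>"
  unfolding homogeneous_def
  using sw_one[OF proj_bilinear] by (simp add: proj_one delta_def)

text \<open>Of the legs e_b and e_(b^(-1) a) of e_a, the second is killed by \<pi> unless b = a,
  where it is e_1 and maps to the unit.\<close>

lemma homogeneous_e:
  assumes a: "a \<in> carrier G"
  shows "homogeneous \<one> (e a)"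
  unfolding homogeneous_def
proof (intro conjI allI impI ballI e_closed[OF a])
  fix f d assume f: "linear_on H f" and d: "d \<in> carrier C"
  have "sw (e a) (\<lambda>y z. f y * \<pi> z d) = (\<Sum>b\<in>carrier G. f (e b) * \<pi> (e (inv\<^bsub>G\<^esub> b \<otimes>\<^bsub>G\<^esub> a)) d)"
    by (rule sw_e[OF proj_bilinear[OF f] a])
  also have "\<dots> = (\<Sum>b\<in>carrier G. if b = a then if d = \<one> then f (e a) else 0 else 0)"
  proof (intro sum.cong refl)
    fix b assume b: "b \<in> carrier G"
    have "inv\<^bsub>G\<^esub> b \<otimes>\<^bsub>G\<^esub> a = \<one>\<^bsub>G\<^esub> \<longleftrightarrow> b = a" using a b G.inv_solve_left'[of "\<one>\<^bsub>G\<^esub>" b a] by auto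
    then show "f (e b) * \<pi> (e (inv\<^bsub>G\<^esub> b \<otimes>\<^bsub>G\<^esub> a)) d = (if b = a then if d = \<one> then f (e a) else 0 else 0)"
      using a b d by (auto simp: proj_e)
  qed
  finally show "sw (e a) (\<lambda>y z. f y * \<pi> z d) = (if d = \<one> then f (e a) else 0)" using a by simp
qed

text \<open>Multiplicativity of \<pi> makes the second leg a convolution, from which the degree of
  r' selects one term.\<close>

lemma homogeneous_mult:
  assumes r: "homogeneous c r" and r2: "homogeneous d r'" and c: "c \<in> carrier C" and d: "d \<in> carrier C"
  shows "homogeneous (c \<otimes> d) (r \<bullet> r')"
  unfolding homogeneous_def
proof (intro conjI allI impI ballI)
  note rc = homogeneousD(1)[OF r] and rc2 = homogeneousD(1)[OF r2]
  show "r \<bullet> r' \<in> carrier H" using rc rc2 by simp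
  fix f k assume f: "linear_on H f" and k: "k \<in> carrier C"
  have inner: "sw r' (\<lambda>y' z'. f (y \<bullet> y') * \<pi> (z \<bullet> z') k) = f (y \<bullet> r') * \<pi> z (k \<otimes> inv d)"
    if m: "y \<in> carrier H" "z \<in> carrier H" for y z
  proof -
    have "sw r' (\<lambda>y' z'. f (y \<bullet> y') * \<pi> (z \<bullet> z') k) =
      sw r' (\<lambda>y' z'. \<Sum>x\<in>carrier C. \<pi> z (inv x \<otimes> k) * (f (y \<bullet> y') * \<pi> z' x))"
    proof (rule sw_cong[OF rc2])
      fix y' z' assume m': "y' \<in> carrier H" "z' \<in> carrier H"
      have "\<pi> (z \<bullet> z') k = conv (\<pi> z') (\<pi> z) k" using m m' k by (simp add: proj_mult conv_comm)
      then show "f (y \<bullet> y') * \<pi> (z \<bullet> z') k = (\<Sum>x\<in>carrier C. \<pi> z (inv x \<otimes> k) * (f (y \<bullet> y') * \<pi> z' x))"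
        by (simp add: conv_def sum_distrib_left ac_simps)
    qed
    also have "\<dots> = (\<Sum>x\<in>carrier C. if x = d then \<pi> z (inv d \<otimes> k) * f (y \<bullet> r') else 0)"
      unfolding sweedler_fun_sum sweedler_fun_mult
      by (intro sum.cong refl)
        (auto simp: homogeneousD(2)[OF r2 linear_functional_mult(1)[OF f m(1)]])
    also have "\<dots> = f (y \<bullet> r') * \<pi> z (k \<otimes> inv d)" using d k by (simp add: comm_C[of "inv d" k])
    finally show ?thesis .
  qed
  have B: "bilinear_on H (\<lambda>y z. f y * \<pi> z k)" by (rule proj_bilinear[OF f])
  have "sw (r \<bullet> r') (\<lambda>y z. f y * \<pi> z k) = sw r (\<lambda>y z. f (y \<bullet> r') * \<pi> z (k \<otimes> inv d))"
    unfolding sw_mult[OF B rc rc2] by (rule sw_cong[OF rc]) (rule inner)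
  also have "\<dots> = (if k \<otimes> inv d = c then f (r \<bullet> r') else 0)"
    by (rule homogeneousD(2)[OF r linear_functional_mult(2)[OF f rc2]]) (use d k in simp)
  also have "k \<otimes> inv d = c \<longleftrightarrow> k = c \<otimes> d"
    using c d k inv_solve_right'[of c k d] by auto
  finally show "sw (r \<bullet> r') (\<lambda>y z. f y * \<pi> z k) = (if k = c \<otimes> d then f (r \<bullet> r') else 0)" .
qed

lemma homogeneous_smult:
  assumes "homogeneous c r"
  shows "homogeneous c (k \<odot>\<^bsub>H\<^esub> r)"
  using assms unfolding homogeneous_def
  by (auto simp: sw_smult[OF proj_bilinear] linear_simps)

lemma homogeneous_pow:
  assumes "homogeneous c r" "c \<in> carrier C"
  shows "homogeneous (c [^] (i::nat)) (r [^]\<^bsub>H\<^esub> i)"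
proof (induction i)
  case 0
  show ?case by (simp add: homogeneous_one)
next
  case (Suc i)
  show ?case using homogeneous_mult[OF Suc assms(1)] assms(2) by simp
qed

end

section \<open>Points of a commutative extension\<close>

context comm_extension
begin

text \<open>Vanishing off the carrier makes equality of points an equality of functions, so that
  they can form the carrier of a group.\<close>

definition point :: "('h \<Rightarrow> 'k) \<Rightarrow> bool" where
  "point t \<longleftrightarrow> linear_on H t \<and> (\<forall>a\<in>carrier H. \<forall>b\<in>carrier H. t (a \<bullet> b) = t a * t b) \<and>
    t \<one>\<^bsub>H\<^esub> = 1 \<and> (\<forall>h. h \<notin> carrier H \<longrightarrow> t h = 0)"

lemma pointD:
  assumes "point t"
  shows "linear_on H t" "a \<in> carrier H \<Longrightarrow> b \<in> carrier H \<Longrightarrow> t (a \<bullet> b) = t a * t b"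
    "t \<one>\<^bsub>H\<^esub> = 1" "h \<notin> carrier H \<Longrightarrow> t h = 0"
  using assms by (simp_all add: point_def)

text \<open>For k of degree x and counit 1, the sum of the S(k_1) k_2 e_a is e_a, and k_2 may be
  replaced by its part of degree x. So some product y u e_a with u of degree x has a nonzero part of
  degree 1, and only the part of y of degree x^(-1) contributes to it.\<close>

lemma homogeneous_pair_exists:
  assumes a: "a \<in> carrier G" and x: "x \<in> carrier C"
  shows "\<exists>u v. homogeneous x u \<and> homogeneous (inv x) v \<and> v \<bullet> u \<bullet> e a \<noteq> \<zero>\<^bsub>H\<^esub>"
proof (rule ccontr)
  assume contra: "\<not> ?thesis"
  obtain f where f: "linear_on H f" "f (e a) = 1"
    using vs.functional_exists[OF e_closed[OF a] e_nonzero[OF a]] by blast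
  \<comment> \<open>Extracts the part of degree 1 before applying \<open>f\<close>.\<close>
  define f' where "f' h = f (comp \<one> h)" for h
  have f': "linear_on H f'" unfolding f'_def by (rule comp_linear[OF f(1)])
  have f'_hom: "f' r = (if d = \<one> then f r else 0)" if "homogeneous d r" for d r
    unfolding f'_def using comp_apply_homogeneous[OF that f(1) one_closed] by auto
  have zero: "f' (y \<bullet> u \<bullet> e a) = 0" if y: "y \<in> carrier H" and u: "homogeneous x u" for y u
  proof -
    note uc = homogeneousD(1)[OF u]
    have lin: "linear_on H (\<lambda>y. f' (y \<bullet> u \<bullet> e a))"
      using linear_simps[OF f'] uc a by (simp add: multilinear_simps)
    have "f' (y \<bullet> u \<bullet> e a) = (\<Sum>c\<in>carrier C. f' (comp c y \<bullet> u \<bullet> e a))"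
      by (rule comp_sum[OF lin y])
    also have "\<dots> = 0"
    proof (intro sum.neutral ballI)
      fix c assume c: "c \<in> carrier C"
      have h: "homogeneous (c \<otimes> x \<otimes> \<one>) (comp c y \<bullet> u \<bullet> e a)"
        by (intro homogeneous_mult comp_homogeneous homogeneous_e) (use c x y u a in auto)
      show "f' (comp c y \<bullet> u \<bullet> e a) = 0"
      proof (cases "c = inv x")
        case True
        have "comp c y \<bullet> u \<bullet> e a = \<zero>\<^bsub>H\<^esub>"
          using contra u comp_homogeneous[OF y c] unfolding True by blast
        then show ?thesis using vs.linear_on_zero[OF f'] by simp
      next
        case False
        then have "c \<otimes> x \<otimes> \<one> \<noteq> \<one>" using c x inv_equality[of c x] by auto
        then show ?thesis using f'_hom[OF h] by simp
      qed
    qed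
    finally show ?thesis .
  qed
  \<comment> \<open>The degree x part of a lift of x. It is still mapped to x by \<pi>, so its
    counit is 1.\<close>
  define k where "k = comp x (lift x)"
  have lc: "lift x \<in> carrier H" and lp: "\<pi> (lift x) = delta x" using lift[OF x] by auto
  have kh: "homogeneous x k" unfolding k_def by (rule comp_homogeneous[OF lc x])
  note kc = homogeneousD(1)[OF kh]
  have "\<pi> k c = (if c = x then 1 else 0)" if c: "c \<in> carrier C" for c
    unfolding k_def comp_apply[OF proj_linear lc]
    using c x lc lp by (auto simp: sw_proj delta_def)
  then have ek: "counit H k = 1" using x by (simp add: counit_proj[OF kc])
  have lin: "linear_on H (\<lambda>y. f' (y \<bullet> e a))" using f' a by (intro linear_functional_mult) auto
  let ?F = "\<lambda>h. sw h (\<lambda>y1 y2. f' (S y1 \<bullet> y2 \<bullet> e a))"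
  have F: "linear_on H ?F" using linear_simps[OF f'] a by (intro linear_sw) (simp add: bilinear_on_def multilinear_simps)
  have "?F k = counit H k * f' (\<one>\<^bsub>H\<^esub> \<bullet> e a)" by (rule sw_antipode(1)[OF lin kc])
  also have "\<dots> = 1" using ek a f(2) f'_hom[OF homogeneous_e[OF a]] by simp
  finally have "?F k = 1" .
  moreover have "?F k = sw k (\<lambda>y z. ?F y * \<pi> z x)"
    using homogeneousD(2)[OF kh F x] by simp
  moreover have "\<dots> = sw k (\<lambda>y z. sw y (\<lambda>y1 y2. f' (S y1 \<bullet> y2 \<bullet> e a) * \<pi> z x))"
    by (simp add: sweedler_fun_mult_right)
  moreover have "\<dots> = sw k (\<lambda>y z. sw z (\<lambda>z1 z2. f' (S y \<bullet> z1 \<bullet> e a) * \<pi> z2 x))"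
    by (rule sw_coassoc[OF _ kc])
      (use linear_simps[OF f'] a in \<open>simp add: trilinear_on_def multilinear_simps proj_add proj_smult algebra_simps\<close>)
  moreover have "\<dots> = sw k (\<lambda>y z. 0)"
  proof (rule sw_cong[OF kc])
    fix y z assume m: "y \<in> carrier H" "z \<in> carrier H"
    have l: "linear_on H (\<lambda>z. f' (S y \<bullet> z \<bullet> e a))" using linear_simps[OF f'] m a by (simp add: multilinear_simps)
    show "sw z (\<lambda>z1 z2. f' (S y \<bullet> z1 \<bullet> e a) * \<pi> z2 x) = 0"
      unfolding comp_apply[OF l m(2), symmetric]
      by (rule zero[OF S_closed[OF m(1)] comp_homogeneous[OF m(2) x]])
  qed
  ultimately show False by (simp add: sweedler_def tensor_eval_def)
qed

text \<open>Put w = u e_a, with v w = c e_a for a nonzero scalar c. As x^p = 1, the power w^p has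
  degree 1 and is a scalar multiple d e_a; d is nonzero because (v w)^p = c^p e_a is. Rescaling w by
  a p-th root of 1/d gives the unit.\<close>

lemma homogeneous_unit_exists:
  assumes a: "a \<in> carrier G" and x: "x \<in> carrier C"
  shows "\<exists>u. homogeneous x u \<and> u \<bullet> e a = u \<and> u [^]\<^bsub>H\<^esub> p = e a"
proof -
  obtain f where f: "linear_on H f" "f (e a) = 1"
    using vs.functional_exists[OF e_closed[OF a] e_nonzero[OF a]] by blast
  obtain u v where uv: "homogeneous x u" "homogeneous (inv x) v" "v \<bullet> u \<bullet> e a \<noteq> \<zero>\<^bsub>H\<^esub>"
    using homogeneous_pair_exists[OF a x] by blast
  note uc = homogeneousD(1)[OF uv(1)] and vc = homogeneousD(1)[OF uv(2)]
  have ec: "e a \<in> carrier H" and ee: "e a \<bullet> e a = e a" using a by (simp_all add: e_mult)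
  define c where "c = f (v \<bullet> u \<bullet> e a)"
  have "homogeneous (inv x \<otimes> x) (v \<bullet> u)" by (rule homogeneous_mult) (use uv x in auto)
  then have "homogeneous \<one> (v \<bullet> u)" using x by simp
  then have vu: "v \<bullet> u \<bullet> e a = c \<odot>\<^bsub>H\<^esub> e a" unfolding c_def by (rule homogeneous_one_e[OF _ a f])
  then have c0: "c \<noteq> 0" using uv(3) vs.smult_l_null[OF ec] by auto
  define w where "w = u \<bullet> e a"
  have wc: "w \<in> carrier H" using uc ec by (simp add: w_def)
  have we: "w \<bullet> e a = w" using uc ec ee by (simp add: w_def H.m_assoc)
  have "homogeneous (x \<otimes> \<one>) w" unfolding w_def by (rule homogeneous_mult) (use uv x a homogeneous_e in auto)
  then have wh: "homogeneous x w" using x by simp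
  have vw: "v \<bullet> w = c \<odot>\<^bsub>H\<^esub> e a" using vu uc vc ec by (simp add: w_def H.m_assoc)
  define d where "d = f (w [^]\<^bsub>H\<^esub> p \<bullet> e a)"
  have "homogeneous (x [^] p) (w [^]\<^bsub>H\<^esub> p)" by (rule homogeneous_pow[OF wh x])
  moreover have "x [^] p = \<one>" using pow_order_eq_1[OF x] by (simp add: order_C)
  ultimately have h1: "homogeneous \<one> (w [^]\<^bsub>H\<^esub> p)" by simp
  \<comment> \<open>Only for positive exponents: the zeroth power is the unit of \<open>H\<close>,
    not e_a.\<close>
  have pe: "w [^]\<^bsub>H\<^esub> (Suc i) \<bullet> e a = w [^]\<^bsub>H\<^esub> (Suc i)" for i
    using wc ec we by (simp add: H.m_assoc)
  obtain p' where p': "p = Suc p'" using p_pos gr0_implies_Suc by blast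
  have wp: "w [^]\<^bsub>H\<^esub> p = d \<odot>\<^bsub>H\<^esub> e a"
    using homogeneous_one_e[OF h1 a f] pe[of p'] by (simp add: d_def p')
  have d0: "d \<noteq> 0"
  proof
    assume "d = 0"
    then have z: "w [^]\<^bsub>H\<^esub> p = \<zero>\<^bsub>H\<^esub>" using wp vs.smult_l_null[OF ec] by simp
    have "(v \<bullet> w) [^]\<^bsub>H\<^esub> p = \<zero>\<^bsub>H\<^esub>"
      using vc wc z by (simp add: H.nat_pow_distrib)
    moreover have "(c \<odot>\<^bsub>H\<^esub> e a) [^]\<^bsub>H\<^esub> Suc i = c ^ Suc i \<odot>\<^bsub>H\<^esub> e a" for i
    proof (induction i)
      case (Suc i)
      have "(c \<odot>\<^bsub>H\<^esub> e a) [^]\<^bsub>H\<^esub> Suc (Suc i) = (c ^ Suc i \<odot>\<^bsub>H\<^esub> e a) \<bullet> (c \<odot>\<^bsub>H\<^esub> e a)"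
        using Suc by simp
      also have "\<dots> = c ^ Suc i \<odot>\<^bsub>H\<^esub> (e a \<bullet> (c \<odot>\<^bsub>H\<^esub> e a))"
        by (rule smult_mult(1)) (use ec in simp_all)
      also have "\<dots> = c ^ Suc i \<odot>\<^bsub>H\<^esub> (c \<odot>\<^bsub>H\<^esub> e a)" using ec ee by (simp add: smult_mult(2))
      also have "\<dots> = c ^ Suc (Suc i) \<odot>\<^bsub>H\<^esub> e a"
        using vs.smult_assoc1[of "c ^ Suc i" c "e a"] ec by (simp add: mult.commute)
      finally show ?case .
    qed (use ec in simp)
    from this[of p'] have "(c \<odot>\<^bsub>H\<^esub> e a) [^]\<^bsub>H\<^esub> p = c ^ p \<odot>\<^bsub>H\<^esub> e a" unfolding p' .
    ultimately have "c ^ p \<odot>\<^bsub>H\<^esub> e a = \<zero>\<^bsub>H\<^esub>" using vw by simp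
    then have "c ^ p * f (e a) = 0" using linear_simps(2)[OF f(1) ec, of "c ^ p"] vs.linear_on_zero[OF f(1)] by simp
    then show False using c0 f(2) by simp
  qed
  obtain t where t: "t ^ p = inverse d" using nth_root_exists[OF p_pos] by blast
  have pw: "(t \<odot>\<^bsub>H\<^esub> w) [^]\<^bsub>H\<^esub> i = t ^ i \<odot>\<^bsub>H\<^esub> (w [^]\<^bsub>H\<^esub> i)" for i :: nat
  proof (induction i)
    case 0
    show ?case using vs.smult_one[OF H.one_closed] by simp
  next
    case (Suc i)
    have pc: "w [^]\<^bsub>H\<^esub> i \<in> carrier H" using wc by simp
    have "(t \<odot>\<^bsub>H\<^esub> w) [^]\<^bsub>H\<^esub> Suc i = (t ^ i \<odot>\<^bsub>H\<^esub> (w [^]\<^bsub>H\<^esub> i)) \<bullet> (t \<odot>\<^bsub>H\<^esub> w)"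
      using Suc by simp
    also have "\<dots> = t ^ i \<odot>\<^bsub>H\<^esub> (w [^]\<^bsub>H\<^esub> i \<bullet> (t \<odot>\<^bsub>H\<^esub> w))"
      by (rule smult_mult(1)) (use wc pc in simp_all)
    also have "\<dots> = t ^ i \<odot>\<^bsub>H\<^esub> (t \<odot>\<^bsub>H\<^esub> (w [^]\<^bsub>H\<^esub> i \<bullet> w))"
      using wc pc by (simp add: smult_mult(2))
    finally show ?case
      using vs.smult_assoc1[of "t ^ i" t "w [^]\<^bsub>H\<^esub> i \<bullet> w"] wc pc by (simp add: mult.commute)
  qed
  show ?thesis
  proof (intro exI[of _ "t \<odot>\<^bsub>H\<^esub> w"] conjI)
    show "homogeneous x (t \<odot>\<^bsub>H\<^esub> w)" by (rule homogeneous_smult[OF wh])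
    show "(t \<odot>\<^bsub>H\<^esub> w) \<bullet> e a = t \<odot>\<^bsub>H\<^esub> w" using wc ec we by (simp add: smult_mult)
    have "(t \<odot>\<^bsub>H\<^esub> w) [^]\<^bsub>H\<^esub> p = t ^ p \<odot>\<^bsub>H\<^esub> (d \<odot>\<^bsub>H\<^esub> e a)" by (simp add: pw wp)
    also have "\<dots> = e a" using vs.smult_assoc1[of "t ^ p" d "e a"] vs.smult_one[OF ec] ec d0 t by simp
    finally show "(t \<odot>\<^bsub>H\<^esub> w) [^]\<^bsub>H\<^esub> p = e a" .
  qed
qed

text \<open>With \<open>u\<close> a unit of \<open>H e\<^sub>a\<close> as above, of degree a generator of \<open>C\<close>, the sum of the powers of \<open>u\<close>
  is a common eigenvector of \<open>H\<close>, and its eigenvalues form a point.\<close>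

lemma point_exists:
  assumes a: "a \<in> carrier G"
  shows "\<exists>t. point t \<and> t (e a) = 1"
proof -
  obtain f where f: "linear_on H f" "f (e a) = 1"
    using vs.functional_exists[OF e_closed[OF a] e_nonzero[OF a]] by blast
  define f' where "f' h = f (comp \<one> h)" for h
  have f': "linear_on H f'" unfolding f'_def by (rule comp_linear[OF f(1)])
  have f'_hom: "f' r = (if d = \<one> then f r else 0)" if "homogeneous d r" for d r
    unfolding f'_def using comp_apply_homogeneous[OF that f(1) one_closed] by auto
  obtain x where x: "x \<in> carrier C" "x \<noteq> \<one>" using generator_exists by blast
  obtain u where u: "homogeneous x u" "u \<bullet> e a = u" "u [^]\<^bsub>H\<^esub> p = e a"
    using homogeneous_unit_exists[OF a x(1)] by blast
  have ec: "e a \<in> carrier H" and ee: "e a \<bullet> e a = e a" using a by (simp_all add: e_mult)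
  note uc = homogeneousD(1)[OF u(1)]
  obtain p' where p': "p = Suc p'" using p_pos gr0_implies_Suc by blast
  have pc: "u [^]\<^bsub>H\<^esub> (i::nat) \<in> carrier H" for i using uc by simp
  \<comment> \<open>The exponents run from 1 to p: u^p = e_a stands in for the zeroth power, which
    would be the unit of \<open>H\<close> instead of that of the fibre.\<close>
  define W where "W = finsum H (\<lambda>i. u [^]\<^bsub>H\<^esub> Suc i) {..<p}"
  have Wf: "(\<lambda>i. u [^]\<^bsub>H\<^esub> Suc i) \<in> {..<p} \<rightarrow> carrier H" using pc by blast
  have Wc: "W \<in> carrier H" unfolding W_def by (rule vs.finsum_closed[OF Wf])
  have W: "g W = (\<Sum>i<p. g (u [^]\<^bsub>H\<^esub> Suc i))" if "linear_on H g" for g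
    unfolding W_def by (rule vs.linear_on_finsum[OF that _ Wf]) simp
  have uW: "u \<bullet> W = W"
  proof (rule vs.eq_if_functionals_eq)
    show "u \<bullet> W \<in> carrier H" "W \<in> carrier H" using uc Wc by auto
    fix g assume g: "linear_on H g"
    have "g (u \<bullet> W) = (\<Sum>i<p. g (u \<bullet> u [^]\<^bsub>H\<^esub> Suc i))"
      by (rule W[OF linear_functional_mult(1)[OF g uc]])
    also have "\<dots> = (\<Sum>i<p. g (u [^]\<^bsub>H\<^esub> Suc (Suc i)))"
      using uc pc by (simp add: H.m_comm)
    also have "\<dots> = (\<Sum>i<p. g (u [^]\<^bsub>H\<^esub> Suc i))"
    proof -
      have per: "u [^]\<^bsub>H\<^esub> Suc p = u [^]\<^bsub>H\<^esub> Suc 0"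
        using u(2,3) uc ec by (simp add: H.m_comm)
      have "g (u [^]\<^bsub>H\<^esub> Suc 0) + (\<Sum>i<p. g (u [^]\<^bsub>H\<^esub> Suc (Suc i))) = (\<Sum>i<p. g (u [^]\<^bsub>H\<^esub> Suc i)) + g (u [^]\<^bsub>H\<^esub> Suc p)"
        by (simp only: sum.lessThan_Suc_shift[symmetric, of "\<lambda>i. g (u [^]\<^bsub>H\<^esub> Suc i)" p] sum.lessThan_Suc)
      then show ?thesis unfolding per by simp
    qed
    also have "\<dots> = g W" by (rule W[OF g, symmetric])
    finally show "g (u \<bullet> W) = g W" .
  qed
  have uiW: "u [^]\<^bsub>H\<^esub> (i::nat) \<bullet> W = W" for i
  proof (induction i)
    case (Suc i)
    then show ?case using uW uc pc Wc by (simp add: H.m_assoc)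
  qed (use Wc in simp)
  have eW: "e a \<bullet> W = W" using uiW[of p] u(3) by simp
  have f'W: "f' W = 1"
  proof -
    \<comment> \<open>The degrees of the summands are the powers of x, so only u^p = e_a, with index
      \<open>p'\<close>, has degree 1.\<close>
    have "f' W = (\<Sum>i<p. if i = p' then 1 else 0)"
      unfolding W[OF f']
    proof (rule sum.cong[OF refl])
      fix i assume i: "i \<in> {..<p}"
      have h: "homogeneous (x [^] Suc i) (u [^]\<^bsub>H\<^esub> Suc i)" by (rule homogeneous_pow[OF u(1) x(1)])
      have "x [^] Suc i = x [^] (0::nat) \<longleftrightarrow> Suc i mod p = 0 mod p" by (rule pow_eq_iff[OF x])
      also have "\<dots> \<longleftrightarrow> i = p'" using i p' by (auto simp: mod_Suc)
      finally have "x [^] Suc i = \<one> \<longleftrightarrow> i = p'" by simp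
      moreover have "f (u [^]\<^bsub>H\<^esub> Suc p') = 1" using u(3) f(2) unfolding p' by simp
      ultimately show "f' (u [^]\<^bsub>H\<^esub> Suc i) = (if i = p' then 1 else 0)"
        unfolding f'_hom[OF h] by auto
    qed
    then show ?thesis using p' by simp
  qed
  \<comment> \<open>Multiplication by the power of u of degree c^(-1) brings r to degree 1, where
    the fibre is the line of e_a. As powers of u fix \<open>W\<close>, r acts on \<open>W\<close> by
    a scalar.\<close>
  have eig_hom: "\<exists>\<kappa>. r \<bullet> W = \<kappa> \<odot>\<^bsub>H\<^esub> W" if r: "homogeneous c r" and c: "c \<in> carrier C" for r c
  proof -
    note rc = homogeneousD(1)[OF r]
    obtain j where j: "j < p" "inv c = x [^] (j::nat)"
      using carrier_eq_powers[OF x] inv_closed[OF c] by blast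
    have "homogeneous (c \<otimes> x [^] j) (r \<bullet> u [^]\<^bsub>H\<^esub> j)"
      by (rule homogeneous_mult[OF r homogeneous_pow[OF u(1) x(1)] c]) (use x in simp)
    moreover have "c \<otimes> x [^] j = \<one>" using c by (simp add: j(2)[symmetric])
    ultimately have h: "homogeneous \<one> (r \<bullet> u [^]\<^bsub>H\<^esub> j)" by simp
    let ?\<kappa> = "f (r \<bullet> u [^]\<^bsub>H\<^esub> j \<bullet> e a)"
    have "r \<bullet> W = r \<bullet> (u [^]\<^bsub>H\<^esub> j \<bullet> (e a \<bullet> W))" by (simp add: uiW eW)
    also have "\<dots> = (r \<bullet> u [^]\<^bsub>H\<^esub> j \<bullet> e a) \<bullet> W" using rc pc ec Wc by (simp add: H.m_assoc)
    also have "\<dots> = (?\<kappa> \<odot>\<^bsub>H\<^esub> e a) \<bullet> W" using homogeneous_one_e[OF h a f] by simp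
    also have "\<dots> = ?\<kappa> \<odot>\<^bsub>H\<^esub> W" using ec Wc eW by (simp add: smult_mult)
    finally show ?thesis by blast
  qed
  have eig: "h \<bullet> W = f' (h \<bullet> W) \<odot>\<^bsub>H\<^esub> W" if h: "h \<in> carrier H" for h
  proof (rule vs.eq_if_functionals_eq)
    show "h \<bullet> W \<in> carrier H" "f' (h \<bullet> W) \<odot>\<^bsub>H\<^esub> W \<in> carrier H" using h Wc by auto
    have "\<forall>c\<in>carrier C. \<exists>\<kappa>. comp c h \<bullet> W = \<kappa> \<odot>\<^bsub>H\<^esub> W"
      using eig_hom[OF comp_homogeneous[OF h]] by blast
    then obtain \<kappa> where k: "\<And>c. c \<in> carrier C \<Longrightarrow> comp c h \<bullet> W = \<kappa> c \<odot>\<^bsub>H\<^esub> W"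
      by (auto dest!: bchoice)
    have g_hW: "g (h \<bullet> W) = (\<Sum>c\<in>carrier C. \<kappa> c) * g W" if g: "linear_on H g" for g
    proof -
      have "g (h \<bullet> W) = (\<Sum>c\<in>carrier C. g (comp c h \<bullet> W))"
        by (rule comp_sum[OF linear_functional_mult(2)[OF g Wc] h])
      also have "\<dots> = (\<Sum>c\<in>carrier C. \<kappa> c * g W)"
        using k linear_simps(2)[OF g Wc] by simp
      finally show ?thesis by (simp add: sum_distrib_right)
    qed
    fix g assume g: "linear_on H g"
    show "g (h \<bullet> W) = g (f' (h \<bullet> W) \<odot>\<^bsub>H\<^esub> W)"
      using g_hW[OF g] g_hW[OF f'] f'W linear_simps(2)[OF g Wc] by simp
  qed
  \<comment> \<open>Since f'(W) = 1, this is the eigenvalue of h on \<open>W\<close>.\<close>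
  define t where "t h = (if h \<in> carrier H then f' (h \<bullet> W) else 0)" for h
  have "point t"
    unfolding point_def
  proof (intro conjI ballI allI impI)
    show "linear_on H t" using linear_functional_mult(2)[OF f' Wc] by (simp add: linear_on_def t_def)
    show "t \<one>\<^bsub>H\<^esub> = 1" using Wc f'W by (simp add: t_def)
    show "t h = 0" if "h \<notin> carrier H" for h using that by (simp add: t_def)
    fix h k assume h: "h \<in> carrier H" and k: "k \<in> carrier H"
    have "h \<bullet> k \<bullet> W = h \<bullet> (f' (k \<bullet> W) \<odot>\<^bsub>H\<^esub> W)" using h k Wc eig[OF k] by (simp add: H.m_assoc)
    also have "\<dots> = f' (k \<bullet> W) \<odot>\<^bsub>H\<^esub> (h \<bullet> W)" using h Wc by (simp add: smult_mult)
    finally show "t (h \<bullet> k) = t h * t k"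
      using h k Wc linear_simps(2)[OF f', of "h \<bullet> W"] by (simp add: t_def mult.commute)
  qed
  moreover have "t (e a) = 1" using ec eW f'W by (simp add: t_def)
  ultimately show ?thesis by blast
qed

end

text \<open>Conjugation by \<open>e\<close> raises the elements of a normal subgroup of order \<open>p\<close> to some power \<open>k\<close>,
  and \<open>k\<close> to a power of \<open>p\<close> is 1 modulo \<open>p\<close>; by Fermat, \<open>k\<close> is 1.\<close>

lemma (in prime_group) normal_prime_order_central:
  assumes E: "group E" and G: "group G" "finite (carrier G)" "Coset.order G = p ^ n"
    and i: "i \<in> hom C E" "inj_on i (carrier C)" and q: "q \<in> hom E G" "kernel E G q = i ` carrier C"
    and c: "c \<in> carrier C" and e: "e \<in> carrier E"
  shows "i c \<otimes>\<^bsub>E\<^esub> e = e \<otimes>\<^bsub>E\<^esub> i c"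
proof -
  interpret E: group E by (rule E)
  interpret G: group G by (rule G)
  interpret i: group_hom C E i by unfold_locales (rule i)
  interpret q: group_hom E G q by unfold_locales (rule q)
  obtain d where d: "d \<in> carrier C" "d \<noteq> \<one>" using generator_exists by blast
  let ?y = "i d"
  have y: "?y \<in> carrier E" using d by simp
  have "?y \<in> kernel E G q" using d q by simp
  then have "e \<otimes>\<^bsub>E\<^esub> ?y \<otimes>\<^bsub>E\<^esub> inv\<^bsub>E\<^esub> e \<in> kernel E G q" using e y by (simp add: kernel_def)
  then obtain k :: nat where k: "e \<otimes>\<^bsub>E\<^esub> ?y \<otimes>\<^bsub>E\<^esub> inv\<^bsub>E\<^esub> e = ?y [^]\<^bsub>E\<^esub> k"
    using q(2) carrier_eq_powers[OF d] d(1) by (auto simp: i.hom_nat_pow)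
  have ey: "e \<otimes>\<^bsub>E\<^esub> ?y [^]\<^bsub>E\<^esub> j = ?y [^]\<^bsub>E\<^esub> (k * j) \<otimes>\<^bsub>E\<^esub> e" for j :: nat
  proof (induction j)
    case (Suc j)
    have "e \<otimes>\<^bsub>E\<^esub> ?y = ?y [^]\<^bsub>E\<^esub> k \<otimes>\<^bsub>E\<^esub> e"
      unfolding k[symmetric] using e y by (simp add: E.m_assoc)
    then have "e \<otimes>\<^bsub>E\<^esub> ?y [^]\<^bsub>E\<^esub> Suc j = ?y [^]\<^bsub>E\<^esub> (k * j) \<otimes>\<^bsub>E\<^esub> (?y [^]\<^bsub>E\<^esub> k \<otimes>\<^bsub>E\<^esub> e)"
      using Suc e y by (simp add: E.m_assoc[symmetric]) (simp add: E.m_assoc)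
    also have "\<dots> = ?y [^]\<^bsub>E\<^esub> (k * j + k) \<otimes>\<^bsub>E\<^esub> e"
      using e y by (simp add: E.m_assoc[symmetric] E.nat_pow_mult)
    finally show ?case by (simp add: add.commute)
  qed (use e in simp)
  have em: "e [^]\<^bsub>E\<^esub> m \<otimes>\<^bsub>E\<^esub> ?y = ?y [^]\<^bsub>E\<^esub> (k ^ m) \<otimes>\<^bsub>E\<^esub> e [^]\<^bsub>E\<^esub> m" for m :: nat
  proof (induction m)
    case (Suc m)
    have "e [^]\<^bsub>E\<^esub> Suc m \<otimes>\<^bsub>E\<^esub> ?y = e \<otimes>\<^bsub>E\<^esub> (e [^]\<^bsub>E\<^esub> m \<otimes>\<^bsub>E\<^esub> ?y)"
      unfolding E.nat_pow_Suc2[OF e] using e y by (simp add: E.m_assoc)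
    also have "\<dots> = e \<otimes>\<^bsub>E\<^esub> ?y [^]\<^bsub>E\<^esub> (k ^ m) \<otimes>\<^bsub>E\<^esub> e [^]\<^bsub>E\<^esub> m" using Suc e y by (simp add: E.m_assoc)
    also have "\<dots> = ?y [^]\<^bsub>E\<^esub> (k ^ Suc m) \<otimes>\<^bsub>E\<^esub> e [^]\<^bsub>E\<^esub> Suc m"
      unfolding E.nat_pow_Suc2[OF e] using e y by (simp add: ey E.m_assoc)
    finally show ?case .
  qed (use y in simp)
  \<comment> \<open>The order of \<open>G\<close>: this power of \<open>e\<close> lies in the kernel
    of \<open>q\<close>, a copy of the abelian group \<open>C\<close>, and so commutes with
    \<open>?y\<close>.\<close>
  let ?m = "p ^ n"
  have "q (e [^]\<^bsub>E\<^esub> ?m) = \<one>\<^bsub>G\<^esub>"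
    using e G.pow_order_eq_1[of "q e"] G(3) by (simp add: q.hom_nat_pow)
  then have "e [^]\<^bsub>E\<^esub> ?m \<in> i ` carrier C" using e q(2) by (auto simp: kernel_def)
  then obtain c' where c': "c' \<in> carrier C" "e [^]\<^bsub>E\<^esub> ?m = i c'" by blast
  have "?y [^]\<^bsub>E\<^esub> (k ^ ?m) \<otimes>\<^bsub>E\<^esub> i c' = ?y \<otimes>\<^bsub>E\<^esub> i c'"
    using em[of ?m] c' d comm_C[of c' d] by (metis i.hom_mult)
  then have "?y [^]\<^bsub>E\<^esub> (k ^ ?m) = ?y" using y c' by (simp add: E.r_cancel)
  then have "i (d [^] (k ^ ?m)) = i (d [^] (1::nat))" using d by (simp add: i.hom_nat_pow)
  then have "d [^] (k ^ ?m) = d [^] (1::nat)" using i(2) d by (auto dest: inj_onD)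
  then have k1: "[k ^ ?m = 1] (mod p)" unfolding pow_eq_iff[OF d] cong_def .
  have "\<not> p dvd k"
  proof
    assume "p dvd k"
    then have "p dvd k ^ ?m" using p_pos by (simp add: dvd_power_same dvd_trans dvd_power)
    with k1 have "p dvd 1" using cong_dvd_iff by blast
    then show False using prime_p by simp
  qed
  \<comment> \<open>Fermat in the form k^p = k modulo p, which can be iterated to k^(p^n) =
    k.\<close>
  then have f: "[k ^ p = k] (mod p)"
  proof -
    have "[k ^ (p - 1) * k = 1 * k] (mod p)" by (rule cong_mult[OF fermat_theorem[OF prime_p \<open>\<not> p dvd k\<close>] cong_refl])
    then show ?thesis using power_minus_mult[OF p_pos, of k] by simp
  qed
  have "[k ^ (p ^ j) = k] (mod p)" for j
  proof (induction j)
    case (Suc j)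
    have "[(k ^ (p ^ j)) ^ p = k ^ p] (mod p)" by (rule cong_pow[OF Suc])
    then have "[(k ^ (p ^ j)) ^ p = k] (mod p)" using f by (rule cong_trans)
    then show ?case by (simp add: power_mult[symmetric] mult.commute)
  qed simp
  then have "[k = 1] (mod p)" using k1 cong_sym cong_trans by blast
  then have "d [^] k = d [^] (1::nat)" unfolding pow_eq_iff[OF d] by (simp add: cong_def)
  then have yk: "?y [^]\<^bsub>E\<^esub> k = ?y" using d by (simp flip: i.hom_nat_pow)
  obtain j :: nat where j: "c = d [^] j" using carrier_eq_powers[OF d] c by blast
  have "?y [^]\<^bsub>E\<^esub> (k * j) = ?y [^]\<^bsub>E\<^esub> j" using yk y by (simp add: E.nat_pow_pow[symmetric])
  then show ?thesis using ey[of j] d by (simp add: j i.hom_nat_pow)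
qed

text \<open>Cocycles are unconstrained off the carrier of \<open>G\<close>; agreement on it gives an
  equivalence through the trivial cochain, not an equality of extensions.\<close>

lemma (in grp_setup) cocycle_ext_cong:
  assumes c: "c \<in> grp_cocycles G A" and c2: "c' \<in> grp_cocycles G A"
    and eq: "\<And>a b. a \<in> carrier G \<Longrightarrow> b \<in> carrier G \<Longrightarrow> c a b = c' a b"
  shows "grp_ext_equiv A (cocycle_ext G A c) (cocycle_ext G A c')"
  unfolding cocycle_ext_equiv_iff[OF c c2]
  by (rule exI[of _ "\<lambda>a. \<one>\<^bsub>A\<^esub>"]) (use eq grp_cocycleD(1)[OF c2] in simp)

section \<open>Scalar cocycles and cocycles with values in the dual of C\<close>

context ext_setup
begin

lemma dual_grp_setup: "grp_setup G (dual_group C :: ('c \<Rightarrow> 'k::field) monoid)"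
  by (simp add: grp_setup_def group_G dual_group_comm_group)

definition dual_cocycle :: "('c \<Rightarrow> 'g \<Rightarrow> 'g \<Rightarrow> 'k::field) \<Rightarrow> 'g \<Rightarrow> 'g \<Rightarrow> 'c \<Rightarrow> 'k" where
  "dual_cocycle \<tau> = (\<lambda>a b x. if x \<in> carrier C then \<tau> x a b else 0)"

lemma G_ext_dual_cocycle: "G_ext C G \<tau> = cocycle_ext G (dual_group C) (dual_cocycle \<tau>)"
  by (simp add: G_ext_def dual_cocycle_def)

lemma dual_cocycle_in:
  fixes \<tau> :: "'c \<Rightarrow> 'g \<Rightarrow> 'g \<Rightarrow> 'k::field"
  assumes \<tau>: "\<tau> \<in> cocycles C G"
  shows "dual_cocycle \<tau> \<in> grp_cocycles G (dual_group C)"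
proof -
  interpret cocycle_setup C p G n \<tau> by unfold_locales (rule \<tau>)
  show ?thesis
    unfolding grp_cocycles_def
    using cocycle_simps by (auto simp: dual_group_iff dual_cocycle_def fun_eq_iff)
qed

lemma cocycle_of_dual:
  fixes c :: "'g \<Rightarrow> 'g \<Rightarrow> 'c \<Rightarrow> 'k::field"
  assumes c: "c \<in> grp_cocycles G (dual_group C)"
  shows "(\<lambda>x a b. c a b x) \<in> cocycles C G"
    and "\<And>a b. a \<in> carrier G \<Longrightarrow> b \<in> carrier G \<Longrightarrow> dual_cocycle (\<lambda>x a b. c a b x) a b = c a b"
proof -
  interpret D: grp_setup G "dual_group C :: ('c \<Rightarrow> 'k) monoid" by (rule dual_grp_setup)
  note cd = D.grp_cocycleD[OF c]
  have m: "c a b \<in> carrier (dual_group C)" if "a \<in> carrier G" "b \<in> carrier G" for a b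
    using cd(1) that .
  show "dual_cocycle (\<lambda>x a b. c a b x) a b = c a b" if "a \<in> carrier G" "b \<in> carrier G" for a b
    using m[OF that] by (auto simp: dual_cocycle_def dual_group_iff fun_eq_iff)
  have "c a (b \<otimes>\<^bsub>G\<^esub> d) x * c b d x = c (a \<otimes>\<^bsub>G\<^esub> b) d x * c a b x"
    if "a \<in> carrier G" "b \<in> carrier G" "d \<in> carrier G" for a b d x
    using fun_cong[OF cd(4)[OF that], of x] by simp
  then show "(\<lambda>x a b. c a b x) \<in> cocycles C G"
    using m cd(2,3) dual_group_one[OF m] unfolding cocycles_def
    by (auto simp: dual_group_iff)
qed

lemma central_extension_equiv_G_ext:
  fixes U :: "('g, 'c \<Rightarrow> 'k::field, 'e) grp_ext"
  assumes U: "central_extension (dual_group C) G U"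
  shows "\<exists>\<tau>\<in>cocycles C G. grp_ext_equiv (dual_group C) U (G_ext C G \<tau>)"
proof -
  interpret D: grp_setup G "dual_group C :: ('c \<Rightarrow> 'k) monoid" by (rule dual_grp_setup)
  obtain c where c: "c \<in> grp_cocycles G (dual_group C)" "grp_ext_equiv (dual_group C) U (cocycle_ext G (dual_group C) c)"
    using D.central_extension_equiv_cocycle_ext[OF U] by blast
  note t = cocycle_of_dual[OF c(1)]
  have "grp_ext_equiv (dual_group C) (cocycle_ext G (dual_group C) c) (G_ext C G (\<lambda>x a b. c a b x))"
    unfolding G_ext_dual_cocycle
    by (rule D.cocycle_ext_cong[OF c(1) dual_cocycle_in[OF t(1)]]) (simp add: t(2))
  then show ?thesis using t(1) grp_ext_equiv_trans[OF c(2)] by blast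
qed

end

section \<open>The group of points as a central extension\<close>

context comm_extension
begin

text \<open>Convolution of algebra maps: the group of rational points of the affine group scheme of
  \<open>H\<close>. The truncations keep the results zero off the carrier.\<close>

definition points :: "('h \<Rightarrow> 'k) monoid" where
  "points = \<lparr>carrier = {t. point t},
    monoid.mult = (\<lambda>t t' h. if h \<in> carrier H then sw h (\<lambda>x y. t x * t' y) else 0),
    one = (\<lambda>h. if h \<in> carrier H then counit H h else 0)\<rparr>"

lemma points_simps [simp]:
  "carrier points = {t. point t}"
  "(t \<otimes>\<^bsub>points\<^esub> t') = (\<lambda>h. if h \<in> carrier H then sw h (\<lambda>x y. t x * t' y) else 0)"
  "\<one>\<^bsub>points\<^esub> = (\<lambda>h. if h \<in> carrier H then counit H h else 0)"
  by (simp_all add: points_def)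

lemma functional_bilinear: "linear_on H f \<Longrightarrow> linear_on H g \<Longrightarrow> bilinear_on H (\<lambda>x y. f x * g y)"
  by (simp add: bilinear_on_def linear_on_def algebra_simps)

lemma point_mult:
  assumes t: "point t" "point t'"
  shows "point (t \<otimes>\<^bsub>points\<^esub> t')"
  unfolding point_def points_simps
proof (intro conjI ballI allI impI)
  note B = functional_bilinear[OF pointD(1)[OF t(1)] pointD(1)[OF t(2)]]
  show "linear_on H (\<lambda>h. if h \<in> carrier H then sw h (\<lambda>x y. t x * t' y) else 0)"
    using linear_sw[OF B] by (simp add: linear_on_def)
  show "(if \<one>\<^bsub>H\<^esub> \<in> carrier H then sw \<one>\<^bsub>H\<^esub> (\<lambda>x y. t x * t' y) else 0) = 1"
    using sw_one[OF B] pointD(3)[OF t(1)] pointD(3)[OF t(2)] by simp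
  fix a b assume a: "a \<in> carrier H" and b: "b \<in> carrier H"
  have "sw (a \<bullet> b) (\<lambda>x y. t x * t' y) = sw a (\<lambda>x y. sw b (\<lambda>z w. t (x \<bullet> z) * t' (y \<bullet> w)))"
    by (rule sw_mult[OF B a b])
  also have "\<dots> = sw a (\<lambda>x y. sw b (\<lambda>z w. (t x * t' y) * (t z * t' w)))"
    by (intro sw_cong a b) (simp add: pointD(2)[OF t(1)] pointD(2)[OF t(2)] ac_simps)
  also have "\<dots> = sw a (\<lambda>x y. t x * t' y) * sw b (\<lambda>x y. t x * t' y)"
    by (simp add: sweedler_fun_mult sweedler_fun_mult_right)
  finally show "(if a \<bullet> b \<in> carrier H then sw (a \<bullet> b) (\<lambda>x y. t x * t' y) else 0) =
    (if a \<in> carrier H then sw a (\<lambda>x y. t x * t' y) else 0) * (if b \<in> carrier H then sw b (\<lambda>x y. t x * t' y) else 0)"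
    using a b by simp
qed simp

text \<open>The candidate for the inverse of \<open>t\<close>; it is multiplicative because the
  antipode is (\<open>S_mult\<close>).\<close>

lemma point_S:
  assumes t: "point t"
  shows "point (\<lambda>h. if h \<in> carrier H then t (S h) else 0)"
  unfolding point_def
proof (intro conjI ballI allI impI)
  show "linear_on H (\<lambda>h. if h \<in> carrier H then t (S h) else 0)"
    using linear_simps[OF pointD(1)[OF t]] by (simp add: linear_on_def S_simps)
qed (simp_all add: pointD(2)[OF t] pointD(3)[OF t] S_closed S_mult S_one)

lemma group_points: "group points"
proof (rule groupI)
  fix t t' assume "t \<in> carrier points" "t' \<in> carrier points"
  then show "t \<otimes>\<^bsub>points\<^esub> t' \<in> carrier points" using point_mult by simp
next
  show "\<one>\<^bsub>points\<^esub> \<in> carrier points"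
    using counit_linear by (auto simp: point_def counit_mult counit_one linear_on_def)
next
  fix t1 t2 t3 assume "t1 \<in> carrier points" "t2 \<in> carrier points" "t3 \<in> carrier points"
  then have t: "point t1" "point t2" "point t3" by auto
  have "sw h (\<lambda>x y. sw x (\<lambda>z w. t1 z * t2 w) * t3 y) = sw h (\<lambda>x y. t1 x * sw y (\<lambda>z w. t2 z * t3 w))"
    if h: "h \<in> carrier H" for h
  proof -
    have "sw h (\<lambda>x y. sw x (\<lambda>z w. t1 z * t2 w * t3 y)) = sw h (\<lambda>x y. sw y (\<lambda>z w. t1 x * t2 z * t3 w))"
      by (rule sw_coassoc[OF _ h])
        (use linear_simps[OF pointD(1)[OF t(1)]] linear_simps[OF pointD(1)[OF t(2)]] linear_simps[OF pointD(1)[OF t(3)]]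
          in \<open>simp add: trilinear_on_def linear_on_def algebra_simps\<close>)
    moreover have "sw h (\<lambda>x y. sw x (\<lambda>z w. t1 z * t2 w * t3 y)) = sw h (\<lambda>x y. sw x (\<lambda>z w. t1 z * t2 w) * t3 y)"
      by (simp only: sweedler_fun_mult_right)
    moreover have "sw h (\<lambda>x y. sw y (\<lambda>z w. t1 x * t2 z * t3 w)) = sw h (\<lambda>x y. t1 x * sw y (\<lambda>z w. t2 z * t3 w))"
      by (simp only: mult.assoc sweedler_fun_mult)
    ultimately show ?thesis by simp
  qed
  moreover have "sw h (\<lambda>x y. (if x \<in> carrier H then f x else 0) * g y) = sw h (\<lambda>x y. f x * g y)"
    "sw h (\<lambda>x y. g x * (if y \<in> carrier H then f y else 0)) = sw h (\<lambda>x y. g x * f y)" if h: "h \<in> carrier H" for h f g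
    by (rule sw_cong[OF h]; simp)+
  ultimately show "t1 \<otimes>\<^bsub>points\<^esub> t2 \<otimes>\<^bsub>points\<^esub> t3 = t1 \<otimes>\<^bsub>points\<^esub> (t2 \<otimes>\<^bsub>points\<^esub> t3)"
    by (simp add: fun_eq_iff)
next
  fix t assume "t \<in> carrier points"
  then have t: "point t" by simp
  have "sw h (\<lambda>x y. (if x \<in> carrier H then counit H x else 0) * t y) = t h" if h: "h \<in> carrier H" for h
  proof -
    have "sw h (\<lambda>x y. (if x \<in> carrier H then counit H x else 0) * t y) = sw h (\<lambda>x y. counit H x * t y)"
      by (rule sw_cong[OF h]) simp
    then show ?thesis using sw_counit(1)[OF pointD(1)[OF t] h] by simp
  qed
  then show "\<one>\<^bsub>points\<^esub> \<otimes>\<^bsub>points\<^esub> t = t" using pointD(4)[OF t] by (auto simp: fun_eq_iff)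
  let ?t = "\<lambda>h. if h \<in> carrier H then t (S h) else 0"
  have "sw h (\<lambda>x y. ?t x * t y) = counit H h" if h: "h \<in> carrier H" for h
  proof -
    have "sw h (\<lambda>x y. ?t x * t y) = sw h (\<lambda>x y. t (S x \<bullet> y))"
      by (rule sw_cong[OF h]) (simp add: pointD(2)[OF t] S_closed)
    then show ?thesis using sw_antipode(1)[OF pointD(1)[OF t] h] pointD(3)[OF t] by simp
  qed
  then have "?t \<otimes>\<^bsub>points\<^esub> t = \<one>\<^bsub>points\<^esub>" by (simp add: fun_eq_iff)
  then show "\<exists>t'\<in>carrier points. t' \<otimes>\<^bsub>points\<^esub> t = \<one>\<^bsub>points\<^esub>"
    using point_S[OF t] by (intro bexI[of _ ?t]) simp_all
qed

definition base :: "('h \<Rightarrow> 'k) \<Rightarrow> 'g" where "base t = (THE a. a \<in> carrier G \<and> t (e a) = 1)"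

text \<open>The scalars t(e_a) are orthogonal idempotents of the field with sum 1, so exactly one of
  them is 1.\<close>

lemma point_e:
  assumes t: "point t"
  shows "base t \<in> carrier G" "b \<in> carrier G \<Longrightarrow> t (e b) = (if b = base t then 1 else 0)"
proof -
  have orth: "t (e a) * t (e b) = (if a = b then t (e a) else 0)" if "a \<in> carrier G" "b \<in> carrier G" for a b
  proof -
    have "t (e a) * t (e b) = t (e a \<bullet> e b)" using that pointD(2)[OF t] by simp
    then show ?thesis using that vs.linear_on_zero[OF pointD(1)[OF t]] by (simp add: e_mult)
  qed
  have "(\<Sum>a\<in>carrier G. t (\<one>\<^bsub>H\<^esub> \<bullet> e a)) \<noteq> 0"
    using e_sum[OF pointD(1)[OF t], of "\<one>\<^bsub>H\<^esub>"] pointD(3)[OF t] by simp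
  then obtain a where a: "a \<in> carrier G" "t (e a) \<noteq> 0" by (auto dest: sum.not_neutral_contains_not_neutral)
  then have a1: "t (e a) = 1" using orth[of a a] by simp
  have other: "t (e b) = 0" if "b \<in> carrier G" "b \<noteq> a" for b
    using orth[of a b] that a a1 by simp
  have "base t = a"
    unfolding base_def
  proof (rule the_equality)
    show "a \<in> carrier G \<and> t (e a) = 1" using a a1 by simp
    show "b = a" if "b \<in> carrier G \<and> t (e b) = 1" for b using other[of b] that by (cases "b = a") auto
  qed
  then show "base t \<in> carrier G" "b \<in> carrier G \<Longrightarrow> t (e b) = (if b = base t then 1 else 0)"
    using a a1 other by auto
qed

lemma base_eqI: "point t \<Longrightarrow> a \<in> carrier G \<Longrightarrow> t (e a) = 1 \<Longrightarrow> base t = a"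
  using point_e(2)[of t a] by (auto split: if_splits)

text \<open>The point obtained by composing \<pi> with the linear extension of \<chi> to kC.\<close>

definition dual_point :: "('c \<Rightarrow> 'k) \<Rightarrow> 'h \<Rightarrow> 'k" where
  "dual_point \<chi> = (\<lambda>h. if h \<in> carrier H then \<Sum>c\<in>carrier C. \<pi> h c * \<chi> c else 0)"

lemma dual_point_eval:
  "h \<in> carrier H \<Longrightarrow> \<chi> \<in> carrier (dual_group C) \<Longrightarrow> dual_point \<chi> h = evaluation C (\<pi> h) \<chi>"
  by (simp add: dual_point_def evaluation_def)

lemma dual_point_linear: "linear_on H (dual_point \<chi>)"
  by (simp add: linear_on_def dual_point_def proj_add proj_smult algebra_simps sum.distrib sum_distrib_left)

lemma dual_point_point:
  assumes x: "\<chi> \<in> carrier (dual_group C)"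
  shows "point (dual_point \<chi>)"
  unfolding point_def
proof (intro conjI ballI allI impI dual_point_linear)
  show "dual_point \<chi> \<one>\<^bsub>H\<^esub> = 1" using dual_group_one[OF x] by (simp add: dual_point_def proj_one delta_def if_distrib[of "\<lambda>c. c * _"] cong: if_cong)
  show "dual_point \<chi> h = 0" if "h \<notin> carrier H" for h using that by (simp add: dual_point_def)
  fix a b assume a: "a \<in> carrier H" "b \<in> carrier H"
  have "evaluation C (\<pi> (a \<bullet> b)) \<chi> = evaluation C (conv (\<pi> a) (\<pi> b)) \<chi>"
    using x a by (simp add: evaluation_def proj_mult)
  then show "dual_point \<chi> (a \<bullet> b) = dual_point \<chi> a * dual_point \<chi> b"
    using a x by (simp add: dual_point_eval evaluation_conv)
qed

definition point_ext :: "('g, 'c \<Rightarrow> 'k, 'h \<Rightarrow> 'k) grp_ext" where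
  "point_ext = \<lparr>grp_total = points, grp_incl = dual_point, grp_proj = base\<rparr>"

lemma point_ext_simps [simp]:
  "grp_total point_ext = points" "grp_incl point_ext = dual_point" "grp_proj point_ext = base"
  by (simp_all add: point_ext_def)

lemma base_hom: "base \<in> hom points G"
proof (rule homI)
  fix t assume "t \<in> carrier points"
  then show "base t \<in> carrier G" using point_e(1) by simp
next
  fix t t' assume "t \<in> carrier points" "t' \<in> carrier points"
  then have t: "point t" "point t'" by auto
  note m = point_e(1)[OF t(1)] point_e(1)[OF t(2)]
  note B = functional_bilinear[OF pointD(1)[OF t(1)] pointD(1)[OF t(2)]]
  let ?a = "base t \<otimes>\<^bsub>G\<^esub> base t'"
  have "sw (e ?a) (\<lambda>x y. t x * t' y) = (\<Sum>b\<in>carrier G. t (e b) * t' (e (inv\<^bsub>G\<^esub> b \<otimes>\<^bsub>G\<^esub> ?a)))"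
    by (rule sw_e[OF B]) (use m in simp)
  also have "\<dots> = (\<Sum>b\<in>carrier G. if b = base t then 1 else 0)"
    by (intro sum.cong refl) (use m in \<open>auto simp: point_e(2)[OF t(1)] point_e(2)[OF t(2)] G.m_assoc[symmetric]\<close>)
  finally have "(t \<otimes>\<^bsub>points\<^esub> t') (e ?a) = 1" using m by simp
  then show "base (t \<otimes>\<^bsub>points\<^esub> t') = ?a"
    using m by (intro base_eqI point_mult t) (simp_all del: points_simps)
qed

lemma dual_point_hom: "dual_point \<in> hom (dual_group C) points"
proof (rule homI)
  fix \<chi> :: "'c \<Rightarrow> 'k" assume "\<chi> \<in> carrier (dual_group C)"
  then show "dual_point \<chi> \<in> carrier points" using dual_point_point by simp
next
  fix \<chi> \<psi> :: "'c \<Rightarrow> 'k"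
  have "sw h (\<lambda>x y. dual_point \<chi> x * dual_point \<psi> y) = (\<Sum>c\<in>carrier C. \<pi> h c * (\<chi> c * \<psi> c))"
    if h: "h \<in> carrier H" for h
  proof -
    have "sw h (\<lambda>x y. dual_point \<chi> x * dual_point \<psi> y) =
      sw h (\<lambda>x y. \<Sum>c\<in>carrier C. \<Sum>d\<in>carrier C. (\<chi> c * \<psi> d) * (\<pi> x c * \<pi> y d))"
      by (rule sw_cong[OF h]) (simp add: dual_point_def sum_product ac_simps)
    also have "\<dots> = (\<Sum>c\<in>carrier C. \<Sum>d\<in>carrier C. if d = c then \<pi> h c * (\<chi> c * \<psi> c) else 0)"
      unfolding sweedler_fun_sum sweedler_fun_mult
      by (intro sum.cong refl) (auto simp: sw_proj[OF h])
    finally show ?thesis by simp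
  qed
  then show "dual_point (\<chi> \<otimes>\<^bsub>dual_group C\<^esub> \<psi>) = dual_point \<chi> \<otimes>\<^bsub>points\<^esub> dual_point \<psi>"
    by (simp add: fun_eq_iff) (simp add: dual_point_def)
qed

lemma dual_point_inj: "inj_on dual_point (carrier (dual_group C))"
proof (rule inj_onI, rule ext)
  fix \<chi> \<psi> :: "'c \<Rightarrow> 'k" and c
  assume x: "\<chi> \<in> carrier (dual_group C)" "\<psi> \<in> carrier (dual_group C)" "dual_point \<chi> = dual_point \<psi>"
  have v: "dual_point \<chi> (lift c) = \<chi> c" if "c \<in> carrier C" for c and \<chi> :: "'c \<Rightarrow> 'k"
    using lift[OF that] that by (simp add: dual_point_def delta_def if_distrib[of "\<lambda>c. c * _"] cong: if_cong)
  show "\<chi> c = \<psi> c"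
    using v[of c \<chi>] v[of c \<psi>] x by (cases "c \<in> carrier C") (auto simp: dual_group_iff)
qed

text \<open>A point over the identity takes the value 1 at e_1. It therefore factors through the
  fibre over 1, a copy of kC, and restricts to a character on the basis \<open>s c\<close>.\<close>

lemma point_kernel: "kernel points G base = dual_point ` carrier (dual_group C)"
proof
  show "dual_point ` carrier (dual_group C) \<subseteq> kernel points G base"
  proof
    fix t assume "t \<in> dual_point ` carrier (dual_group C)"
    then obtain \<chi> where x: "\<chi> \<in> carrier (dual_group C)" "t = dual_point \<chi>" by auto
    have "t (e \<one>\<^bsub>G\<^esub>) = (\<Sum>c\<in>carrier C. (if c = \<one> then 1 else 0) * \<chi> c)"
      by (simp add: x(2) dual_point_def proj_e)
    also have "\<dots> = 1"
      using dual_group_one[OF x(1)] by (simp add: if_distrib[of "\<lambda>c. c * _"] cong: if_cong)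
    finally show "t \<in> kernel points G base"
      using base_eqI[of t "\<one>\<^bsub>G\<^esub>"] dual_point_point[OF x(1)] by (simp add: kernel_def x(2))
  qed
  show "kernel points G base \<subseteq> dual_point ` carrier (dual_group C)"
  proof
    fix t assume "t \<in> kernel points G base"
    then have t: "point t" and b: "base t = \<one>\<^bsub>G\<^esub>" by (auto simp: kernel_def)
    have e1: "t (e \<one>\<^bsub>G\<^esub>) = 1" using point_e(2)[OF t] b by simp
    define \<chi> where "\<chi> c = (if c \<in> carrier C then t (s c) else 0)" for c
    have th: "t h = (\<Sum>c\<in>carrier C. \<pi> h c * \<chi> c)" if h: "h \<in> carrier H" for h
    proof -
      have "t h = t (h \<bullet> e \<one>\<^bsub>G\<^esub>)" using pointD(2)[OF t h, of "e \<one>\<^bsub>G\<^esub>"] e1 by simp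
      then show ?thesis using mult_e_one_expand[OF pointD(1)[OF t] h] by (simp add: \<chi>_def)
    qed
    have mul: "\<chi> (c \<otimes> d) = \<chi> c * \<chi> d" if cd: "c \<in> carrier C" "d \<in> carrier C" for c d
    proof -
      have "\<chi> c * \<chi> d = t (s c \<bullet> s d)" using cd pointD(2)[OF t] s_closed by (simp add: \<chi>_def)
      also have "\<dots> = (\<Sum>x\<in>carrier C. \<pi> (s c \<bullet> s d) x * \<chi> x)" using cd s_closed by (intro th) simp
      also have "\<dots> = (\<Sum>x\<in>carrier C. if x = c \<otimes> d then \<chi> x else 0)"
      proof (intro sum.cong refl)
        fix x assume x: "x \<in> carrier C"
        have "\<pi> (s c \<bullet> s d) x = conv (\<pi> (s c)) (\<pi> (s d)) x"
          using x cd s_closed by (simp add: proj_mult)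
        also have "\<dots> = conv (\<lambda>y. if y = c then 1 else 0) (\<pi> (s d)) x"
          by (rule conv_cong) (use x cd in \<open>auto simp: proj_s delta_def\<close>)
        also have "\<dots> = delta d (inv c \<otimes> x)" using x cd by (simp add: conv_delta proj_s)
        finally have "\<pi> (s c \<bullet> s d) x = delta d (inv c \<otimes> x)" .
        moreover have "inv c \<otimes> x = d \<longleftrightarrow> x = c \<otimes> d" using x cd inv_solve_left'[of d c x] by auto
        ultimately show "\<pi> (s c \<bullet> s d) x * \<chi> x = (if x = c \<otimes> d then \<chi> x else 0)" by (simp add: delta_def)
      qed
      finally show ?thesis using cd by simp
    qed
    have "t \<one>\<^bsub>H\<^esub> = (\<Sum>c\<in>carrier C. \<pi> \<one>\<^bsub>H\<^esub> c * \<chi> c)" by (rule th) simp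
    then have one: "\<chi> \<one> = 1"
      using pointD(3)[OF t] by (simp add: proj_one delta_def if_distrib[of "\<lambda>c. c * _"] cong: if_cong)
    have nz: "\<chi> c \<noteq> 0" if "c \<in> carrier C" for c
      using mul[of c "inv c"] that one by auto
    have "\<chi> \<in> carrier (dual_group C)" using mul nz by (auto simp: dual_group_iff \<chi>_def)
    moreover have "t = dual_point \<chi>" using th pointD(4)[OF t] by (auto simp: dual_point_def fun_eq_iff)
    ultimately show "t \<in> dual_point ` carrier (dual_group C)" by blast
  qed
qed

lemma point_ext_central: "central_extension (dual_group C) G point_ext"
proof -
  interpret D: prime_group "dual_group C :: ('c \<Rightarrow> 'k) monoid" p by (rule dual_prime_group)
  have "base ` carrier points = carrier G"
  proof
    show "base ` carrier points \<subseteq> carrier G" using base_hom by (auto simp: hom_def)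
    show "carrier G \<subseteq> base ` carrier points"
    proof
      fix a assume a: "a \<in> carrier G"
      obtain t where "point t" "t (e a) = 1" using point_exists[OF a] by blast
      then have "t \<in> carrier points" "base t = a" using base_eqI a by auto
      then show "a \<in> base ` carrier points" by blast
    qed
  qed
  moreover have "dual_point c \<otimes>\<^bsub>points\<^esub> t = t \<otimes>\<^bsub>points\<^esub> dual_point c"
    if "c \<in> carrier (dual_group C)" "t \<in> carrier points" for c t
    using D.normal_prime_order_central[OF group_points group_G finite_G order_G dual_point_hom dual_point_inj base_hom point_kernel that] .
  ultimately show ?thesis
    unfolding central_extension_def Let_def point_ext_simps
    using group_points dual_point_hom dual_point_inj base_hom point_kernel by blast
qed

text \<open>There is no dimension bound on \<open>H\<close> to appeal to; the bound comes from the
  extension, whose kernel and quotient are finite.\<close>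

lemma finite_points: "finite (carrier points)"
proof -
  interpret D: grp_setup G "dual_group C :: ('c \<Rightarrow> 'k) monoid" by (rule dual_grp_setup)
  obtain c where "grp_ext_equiv (dual_group C) point_ext (cocycle_ext G (dual_group C) c)"
    using D.central_extension_equiv_cocycle_ext[OF point_ext_central] by blast
  then obtain F where "F \<in> iso points (grp_total (cocycle_ext G (dual_group C) c))"
    unfolding grp_ext_equiv_def by auto
  then have "bij_betw F (carrier points) (carrier G \<times> carrier (dual_group C))" by (simp add: iso_def)
  moreover have "finite (carrier G \<times> carrier (dual_group C :: ('c \<Rightarrow> 'k) monoid))"
    by (rule finite_cartesian_product[OF finite_G finite_dual])
  ultimately show ?thesis using bij_betw_finite by blast
qed

text \<open>With a point t over a, h e_a is the sum of the t(h_1) t(S(h_2)) h_3 e_a. By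
  \<open>N_expand\<close> the last two legs enter only through \<pi>, so h e_a depends only on the
  coefficients t(h_1) \<pi>(h_2)(c). Fourier inversion recovers these from the values of h at the
  translates of t by the dual of \<open>C\<close>.\<close>

lemma points_separate:
  assumes h: "h \<in> carrier H" and z: "\<And>t. point t \<Longrightarrow> t h = 0"
  shows "h = \<zero>\<^bsub>H\<^esub>"
proof (rule vs.eq_if_functionals_eq[OF h])
  fix f assume f: "linear_on H f"
  have "f (h \<bullet> e a) = 0" if a: "a \<in> carrier G" for a
  proof -
    obtain t where t: "point t" "t (e a) = 1" using point_exists[OF a] by blast
    note tl = pointD(1)[OF t(1)]
    have lin: "linear_on H (\<lambda>y. f (y \<bullet> e a))" using f a by (intro linear_functional_mult) auto
    \<comment> \<open>As t(e_a) = 1, the factor e_a inside \<open>N\<close> is invisible to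
      t.\<close>
    have tN: "t (e a \<bullet> \<one>\<^bsub>H\<^esub> \<bullet> S x) = t (S x)" if "x \<in> carrier H" for x
      using that a pointD(2)[OF t(1)] t(2) by (simp add: S_closed)
    have "f (h \<bullet> e a) = sw h (\<lambda>x y. counit H x * f (y \<bullet> e a))"
      by (rule sw_counit(1)[OF lin h, symmetric])
    also have "\<dots> = sw h (\<lambda>x y. sw x (\<lambda>x1 x2. t x1 * t (S x2) * f (y \<bullet> e a)))"
    proof (rule sw_cong[OF h])
      fix x y assume m: "x \<in> carrier H" "y \<in> carrier H"
      have "sw x (\<lambda>x1 x2. t x1 * t (S x2)) = sw x (\<lambda>x1 x2. t (x1 \<bullet> S x2))"
        by (rule sw_cong[OF m(1)]) (simp add: pointD(2)[OF t(1)] S_closed)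
      then have "sw x (\<lambda>x1 x2. t x1 * t (S x2)) = counit H x"
        using sw_antipode(2)[OF tl m(1)] pointD(3)[OF t(1)] by simp
      then show "counit H x * f (y \<bullet> e a) = sw x (\<lambda>x1 x2. t x1 * t (S x2) * f (y \<bullet> e a))"
        by (simp add: sweedler_fun_mult_right)
    qed
    also have "\<dots> = sw h (\<lambda>x y. sw y (\<lambda>y1 y2. t x * t (S y1) * f (y2 \<bullet> e a)))"
      by (rule sw_coassoc[OF _ h])
        (use linear_simps[OF tl] linear_simps[OF f] a in \<open>simp add: trilinear_on_def multilinear_simps algebra_simps\<close>)
    also have "\<dots> = sw h (\<lambda>x y. \<Sum>c\<in>carrier C. N t f a \<one>\<^bsub>H\<^esub> (s c) * (t x * \<pi> y c))"
    proof (rule sw_cong[OF h])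
      fix x y assume m: "x \<in> carrier H" "y \<in> carrier H"
      have "sw y (\<lambda>y1 y2. t x * t (S y1) * f (y2 \<bullet> e a)) = t x * N t f a \<one>\<^bsub>H\<^esub> y"
        unfolding N_def sweedler_fun_mult[symmetric]
        by (rule sw_cong[OF m(2)]) (simp add: tN mult.assoc del: H.r_one)
      then show "sw y (\<lambda>y1 y2. t x * t (S y1) * f (y2 \<bullet> e a)) =
        (\<Sum>c\<in>carrier C. N t f a \<one>\<^bsub>H\<^esub> (s c) * (t x * \<pi> y c))"
        using N_expand[OF tl f a H.one_closed m(2)] by (simp add: sum_distrib_left ac_simps)
    qed
    also have "\<dots> = (\<Sum>c\<in>carrier C. N t f a \<one>\<^bsub>H\<^esub> (s c) * sw h (\<lambda>x y. t x * \<pi> y c))"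
      by (simp add: sweedler_fun_sum sweedler_fun_mult)
    also have "\<dots> = 0"
    proof -
      \<comment> \<open>Its Fourier transform at \<chi> is the value of h at the product of t with
        the point of \<chi>, which is 0 by hypothesis.\<close>
      define u where "u c = (if c \<in> carrier C then sw h (\<lambda>x y. t x * \<pi> y c) else 0)" for c
      have "evaluation C u \<chi> = evaluation C (\<lambda>x. 0) \<chi>" for \<chi>
      proof (cases "\<chi> \<in> carrier (dual_group C)")
        case True
        have "evaluation C u \<chi> = sw h (\<lambda>x y. \<Sum>c\<in>carrier C. t x * \<pi> y c * \<chi> c)"
          using True by (simp add: evaluation_def u_def sweedler_fun_sum sweedler_fun_mult_right)
        also have "\<dots> = sw h (\<lambda>x y. t x * dual_point \<chi> y)"
          by (rule sw_cong[OF h]) (simp add: dual_point_def sum_distrib_left mult.assoc)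
        also have "\<dots> = 0"
          using z[OF point_mult[OF t(1) dual_point_point[OF True]]] h by simp
        finally show ?thesis using True by (simp add: evaluation_def)
      qed (simp add: evaluation_def)
      then have "u = (\<lambda>x. 0)"
        by (intro inj_onD[OF evaluation_inj_on]) (auto simp: u_def funs_on_def fun_eq_iff)
      then have "u c = 0" for c by (rule fun_cong)
      then have "sw h (\<lambda>x y. t x * \<pi> y c) = 0" if "c \<in> carrier C" for c
        using that unfolding u_def by metis
      then show ?thesis by simp
    qed
    finally show ?thesis .
  qed
  then show "f h = f \<zero>\<^bsub>H\<^esub>" using e_sum[OF f h] vs.linear_on_zero[OF f] by simp
qed simp

text \<open>Lagrange interpolation: a product with one factor for every point to be avoided.\<close>

lemma points_interpolate:
  assumes t: "point t" and F: "finite F" "\<And>t'. t' \<in> F \<Longrightarrow> point t' \<and> t' \<noteq> t"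
  shows "\<exists>h\<in>carrier H. t h = 1 \<and> (\<forall>t'\<in>F. t' h = 0)"
  using F
proof (induction F rule: finite_induct)
  case empty
  show ?case using pointD(3)[OF t] by (intro bexI[of _ "\<one>\<^bsub>H\<^esub>"]) auto
next
  case (insert t' F)
  then obtain h where h: "h \<in> carrier H" "t h = 1" "\<forall>t'\<in>F. t' h = 0" by auto
  have t': "point t'" "t' \<noteq> t" using insert by auto
  then obtain g where g: "t' g \<noteq> t g" by (auto simp: fun_eq_iff)
  then have gc: "g \<in> carrier H" using pointD(4)[OF t] pointD(4)[OF t'(1)] by metis
  \<comment> \<open>The factor with value 1 at t and 0 at t'.\<close>
  let ?g = "inverse (t g - t' g) \<odot>\<^bsub>H\<^esub> (g \<ominus>\<^bsub>H\<^esub> (t' g \<odot>\<^bsub>H\<^esub> \<one>\<^bsub>H\<^esub>))"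
  have cl: "?g \<in> carrier H" using gc by auto
  have val: "t'' ?g = inverse (t g - t' g) * (t'' g - t' g)" if "point t''" for t''
    using gc linear_simps(2)[OF pointD(1)[OF that]] vs.linear_on_minus[OF pointD(1)[OF that]] pointD(3)[OF that]
    by simp
  show ?case
  proof (rule bexI[of _ "h \<bullet> ?g"], intro conjI ballI)
    show "h \<bullet> ?g \<in> carrier H" using h cl by simp
    show "t (h \<bullet> ?g) = 1" using pointD(2)[OF t h(1) cl] h val[OF t] g by simp
    fix t'' assume "t'' \<in> insert t' F"
    then show "t'' (h \<bullet> ?g) = 0"
    proof
      assume "t'' = t'"
      then show ?thesis using pointD(2)[OF t'(1) h(1) cl] val[OF t'(1)] by simp
    next
      assume t'': "t'' \<in> F"
      then have "point t''" using insert by auto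
      from pointD(2)[OF this h(1) cl] show ?thesis using h(3) t'' by simp
    qed
  qed
qed

text \<open>The Gelfand transform of \<open>H\<close>: injective by \<open>points_separate\<close>,
  surjective by interpolation on the finite set of points, and compatible with the comultiplication
  because points are multiplied by convolution.\<close>

lemma equiv_fun_ext_points: "hopf_ext_equiv G E (fun_ext C point_ext)"
proof -
  define \<Theta> where "\<Theta> h = (\<lambda>t. if point t then t h else 0)" for h
  interpret L: group points by (rule group_points)
  interpret A: fun_space "fun_alg points :: ('k, ('h \<Rightarrow> 'k) \<Rightarrow> 'k) bialg" "carrier points"
    by (rule fun_space_fun_alg[OF finite_points])
  have \<Theta>c: "\<Theta> h \<in> funs_on (carrier points)" for h by (auto simp: \<Theta>_def funs_on_def)
  have "hopf_map H (fun_alg points) \<Theta>"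
    unfolding hopf_map_iff
  proof (intro conjI allI ballI)
    have "\<Theta> (a \<bullet> b) t = \<Theta> a t * \<Theta> b t" "\<Theta> (a \<oplus>\<^bsub>H\<^esub> b) t = \<Theta> a t + \<Theta> b t"
      if "a \<in> carrier H" "b \<in> carrier H" for a b t
      using pointD(2)[OF _ that, of t] linear_simps(1)[OF _ that, of t] pointD(1)[of t] by (simp_all add: \<Theta>_def)
    moreover have "\<Theta> \<one>\<^bsub>H\<^esub> t = (if t \<in> carrier points then 1 else 0)" for t
      using pointD(3)[of t] by (simp add: \<Theta>_def)
    ultimately show "\<Theta> \<in> ring_hom H (fun_alg points)"
      using \<Theta>c by (simp add: ring_hom_def fun_eq_iff)
    fix h assume h: "h \<in> carrier H"
    show "\<Theta> (c \<odot>\<^bsub>H\<^esub> h) = c \<odot>\<^bsub>fun_alg points\<^esub> \<Theta> h" for c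
    proof
      fix t show "\<Theta> (c \<odot>\<^bsub>H\<^esub> h) t = (c \<odot>\<^bsub>fun_alg points\<^esub> \<Theta> h) t"
        using linear_simps(2)[OF _ h, of t] pointD(1)[of t] by (simp add: \<Theta>_def)
    qed
    show "counit (fun_alg points) (\<Theta> h) = counit H h"
      using L.one_closed h by (simp add: \<Theta>_def)
    show "tensor_eq (fun_alg points) 2 (comult (fun_alg points) (\<Theta> h)) (map_tensor \<Theta> (comult H h))"
    proof (rule A.tensor_eq_2_coords[OF fun_alg_tensors])
      show "map_tensor \<Theta> (comult H h) \<in> tensors (fun_alg points) 2"
        by (rule map_tensor_in_tensors[OF comult_H[OF h]]) (use \<Theta>c in simp)
      fix t t' assume t: "t \<in> carrier points" "t' \<in> carrier points"
      have pm: "point (t \<otimes>\<^bsub>points\<^esub> t')" using t point_mult by simp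
      have "sweedler (comult (fun_alg points) (\<Theta> h)) (\<lambda>u v. u t * v t') = \<Theta> h (t \<otimes>\<^bsub>points\<^esub> t')"
        by (rule fun_alg_coords[OF finite_points t])
      also have "\<dots> = sw h (\<lambda>x y. t x * t' y)" using pm h by (simp add: \<Theta>_def)
      also have "\<dots> = sweedler (map_tensor \<Theta> (comult H h)) (\<lambda>u v. u t * v t')"
        using t by (simp add: sweedler_map_tensor[OF comult_H[OF h]] \<Theta>_def)
      finally show "sweedler (comult (fun_alg points) (\<Theta> h)) (\<lambda>u v. u t * v t') =
        sweedler (map_tensor \<Theta> (comult H h)) (\<lambda>u v. u t * v t')" .
    qed
  qed
  moreover have "bij_betw \<Theta> (carrier H) (funs_on (carrier points))"
  proof -
    have "inj_on \<Theta> (carrier H)"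
    proof (rule inj_onI)
      fix h k assume h: "h \<in> carrier H" and k: "k \<in> carrier H" and eq: "\<Theta> h = \<Theta> k"
      have "t (h \<ominus>\<^bsub>H\<^esub> k) = 0" if t: "point t" for t
        using fun_cong[OF eq, of t] t vs.linear_on_minus[OF pointD(1)[OF t] h k] by (simp add: \<Theta>_def)
      then have d: "h \<ominus>\<^bsub>H\<^esub> k = \<zero>\<^bsub>H\<^esub>" using h k by (intro points_separate) auto
      then show "h = k" using h k by (simp add: H.r_right_minus_eq)
    qed
    moreover have "funs_on (carrier points) \<subseteq> \<Theta> ` carrier H"
    proof
      fix w :: "('h \<Rightarrow> 'k) \<Rightarrow> 'k" assume w: "w \<in> funs_on (carrier points)"
      have "\<forall>t\<in>carrier points. \<exists>h. h \<in> carrier H \<and> t h = 1 \<and> (\<forall>t'\<in>carrier points - {t}. t' h = 0)"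
      proof
        fix t assume t: "t \<in> carrier points"
        have "finite (carrier points - {t})" by (rule finite_Diff[OF finite_points])
        from points_interpolate[OF _ this, of t] t
        obtain h where "h \<in> carrier H" "t h = 1" "\<forall>t'\<in>carrier points - {t}. t' h = 0" by fastforce
        then show "\<exists>h. h \<in> carrier H \<and> t h = 1 \<and> (\<forall>t'\<in>carrier points - {t}. t' h = 0)" by (intro exI conjI)
      qed
      from bchoice[OF this] obtain k where
        k: "\<forall>t\<in>carrier points. k t \<in> carrier H \<and> t (k t) = 1 \<and> (\<forall>t'\<in>carrier points - {t}. t' (k t) = 0)" ..
      let ?h = "finsum H (\<lambda>t. w t \<odot>\<^bsub>H\<^esub> k t) (carrier points)"
      have kc: "(\<lambda>t. w t \<odot>\<^bsub>H\<^esub> k t) \<in> carrier points \<rightarrow> carrier H" using k by auto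
      have eq: "\<Theta> ?h = w"
      proof
        fix t show "\<Theta> ?h t = w t"
        proof (cases "point t")
          case True
          have "t ?h = (\<Sum>t'\<in>carrier points. w t' * t (k t'))"
            using vs.linear_on_finsum[OF pointD(1)[OF True] finite_points kc] k linear_simps(2)[OF pointD(1)[OF True]] by simp
          also have "\<dots> = (\<Sum>t'\<in>carrier points. if t' = t then w t else 0)"
            by (intro sum.cong refl) (use k True in auto)
          finally show ?thesis using True finite_points by (simp add: \<Theta>_def)
        qed (use w in \<open>simp add: \<Theta>_def funs_on_def\<close>)
      qed
      have "?h \<in> carrier H" by (rule vs.finsum_closed[OF kc])
      with eq[symmetric] show "w \<in> \<Theta> ` carrier H" by (rule image_eqI)
    qed
    ultimately show ?thesis using \<Theta>c by (auto simp: bij_betw_def)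
  qed
  moreover have "\<Theta> (\<iota> f) = hopf_incl (fun_ext C point_ext) f" if f: "f \<in> funs_on (carrier G)" for f
  proof
    fix t show "\<Theta> (\<iota> f) t = hopf_incl (fun_ext C point_ext) f t"
    proof (cases "point t")
      case True
      have "t (\<iota> f) = (\<Sum>a\<in>carrier G. f a * t (e a))" by (rule incl_expand[OF pointD(1)[OF True] f])
      also have "\<dots> = (\<Sum>a\<in>carrier G. if a = base t then f (base t) else 0)"
        by (intro sum.cong refl) (simp add: point_e(2)[OF True])
      finally show ?thesis using True point_e(1)[OF True] by (simp add: \<Theta>_def)
    qed (simp add: \<Theta>_def)
  qed
  moreover have "hopf_proj (fun_ext C point_ext) (\<Theta> h) = \<pi> h" if h: "h \<in> carrier H" for h
    by (rule fun_ext_proj) (use h proj_closed dual_point_point in \<open>auto simp: \<Theta>_def dual_point_eval\<close>)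
  ultimately show ?thesis unfolding hopf_ext_equiv_def by auto
qed

lemma equiv_H_ext: "\<exists>\<tau>\<in>cocycles C G. hopf_ext_equiv G E (H_ext C G \<tau>)"
proof -
  obtain \<tau> where t: "\<tau> \<in> cocycles C G" "grp_ext_equiv (dual_group C) point_ext (G_ext C G \<tau>)"
    using central_extension_equiv_G_ext[OF point_ext_central] by blast
  interpret D: grp_setup G "dual_group C :: ('c \<Rightarrow> 'k) monoid" by (rule dual_grp_setup)
  interpret T: cocycle_setup C p G n \<tau> by unfold_locales (rule t)
  have gV: "group (grp_total (G_ext C G \<tau>))"
    unfolding G_ext_dual_cocycle
    by (rule central_extension_simps(1)[OF D.cocycle_ext_central[OF dual_cocycle_in[OF t(1)]]])
  have "hopf_ext_equiv G (fun_ext C point_ext) (fun_ext C (G_ext C G \<tau>))"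
    by (rule fun_ext_equiv_if_grp_ext_equiv)
      (use finite_points group_points gV t dual_point_point in auto)
  from hopf_ext_equiv_trans[OF equiv_fun_ext_points this]
  have "hopf_ext_equiv G E (fun_ext C (G_ext C G \<tau>))" .
  moreover have "hopf_ext_equiv G (fun_ext C (G_ext C G \<tau>)) (H_ext C G \<tau>)"
    by (rule hopf_ext_equiv_sym[OF T.H_ext_hopf H_ext_equiv_fun_ext[OF t(1)]])
  ultimately have "hopf_ext_equiv G E (H_ext C G \<tau>)" by (rule hopf_ext_equiv_trans)
  with t(1) show ?thesis by - (rule bexI)
qed

end

section \<open>The isomorphism\<close>

text \<open>The group laws are asked only after applying \<open>h\<close>: cocycles take arbitrary
  values off the carriers, so representatives have inverses only up to the passage to
  classes.\<close>

lemma group_image: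
  fixes M :: "'a set" and h :: "'a \<Rightarrow> 'b"
  assumes "carrier K = h ` M"
    and "\<And>s t. s \<in> M \<Longrightarrow> t \<in> M \<Longrightarrow> f s t \<in> M" "\<And>s t. s \<in> M \<Longrightarrow> t \<in> M \<Longrightarrow> h s \<otimes>\<^bsub>K\<^esub> h t = h (f s t)"
    and "u \<in> M" "\<one>\<^bsub>K\<^esub> = h u"
    and "\<And>r s t. r \<in> M \<Longrightarrow> s \<in> M \<Longrightarrow> t \<in> M \<Longrightarrow> h (f (f r s) t) = h (f r (f s t))"
    and "\<And>t. t \<in> M \<Longrightarrow> h (f u t) = h t"
    and "\<And>t. t \<in> M \<Longrightarrow> \<exists>s\<in>M. h (f s t) = h u"
  shows "group K"
proof (rule groupI)
  fix x assume "x \<in> carrier K"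
  then obtain t where t: "t \<in> M" "x = h t" using assms(1) by auto
  obtain s where "s \<in> M" "h (f s t) = h u" using assms(8)[OF t(1)] by blast
  then show "\<exists>y\<in>carrier K. y \<otimes>\<^bsub>K\<^esub> x = \<one>\<^bsub>K\<^esub>"
    using t assms(1,3,5) by (intro bexI[of _ "h s"]) auto
qed (use assms in auto)

lemma grp_cocycles_hom:
  assumes c: "c \<in> grp_cocycles G A" and f: "f \<in> hom A B" and A: "group A" and B: "group B" and G: "group G"
  shows "(\<lambda>a b. f (c a b)) \<in> grp_cocycles G B"
proof -
  interpret f: group_hom A B f by (rule group_hom.intro[OF A B]) (simp add: group_hom_axioms_def f)
  interpret G: group G by (rule G)
  have cc: "c a b \<in> carrier A" if "a \<in> carrier G" "b \<in> carrier G" for a b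
    using c that by (simp add: grp_cocycles_def)
  have "f (c a (b \<otimes>\<^bsub>G\<^esub> d)) \<otimes>\<^bsub>B\<^esub> f (c b d) = f (c (a \<otimes>\<^bsub>G\<^esub> b) d) \<otimes>\<^bsub>B\<^esub> f (c a b)"
    if "a \<in> carrier G" "b \<in> carrier G" "d \<in> carrier G" for a b d
  proof -
    have "f (c a (b \<otimes>\<^bsub>G\<^esub> d)) \<otimes>\<^bsub>B\<^esub> f (c b d) = f (c a (b \<otimes>\<^bsub>G\<^esub> d) \<otimes>\<^bsub>A\<^esub> c b d)"
      using that cc by simp
    also have "c a (b \<otimes>\<^bsub>G\<^esub> d) \<otimes>\<^bsub>A\<^esub> c b d = c (a \<otimes>\<^bsub>G\<^esub> b) d \<otimes>\<^bsub>A\<^esub> c a b"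
      using c that by (simp add: grp_cocycles_def)
    finally show ?thesis using that cc by simp
  qed
  then show ?thesis using c cc by (auto simp: grp_cocycles_def)
qed

definition cocycle_times :: "('c \<Rightarrow> 'g \<Rightarrow> 'g \<Rightarrow> 'k::field) \<Rightarrow> ('c \<Rightarrow> 'g \<Rightarrow> 'g \<Rightarrow> 'k) \<Rightarrow> 'c \<Rightarrow> 'g \<Rightarrow> 'g \<Rightarrow> 'k" where
  "cocycle_times \<sigma> \<tau> = (\<lambda>x a b. \<sigma> x a b * \<tau> x a b)"

section \<open>The group of classes of commutative Hopf extensions\<close>

context ext_setup
begin

lemma C_grp_setup: "grp_setup G C"
  by (simp add: grp_setup_def group_G C_comm_group)

lemma cocycle_times_in:
  fixes \<sigma> \<tau> :: "'c \<Rightarrow> 'g \<Rightarrow> 'g \<Rightarrow> 'k::field"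
  assumes "\<sigma> \<in> cocycles C G" "\<tau> \<in> cocycles C G"
  shows "cocycle_times \<sigma> \<tau> \<in> cocycles C G"
proof -
  interpret S: cocycle_setup C p G n \<sigma> by unfold_locales (rule assms)
  interpret T: cocycle_setup C p G n \<tau> by unfold_locales (rule assms)
  have "\<sigma> x a (b \<otimes>\<^bsub>G\<^esub> c) * \<tau> x a (b \<otimes>\<^bsub>G\<^esub> c) * (\<sigma> x b c * \<tau> x b c) =
      \<sigma> x (a \<otimes>\<^bsub>G\<^esub> b) c * \<tau> x (a \<otimes>\<^bsub>G\<^esub> b) c * (\<sigma> x a b * \<tau> x a b)"
    if m: "x \<in> carrier C" "a \<in> carrier G" "b \<in> carrier G" "c \<in> carrier G" for x a b c
  proof -
    have "\<sigma> x a (b \<otimes>\<^bsub>G\<^esub> c) * \<tau> x a (b \<otimes>\<^bsub>G\<^esub> c) * (\<sigma> x b c * \<tau> x b c) =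
      (\<sigma> x a (b \<otimes>\<^bsub>G\<^esub> c) * \<sigma> x b c) * (\<tau> x a (b \<otimes>\<^bsub>G\<^esub> c) * \<tau> x b c)" by (simp only: ac_simps)
    also have "\<dots> = (\<sigma> x (a \<otimes>\<^bsub>G\<^esub> b) c * \<sigma> x a b) * (\<tau> x (a \<otimes>\<^bsub>G\<^esub> b) c * \<tau> x a b)"
      by (simp only: S.cocycle_simps(5)[OF m] T.cocycle_simps(5)[OF m])
    finally show ?thesis by (simp only: ac_simps)
  qed
  then show ?thesis
    unfolding cocycles_def cocycle_times_def
    by (auto simp: S.cocycle_simps(1-4) T.cocycle_simps(1-4) S.cocycle_simps(6) T.cocycle_simps(6))
qed

lemma one_cocycle: "(\<lambda>x a b. 1) \<in> cocycles C G"
  by (simp add: cocycles_def)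

lemma cocycle_inverse:
  fixes \<tau> :: "'c \<Rightarrow> 'g \<Rightarrow> 'g \<Rightarrow> 'k::field"
  assumes "\<tau> \<in> cocycles C G"
  shows "(\<lambda>x a b. inverse (\<tau> x a b)) \<in> cocycles C G"
proof -
  interpret T: cocycle_setup C p G n \<tau> by unfold_locales (rule assms)
  have "inverse (\<tau> x a (b \<otimes>\<^bsub>G\<^esub> c)) * inverse (\<tau> x b c) = inverse (\<tau> x (a \<otimes>\<^bsub>G\<^esub> b) c) * inverse (\<tau> x a b)"
    if m: "x \<in> carrier C" "a \<in> carrier G" "b \<in> carrier G" "c \<in> carrier G" for x a b c
    unfolding inverse_mult_distrib[symmetric] T.cocycle_simps(5)[OF m] ..
  then show ?thesis
    unfolding cocycles_def by (auto simp: T.cocycle_simps(1-4) T.cocycle_simps(6))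
qed

lemma cohomologous_times:
  fixes \<sigma> \<sigma>' \<tau> \<tau>' :: "'c \<Rightarrow> 'g \<Rightarrow> 'g \<Rightarrow> 'k::field"
  assumes "cohomologous C G \<sigma> \<sigma>'" "cohomologous C G \<tau> \<tau>'"
  shows "cohomologous C G (cocycle_times \<sigma> \<tau>) (cocycle_times \<sigma>' \<tau>')"
proof -
  obtain \<eta> where e: "\<forall>x\<in>carrier C. \<forall>a\<in>carrier G. \<eta> x a \<noteq> 0"
    "\<forall>x\<in>carrier C. \<forall>y\<in>carrier C. \<forall>a\<in>carrier G. \<eta> (x \<otimes> y) a = \<eta> x a * \<eta> y a"
    "\<forall>x\<in>carrier C. \<forall>a\<in>carrier G. \<forall>b\<in>carrier G.
      \<sigma> x a b * (\<eta> x a * \<eta> x b) = \<sigma>' x a b * \<eta> x (a \<otimes>\<^bsub>G\<^esub> b)"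
    using assms(1) unfolding cohomologous_def by blast
  obtain \<zeta> where z: "\<forall>x\<in>carrier C. \<forall>a\<in>carrier G. \<zeta> x a \<noteq> 0"
    "\<forall>x\<in>carrier C. \<forall>y\<in>carrier C. \<forall>a\<in>carrier G. \<zeta> (x \<otimes> y) a = \<zeta> x a * \<zeta> y a"
    "\<forall>x\<in>carrier C. \<forall>a\<in>carrier G. \<forall>b\<in>carrier G.
      \<tau> x a b * (\<zeta> x a * \<zeta> x b) = \<tau>' x a b * \<zeta> x (a \<otimes>\<^bsub>G\<^esub> b)"
    using assms(2) unfolding cohomologous_def by blast
  have "\<sigma> x a b * \<tau> x a b * (\<eta> x a * \<zeta> x a * (\<eta> x b * \<zeta> x b)) =
      \<sigma>' x a b * \<tau>' x a b * (\<eta> x (a \<otimes>\<^bsub>G\<^esub> b) * \<zeta> x (a \<otimes>\<^bsub>G\<^esub> b))"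
    if m: "x \<in> carrier C" "a \<in> carrier G" "b \<in> carrier G" for x a b
  proof -
    have "\<sigma> x a b * \<tau> x a b * (\<eta> x a * \<zeta> x a * (\<eta> x b * \<zeta> x b)) =
      (\<sigma> x a b * (\<eta> x a * \<eta> x b)) * (\<tau> x a b * (\<zeta> x a * \<zeta> x b))" by (simp only: ac_simps)
    also have "\<dots> = (\<sigma>' x a b * \<eta> x (a \<otimes>\<^bsub>G\<^esub> b)) * (\<tau>' x a b * \<zeta> x (a \<otimes>\<^bsub>G\<^esub> b))"
      using e(3)[rule_format, OF m] z(3)[rule_format, OF m] by simp
    finally show ?thesis by (simp only: ac_simps)
  qed
  moreover have "\<eta> (x \<otimes> y) a * \<zeta> (x \<otimes> y) a = \<eta> x a * \<zeta> x a * (\<eta> y a * \<zeta> y a)"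
    if "x \<in> carrier C" "y \<in> carrier C" "a \<in> carrier G" for x y a
    using e(2) z(2) that by simp
  ultimately show ?thesis
    unfolding cohomologous_def cocycle_times_def
    by (intro exI[of _ "\<lambda>x a. \<eta> x a * \<zeta> x a"]) (use e(1) z(1) in simp)
qed

lemma cohomologous_refl_on:
  fixes \<sigma> \<tau> :: "'c \<Rightarrow> 'g \<Rightarrow> 'g \<Rightarrow> 'k::field"
  assumes "\<And>x a b. x \<in> carrier C \<Longrightarrow> a \<in> carrier G \<Longrightarrow> b \<in> carrier G \<Longrightarrow> \<sigma> x a b = \<tau> x a b"
  shows "cohomologous C G \<sigma> \<tau>"
  unfolding cohomologous_def using assms by (intro exI[of _ "\<lambda>x a. 1"]) simp

lemma H_ext_comm_extension:
  fixes \<tau> :: "'c \<Rightarrow> 'g \<Rightarrow> 'g \<Rightarrow> 'k::field"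
  assumes "\<tau> \<in> cocycles C G"
  shows "comm_hopf_extension C G (H_ext C G \<tau>)" "hopf_extension C G (H_ext C G \<tau>)"
proof -
  interpret T: cocycle_setup C p G n \<tau> by unfold_locales (rule assms)
  show "comm_hopf_extension C G (H_ext C G \<tau>)" "hopf_extension C G (H_ext C G \<tau>)"
    by (rule T.H_ext_comm T.H_ext_hopf)+
qed

lemma hopf_class_H_ext_eq_iff:
  fixes \<sigma> \<tau> :: "'c \<Rightarrow> 'g \<Rightarrow> 'g \<Rightarrow> 'k::field"
  assumes "\<sigma> \<in> cocycles C G" "\<tau> \<in> cocycles C G"
  shows "hopf_class C G (H_ext C G \<sigma>) = hopf_class C G (H_ext C G \<tau>) \<longleftrightarrow> cohomologous C G \<sigma> \<tau>"
  using hopf_class_eq_iff[OF H_ext_comm_extension(1)[OF assms(1)]] H_ext_equiv_iff[OF assms] by blast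

lemma comm_extension_equiv_H_ext:
  fixes E :: "('g, 'c, 'k::{alg_closed_field, field_char_0}, 'h) hopf_ext"
  assumes "comm_hopf_extension C G E"
  shows "\<exists>\<tau>\<in>cocycles C G. hopf_ext_equiv G E (H_ext C G \<tau>)"
proof -
  interpret comm_extension C p G n E by unfold_locales (rule assms)
  show ?thesis by (rule equiv_H_ext)
qed

abbreviation h_class :: "('c \<Rightarrow> 'g \<Rightarrow> 'g \<Rightarrow> 'k::field) \<Rightarrow> ('g, 'c, 'k, 'c \<times> 'g \<Rightarrow> 'k) hopf_ext set" where
  "h_class \<tau> \<equiv> hopf_class C G (H_ext C G \<tau>)"

lemma carrier_Ext_triv:
  "carrier (Ext_triv C G :: ('g, 'c, 'k::{alg_closed_field, field_char_0}, 'c \<times> 'g \<Rightarrow> 'k) hopf_ext set monoid) =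
    h_class ` cocycles C G"
proof
  show "h_class ` cocycles C G \<subseteq> carrier (Ext_triv C G :: ('g, 'c, 'k, 'c \<times> 'g \<Rightarrow> 'k) hopf_ext set monoid)"
    using H_ext_comm_extension(1) by (auto simp: Ext_triv_def)
  show "carrier (Ext_triv C G :: ('g, 'c, 'k, 'c \<times> 'g \<Rightarrow> 'k) hopf_ext set monoid) \<subseteq> h_class ` cocycles C G"
  proof
    fix U assume "U \<in> carrier (Ext_triv C G :: ('g, 'c, 'k, 'c \<times> 'g \<Rightarrow> 'k) hopf_ext set monoid)"
    then obtain E :: "('g, 'c, 'k, 'c \<times> 'g \<Rightarrow> 'k) hopf_ext"
      where E: "comm_hopf_extension C G E" "U = hopf_class C G E" by (auto simp: Ext_triv_def)
    obtain \<tau> where t: "\<tau> \<in> cocycles C G" "hopf_ext_equiv G E (H_ext C G \<tau>)"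
      using comm_extension_equiv_H_ext[OF E(1)] by blast
    then have "U = h_class \<tau>" using hopf_class_eq_iff[OF E(1)] E(2) by blast
    then show "U \<in> h_class ` cocycles C G" using t(1) by (rule image_eqI)
  qed
qed

text \<open>The product is a union over all cocycles representing the two classes. Cohomologous
  cocycles have cohomologous products, so all members of the union are the same class.\<close>

lemma mult_Ext_triv:
  fixes \<sigma> \<tau> :: "'c \<Rightarrow> 'g \<Rightarrow> 'g \<Rightarrow> 'k::field"
  assumes "\<sigma> \<in> cocycles C G" "\<tau> \<in> cocycles C G"
  shows "h_class \<sigma> \<otimes>\<^bsub>Ext_triv C G\<^esub> h_class \<tau> = h_class (cocycle_times \<sigma> \<tau>)"
proof -
  have mem: "H_ext C G \<sigma>' \<in> h_class \<sigma> \<longleftrightarrow> cohomologous C G \<sigma>' \<sigma>"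
    if "\<sigma>' \<in> cocycles C G" "\<sigma> \<in> cocycles C G" for \<sigma>' \<sigma> :: "'c \<Rightarrow> 'g \<Rightarrow> 'g \<Rightarrow> 'k"
    using that H_ext_comm_extension(1)[OF that(1)] H_ext_equiv_iff[OF that] by (simp add: hopf_class_def)
  have "{hopf_class C G (H_ext C G (\<lambda>x a b. \<sigma>' x a b * \<tau>' x a b)) | \<sigma>' \<tau>'.
        \<sigma>' \<in> cocycles C G \<and> \<tau>' \<in> cocycles C G \<and> H_ext C G \<sigma>' \<in> h_class \<sigma> \<and> H_ext C G \<tau>' \<in> h_class \<tau>} =
    {h_class (cocycle_times \<sigma> \<tau>)}" (is "?S = _")
  proof
    show "?S \<subseteq> {h_class (cocycle_times \<sigma> \<tau>)}"
    proof
      fix U assume "U \<in> ?S"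
      then obtain \<sigma>' \<tau>' where st: "U = h_class (cocycle_times \<sigma>' \<tau>')" "\<sigma>' \<in> cocycles C G" "\<tau>' \<in> cocycles C G"
        "H_ext C G \<sigma>' \<in> h_class \<sigma>" "H_ext C G \<tau>' \<in> h_class \<tau>"
        unfolding cocycle_times_def by blast
      then have "cohomologous C G (cocycle_times \<sigma>' \<tau>') (cocycle_times \<sigma> \<tau>)"
        using mem assms by (intro cohomologous_times) auto
      then show "U \<in> {h_class (cocycle_times \<sigma> \<tau>)}"
        using hopf_class_H_ext_eq_iff[OF cocycle_times_in[OF st(2,3)] cocycle_times_in[OF assms]] st(1) by blast
    qed
    have "H_ext C G \<sigma> \<in> h_class \<sigma>" "H_ext C G \<tau> \<in> h_class \<tau>"
      using mem assms cohomologous_refl_on by auto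
    then show "{h_class (cocycle_times \<sigma> \<tau>)} \<subseteq> ?S" unfolding cocycle_times_def using assms by blast
  qed
  then show ?thesis by (simp add: Ext_triv_def)
qed

lemma one_Ext_triv: "\<one>\<^bsub>Ext_triv C G\<^esub> = h_class (\<lambda>x a b. 1)"
  by (simp add: Ext_triv_def)

end

section \<open>Transport to central extensions by C, and comparison of the two groups\<close>

locale identified_dual = ext_setup C p G n for C :: "'c monoid" (structure) and p and G :: "'g monoid" and n +
  fixes \<theta> :: "'c \<Rightarrow> 'c \<Rightarrow> 'k::{alg_closed_field, field_char_0}"
  assumes \<theta>: "\<theta> \<in> iso C (dual_group C)"
begin

abbreviation "D \<equiv> dual_group C :: ('c \<Rightarrow> 'k) monoid"
abbreviation "\<psi> \<equiv> inv_into (carrier C) \<theta>"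

lemma D_group: "group D"
  by (rule dual_group_group)

sublocale P: grp_setup G C by (rule C_grp_setup)

lemma psi_iso: "\<psi> \<in> iso D C"
  by (rule iso_set_sym[OF \<theta>])

lemma \<theta>_simps:
  "c \<in> carrier C \<Longrightarrow> \<theta> c \<in> carrier D" "c \<in> carrier C \<Longrightarrow> \<psi> (\<theta> c) = c"
  "\<chi> \<in> carrier D \<Longrightarrow> \<psi> \<chi> \<in> carrier C" "\<chi> \<in> carrier D \<Longrightarrow> \<theta> (\<psi> \<chi>) = \<chi>"
  "c \<in> carrier C \<Longrightarrow> d \<in> carrier C \<Longrightarrow> \<theta> (c \<otimes> d) = (\<lambda>x. \<theta> c x * \<theta> d x)"
  "\<chi> \<in> carrier D \<Longrightarrow> \<chi>' \<in> carrier D \<Longrightarrow> \<psi> (\<chi> \<otimes>\<^bsub>D\<^esub> \<chi>') = \<psi> \<chi> \<otimes> \<psi> \<chi>'"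
proof -
  have bij: "bij_betw \<theta> (carrier C) (carrier D)" using \<theta> by (simp add: iso_def)
  show "c \<in> carrier C \<Longrightarrow> \<theta> c \<in> carrier D" using bij by (auto simp: bij_betw_def)
  show "c \<in> carrier C \<Longrightarrow> \<psi> (\<theta> c) = c" using bij by (simp add: bij_betw_inv_into_left)
  show "\<chi> \<in> carrier D \<Longrightarrow> \<psi> \<chi> \<in> carrier C" using psi_iso by (auto simp: iso_def hom_def)
  show "\<chi> \<in> carrier D \<Longrightarrow> \<theta> (\<psi> \<chi>) = \<chi>" using bij by (simp add: bij_betw_inv_into_right)
  show "c \<in> carrier C \<Longrightarrow> d \<in> carrier C \<Longrightarrow> \<theta> (c \<otimes> d) = (\<lambda>x. \<theta> c x * \<theta> d x)"
    using \<theta> by (simp add: iso_def hom_def)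
  show "\<chi> \<in> carrier D \<Longrightarrow> \<chi>' \<in> carrier D \<Longrightarrow> \<psi> (\<chi> \<otimes>\<^bsub>D\<^esub> \<chi>') = \<psi> \<chi> \<otimes> \<psi> \<chi>'"
    using psi_iso by (auto simp: iso_def hom_def)
qed

text \<open>The cocycle \<tau> moved from the dual of \<open>C\<close> to \<open>C\<close> itself,
  which is the kernel of the extensions in \<open>Cext\<close>.\<close>

definition primal :: "('c \<Rightarrow> 'g \<Rightarrow> 'g \<Rightarrow> 'k) \<Rightarrow> 'g \<Rightarrow> 'g \<Rightarrow> 'c" where
  "primal \<tau> a b = \<psi> (dual_cocycle \<tau> a b)"

lemma primal_in:
  assumes "\<tau> \<in> cocycles C G"
  shows "primal \<tau> \<in> grp_cocycles G C"
proof -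
  have "\<psi> \<in> hom D C" using psi_iso by (simp add: iso_def)
  from grp_cocycles_hom[OF dual_cocycle_in[OF assms] this D_group is_group group_G]
  show ?thesis unfolding primal_def .
qed

lemma dual_cocycle_closed:
  "\<tau> \<in> cocycles C G \<Longrightarrow> a \<in> carrier G \<Longrightarrow> b \<in> carrier G \<Longrightarrow> dual_cocycle \<tau> a b \<in> carrier D"
  using dual_cocycle_in[of \<tau>] by (simp add: grp_cocycles_def)

lemma \<theta>_primal:
  "\<tau> \<in> cocycles C G \<Longrightarrow> a \<in> carrier G \<Longrightarrow> b \<in> carrier G \<Longrightarrow> \<theta> (primal \<tau> a b) = dual_cocycle \<tau> a b"
  unfolding primal_def by (intro \<theta>_simps dual_cocycle_closed)

lemma primal_times:
  assumes "\<sigma> \<in> cocycles C G" "\<tau> \<in> cocycles C G" "a \<in> carrier G" "b \<in> carrier G"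
  shows "primal (cocycle_times \<sigma> \<tau>) a b = primal \<sigma> a b \<otimes> primal \<tau> a b"
proof -
  have "dual_cocycle (cocycle_times \<sigma> \<tau>) a b = dual_cocycle \<sigma> a b \<otimes>\<^bsub>D\<^esub> dual_cocycle \<tau> a b"
    by (auto simp: dual_cocycle_def cocycle_times_def fun_eq_iff)
  then show ?thesis unfolding primal_def
    using \<theta>_simps(6)[OF dual_cocycle_closed[OF assms(1,3,4)] dual_cocycle_closed[OF assms(2-4)]] by simp
qed

lemma primal_equiv_via:
  assumes t: "\<tau> \<in> cocycles C G"
  shows "grp_ext_equiv C (cocycle_ext G C (primal \<tau>)) (via \<theta> (G_ext C G \<tau>))"
    "grp_ext_equiv C (via \<theta> (G_ext C G \<tau>)) (cocycle_ext G C (primal \<tau>))"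
proof -
  let ?F = "\<lambda>(a, u). (a, \<theta> u)"
  have pc: "primal \<tau> a b \<in> carrier C" if "a \<in> carrier G" "b \<in> carrier G" for a b
    using P.grp_cocycleD(1)[OF primal_in[OF t]] that .
  have "bij_betw ?F (carrier G \<times> carrier C) (carrier G \<times> carrier D)"
    by (rule bij_betwI[of _ _ _ "\<lambda>(a, \<chi>). (a, \<psi> \<chi>)"]) (auto simp: \<theta>_simps)
  moreover have "?F (x \<otimes>\<^bsub>grp_total (cocycle_ext G C (primal \<tau>))\<^esub> y) = ?F x \<otimes>\<^bsub>grp_total (G_ext C G \<tau>)\<^esub> ?F y"
    if xy: "x \<in> carrier G \<times> carrier C" "y \<in> carrier G \<times> carrier C" for x y
  proof -
    obtain a u b v where x: "x = (a, u)" "y = (b, v)"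
      and m: "a \<in> carrier G" "b \<in> carrier G" "u \<in> carrier C" "v \<in> carrier C" using xy by auto
    have "\<theta> (u \<otimes> v \<otimes> primal \<tau> a b) = (\<lambda>y. \<theta> u y * \<theta> v y * dual_cocycle \<tau> a b y)"
      using m pc by (simp add: \<theta>_simps \<theta>_primal[OF t])
    then show ?thesis by (simp add: x dual_cocycle_def)
  qed
  ultimately have "?F \<in> iso (grp_total (cocycle_ext G C (primal \<tau>))) (grp_total (via \<theta> (G_ext C G \<tau>)))"
    by (auto simp: iso_def hom_def via_def bij_betw_def intro: \<theta>_simps(1) simp del: cocycle_ext_simps(2) G_ext_simps(2))
  then show *: "grp_ext_equiv C (cocycle_ext G C (primal \<tau>)) (via \<theta> (G_ext C G \<tau>))"
    unfolding grp_ext_equiv_def by (rule bexI[rotated]) (auto simp: via_def)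
  show "grp_ext_equiv C (via \<theta> (G_ext C G \<tau>)) (cocycle_ext G C (primal \<tau>))"
    by (rule central_extension_equiv_sym[OF P.cocycle_ext_central[OF primal_in[OF t]] *])
qed

abbreviation g_class :: "('c \<Rightarrow> 'g \<Rightarrow> 'g \<Rightarrow> 'k) \<Rightarrow> ('g, 'c, 'g \<times> 'c) grp_ext set" where
  "g_class \<tau> \<equiv> grp_class C G (via \<theta> (G_ext C G \<tau>))"

lemma g_class_primal: "\<tau> \<in> cocycles C G \<Longrightarrow> g_class \<tau> = grp_class C G (cocycle_ext G C (primal \<tau>))"
  by (intro P.grp_class_cong primal_equiv_via)

text \<open>\<theta> and its inverse translate cochains with values in \<open>C\<close> into
  cochains \<eta> multiplicative in x. The cocycles change places because
  \<open>cocycle_ext_equiv_iff\<close> multiplies the second one by the product of the values of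
  \<eta>.\<close>

lemma primal_equiv_iff:
  assumes s: "\<sigma> \<in> cocycles C G" and t: "\<tau> \<in> cocycles C G"
  shows "grp_ext_equiv C (cocycle_ext G C (primal \<tau>)) (cocycle_ext G C (primal \<sigma>)) \<longleftrightarrow> cohomologous C G \<sigma> \<tau>"
proof -
  have ps: "primal \<sigma> a b \<in> carrier C" if "a \<in> carrier G" "b \<in> carrier G" for a b
    using P.grp_cocycleD(1)[OF primal_in[OF s]] that .
  have pt: "primal \<tau> a b \<in> carrier C" if "a \<in> carrier G" "b \<in> carrier G" for a b
    using P.grp_cocycleD(1)[OF primal_in[OF t]] that .
  show ?thesis
    unfolding P.cocycle_ext_equiv_iff[OF primal_in[OF t] primal_in[OF s]]
  proof
    assume "\<exists>\<eta>. (\<forall>a\<in>carrier G. \<eta> a \<in> carrier C) \<and> (\<forall>a\<in>carrier G. \<forall>b\<in>carrier G.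
      primal \<sigma> a b \<otimes> (\<eta> a \<otimes> \<eta> b) = primal \<tau> a b \<otimes> \<eta> (a \<otimes>\<^bsub>G\<^esub> b))"
    then obtain \<eta> where e: "\<forall>a\<in>carrier G. \<eta> a \<in> carrier C"
      "\<forall>a\<in>carrier G. \<forall>b\<in>carrier G. primal \<sigma> a b \<otimes> (\<eta> a \<otimes> \<eta> b) = primal \<tau> a b \<otimes> \<eta> (a \<otimes>\<^bsub>G\<^esub> b)" by blast
    have "\<sigma> x a b * (\<theta> (\<eta> a) x * \<theta> (\<eta> b) x) = \<tau> x a b * \<theta> (\<eta> (a \<otimes>\<^bsub>G\<^esub> b)) x"
      if m: "x \<in> carrier C" "a \<in> carrier G" "b \<in> carrier G" for x a b
    proof -
      have "\<theta> (primal \<sigma> a b \<otimes> (\<eta> a \<otimes> \<eta> b)) = \<theta> (primal \<tau> a b \<otimes> \<eta> (a \<otimes>\<^bsub>G\<^esub> b))" using e(2) m by simp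
      then have "(\<lambda>x. dual_cocycle \<sigma> a b x * (\<theta> (\<eta> a) x * \<theta> (\<eta> b) x)) = (\<lambda>x. dual_cocycle \<tau> a b x * \<theta> (\<eta> (a \<otimes>\<^bsub>G\<^esub> b)) x)"
        using m ps pt e(1) by (simp add: \<theta>_simps \<theta>_primal[OF s] \<theta>_primal[OF t])
      from fun_cong[OF this, of x] show ?thesis using m by (simp add: dual_cocycle_def)
    qed
    moreover have "\<theta> (\<eta> a) \<in> carrier D" if "a \<in> carrier G" for a using e(1) that \<theta>_simps(1) by blast
    ultimately show "cohomologous C G \<sigma> \<tau>"
      unfolding cohomologous_def by (intro exI[of _ "\<lambda>x a. \<theta> (\<eta> a) x"]) (simp add: dual_group_iff)
  next
    assume "cohomologous C G \<sigma> \<tau>"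
    then obtain \<eta> where e: "\<forall>x\<in>carrier C. \<forall>a\<in>carrier G. \<eta> x a \<noteq> 0"
      "\<forall>x\<in>carrier C. \<forall>y\<in>carrier C. \<forall>a\<in>carrier G. \<eta> (x \<otimes> y) a = \<eta> x a * \<eta> y a"
      "\<forall>x\<in>carrier C. \<forall>a\<in>carrier G. \<forall>b\<in>carrier G.
        \<sigma> x a b * (\<eta> x a * \<eta> x b) = \<tau> x a b * \<eta> x (a \<otimes>\<^bsub>G\<^esub> b)"
      unfolding cohomologous_def by blast
    define d where "d a = (\<lambda>x. if x \<in> carrier C then \<eta> x a else 0)" for a
    have dD: "d a \<in> carrier D" if "a \<in> carrier G" for a using e(1,2) that by (simp add: dual_group_iff d_def)
    have "primal \<sigma> a b \<otimes> (\<psi> (d a) \<otimes> \<psi> (d b)) = primal \<tau> a b \<otimes> \<psi> (d (a \<otimes>\<^bsub>G\<^esub> b))"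
      if m: "a \<in> carrier G" "b \<in> carrier G" for a b
    proof -
      have "dual_cocycle \<sigma> a b \<otimes>\<^bsub>D\<^esub> (d a \<otimes>\<^bsub>D\<^esub> d b) = dual_cocycle \<tau> a b \<otimes>\<^bsub>D\<^esub> d (a \<otimes>\<^bsub>G\<^esub> b)"
        using e(3) m by (auto simp: dual_cocycle_def d_def fun_eq_iff)
      then have "\<psi> (dual_cocycle \<sigma> a b \<otimes>\<^bsub>D\<^esub> (d a \<otimes>\<^bsub>D\<^esub> d b)) = \<psi> (dual_cocycle \<tau> a b \<otimes>\<^bsub>D\<^esub> d (a \<otimes>\<^bsub>G\<^esub> b))"
        by (rule arg_cong)
      moreover have "d a \<otimes>\<^bsub>D\<^esub> d b \<in> carrier D"
        using monoid.m_closed[OF group.is_monoid[OF D_group] dD[OF m(1)] dD[OF m(2)]] .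
      ultimately show ?thesis
        using \<theta>_simps(6) dD m dual_cocycle_closed[OF s m] dual_cocycle_closed[OF t m]
        by (simp add: primal_def del: dual_group_simps)
    qed
    then show "\<exists>\<eta>. (\<forall>a\<in>carrier G. \<eta> a \<in> carrier C) \<and> (\<forall>a\<in>carrier G. \<forall>b\<in>carrier G.
      primal \<sigma> a b \<otimes> (\<eta> a \<otimes> \<eta> b) = primal \<tau> a b \<otimes> \<eta> (a \<otimes>\<^bsub>G\<^esub> b))"
      using dD \<theta>_simps(3) by (intro exI[of _ "\<lambda>a. \<psi> (d a)"]) simp
  qed
qed

lemma g_class_eq_iff:
  assumes s: "\<sigma> \<in> cocycles C G" and t: "\<tau> \<in> cocycles C G"
  shows "g_class \<sigma> = g_class \<tau> \<longleftrightarrow> cohomologous C G \<sigma> \<tau>"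
  unfolding g_class_primal[OF s] g_class_primal[OF t] primal_equiv_iff[OF s t, symmetric]
  using P.grp_class_eq_iff[OF P.cocycle_ext_central[OF primal_in[OF t]], of "cocycle_ext G C (primal \<sigma>)"] by auto

lemma central_extension_equiv_via:
  fixes U :: "('g, 'c, 'e) grp_ext"
  assumes U: "central_extension C G U"
  shows "\<exists>\<tau>\<in>cocycles C G. grp_ext_equiv C U (via \<theta> (G_ext C G \<tau>))"
proof -
  obtain c where c: "c \<in> grp_cocycles G C" "grp_ext_equiv C U (cocycle_ext G C c)"
    using P.central_extension_equiv_cocycle_ext[OF U] by blast
  have "\<theta> \<in> hom C D" using \<theta> by (simp add: iso_def)
  note d = grp_cocycles_hom[OF c(1) this is_group D_group group_G]
  \<comment> \<open>Applies \<theta> to the values, which undoes \<open>primal\<close> on the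
    carrier of \<open>G\<close>.\<close>
  define \<tau> where "\<tau> = (\<lambda>x a b. \<theta> (c a b) x)"
  note t = cocycle_of_dual[OF d, folded \<tau>_def]
  have "primal \<tau> a b = c a b" if "a \<in> carrier G" "b \<in> carrier G" for a b
    using t(2)[OF that] P.grp_cocycleD(1)[OF c(1) that] by (simp add: primal_def \<theta>_simps)
  then have "grp_ext_equiv C (cocycle_ext G C c) (cocycle_ext G C (primal \<tau>))"
    by (intro P.cocycle_ext_cong[OF c(1) primal_in[OF t(1)]]) simp
  from grp_ext_equiv_trans[OF grp_ext_equiv_trans[OF c(2) this] primal_equiv_via(1)[OF t(1)]] t(1)
  show ?thesis by - (rule bexI)
qed

lemma carrier_Cext: "carrier (Cext G C) = g_class ` cocycles C G"
proof
  show "g_class ` cocycles C G \<subseteq> carrier (Cext G C)"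
  proof
    fix K assume "K \<in> g_class ` cocycles C G"
    then obtain \<tau> where t: "\<tau> \<in> cocycles C G" "K = g_class \<tau>" by blast
    show "K \<in> carrier (Cext G C)"
      unfolding t(2) g_class_primal[OF t(1)] using P.cocycle_ext_central[OF primal_in[OF t(1)]]
      by (auto simp: Cext_def)
  qed
  show "carrier (Cext G C) \<subseteq> g_class ` cocycles C G"
  proof
    fix K assume "K \<in> carrier (Cext G C)"
    then obtain U :: "('g, 'c, 'g \<times> 'c) grp_ext" where U: "central_extension C G U" "K = grp_class C G U"
      by (auto simp: Cext_def)
    obtain \<tau> where t: "\<tau> \<in> cocycles C G" "grp_ext_equiv C U (via \<theta> (G_ext C G \<tau>))"
      using central_extension_equiv_via[OF U(1)] by blast
    have "K = g_class \<tau>"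
      unfolding U(2) by (rule P.grp_class_cong[OF t(2) central_extension_equiv_sym[OF U(1) t(2)]])
    then show "K \<in> g_class ` cocycles C G" using t(1) by (rule image_eqI)
  qed
qed

text \<open>Any two representatives are equivalent to the extensions of
  \<open>primal \<sigma>\<close> and \<open>primal \<tau>\<close>, so their Baer sum has the product
  cocycle and the union defining the product collapses to one class.\<close>

lemma mult_Cext:
  assumes s: "\<sigma> \<in> cocycles C G" and t: "\<tau> \<in> cocycles C G"
  shows "g_class \<sigma> \<otimes>\<^bsub>Cext G C\<^esub> g_class \<tau> = g_class (cocycle_times \<sigma> \<tau>)"
proof -
  note st = cocycle_times_in[OF s t]
  let ?c = "\<lambda>a b. primal \<sigma> a b \<otimes> primal \<tau> a b"
  have c: "?c \<in> grp_cocycles G C" by (rule P.cocycle_mult[OF primal_in[OF s] primal_in[OF t]])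
  have e1: "grp_ext_equiv C (cocycle_ext G C ?c) (cocycle_ext G C (primal (cocycle_times \<sigma> \<tau>)))"
    by (rule P.cocycle_ext_cong[OF c primal_in[OF st]]) (simp add: primal_times[OF s t])
  have e2: "grp_ext_equiv C (cocycle_ext G C (primal (cocycle_times \<sigma> \<tau>))) (cocycle_ext G C ?c)"
    by (rule P.cocycle_ext_cong[OF primal_in[OF st] c]) (simp add: primal_times[OF s t])
  have baer: "grp_class C G (baer_sum C U V) = g_class (cocycle_times \<sigma> \<tau>)"
    if U: "U \<in> g_class \<sigma>" and V: "V \<in> g_class \<tau>" for U V
  proof -
    have U': "central_extension C G U" "grp_ext_equiv C U (cocycle_ext G C (primal \<sigma>))"
      using U unfolding g_class_primal[OF s] by (simp_all add: grp_class_def)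
    have V': "central_extension C G V" "grp_ext_equiv C V (cocycle_ext G C (primal \<tau>))"
      using V unfolding g_class_primal[OF t] by (simp_all add: grp_class_def)
    note b = P.baer_sum_equiv[OF U'(1) V'(1) primal_in[OF s] primal_in[OF t] U'(2) V'(2)]
    show ?thesis
      unfolding g_class_primal[OF st]
      by (rule P.grp_class_cong[OF grp_ext_equiv_trans[OF b(1) e1] grp_ext_equiv_trans[OF e2 b(2)]])
  qed
  have "cocycle_ext G C (primal \<sigma>) \<in> g_class \<sigma>" "cocycle_ext G C (primal \<tau>) \<in> g_class \<tau>"
    unfolding g_class_primal[OF s] g_class_primal[OF t]
    using P.cocycle_ext_central primal_in s t grp_ext_equiv_refl by (auto simp: grp_class_def)
  then have "{grp_class C G (baer_sum C U V) | U V. U \<in> g_class \<sigma> \<and> V \<in> g_class \<tau>} = {g_class (cocycle_times \<sigma> \<tau>)}"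
    using baer by blast
  then show ?thesis by (simp add: Cext_def)
qed

text \<open>The constant cocycle 1 has trivial \<open>primal\<close>, and a trivial cocycle defines
  the direct product.\<close>

lemma one_Cext: "\<one>\<^bsub>Cext G C\<^esub> = g_class (\<lambda>x a b. 1)"
proof -
  let ?V = "\<lparr>grp_total = G \<times>\<times> C, grp_incl = (\<lambda>c. (\<one>\<^bsub>G\<^esub>, c)), grp_proj = fst\<rparr>"
  note t = one_cocycle[where 'a = 'k]
  have one: "primal (\<lambda>x a b. 1) a b = \<one>" for a b
  proof -
    have "dual_cocycle (\<lambda>x a b. 1) a b = \<one>\<^bsub>D\<^esub>" by (simp add: dual_cocycle_def)
    moreover have "\<psi> \<one>\<^bsub>D\<^esub> = \<one>"
      using hom_one[of \<psi> D C] psi_iso D_group is_group by (simp add: iso_def)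
    ultimately show ?thesis by (simp add: primal_def)
  qed
  have id: "(\<lambda>x. x) \<in> iso (grp_total (cocycle_ext G C (primal (\<lambda>x a b. 1)))) (G \<times>\<times> C)"
    by (auto simp: iso_def hom_def one bij_betw_def)
  have e: "grp_ext_equiv C (cocycle_ext G C (primal (\<lambda>x a b. 1))) ?V"
    unfolding grp_ext_equiv_def by (rule bexI[of _ "\<lambda>x. x"]) (use id in auto)
  have "grp_class C G (cocycle_ext G C (primal (\<lambda>x a b. 1))) = grp_class C G ?V"
    by (rule P.grp_class_cong[OF e central_extension_equiv_sym[OF P.cocycle_ext_central[OF primal_in[OF t]] e]])
  then show ?thesis by (simp add: Cext_def g_class_primal[OF t])
qed


text \<open>A class does not determine its cocycle; any choice serves, since \<open>g_class\<close>
  sees cocycles only up to cohomology.\<close>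

definition cocycle_rep :: "('g, 'c, 'k, 'c \<times> 'g \<Rightarrow> 'k) hopf_ext set \<Rightarrow> 'c \<Rightarrow> 'g \<Rightarrow> 'g \<Rightarrow> 'k" where
  "cocycle_rep K = (SOME \<tau>. \<tau> \<in> cocycles C G \<and> h_class \<tau> = K)"

lemma g_class_cocycle_rep:
  assumes t: "\<tau> \<in> cocycles C G"
  shows "g_class (cocycle_rep (h_class \<tau>)) = g_class \<tau>"
proof -
  have "\<exists>\<sigma>. \<sigma> \<in> cocycles C G \<and> h_class \<sigma> = h_class \<tau>" using t by blast
  then have "cocycle_rep (h_class \<tau>) \<in> cocycles C G \<and> h_class (cocycle_rep (h_class \<tau>)) = h_class \<tau>"
    unfolding cocycle_rep_def by (rule someI_ex)
  then show ?thesis using hopf_class_H_ext_eq_iff[OF _ t] g_class_eq_iff[OF _ t] by blast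
qed

text \<open>Both groups are quotients of the same set of cocycles by the same relation:
  \<open>h_class\<close> and \<open>g_class\<close> identify exactly the cohomologous cocycles, and
  both turn products of cocycles into products of classes.\<close>

lemma classes_iso:
  "(\<lambda>K. g_class (cocycle_rep K)) \<in> iso (Ext_triv C G) (Cext G C)"
proof -
  have "inj_on (\<lambda>K. g_class (cocycle_rep K)) (h_class ` cocycles C G)"
  proof (rule inj_onI)
    fix K L assume "K \<in> h_class ` cocycles C G" "L \<in> h_class ` cocycles C G"
      and eq: "g_class (cocycle_rep K) = g_class (cocycle_rep L)"
    then obtain \<sigma> \<tau> where st: "K = h_class \<sigma>" "L = h_class \<tau>" "\<sigma> \<in> cocycles C G" "\<tau> \<in> cocycles C G" by blast
    show "K = L"
      using eq unfolding st(1,2) g_class_cocycle_rep[OF st(3)] g_class_cocycle_rep[OF st(4)]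
        g_class_eq_iff[OF st(3,4)] hopf_class_H_ext_eq_iff[OF st(3,4)] .
  qed
  moreover have "(\<lambda>K. g_class (cocycle_rep K)) ` h_class ` cocycles C G = g_class ` cocycles C G"
    unfolding image_image by (rule image_cong[OF refl g_class_cocycle_rep])
  ultimately have "bij_betw (\<lambda>K. g_class (cocycle_rep K)) (carrier (Ext_triv C G)) (carrier (Cext G C))"
    by (simp add: bij_betw_def carrier_Ext_triv carrier_Cext)
  moreover have "(\<lambda>K. g_class (cocycle_rep K)) \<in> hom (Ext_triv C G) (Cext G C)"
  proof (rule homI)
    fix K L
    assume "K \<in> carrier (Ext_triv C G :: ('g, 'c, 'k, 'c \<times> 'g \<Rightarrow> 'k) hopf_ext set monoid)"
      "L \<in> carrier (Ext_triv C G :: ('g, 'c, 'k, 'c \<times> 'g \<Rightarrow> 'k) hopf_ext set monoid)"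
    then obtain \<sigma> \<tau> where st: "K = h_class \<sigma>" "L = h_class \<tau>" "\<sigma> \<in> cocycles C G" "\<tau> \<in> cocycles C G"
      unfolding carrier_Ext_triv by blast
    show "g_class (cocycle_rep (K \<otimes>\<^bsub>Ext_triv C G\<^esub> L)) =
        g_class (cocycle_rep K) \<otimes>\<^bsub>Cext G C\<^esub> g_class (cocycle_rep L)"
      unfolding st(1,2) mult_Ext_triv[OF st(3,4)] g_class_cocycle_rep[OF cocycle_times_in[OF st(3,4)]]
        g_class_cocycle_rep[OF st(3)] g_class_cocycle_rep[OF st(4)] mult_Cext[OF st(3,4)] ..
  qed (use calculation in \<open>auto simp: bij_betw_def\<close>)
  ultimately show ?thesis by (simp add: iso_def)
qed

text \<open>Inverses are taken pointwise; the product with the inverse is 1 only on the carriers,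
  hence cohomologous to the constant cocycle.\<close>

lemma group_Ext_triv: "group (Ext_triv C G :: ('g, 'c, 'k, 'c \<times> 'g \<Rightarrow> 'k) hopf_ext set monoid)"
proof (rule group_image[where h = h_class, OF carrier_Ext_triv cocycle_times_in mult_Ext_triv one_cocycle one_Ext_triv])
  fix \<tau> :: "'c \<Rightarrow> 'g \<Rightarrow> 'g \<Rightarrow> 'k" assume t: "\<tau> \<in> cocycles C G"
  interpret T: cocycle_setup C p G n \<tau> by unfold_locales (rule t)
  let ?\<sigma> = "\<lambda>x a b. inverse (\<tau> x a b)"
  have "cohomologous C G (cocycle_times ?\<sigma> \<tau>) (\<lambda>x a b. 1)"
    by (rule cohomologous_refl_on) (simp add: cocycle_times_def T.cocycle_simps(1))
  then show "\<exists>\<sigma>\<in>cocycles C G. h_class (cocycle_times \<sigma> \<tau>) = h_class (\<lambda>x a b. 1)"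
    using hopf_class_H_ext_eq_iff[OF cocycle_times_in[OF cocycle_inverse[OF t] t] one_cocycle] cocycle_inverse[OF t]
    by blast
qed (simp_all add: cocycle_times_def mult.assoc)

text \<open>The group laws for Baer sums are transported along the isomorphism rather than verified
  on extensions.\<close>

lemma group_Cext: "group (Cext G C)"
proof -
  interpret Ext: group "Ext_triv C G :: ('g, 'c, 'k, 'c \<times> 'g \<Rightarrow> 'k) hopf_ext set monoid"
    by (rule group_Ext_triv)
  \<comment> \<open>Transport yields a group whose unit is the image of the unit; this identifies it
    with the unit of \<open>Cext\<close>.\<close>
  have "g_class (cocycle_rep \<one>\<^bsub>Ext_triv C G\<^esub>) = \<one>\<^bsub>Cext G C\<^esub>"
    unfolding one_Ext_triv one_Cext by (rule g_class_cocycle_rep[OF one_cocycle])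
  then show ?thesis using Ext.iso_imp_img_group[OF classes_iso] by simp
qed

text \<open>The function algebra of G(\<tau>) has another carrier type, so it names a class without
  being a member of it; equivalences in both directions identify the classes.\<close>

lemma h_class_fun_ext:
  fixes \<tau> :: "'c \<Rightarrow> 'g \<Rightarrow> 'g \<Rightarrow> 'k"
  assumes t: "\<tau> \<in> cocycles C G"
  shows "h_class \<tau> = hopf_class C G (fun_ext C (G_ext C G \<tau>))"
  by (rule hopf_class_cong[OF H_ext_equiv_fun_ext[OF t]
        hopf_ext_equiv_sym[OF H_ext_comm_extension(2)[OF t] H_ext_equiv_fun_ext[OF t]]])

end

theorem proposition5p1:
  fixes C :: "'c monoid" and G :: "'g monoid" and p n :: nat
  assumes "prime p"
    and "group C" and "cyclic_group C" and "Coset.order C = p"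
    and "comm_group G" and "finite (carrier G)" and "Coset.order G = p ^ n"
  shows "(\<exists>\<theta>. \<theta> \<in> iso C (dual_group C :: ('c \<Rightarrow> 'k::{alg_closed_field, field_char_0}) monoid)) \<and>
    group (Ext_triv C G :: ('g, 'c, 'k, 'c \<times> 'g \<Rightarrow> 'k) hopf_ext set monoid) \<and>
    group (Cext G C) \<and>
    (\<forall>E :: ('g, 'c, 'k, 'h) hopf_ext. comm_hopf_extension C G E \<longrightarrow>
      (\<exists>\<tau>\<in>cocycles C G. hopf_ext_equiv G E (H_ext C G \<tau>))) \<and>
    (\<forall>\<theta> \<in> iso C (dual_group C :: ('c \<Rightarrow> 'k) monoid).
      (\<forall>U :: ('g, 'c, 'e) grp_ext. central_extension C G U \<longrightarrow>
        (\<exists>\<tau>\<in>cocycles C G. grp_ext_equiv C U (via \<theta> (G_ext C G \<tau>)))) \<and>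
      (\<exists>\<Phi> \<in> iso (Ext_triv C G :: ('g, 'c, 'k, 'c \<times> 'g \<Rightarrow> 'k) hopf_ext set monoid) (Cext G C).
        \<forall>\<tau> \<in> cocycles C G.
          \<Phi> (hopf_class C G (H_ext C G \<tau>)) = grp_class C G (via \<theta> (G_ext C G \<tau>)) \<and>
          inv_into (carrier (Ext_triv C G)) \<Phi> (grp_class C G (via \<theta> (G_ext C G \<tau>)))
            = hopf_class C G (fun_ext C (G_ext C G \<tau>)) \<and>
          hopf_ext_equiv G (H_ext C G \<tau>) (fun_ext C (G_ext C G \<tau>))))"
proof -
  interpret ext_setup C p G n
    using assms
    by (auto simp: ext_setup_def ext_setup_axioms_def prime_group_def prime_group_axioms_def plain_group_def)
  \<comment> \<open>That both sides are groups does not depend on an identification of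
    \<open>C\<close> with its dual, but the proof for \<open>Cext\<close> passes through one; any
    choice will do.\<close>
  obtain \<theta>\<^sub>0 :: "'c \<Rightarrow> 'c \<Rightarrow> 'k" where \<theta>\<^sub>0: "\<theta>\<^sub>0 \<in> iso C (dual_group C)" using dual_iso_exists by blast
  interpret Z: identified_dual C p G n \<theta>\<^sub>0 by unfold_locales (rule \<theta>\<^sub>0)
  have "(\<forall>U :: ('g, 'c, 'e) grp_ext. central_extension C G U \<longrightarrow>
        (\<exists>\<tau>\<in>cocycles C G. grp_ext_equiv C U (via \<theta> (G_ext C G \<tau>)))) \<and>
      (\<exists>\<Phi> \<in> iso (Ext_triv C G :: ('g, 'c, 'k, 'c \<times> 'g \<Rightarrow> 'k) hopf_ext set monoid) (Cext G C).
        \<forall>\<tau> \<in> cocycles C G.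
          \<Phi> (hopf_class C G (H_ext C G \<tau>)) = grp_class C G (via \<theta> (G_ext C G \<tau>)) \<and>
          inv_into (carrier (Ext_triv C G)) \<Phi> (grp_class C G (via \<theta> (G_ext C G \<tau>)))
            = hopf_class C G (fun_ext C (G_ext C G \<tau>)) \<and>
          hopf_ext_equiv G (H_ext C G \<tau>) (fun_ext C (G_ext C G \<tau>)))"
    if \<theta>: "\<theta> \<in> iso C (dual_group C :: ('c \<Rightarrow> 'k) monoid)" for \<theta>
  proof -
    interpret T: identified_dual C p G n \<theta> by unfold_locales (rule \<theta>)
    let ?\<Phi> = "\<lambda>K. T.g_class (T.cocycle_rep K)"
    have "inv_into (carrier (Ext_triv C G)) ?\<Phi> (T.g_class \<tau>) = hopf_class C G (fun_ext C (G_ext C G \<tau>))"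
      if t: "\<tau> \<in> cocycles C G" for \<tau>
    proof -
      have "inj_on ?\<Phi> (carrier (Ext_triv C G))" using T.classes_iso by (simp add: iso_def bij_betw_def)
      moreover have "h_class \<tau> \<in> carrier (Ext_triv C G)" using t by (simp add: carrier_Ext_triv)
      ultimately have "inv_into (carrier (Ext_triv C G)) ?\<Phi> (?\<Phi> (h_class \<tau>)) = h_class \<tau>"
        by (rule inv_into_f_f)
      then show ?thesis unfolding T.g_class_cocycle_rep[OF t] by (simp only: T.h_class_fun_ext[OF t])
    qed
    then show ?thesis
      using T.central_extension_equiv_via T.g_class_cocycle_rep H_ext_equiv_fun_ext
      by (intro conjI bexI[OF _ T.classes_iso]) auto
  qed
  then show ?thesis
    using \<theta>\<^sub>0 Z.group_Ext_triv Z.group_Cext comm_extension_equiv_H_ext by blast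
qed

end
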